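(* Let $k=\mathbb F_q$, $t=1/q$, and let $(\alpha;\beta)$ be a point of the Thoma simplex. Then: (i) for every $n$ and every unipotent matrix $u\in GL_n(k)$ with Jordan form partition $\rho\vdash n$, $$\chi^{(\alpha;\beta)}(u)=r_\rho(\alpha;\beta)=t^{-n(\rho)}\sum_{\lambda\vdash n}K_{\lambda\rho}(t)\,s_\lambda(\alpha;\beta);$$ (ii) the unipotent characters $\chi^{(\alpha;\beta)}$ of $GLB(k)$ are determined by their values at unipotent classes, i.e. if $\chi^{(\alpha;\beta)}(u)=\chi^{(\alpha';\beta')}(u)$ for all $n$ and all unipotent $u\in GL_n(k)$, then $\chi^{(\alpha;\beta)}(g)=\chi^{(\alpha';\beta')}(g)$ for all $n$ and all $g\in GL_n(k)$.
   Context: Thoma simplex: the set of pairs $(\alpha;\beta)$ of weakly decreasing sequences of nonnegative reals with $\sum_i\alpha_i+\sum_i\beta_i\le 1$. For a symmetric function $u$, $u(\alpha;\beta)$ is its image under the algebra homomorphism with $p_1\mapsto1$ and $p_m\mapsto\sum_i\alpha_i^m-\sum_i(-\beta_i)^m$ for $m\ge2$. For $\mu\vdash n$ let $\psi^\mu$ be the character of $GL_n(k)$ induced from the trivial character of the parabolic subgroup of block upper triangular matrices with diagonal blocks of sizes $\mu_1,\mu_2,\dots$. The irreducible unipotent characters $\chi^\lambda$, $\lambda\vdash n$, of $GL_n(k)$ are determined by $\psi^\mu=\sum_{\lambda\vdash n}K_{\lambda\mu}\chi^\lambda$ with $K_{\lambda\mu}$ the ordinary Kostka numbers. $GLB(k)$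 is the group of invertible infinite matrices over $k$ with only finitely many nonzero entries below the main diagonal. The unipotent character $\chi^{(\alpha;\beta)}$ of (the Bruhat–Schwartz group algebra of) $GLB(k)$, evaluated at the element of the subalgebra isomorphic to $\mathbb C[GL_n(k)]$ corresponding to $g\in GL_n(k)$, is $$\chi^{(\alpha;\beta)}(g)=\sum_{\lambda\vdash n}\chi^\lambda(g)\,s_\lambda(\alpha;\beta).$$ Its values on the subalgebras $\mathbb C[GL_n(k)]$, $n\ge1$, determine it, since the group algebra is the union of these subalgebras. $K_{\lambda\rho}(t)$ are the Kostka–Foulkes polynomials ($s_\lambda=\sum_\rho K_{\lambda\rho}(t)P_\rho(\,\cdot\,;t)$, $P_\rho$ the Hall–Littlewood functions), and $n(\rho)=\sum_{i\ge1}(i-1)\rho_i$. *)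

theory Defs
  imports
    Complex_Main
    "HOL-Library.Cardinality"
    "HOL-Library.FuncSet"
    "HOL-Library.Poly_Mapping"
    "HOL-Combinatorics.Permutations"
    "HOL-Computational_Algebra.Fraction_Field"
    "HOL-Computational_Algebra.Polynomial"
    "HOL-Algebra.Group"
    "Jordan_Normal_Form.Jordan_Normal_Form"
begin

section \<open>Partitions, tableaux and Kostka numbers\<close>

definition partitions :: "nat \<Rightarrow> nat list set" where
  "partitions n = {xs. sorted_wrt (\<ge>) xs \<and> 0 \<notin> set xs \<and> sum_list xs = n}"

definition part :: "nat list \<Rightarrow> nat \<Rightarrow> nat" where
  "part xs i = (if i < length xs then xs ! i else 0)"

text \<open>The statistic \<open>n(\<rho>) = \<Sum>(i - 1) \<rho>\<^sub>i\<close>; list positions start at 0.\<close>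

definition n_stat :: "nat list \<Rightarrow> nat" where
  "n_stat xs = (\<Sum>i<length xs. i * xs ! i)"

definition young_diagram :: "nat list \<Rightarrow> (nat \<times> nat) set" where
  "young_diagram xs = {(i, j). i < length xs \<and> j < xs ! i}"

text \<open>Semistandard tableaux of a given shape and content: the entry \<open>k\<close> (a natural number,
  so entries start at 0) occurs \<open>Poly_Mapping.lookup m k\<close> times.\<close>

definition ssyt :: "nat list \<Rightarrow> (nat \<Rightarrow>\<^sub>0 nat) \<Rightarrow> (nat \<times> nat \<Rightarrow> nat) set" where
  "ssyt lam m = {T \<in> young_diagram lam \<rightarrow>\<^sub>E UNIV.
     (\<forall>i j j'. (i, j) \<in> young_diagram lam \<and> (i, j') \<in> young_diagram lam \<and> j < j'
        \<longrightarrow> T (i, j) \<le> T (i, j')) \<and>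
     (\<forall>i i' j. (i, j) \<in> young_diagram lam \<and> (i', j) \<in> young_diagram lam \<and> i < i'
        \<longrightarrow> T (i, j) < T (i', j)) \<and>
     (\<forall>k. card {c \<in> young_diagram lam. T c = k} = Poly_Mapping.lookup m k)}"

definition kostka :: "nat list \<Rightarrow> nat list \<Rightarrow> nat" where
  "kostka lam mu = card (ssyt lam (Poly_Mapping.nth mu))"


section \<open>Symmetric functions\<close>

text \<open>A formal series in \<open>x\<^sub>0, x\<^sub>1, x\<^sub>2, \<dots>\<close> is the function sending (the exponent vector of) a
  monomial to its coefficient. A symmetric function is such a series of bounded degree that is
  invariant under permutations of the variables.\<close>

type_synonym 'a series = "(nat \<Rightarrow>\<^sub>0 nat) \<Rightarrow> 'a"

definition mdeg :: "(nat \<Rightarrow>\<^sub>0 nat) \<Rightarrow> nat" where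
  "mdeg m = (\<Sum>i\<in>Poly_Mapping.keys m. Poly_Mapping.lookup m i)"

definition symfuns :: "'a::comm_ring_1 series set" where
  "symfuns = {f. (\<forall>\<pi> m. bij \<pi> \<longrightarrow> f (Poly_Mapping.map_key \<pi> m) = f m) \<and>
                 (\<exists>d. \<forall>m. f m \<noteq> 0 \<longrightarrow> mdeg m \<le> d)}"

definition series_mult :: "'a::comm_ring_1 series \<Rightarrow> 'a series \<Rightarrow> 'a series" where
  "series_mult f g = (\<lambda>m. \<Sum>(a, b) | a + b = m. f a * g b)"

definition series_one :: "'a::comm_ring_1 series" where
  "series_one = (\<lambda>m. if m = 0 then 1 else 0)"

definition power_sum :: "nat \<Rightarrow> 'a::comm_ring_1 series" where
  "power_sum k = (\<lambda>m. if \<exists>i. m = Poly_Mapping.single i k then 1 else 0)"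

definition schur :: "nat list \<Rightarrow> 'a::comm_ring_1 series" where
  "schur lam = (\<lambda>m. of_nat (card (ssyt lam m)))"


section \<open>Hall-Littlewood functions and Kostka-Foulkes polynomials\<close>

text \<open>Hall-Littlewood polynomials in \<open>x\<^sub>0, \<dots>, x\<^bsub>N-1\<^esub>\<close> are computed in the field of fractions of
  \<open>\<int>[t][x\<^sub>0, x\<^sub>1, \<dots>]\<close>.\<close>

type_synonym hl_poly = "(nat \<Rightarrow>\<^sub>0 nat) \<Rightarrow>\<^sub>0 int poly"

definition hl_x :: "nat \<Rightarrow> hl_poly fract" where
  "hl_x i = Fract (Poly_Mapping.single (Poly_Mapping.single i 1) 1) 1"

definition hl_t :: "hl_poly fract" where
  "hl_t = Fract (Poly_Mapping.single 0 [:0, 1:]) 1"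

text \<open>\<open>v\<^sub>\<lambda>(t)\<close> is the product over \<open>i \<ge> 0\<close> of \<open>v\<^sub>m(t) = (1 - t) \<dots> (1 - t\<^sup>m) / (1 - t)\<^sup>m\<close>, where \<open>m\<close> is
  the multiplicity of \<open>i\<close> in \<open>\<lambda>\<close> padded by zeros to length \<open>N\<close>.\<close>

definition hl_v :: "nat \<Rightarrow> nat list \<Rightarrow> hl_poly fract" where
  "hl_v N lam = (\<Prod>i\<in>insert 0 (set lam).
     \<Prod>k = 1..card {r. r < N \<and> part lam r = i}. (1 - hl_t ^ k) / (1 - hl_t))"

text \<open>\<open>P\<^sub>\<lambda>(x; t) = v\<^sub>\<lambda>(t)\<^sup>-\<^sup>1 \<Sum>\<^sub>w w (x\<^sup>\<lambda> \<Prod>\<^bsub>i<j\<^esub> (x\<^sub>i - t x\<^sub>j) / (x\<^sub>i - x\<^sub>j))\<close>, the sum over the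
  symmetric group on the \<open>N\<close> variables.\<close>

definition hall_littlewood_vars :: "nat \<Rightarrow> nat list \<Rightarrow> hl_poly fract" where
  "hall_littlewood_vars N lam =
     (\<Sum>w | w permutes {..<N}.
        (\<Prod>i<N. hl_x (w i) ^ part lam i) *
        (\<Prod>(i, j) | i < j \<and> j < N.
           (hl_x (w i) - hl_t * hl_x (w j)) / (hl_x (w i) - hl_x (w j))))
     / hl_v N lam"

text \<open>Setting \<open>x\<^sub>i = 0\<close> for all \<open>i \<ge> N\<close>; for symmetric functions the result is a polynomial.\<close>

definition restrict_vars :: "nat \<Rightarrow> 'a::comm_ring_1 series \<Rightarrow> (nat \<Rightarrow>\<^sub>0 nat) \<Rightarrow>\<^sub>0 'a" where
  "restrict_vars N f =
     Abs_poly_mapping (\<lambda>m. if Poly_Mapping.keys m \<subseteq> {..<N} then f m else 0)"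

definition hall_littlewood :: "nat list \<Rightarrow> int poly series" where
  "hall_littlewood lam = (THE f. f \<in> symfuns \<and>
     (\<forall>N\<ge>length lam. Fract (restrict_vars N f) 1 = hall_littlewood_vars N lam))"

definition kostka_foulkes :: "nat list \<Rightarrow> nat list \<Rightarrow> int poly" where
  "kostka_foulkes lam = (THE K. K \<in> extensional (partitions (sum_list lam)) \<and>
     schur lam = (\<lambda>m. \<Sum>rho\<in>partitions (sum_list lam). K rho * hall_littlewood rho m))"

definition kostka_foulkes_at :: "nat list \<Rightarrow> nat list \<Rightarrow> real \<Rightarrow> real" where
  "kostka_foulkes_at lam rho t = poly (map_poly of_int (kostka_foulkes lam rho)) t"

text \<open>The symmetric function \<open>r\<^sub>\<rho>\<close> (for a partition \<open>\<rho>\<close>), with real coefficients.\<close>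

definition r_fun :: "real \<Rightarrow> nat list \<Rightarrow> real series" where
  "r_fun t rho = (\<lambda>m. t powi (- int (n_stat rho)) *
     (\<Sum>lam\<in>partitions (sum_list rho). kostka_foulkes_at lam rho t * schur lam m))"


section \<open>Thoma simplex and specializations\<close>

definition thoma_simplex :: "((nat \<Rightarrow> real) \<times> (nat \<Rightarrow> real)) set" where
  "thoma_simplex = {(\<alpha>, \<beta>). decseq \<alpha> \<and> decseq \<beta> \<and> (\<forall>i. 0 \<le> \<alpha> i) \<and> (\<forall>i. 0 \<le> \<beta> i) \<and>
     summable \<alpha> \<and> summable \<beta> \<and> suminf \<alpha> + suminf \<beta> \<le> 1}"

definition thoma_power_sum :: "(nat \<Rightarrow> real) \<times> (nat \<Rightarrow> real) \<Rightarrow> nat \<Rightarrow> real" where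
  "thoma_power_sum \<omega> k =
     (if k = 1 then 1 else suminf (\<lambda>i. fst \<omega> i ^ k) - suminf (\<lambda>i. (- snd \<omega> i) ^ k))"

definition symfun_alg_hom :: "(real series \<Rightarrow> real) \<Rightarrow> bool" where
  "symfun_alg_hom \<phi> \<longleftrightarrow>
     \<phi> series_one = 1 \<and>
     (\<forall>f\<in>symfuns. \<forall>g\<in>symfuns. \<phi> (\<lambda>m. f m + g m) = \<phi> f + \<phi> g) \<and>
     (\<forall>f\<in>symfuns. \<forall>g\<in>symfuns. \<phi> (series_mult f g) = \<phi> f * \<phi> g) \<and>
     (\<forall>c. \<forall>f\<in>symfuns. \<phi> (\<lambda>m. c * f m) = c * \<phi> f)"

text \<open>\<open>thoma_eval \<omega> u\<close> is \<open>u(\<alpha>;\<beta>)\<close> for \<open>\<omega> = (\<alpha>, \<beta>)\<close>.\<close>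

definition thoma_eval :: "(nat \<Rightarrow> real) \<times> (nat \<Rightarrow> real) \<Rightarrow> real series \<Rightarrow> real" where
  "thoma_eval \<omega> = (THE \<phi>. \<phi> \<in> extensional symfuns \<and> symfun_alg_hom \<phi> \<and>
     (\<forall>k\<ge>1. \<phi> (power_sum k) = thoma_power_sum \<omega> k))"


section \<open>Unipotent characters of the finite general linear groups\<close>

definition GL :: "nat \<Rightarrow> 'k::field mat monoid" where
  "GL n = units_of (ring_mat TYPE('k) n ())"

definition induced_char ::
  "('g, 'm) monoid_scheme \<Rightarrow> 'g set \<Rightarrow> ('g \<Rightarrow> complex) \<Rightarrow> 'g \<Rightarrow> complex" where
  "induced_char G H \<theta> g =
     (\<Sum>x | x \<in> carrier G \<and> inv\<^bsub>G\<^esub> x \<otimes>\<^bsub>G\<^esub> g \<otimes>\<^bsub>G\<^esub> x \<in> H. \<theta> (inv\<^bsub>G\<^esub> x \<otimes>\<^bsub>G\<^esub> g \<otimes>\<^bsub>G\<^esub> x))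
     / of_nat (card H)"

text \<open>The block (numbered from 0) containing the row or column index \<open>i\<close>, for consecutive blocks
  of sizes \<open>mu ! 0, mu ! 1, \<dots>\<close>.\<close>

definition block_of :: "nat list \<Rightarrow> nat \<Rightarrow> nat" where
  "block_of mu i = (LEAST r. i < sum_list (take (Suc r) mu))"

definition parabolic :: "nat list \<Rightarrow> 'k::field mat set" where
  "parabolic mu = {A \<in> carrier (GL (sum_list mu)).
     \<forall>i<sum_list mu. \<forall>j<sum_list mu. block_of mu j < block_of mu i \<longrightarrow> A $$ (i, j) = 0}"

definition parabolic_char :: "nat list \<Rightarrow> 'k::{field,finite} mat \<Rightarrow> complex" where
  "parabolic_char mu = induced_char (GL (sum_list mu)) (parabolic mu) (\<lambda>_. 1)"

text \<open>The family \<open>\<chi>\<^sup>\<lambda>\<close>, \<open>\<lambda>\<close> a partition of \<open>n\<close>, of functions on \<open>GL n\<close>.\<close>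

definition unipotent_char :: "nat \<Rightarrow> nat list \<Rightarrow> 'k::{field,finite} mat \<Rightarrow> complex" where
  "unipotent_char n = (THE X. X \<in> partitions n \<rightarrow>\<^sub>E extensional (carrier (GL n)) \<and>
     (\<forall>mu\<in>partitions n. \<forall>g\<in>carrier (GL n).
        parabolic_char mu g = (\<Sum>lam\<in>partitions n. of_nat (kostka lam mu) * X lam g)))"

text \<open>The value of the unipotent character \<open>\<chi>\<^sup>(\<^sup>\<alpha>\<^sup>;\<^sup>\<beta>\<^sup>)\<close> of \<open>GLB(k)\<close> on the element \<open>g\<close> of the subalgebra
  \<open>\<complex>[GL\<^sub>n(k)]\<close> of its group algebra.\<close>

definition GLB_char ::
  "(nat \<Rightarrow> real) \<times> (nat \<Rightarrow> real) \<Rightarrow> nat \<Rightarrow> 'k::{field,finite} mat \<Rightarrow> complex" where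
  "GLB_char \<omega> n g =
     (\<Sum>lam\<in>partitions n. unipotent_char n lam g * of_real (thoma_eval \<omega> (schur lam)))"

definition unipotent_mat :: "nat \<Rightarrow> 'k::field mat \<Rightarrow> bool" where
  "unipotent_mat n u \<longleftrightarrow> u \<in> carrier (GL n) \<and> (\<exists>r. (u - 1\<^sub>m n) ^\<^sub>m r = 0\<^sub>m n n)"

definition has_jordan_type :: "'k::field mat \<Rightarrow> nat list \<Rightarrow> bool" where
  "has_jordan_type u rho \<longleftrightarrow> jordan_nf u (map (\<lambda>r. (r, 1)) rho)"

end

theory Submission
  imports Defs "HOL-Library.Function_Algebras"
begin

text \<open>The value of \<open>\<psi>\<^sup>\<mu>\<close> at a unipotent matrix \<open>u\<close> of type \<open>\<rho>\<close> is the number of \<open>u\<close>-stable flags with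
  block sizes \<open>\<mu>\<close>. It equals \<open>t\<^sup>-\<^sup>n\<^sup>(\<^sup>\<rho>\<^sup>)\<close> times the coefficient of \<open>P\<^sub>\<rho>\<close> in \<open>h\<^sub>\<mu> = \<Sum>\<^sub>\<lambda> K\<^bsub>\<lambda>\<mu>\<^esub> s\<^sub>\<lambda>\<close>, because both
  satisfy the same recursion in the last part \<open>r\<close> of \<open>\<mu>\<close>. For the coefficients it comes from
  \<open>\<Sum>\<^sub>i (-1)\<^sup>i e\<^sub>i h\<^bsub>r-i\<^esub> = 0\<close> and the Pieri rule for \<open>e\<^sub>i P\<^sub>\<rho>\<close>; for the flags it is a Moebius inversion over
  the subspaces containing the image of \<open>u - 1\<close>, the number of those of given type being a power
  of \<open>q\<close> times a Pieri coefficient. Inverting the Kostka matrix gives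
  \<open>\<chi>\<^sup>\<lambda>(u) = t\<^sup>-\<^sup>n\<^sup>(\<^sup>\<rho>\<^sup>) K\<^bsub>\<lambda>\<rho>\<^esub>(t)\<close>, hence (i), and (ii) follows as the matrix of all \<open>K\<^bsub>\<lambda>\<rho>\<^esub>(t)\<close> is
  invertible: it relates two bases of symmetric functions.\<close>


text \<open>\<open>hall_littlewood\<close>, \<open>kostka_foulkes\<close>, \<open>thoma_eval\<close>
  and \<open>unipotent_char\<close> are definite descriptions, so existence and uniqueness come
  before any use. The obstacle is \<open>hall_littlewood\<close>: one series over Z[t] has to
  restrict, for every number of variables, to a sum of symmetrized fractions. It is obtained from
  the Pieri rule in finitely many variables, read as a recursion for P_lam. Partitions are mostly
  handled through their column lengths: there a vertical strip becomes an interlacing condition,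
  Pieri coefficients become products of Gaussian binomials of column differences, and the columns of
  a Jordan type are the dimensions of N^i V / N^(i+1) V, where N = u - 1. Counting subspaces
  produces Gaussian binomials at q, the Pieri rule produces them at t = 1/q; the powers of q by
  which they differ add up to differences of n(rho), which is where the factor t^(-n(rho)) comes
  from. The Moebius inversion leaves no boundary term because N V + C = V forces C = V for an
  N-stable C, a Nakayama argument.\<close>

section \<open>Exponent vectors and symmetric series\<close>

abbreviation expo :: "(nat \<Rightarrow>\<^sub>0 nat) \<Rightarrow> nat \<Rightarrow> nat" where "expo \<equiv> Poly_Mapping.lookup"
abbreviation vars :: "(nat \<Rightarrow>\<^sub>0 nat) \<Rightarrow> nat set" where "vars \<equiv> Poly_Mapping.keys"

text \<open>The exponent vector of the squarefree monomial with variable set \<open>S\<close>;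
  multiplication by an elementary symmetric function sums over these.\<close>

definition ind :: "nat set \<Rightarrow> nat \<Rightarrow>\<^sub>0 nat" where
  "ind S = (\<Sum>i\<in>S. Poly_Mapping.single i 1)"

lemma expo_ind: "finite S \<Longrightarrow> expo (ind S) i = (if i \<in> S then 1 else 0)"
  unfolding ind_def by (simp add: Poly_Mapping.lookup_sum lookup_single when_def)

lemma vars_ind [simp]: "finite S \<Longrightarrow> vars (ind S) = S"
  by (auto simp: in_keys_iff expo_ind split: if_splits)

lemma vars_plus [simp]: "vars (a + b) = vars a \<union> vars b"
  by (auto simp: in_keys_iff lookup_add)

lemma mdeg_eq: "finite A \<Longrightarrow> vars m \<subseteq> A \<Longrightarrow> mdeg m = (\<Sum>i\<in>A. expo m i)"
  unfolding mdeg_def by (rule sum.mono_neutral_left) (auto simp: in_keys_iff)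

lemma mdeg_plus: "mdeg (a + b) = mdeg a + mdeg b"
proof -
  let ?A = "vars a \<union> vars b"
  have "mdeg (a + b) = (\<Sum>i\<in>?A. expo (a + b) i)" "mdeg a = (\<Sum>i\<in>?A. expo a i)"
    "mdeg b = (\<Sum>i\<in>?A. expo b i)" by (auto intro!: mdeg_eq)
  then show ?thesis by (simp add: lookup_add sum.distrib)
qed

lemma mdeg_0 [simp]: "mdeg 0 = 0" by (simp add: mdeg_def)

lemma mdeg_eq_0_iff: "mdeg m = 0 \<longleftrightarrow> m = 0"
proof
  assume "mdeg m = 0"
  then have "\<forall>i\<in>vars m. expo m i = 0" by (simp add: mdeg_def)
  then show "m = 0" by (intro poly_mapping_eqI) (auto simp: in_keys_iff)
qed simp

lemma mdeg_ind: "finite S \<Longrightarrow> mdeg (ind S) = card S"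
  by (simp add: mdeg_eq[of S] expo_ind)

lemma mdeg_single: "mdeg (Poly_Mapping.single i k) = k"
  by (cases "k = 0") (auto simp: mdeg_def)

lemma card_vars_le_mdeg: "card (vars m) \<le> mdeg m"
proof -
  have "card (vars m) = (\<Sum>i\<in>vars m. 1)" by simp
  also have "\<dots> \<le> mdeg m" unfolding mdeg_def by (intro sum_mono) (auto simp: in_keys_iff)
  finally show ?thesis .
qed

lemma expo_map_key: "inj \<pi> \<Longrightarrow> expo (Poly_Mapping.map_key \<pi> m) i = expo m (\<pi> i)"
  by (simp add: Poly_Mapping.map_key.rep_eq)

lemma mdeg_map_key: assumes "bij \<pi>" shows "mdeg (Poly_Mapping.map_key \<pi> m) = mdeg m"
proof -
  have i: "inj \<pi>" using assms bij_is_inj by blast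
  have "mdeg (Poly_Mapping.map_key \<pi> m) = (\<Sum>i\<in>\<pi> -` vars m. expo m (\<pi> i))"
    by (simp add: mdeg_def keys_map_key[OF i] expo_map_key[OF i])
  also have "\<dots> = (\<Sum>i\<in>vars m. expo m i)"
    by (rule sum.reindex_bij_betw) (use assms in \<open>auto simp: bij_betw_def inj_on_def surj_image_vimage_eq bij_def inj_def\<close>)
  finally show ?thesis by (simp add: mdeg_def)
qed

lemma map_key_ind:
  assumes "bij \<pi>" "finite S" shows "Poly_Mapping.map_key \<pi> (ind S) = ind (\<pi> -` S)"
proof (rule poly_mapping_eqI)
  fix i
  have "finite (\<pi> -` S)" using assms by (simp add: bij_is_inj finite_vimageI)
  then show "expo (Poly_Mapping.map_key \<pi> (ind S)) i = expo (ind (\<pi> -` S)) i"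
    using assms by (simp add: expo_map_key bij_is_inj expo_ind)
qed

text \<open>Membership in \<open>symfuns\<close> only bounds the degree. Separating symmetry from
  exact degree allows all expansions to be done one degree at a time, indexed by
  \<open>partitions n\<close>.\<close>

definition symmetric_series :: "'a::zero series \<Rightarrow> bool" where
  "symmetric_series f \<longleftrightarrow> (\<forall>\<pi> m. bij \<pi> \<longrightarrow> f (Poly_Mapping.map_key \<pi> m) = f m)"

definition homogeneous :: "nat \<Rightarrow> 'a::zero series \<Rightarrow> bool" where
  "homogeneous n f \<longleftrightarrow> (\<forall>m. f m \<noteq> 0 \<longrightarrow> mdeg m = n)"

lemma symfunsI: "symmetric_series f \<Longrightarrow> homogeneous n f \<Longrightarrow> f \<in> symfuns"
  by (auto simp: symfuns_def symmetric_series_def homogeneous_def)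

text \<open>Symmetry is stated for bijections of all variables, so a renaming of finitely many of
  them has to be extended. Inside the finite set \<open>B\<close> the remaining sources and targets
  are equinumerous; outside \<open>B\<close> the identity is used.\<close>

lemma bij_extending_enumeration:
  fixes L :: "nat list" assumes "distinct L"
  obtains \<pi> :: "nat \<Rightarrow> nat" where "bij \<pi>" "\<And>i. i < length L \<Longrightarrow> \<pi> i = L ! i"
proof -
  define k where "k = length L"
  define B where "B = set L \<union> {..<k}"
  have "card (B - {..<k}) = card (B - set L)"
    using assms by (simp add: B_def card_Diff_subset k_def distinct_card)
  then obtain h where h: "bij_betw h (B - {..<k}) (B - set L)"
    using finite_same_card_bij[of "B - {..<k}" "B - set L"] by (auto simp: B_def)
  have nth: "bij_betw ((!) L) {..<k} (set L)"
    using assms bij_betw_nth[of L "{..<k}" "set L"] by (auto simp: k_def lessThan_atLeast0)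
  define g where "g = (\<lambda>i. if i < k then L ! i else h i)"
  have "bij_betw g {..<k} (set L)" using nth by (subst bij_betw_cong[of _ _ "(!) L"]) (auto simp: g_def)
  moreover have "bij_betw g (B - {..<k}) (B - set L)"
    using h by (subst bij_betw_cong[of _ _ h]) (auto simp: g_def)
  ultimately have "bij_betw g ({..<k} \<union> (B - {..<k})) (set L \<union> (B - set L))"
    by (rule bij_betw_combine) auto
  then have gB: "bij_betw g B B" by (simp add: B_def Un_absorb1 Un_commute)
  define \<pi> where "\<pi> = (\<lambda>i. if i \<in> B then g i else i)"
  have "bij_betw \<pi> B B" using gB by (subst bij_betw_cong[of _ _ g]) (auto simp: \<pi>_def)
  moreover have "bij_betw \<pi> (- B) (- B)" by (subst bij_betw_cong[of _ _ id]) (auto simp: \<pi>_def)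
  ultimately have "bij_betw \<pi> (B \<union> - B) (B \<union> - B)" by (rule bij_betw_combine) auto
  then have "bij \<pi>" by simp
  moreover have "\<pi> i = L ! i" if "i < length L" for i
    using that by (simp add: \<pi>_def B_def g_def k_def)
  ultimately show thesis by (rule that)
qed

section \<open>Partitions and the removal of the first column\<close>

lemma partitions_0 [simp]: "partitions 0 = {[]}"
  by (auto simp: partitions_def) (metis list.set_intros(1) list.exhaust)

lemma length_le_sum_list: "0 \<notin> set xs \<Longrightarrow> length xs \<le> sum_list (xs :: nat list)"
  by (induction xs) auto

lemma length_partition_le: "lam \<in> partitions n \<Longrightarrow> length lam \<le> n"
  using length_le_sum_list by (auto simp: partitions_def)

lemma finite_partitions [simp]: "finite (partitions n)"
proof (rule finite_subset)
  show "partitions n \<subseteq> {xs. set xs \<subseteq> {..n} \<and> length xs \<le> n}"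
    using member_le_sum_list length_le_sum_list by (fastforce simp: partitions_def)
  show "finite {xs. set xs \<subseteq> {..n} \<and> length xs \<le> n}" by (rule finite_lists_length_le) simp
qed

definition strip_col :: "nat list \<Rightarrow> nat list" where
  "strip_col lam = filter (\<lambda>x. x \<noteq> 0) (map (\<lambda>x. x - 1) lam)"

text \<open>\<open>N\<close> is the height of the new column; the padding by zero rows lets it
  exceed the number of rows of \<open>nu\<close>.\<close>

definition add_col :: "nat \<Rightarrow> nat list \<Rightarrow> nat list" where
  "add_col N nu = map Suc (nu @ replicate (N - length nu) 0)"

lemma sum_list_nonzero: "sum_list (filter (\<lambda>x. x \<noteq> 0) xs) = sum_list (xs :: nat list)"
  by (induction xs) auto

lemma sum_list_pred: "0 \<notin> set xs \<Longrightarrow> sum_list (map (\<lambda>x. x - 1) xs) = sum_list xs - length (xs :: nat list)"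
proof (induction xs)
  case (Cons x xs)
  then show ?case using length_le_sum_list[of xs] by auto
qed simp

lemma strip_col_partition:
  assumes "lam \<in> partitions n"
  shows "strip_col lam \<in> partitions (n - length lam)" "length (strip_col lam) \<le> length lam"
proof -
  have "sorted_wrt (\<ge>) (map (\<lambda>x. x - 1) lam)"
    using assms unfolding sorted_wrt_map partitions_def by (auto elim!: sorted_wrt_mono_rel[rotated])
  then have "sorted_wrt (\<ge>) (strip_col lam)" unfolding strip_col_def by (rule sorted_wrt_filter)
  moreover have "sum_list (strip_col lam) = n - length lam"
    using assms sum_list_pred[of lam] by (simp only: strip_col_def sum_list_nonzero) (simp add: partitions_def)
  ultimately show "strip_col lam \<in> partitions (n - length lam)"
    by (auto simp: partitions_def strip_col_def)
  show "length (strip_col lam) \<le> length lam" by (simp add: strip_col_def length_filter_le[THEN order_trans])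
qed

lemma add_col_partition:
  assumes "nu \<in> partitions k" "length nu \<le> N"
  shows "add_col N nu \<in> partitions (k + N)" "length (add_col N nu) = N" "strip_col (add_col N nu) = nu"
proof -
  have s: "sum_list (map Suc xs) = sum_list xs + length xs" for xs :: "nat list" by (induction xs) auto
  have r: "sorted_wrt (\<ge>) (replicate k (0::nat))" for k by (induction k) auto
  have "sorted_wrt (\<ge>) (nu @ replicate (N - length nu) 0)"
    using assms r by (auto simp: partitions_def sorted_wrt_append)
  then have "sorted_wrt (\<ge>) (add_col N nu)"
    unfolding add_col_def sorted_wrt_map by (auto elim!: sorted_wrt_mono_rel[rotated])
  then show "add_col N nu \<in> partitions (k + N)"
    using assms by (auto simp: partitions_def add_col_def s sum_list_replicate simp del: map_append)
  show "length (add_col N nu) = N" using assms by (simp add: add_col_def)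
  have "filter (\<lambda>x. x \<noteq> 0) nu = nu" using assms by (intro filter_True) (auto simp: partitions_def intro: ccontr)
  then show "strip_col (add_col N nu) = nu" by (simp add: strip_col_def add_col_def comp_def)
qed

lemma add_strip_col:
  assumes "lam \<in> partitions n" shows "add_col (length lam) (strip_col lam) = lam"
proof -
  have *: "filter (\<lambda>x. x \<noteq> 0) xs @ replicate (length xs - length (filter (\<lambda>x. x \<noteq> 0) xs)) 0 = xs"
    if "sorted_wrt (\<ge>) xs" for xs :: "nat list"
    using that
  proof (induction xs)
    case (Cons x xs)
    show ?case
    proof (cases "x = 0")
      case True
      then have "set xs \<subseteq> {0}" using Cons.prems by auto
      then have "filter (\<lambda>x. x \<noteq> 0) xs = []" "replicate (length xs) 0 = xs"
        by (auto simp: filter_empty_conv) (metis replicate_length_same singletonD subsetD)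
      then show ?thesis using True by simp
    next
      case False
      have "sorted_wrt (\<ge>) xs" using Cons.prems by simp
      from Cons.IH[OF this] show ?thesis using False by simp
    qed
  qed simp
  have "sorted_wrt (\<ge>) (map (\<lambda>x. x - 1) lam)"
    using assms unfolding sorted_wrt_map partitions_def by (auto elim!: sorted_wrt_mono_rel[rotated])
  from *[OF this] have "strip_col lam @ replicate (length lam - length (strip_col lam)) 0 = map (\<lambda>x. x - 1) lam"
    by (simp add: strip_col_def)
  moreover have "map (\<lambda>x. Suc (x - 1)) lam = lam"
  proof (rule map_idI)
    fix x assume "x \<in> set lam"
    then have "x \<noteq> 0" using assms unfolding partitions_def by (metis (mono_tags, lifting) mem_Collect_eq)
    then show "Suc (x - 1) = x" by simp
  qed
  ultimately show ?thesis by (simp add: add_col_def comp_def del: map_append)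
qed

lemma strip_col_bij:
  "bij_betw strip_col {lam \<in> partitions n. length lam = N} {nu \<in> partitions (n - N). length nu \<le> N}" if "N \<le> n"
proof (rule bij_betw_byWitness[where f' = "add_col N"])
  show "\<forall>a\<in>{lam \<in> partitions n. length lam = N}. add_col N (strip_col a) = a"
    using add_strip_col by blast
  show "\<forall>a'\<in>{nu \<in> partitions (n - N). length nu \<le> N}. strip_col (add_col N a') = a'"
    using add_col_partition by blast
  show "strip_col ` {lam \<in> partitions n. length lam = N} \<subseteq> {nu \<in> partitions (n - N). length nu \<le> N}"
    using strip_col_partition by blast
  show "add_col N ` {nu \<in> partitions (n - N). length nu \<le> N} \<subseteq> {lam \<in> partitions n. length lam = N}"
    using add_col_partition[of _ "n - N" N] that by auto
qed

lemma add_ind_diff: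
  assumes "vars m = S" "finite S" shows "m - ind S + ind S = m"
proof (rule poly_mapping_eqI)
  fix i show "expo (m - ind S + ind S) i = expo m i"
    using assms by (auto simp: lookup_add lookup_minus expo_ind in_keys_iff)
qed

lemma ex_variables_initial:
  obtains \<pi> :: "nat \<Rightarrow> nat" where "bij \<pi>" "vars (Poly_Mapping.map_key \<pi> m) = {..<card (vars m)}"
proof -
  obtain \<pi> where p: "bij \<pi>" "\<And>i. i < length (sorted_list_of_set (vars m)) \<Longrightarrow> \<pi> i = sorted_list_of_set (vars m) ! i"
    using bij_extending_enumeration[of "sorted_list_of_set (vars m)"] by auto
  have "vars m = (!) (sorted_list_of_set (vars m)) ` {..<card (vars m)}"
    by (metis lessThan_atLeast0 finite_keys length_sorted_list_of_set list.set_map map_nth set_sorted_list_of_set set_upt)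
  also have "\<dots> = \<pi> ` {..<card (vars m)}" using p by (intro image_cong) auto
  finally have "\<pi> -` vars m = {..<card (vars m)}" using p by (metis bij_is_inj inj_vimage_image_eq)
  then show thesis using that[of \<pi>] p keys_map_key[of \<pi> m] by (simp add: bij_is_inj)
qed

section \<open>Bases of symmetric functions that are triangular for column removal\<close>

text \<open>A family indexed by partitions that is unitriangular for the order comparing first columns,
  then second columns, and so on.\<close>

locale strip_family =
  fixes f :: "nat list \<Rightarrow> 'a::comm_ring_1 series"
  assumes sym: "lam \<in> partitions n \<Longrightarrow> symmetric_series (f lam)"
    and hom: "lam \<in> partitions n \<Longrightarrow> homogeneous n (f lam)"
    and vanish: "lam \<in> partitions n \<Longrightarrow> card (vars m) < length lam \<Longrightarrow> f lam m = 0"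
    and strip: "lam \<in> partitions n \<Longrightarrow> vars m \<subseteq> {..<length lam} \<Longrightarrow>
      f lam (m + ind {..<length lam}) = f (strip_col lam) m"
    and base: "f [] 0 = 1"
begin

lemma map_keyD: "lam \<in> partitions n \<Longrightarrow> bij \<pi> \<Longrightarrow> f lam (Poly_Mapping.map_key \<pi> m) = f lam m"
  using sym by (auto simp: symmetric_series_def)

text \<open>The scheme of the fundamental theorem of symmetric functions: subtract an expansion that
  is exact when the last of the \<open>N\<close> variables is absent; the difference is divisible by
  the product of all \<open>N\<close> variables, and the quotient has degree \<open>n - N\<close>.
  Axiom \<open>strip\<close> turns an expansion of the quotient into one of the difference. Symmetry
  is demanded in the first \<open>N\<close> variables only, because the quotient \<open>h'\<close>
  is cut off outside them.\<close>

lemma expand_vars: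
  assumes "\<And>\<pi> m. \<pi> permutes {..<N} \<Longrightarrow> vars m \<subseteq> {..<N} \<Longrightarrow> g (Poly_Mapping.map_key \<pi> m) = g m"
    and "\<And>m. g m \<noteq> 0 \<Longrightarrow> mdeg m = n"
  shows "\<exists>c. (\<forall>lam. c lam \<noteq> 0 \<longrightarrow> lam \<in> partitions n \<and> length lam \<le> N) \<and>
    (\<forall>m. vars m \<subseteq> {..<N} \<longrightarrow> g m = (\<Sum>lam\<in>partitions n. c lam * f lam m))"
  using assms
proof (induction "n + N" arbitrary: n N g rule: less_induct)
  case less
  show ?case
  proof (cases "N = 0")
    case True
    have z: "m = 0" if "vars m \<subseteq> {..<N}" for m using that True by simp
    show ?thesis
    proof (cases "n = 0")
      case nz: True
      have "g m = (\<Sum>lam\<in>partitions n. (if lam = [] then g 0 else 0) * f lam m)" if "vars m \<subseteq> {..<N}" for m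
        using z[OF that] nz base by simp
      moreover have "(if lam = [] then g 0 else 0) \<noteq> 0 \<Longrightarrow> lam \<in> partitions n \<and> length lam \<le> N" for lam
        using nz by (simp split: if_splits)
      ultimately show ?thesis by (intro exI[of _ "\<lambda>lam. if lam = [] then g 0 else 0"]) blast
    next
      case False
      then have "g 0 = 0" using less.prems(2)[of 0] by auto
      then have "g m = 0" if "vars m \<subseteq> {..<N}" for m using z[OF that] by simp
      then show ?thesis by (intro exI[of _ "\<lambda>_. 0"]) auto
    qed
  next
    case False
    then obtain M where M: "N = Suc M" by (cases N) auto
    have "\<exists>c. (\<forall>lam. c lam \<noteq> 0 \<longrightarrow> lam \<in> partitions n \<and> length lam \<le> M) \<and>
      (\<forall>m. vars m \<subseteq> {..<M} \<longrightarrow> g m = (\<Sum>lam\<in>partitions n. c lam * f lam m))"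
    proof (rule less.hyps)
      show "n + M < n + N" using M by simp
      fix \<pi> m assume "\<pi> permutes {..<M}" "vars m \<subseteq> {..<M}"
      then show "g (Poly_Mapping.map_key \<pi> m) = g m"
        using M permutes_subset[of \<pi> "{..<M}" "{..<N}"] by (intro less.prems(1)) auto
    qed (use less.prems(2) in auto)
    then obtain c where c: "\<And>lam. c lam \<noteq> 0 \<Longrightarrow> lam \<in> partitions n \<and> length lam \<le> M"
      "\<And>m. vars m \<subseteq> {..<M} \<Longrightarrow> g m = (\<Sum>lam\<in>partitions n. c lam * f lam m)" by blast
    define h where "h m = g m - (\<Sum>lam\<in>partitions n. c lam * f lam m)" for m
    have hsym: "h (Poly_Mapping.map_key \<pi> m) = h m" if "\<pi> permutes {..<N}" "vars m \<subseteq> {..<N}" for \<pi> m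
    proof -
      have "(\<Sum>lam\<in>partitions n. c lam * f lam (Poly_Mapping.map_key \<pi> m)) = (\<Sum>lam\<in>partitions n. c lam * f lam m)"
        using that(1) by (intro sum.cong refl) (simp add: map_keyD permutes_bij)
      then show ?thesis using less.prems(1)[OF that] by (simp add: h_def)
    qed
    have hdeg: "mdeg m = n" if "h m \<noteq> 0" for m
    proof (rule ccontr)
      assume ne: "mdeg m \<noteq> n"
      then have "g m = 0" using less.prems(2) by blast
      moreover have "(\<Sum>lam\<in>partitions n. c lam * f lam m) = 0"
        using hom ne unfolding homogeneous_def by (intro sum.neutral ballI) (metis mult_zero_right)
      ultimately show False using that by (simp add: h_def)
    qed
    \<comment> \<open>A monomial without variable \<open>i\<close> is carried by a transposition to
      one without the last variable, where the expansion \<open>c\<close> is exact.\<close>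
    have h0: "h m = 0" if m: "vars m \<subset> {..<N}" for m
    proof -
      have "card (vars m) < N" using psubset_card_mono[OF _ m] by simp
      obtain i where i: "i < N" "i \<notin> vars m" using m by blast
      define \<pi> where "\<pi> = Transposition.transpose i M"
      have p: "\<pi> permutes {..<N}" unfolding \<pi>_def using i M by (intro permutes_swap_id) auto
      have "vars (Poly_Mapping.map_key \<pi> m) \<subseteq> {..<M}"
      proof
        fix j assume "j \<in> vars (Poly_Mapping.map_key \<pi> m)"
        then have "\<pi> j \<in> vars m" by (simp add: keys_map_key permutes_inj[OF p])
        moreover have "\<pi> M \<notin> vars m" using i by (simp add: \<pi>_def)
        ultimately have "j \<noteq> M" "\<pi> j < N" using m by auto
        then show "j \<in> {..<M}" using p M permutes_in_image[OF p, of j] by auto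
      qed
      then have "h (Poly_Mapping.map_key \<pi> m) = 0" using c(2) by (simp add: h_def)
      then show ?thesis using hsym[OF p] m by auto
    qed
    show ?thesis
    proof (cases "N \<le> n")
      case False
      have "h m = 0" if "vars m \<subseteq> {..<N}" for m
      proof (rule ccontr)
        assume nz: "h m \<noteq> 0"
        then have "vars m = {..<N}" using h0 that by blast
        then have "N \<le> mdeg m" using card_vars_le_mdeg[of m] by simp
        then show False using hdeg[OF nz] False by simp
      qed
      then show ?thesis using c M by (intro exI[of _ c]) (force simp: h_def)
    next
      case le: True
      \<comment> \<open>Division of \<open>h\<close> by the product of the first \<open>N\<close>
        variables.\<close>
      define h' where "h' m = (if vars m \<subseteq> {..<N} then h (m + ind {..<N}) else 0)" for m
      have "\<exists>c. (\<forall>lam. c lam \<noteq> 0 \<longrightarrow> lam \<in> partitions (n - N) \<and> length lam \<le> N) \<and>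
        (\<forall>m. vars m \<subseteq> {..<N} \<longrightarrow> h' m = (\<Sum>lam\<in>partitions (n - N). c lam * f lam m))"
      proof (rule less.hyps)
        show "n - N + N < n + N" using le M by simp
        fix \<pi> m assume p: "\<pi> permutes {..<N}" and v: "vars m \<subseteq> {..<N}"
        have i: "inj \<pi>" "bij \<pi>" using p permutes_inj permutes_bij by auto
        have pv: "\<pi> -` {..<N} = {..<N}" using p by (rule permutes_vimage)
        have "vars (Poly_Mapping.map_key \<pi> m) \<subseteq> {..<N}"
          using v pv unfolding keys_map_key[OF i(1)] by blast
        moreover have "Poly_Mapping.map_key \<pi> m + ind {..<N} = Poly_Mapping.map_key \<pi> (m + ind {..<N})"
          by (simp add: map_key_plus i map_key_ind pv)
        ultimately show "h' (Poly_Mapping.map_key \<pi> m) = h' m"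
          using hsym[OF p, of "m + ind {..<N}"] v by (simp add: h'_def)
      next
        fix m assume "h' m \<noteq> 0"
        then have "mdeg (m + ind {..<N}) = n" using hdeg by (auto simp: h'_def split: if_splits)
        then show "mdeg m = n - N" by (simp add: mdeg_plus mdeg_ind)
      qed
      then obtain d where d: "\<And>lam. d lam \<noteq> 0 \<Longrightarrow> lam \<in> partitions (n - N) \<and> length lam \<le> N"
        "\<And>m. vars m \<subseteq> {..<N} \<Longrightarrow> h' m = (\<Sum>lam\<in>partitions (n - N). d lam * f lam m)" by blast
      define e where "e lam = (if lam \<in> partitions n \<and> length lam = N then d (strip_col lam) else 0)" for lam
      have he: "h m = (\<Sum>lam\<in>partitions n. e lam * f lam m)" if v: "vars m \<subseteq> {..<N}" for m
      proof (cases "vars m = {..<N}")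
        case True
        define m' where "m' = m - ind {..<N}"
        have m': "m = m' + ind {..<N}" using add_ind_diff[OF True] by (simp add: m'_def)
        then have vm': "vars m' \<subseteq> {..<N}" using v by (metis Un_upper1 order_trans vars_plus)
        have "(\<Sum>lam\<in>partitions n. e lam * f lam m) =
            (\<Sum>lam\<in>{lam \<in> partitions n. length lam = N}. d (strip_col lam) * f (strip_col lam) m')"
          using vm' by (intro sum.mono_neutral_cong_right) (auto simp: e_def m' strip)
        also have "\<dots> = (\<Sum>nu\<in>{nu \<in> partitions (n - N). length nu \<le> N}. d nu * f nu m')"
          by (rule sum.reindex_bij_betw[OF strip_col_bij[OF le]])
        also have "\<dots> = (\<Sum>nu\<in>partitions (n - N). d nu * f nu m')"
          by (intro sum.mono_neutral_left) (auto, metis d(1) mult_zero_left)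
        also have "\<dots> = h m" using d(2)[OF vm'] vm' by (simp add: h'_def m')
        finally show ?thesis ..
      next
        case False
        then have lt: "vars m \<subset> {..<N}" using v by blast
        then have "card (vars m) < N" using psubset_card_mono[of "{..<N}" "vars m"] by simp
        then have "(\<Sum>lam\<in>partitions n. e lam * f lam m) = 0"
          by (intro sum.neutral) (auto simp: e_def vanish)
        then show ?thesis using h0[OF lt] by simp
      qed
      show ?thesis
      proof (intro exI[of _ "\<lambda>lam. c lam + e lam"] conjI allI impI)
        fix lam assume "c lam + e lam \<noteq> 0"
        then have "c lam \<noteq> 0 \<or> e lam \<noteq> 0" by auto
        then show "lam \<in> partitions n" "length lam \<le> N" using c(1) M
          by (auto simp: e_def split: if_splits dest!: c(1))
      next
        fix m assume "vars m \<subseteq> {..<N}"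
        then have "g m = (\<Sum>lam\<in>partitions n. c lam * f lam m) + (\<Sum>lam\<in>partitions n. e lam * f lam m)"
          using he by (simp add: h_def algebra_simps)
        then show "g m = (\<Sum>lam\<in>partitions n. (c lam + e lam) * f lam m)"
          by (simp add: sum.distrib algebra_simps)
      qed
    qed
  qed
qed

text \<open>A monomial of degree \<open>n\<close> has at most \<open>n\<close> variables, so after a
  renaming the first \<open>n\<close> variables suffice.\<close>

lemma eq_expansionI:
  assumes "symmetric_series g" "homogeneous n g"
    and "\<And>m. vars m \<subseteq> {..<n} \<Longrightarrow> g m = (\<Sum>lam\<in>partitions n. c lam * f lam m)"
  shows "g = (\<lambda>m. \<Sum>lam\<in>partitions n. c lam * f lam m)"
proof
  fix m
  show "g m = (\<Sum>lam\<in>partitions n. c lam * f lam m)"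
  proof (cases "mdeg m = n")
    case True
    obtain \<pi> where p: "bij \<pi>" "vars (Poly_Mapping.map_key \<pi> m) = {..<card (vars m)}"
      by (rule ex_variables_initial)
    then have "vars (Poly_Mapping.map_key \<pi> m) \<subseteq> {..<n}" using True card_vars_le_mdeg[of m] by auto
    then have "g (Poly_Mapping.map_key \<pi> m) = (\<Sum>lam\<in>partitions n. c lam * f lam (Poly_Mapping.map_key \<pi> m))"
      by (rule assms(3))
    then show ?thesis using assms(1) p(1) by (simp add: symmetric_series_def map_keyD)
  next
    case False
    then have "g m = 0" "(\<Sum>lam\<in>partitions n. c lam * f lam m) = 0"
      using assms(2) hom unfolding homogeneous_def
      by (blast, intro sum.neutral ballI) (metis mult_zero_right)
    then show ?thesis by simp
  qed
qed

theorem expand: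
  assumes "symmetric_series g" "homogeneous n g"
  obtains c where "g = (\<lambda>m. \<Sum>lam\<in>partitions n. c lam * f lam m)"
proof -
  have "g (Poly_Mapping.map_key \<pi> m) = g m" if "\<pi> permutes {..<n}" for \<pi> m
    using assms(1) permutes_bij[OF that] by (auto simp: symmetric_series_def)
  then obtain c where c: "\<forall>m. vars m \<subseteq> {..<n} \<longrightarrow> g m = (\<Sum>lam\<in>partitions n. c lam * f lam m)"
    using expand_vars[of n g n] assms(2) by (auto simp: homogeneous_def)
  show thesis using that[OF eq_expansionI[OF assms, of c]] c by blast
qed

text \<open>The same induction as for existence. Partitions with more than \<open>N\<close> rows
  vanish on the monomials considered, which is why the conclusion is limited to
  \<open>length lam \<le> N\<close>. Those with fewer rows are settled by dropping a variable; for
  those with exactly \<open>N\<close> rows, evaluation at multiples of the full product strips a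
  column.\<close>

lemma independent_vars:
  assumes "\<And>m. vars m \<subseteq> {..<N} \<Longrightarrow> (\<Sum>lam\<in>partitions n. c lam * f lam m) = 0"
    and "lam \<in> partitions n" "length lam \<le> N"
  shows "c lam = 0"
  using assms
proof (induction "n + N" arbitrary: n N c lam rule: less_induct)
  case less
  show ?case
  proof (cases "N = 0")
    case True
    then have "lam = []" "n = 0" using less.prems by (auto simp: partitions_def)
    then show ?thesis using less.prems(1)[of 0] base by simp
  next
    case False
    then obtain M where M: "N = Suc M" by (cases N) auto
    have small: "c mu = 0" if "mu \<in> partitions n" "length mu < N" for mu
      by (rule less.hyps[of n M c mu]) (use M less.prems(1) that in force)+
    show ?thesis
    proof (cases "length lam = N")
      case True
      have le: "N \<le> n" using True less.prems(2) length_partition_le by blast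
      define c' where "c' nu = (if length nu \<le> N then c (add_col N nu) else 0)" for nu
      have "c' (strip_col lam) = 0"
      proof (rule less.hyps[of "n - N" N c' "strip_col lam"])
        show "n - N + N < n + N" using le M by simp
        show "strip_col lam \<in> partitions (n - N)" "length (strip_col lam) \<le> N"
          using strip_col_partition[OF less.prems(2)] True by auto
        fix m assume v: "vars m \<subseteq> {..<N}"
        have vN: "vars (m + ind {..<N}) = {..<N}" using v by auto
        have "(\<Sum>nu\<in>partitions (n - N). c' nu * f nu m) = (\<Sum>nu\<in>{nu \<in> partitions (n - N). length nu \<le> N}. c' nu * f nu m)"
          by (intro sum.mono_neutral_right) (auto simp: c'_def)
        also have "\<dots> = (\<Sum>lam\<in>{lam \<in> partitions n. length lam = N}. c' (strip_col lam) * f (strip_col lam) m)"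
          by (rule sum.reindex_bij_betw[OF strip_col_bij[OF le], symmetric])
        also have "\<dots> = (\<Sum>lam\<in>{lam \<in> partitions n. length lam = N}. c lam * f lam (m + ind {..<N}))"
          using v strip_col_partition add_strip_col by (intro sum.cong) (auto simp: c'_def strip)
        also have "\<dots> = (\<Sum>lam\<in>partitions n. c lam * f lam (m + ind {..<N}))"
        proof (intro sum.mono_neutral_left)
          show "\<forall>i\<in>partitions n - {lam \<in> partitions n. length lam = N}. c i * f i (m + ind {..<N}) = 0"
          proof
            fix mu assume mu: "mu \<in> partitions n - {lam \<in> partitions n. length lam = N}"
            show "c mu * f mu (m + ind {..<N}) = 0"
            proof (cases "length mu < N")
              case True then show ?thesis using small mu by simp
            next
              case False
              then have "card (vars (m + ind {..<N})) < length mu" using mu unfolding vN by auto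
              then show ?thesis using vanish[of mu n "m + ind {..<N}"] mu by auto
            qed
          qed
        qed auto
        also have "\<dots> = 0" using less.prems(1) vN by simp
        finally show "(\<Sum>nu\<in>partitions (n - N). c' nu * f nu m) = 0" .
      qed
      then show ?thesis using strip_col_partition(2)[OF less.prems(2)] add_strip_col[OF less.prems(2)] True
        by (simp add: c'_def)
    qed (use small less.prems in auto)
  qed
qed

theorem unique_coefficients:
  assumes "(\<lambda>m. \<Sum>lam\<in>partitions n. c lam * f lam m) = (\<lambda>m. \<Sum>lam\<in>partitions n. d lam * f lam m)"
    and "lam \<in> partitions n"
  shows "c lam = d lam"
proof -
  have "c lam - d lam = 0"
    using fun_cong[OF assms(1)]
    by (intro independent_vars[where N = n and n = n and c = "\<lambda>lam. c lam - d lam"])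
      (use assms(2) length_partition_le in \<open>auto simp: algebra_simps sum_subtractf\<close>)
  then show ?thesis by simp
qed

end

subsection \<open>Horizontal strips\<close>

definition fin_supp :: "(nat \<Rightarrow> nat) \<Rightarrow> bool" where
  "fin_supp g \<longleftrightarrow> (\<exists>L. \<forall>i\<ge>L. g i = 0)"

text \<open>Partitions are now sequences with zero tail, so that rows can be compared without index
  bounds. A sum over an infinite support is 0 by convention, hence the recurring condition
  \<open>fin_supp\<close>.\<close>

definition fsize :: "(nat \<Rightarrow> nat) \<Rightarrow> nat" where
  "fsize g = (\<Sum>i | g i \<noteq> 0. g i)"

definition par :: "(nat \<Rightarrow> nat) \<Rightarrow> bool" where
  "par g \<longleftrightarrow> fin_supp g \<and> (\<forall>i. g (Suc i) \<le> g i)"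

text \<open>Interlacing of rows: the removed cells form a horizontal strip. Applied to column
  lengths the same relation describes vertical strips, and it is used in both ways.\<close>

definition hstrip :: "(nat \<Rightarrow> nat) \<Rightarrow> (nat \<Rightarrow> nat) \<Rightarrow> bool" where
  "hstrip g k \<longleftrightarrow> (\<forall>i. g (Suc i) \<le> k i \<and> k i \<le> g i)"

definition remove_strip :: "(nat \<Rightarrow> nat) \<Rightarrow> nat \<Rightarrow> (nat \<Rightarrow> nat) set" where
  "remove_strip g a = {k. fin_supp g \<and> hstrip g k \<and> fsize g = fsize k + a}"

definition add_strip :: "(nat \<Rightarrow> nat) \<Rightarrow> nat \<Rightarrow> (nat \<Rightarrow> nat) set" where
  "add_strip k a = {g. k \<in> remove_strip g a}"

lemma fsize_eq: "(\<forall>i\<ge>L. g i = 0) \<Longrightarrow> fsize g = (\<Sum>i<L. g i)"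
  unfolding fsize_def by (rule sum.mono_neutral_left) (auto intro: leI)

lemma fin_supp_le: "fin_supp g \<Longrightarrow> (\<And>i. k i \<le> g i) \<Longrightarrow> fin_supp k"
  unfolding fin_supp_def by (metis bot_nat_0.extremum_uniqueI)

lemma fsize_mono:
  assumes "fin_supp g" "\<And>i. k i \<le> g i" shows "fsize k \<le> fsize g"
proof -
  obtain L where L: "\<forall>i\<ge>L. g i = 0" using assms by (auto simp: fin_supp_def)
  then have L': "\<forall>i\<ge>L. k i = 0" using assms(2) by (metis bot_nat_0.extremum_uniqueI)
  show ?thesis unfolding fsize_eq[OF L] fsize_eq[OF L'] by (intro sum_mono assms)
qed

lemma remove_stripD:
  assumes "k \<in> remove_strip g a"
  shows "hstrip g k" "fin_supp g" "fin_supp k" "fsize g = fsize k + a"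
  using assms fin_supp_le[of g k] by (auto simp: remove_strip_def hstrip_def)

lemma remove_strip_par: "k \<in> remove_strip g a \<Longrightarrow> par g \<and> par k"
  using remove_stripD[of k g a] unfolding par_def hstrip_def by (meson order_trans)

lemma finite_bounded_functions: "finite {k :: nat \<Rightarrow> nat. \<forall>i. k i \<le> B \<and> (i \<ge> L \<longrightarrow> k i = 0)}"
proof (rule finite_subset)
  show "{k :: nat \<Rightarrow> nat. \<forall>i. k i \<le> B \<and> (i \<ge> L \<longrightarrow> k i = 0)} \<subseteq>
    {f. \<forall>x. (x \<in> {..<L} \<longrightarrow> f x \<in> {..B}) \<and> (x \<notin> {..<L} \<longrightarrow> f x = 0)}" by auto
  show "finite {f. \<forall>x. (x \<in> {..<L} \<longrightarrow> f x \<in> {..B}) \<and> (x \<notin> {..<L} \<longrightarrow> f x = (0::nat))}"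
    by (rule finite_set_of_finite_funs) auto
qed

lemma par_antimono: "par g \<Longrightarrow> i \<le> j \<Longrightarrow> g j \<le> g i"
  using lift_Suc_antimono_le[of g i j] by (auto simp: par_def)

lemma par_le_fsize: assumes "par g" shows "g i \<le> fsize g"
proof (cases "g i = 0")
  case False
  obtain L where "\<forall>i\<ge>L. g i = 0" using assms by (auto simp: par_def fin_supp_def)
  then have "{i. g i \<noteq> 0} \<subseteq> {..<L}" by (auto intro: leI)
  then have "finite {i. g i \<noteq> 0}" by (rule finite_subset) simp
  then show ?thesis unfolding fsize_def using False by (intro member_le_sum) auto
qed simp

text \<open>If all rows up to index \<open>fsize g\<close> were nonempty, the size would exceed
  itself. The size thus serves as a bound beyond which the factors of \<open>pieri_coeff\<close> and
  the terms of \<open>nst\<close> are trivial.\<close>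

lemma par_zero_from: assumes "par g" shows "g (fsize g) = 0"
proof (rule ccontr)
  let ?n = "fsize g"
  assume "g ?n \<noteq> 0"
  then have pos: "g i \<ge> 1" if "i \<le> ?n" for i using par_antimono[OF assms that] by simp
  obtain L where L: "\<forall>i\<ge>L. g i = 0" using assms by (auto simp: par_def fin_supp_def)
  then have "Suc ?n \<le> L" using \<open>g ?n \<noteq> 0\<close> by (metis not_less_eq_eq)
  have "(\<Sum>i<Suc ?n. 1) \<le> (\<Sum>i<Suc ?n. g i)" by (intro sum_mono) (use pos in auto)
  also have "\<dots> \<le> (\<Sum>i<L. g i)" using \<open>Suc ?n \<le> L\<close> by (intro sum_mono2) auto
  finally show False using fsize_eq[OF L] by simp
qed

lemma finite_par: "finite {g. par g \<and> fsize g = n}"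
proof (rule finite_subset[OF _ finite_bounded_functions[of n n]])
  show "{g. par g \<and> fsize g = n} \<subseteq> {k. \<forall>i. k i \<le> n \<and> (n \<le> i \<longrightarrow> k i = 0)}"
    using par_le_fsize par_zero_from par_antimono by clarsimp (metis le_zero_eq)
qed

lemma finite_remove_strip [simp]: "finite (remove_strip g a)"
  by (rule finite_subset[OF _ finite_par[of "fsize g - a"]])
    (auto dest: remove_strip_par remove_stripD(4))

lemma finite_add_strip [simp]: "finite (add_strip k a)"
  by (rule finite_subset[OF _ finite_par[of "fsize k + a"]])
    (auto simp: add_strip_def dest: remove_strip_par remove_stripD(4))

definition strip_sum :: "nat \<Rightarrow> ((nat \<Rightarrow> nat) \<Rightarrow> 'b::comm_monoid_add) \<Rightarrow> (nat \<Rightarrow> nat) \<Rightarrow> 'b" where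
  "strip_sum a F g = (\<Sum>k\<in>remove_strip g a. F k)"

lemma max_min_shift: "max (a::nat) b + min a b = a + b" by linarith

text \<open>The local Bender-Knuth involution: between two fixed partitions, the rows of the middle
  partition of two successive strips vary independently in intervals, which are reflected.\<close>

lemma reflect_middle:
  assumes "m \<in> remove_strip g a" "k \<in> remove_strip m b"
  defines "lo \<equiv> \<lambda>i. max (g (Suc i)) (k i)"
    and "hi \<equiv> \<lambda>i. min (g i) (case i of 0 \<Rightarrow> g 0 | Suc j \<Rightarrow> k j)"
  defines "m' \<equiv> \<lambda>i. lo i + hi i - m i"
  shows "m' \<in> remove_strip g b" "k \<in> remove_strip m' a" "\<And>i. lo i + hi i - m' i = m i"
proof -
  note d1 = remove_stripD[OF assms(1)] and d2 = remove_stripD[OF assms(2)]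
  have b: "lo i \<le> m i" "m i \<le> hi i" for i
    using d1(1) d2(1) by (auto simp: hstrip_def lo_def hi_def split: nat.splits)
  have b': "lo i \<le> m' i" "m' i \<le> hi i" for i using b[of i] by (auto simp: m'_def)
  show "lo i + hi i - m' i = m i" for i using b[of i] by (simp add: m'_def)
  have h1: "hstrip g m'" unfolding hstrip_def
  proof
    fix i show "g (Suc i) \<le> m' i \<and> m' i \<le> g i" using b'[of i] by (auto simp: lo_def hi_def)
  qed
  have h2: "hstrip m' k" unfolding hstrip_def
  proof
    fix i show "m' (Suc i) \<le> k i \<and> k i \<le> m' i" using b'[of i] b'[of "Suc i"] by (auto simp: lo_def hi_def)
  qed
  obtain L where L: "\<forall>i\<ge>L. g i = 0" using d1(2) by (auto simp: fin_supp_def)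
  have Lm: "\<forall>i\<ge>L. m i = 0" using L d1(1) unfolding hstrip_def by (metis le_zero_eq)
  have Lk: "\<forall>i\<ge>L. k i = 0" using Lm d2(1) unfolding hstrip_def by (metis le_zero_eq)
  have Lm': "\<forall>i\<ge>L. m' i = 0" using L h1 unfolding hstrip_def by (metis le_zero_eq)
  have up: "\<forall>i\<ge>L. f i = 0 \<Longrightarrow> \<forall>i\<ge>Suc L. f i = 0" for f :: "nat \<Rightarrow> nat" by auto
  have "fsize m + fsize m' = (\<Sum>i<Suc L. m i + m' i)"
    by (simp only: fsize_eq[OF up[OF Lm]] fsize_eq[OF up[OF Lm']] sum.distrib)
  also have "\<dots> = (\<Sum>i<Suc L. lo i) + (\<Sum>i<Suc L. hi i)"
  proof -
    have "m i + m' i = lo i + hi i" for i using b[of i] by (simp add: m'_def)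
    then show ?thesis by (simp only: sum.distrib)
  qed
  also have "(\<Sum>i<Suc L. hi i) = g 0 + (\<Sum>i<L. min (g (Suc i)) (k i))"
    by (subst sum.lessThan_Suc_shift) (simp add: hi_def)
  also have "(\<Sum>i<Suc L. lo i) = (\<Sum>i<L. max (g (Suc i)) (k i))"
    using L Lk by (simp add: lo_def)
  finally have "fsize m + fsize m' = g 0 + (\<Sum>i<L. max (g (Suc i)) (k i) + min (g (Suc i)) (k i))"
    by (simp add: sum.distrib)
  also have "\<dots> = (g 0 + (\<Sum>i<L. g (Suc i))) + (\<Sum>i<L. k i)"
    by (simp only: max_min_shift sum.distrib add.assoc)
  also have "g 0 + (\<Sum>i<L. g (Suc i)) = fsize g"
    unfolding fsize_eq[OF up[OF L]] by (simp add: sum.lessThan_Suc_shift del: sum.lessThan_Suc)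
  finally have s: "fsize m + fsize m' = fsize g + fsize k" using fsize_eq[OF Lk] by simp
  have "fin_supp m'" using Lm' by (auto simp: fin_supp_def)
  then show "m' \<in> remove_strip g b" "k \<in> remove_strip m' a"
    using s h1 h2 d1 d2 by (auto simp: remove_strip_def)
qed

text \<open>For fixed outer and inner shape the reflection of \<open>reflect_middle\<close> is an
  involution exchanging the two strip sizes. Commuting neighbouring steps is what makes Schur
  functions symmetric.\<close>

lemma strip_sum_commute: "strip_sum a (strip_sum b F) = strip_sum b (strip_sum a F)"
proof
  fix g
  define r where "r = (\<lambda>(m, k :: nat \<Rightarrow> nat). (\<lambda>i. max (g (Suc i)) (k i) + min (g i) (case i of 0 \<Rightarrow> g 0 | Suc j \<Rightarrow> k j) - m i, k))"
  have "(\<Sum>(m, k)\<in>(SIGMA m:remove_strip g a. remove_strip m b). F k) =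
      (\<Sum>(m, k)\<in>(SIGMA m:remove_strip g b. remove_strip m a). F k)"
    by (rule sum.reindex_bij_witness[of _ r r]) (auto simp: r_def reflect_middle)
  then show "strip_sum a (strip_sum b F) g = strip_sum b (strip_sum a F) g"
    by (simp add: strip_sum_def sum.Sigma)
qed

text \<open>The local rule of the Robinson-Schensted-Knuth correspondence. The first row of the large
  partition is unbounded above, and its excess is the extra parameter \<open>j\<close>.\<close>

lemma local_rule_down:
  assumes "n \<in> remove_strip l r" "k \<in> remove_strip l c"
  defines "s \<equiv> \<lambda>i. max (k (Suc i)) (n (Suc i)) + min (k i) (n i)"
  defines "t \<equiv> \<lambda>i. s i - l (Suc i)" and "j \<equiv> l 0 - max (k 0) (n 0)"
  shows "j \<le> c" "j \<le> r" "t \<in> remove_strip n (c - j)" "t \<in> remove_strip k (r - j)"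
    "l = (\<lambda>i. case i of 0 \<Rightarrow> max (k 0) (n 0) + j | Suc i \<Rightarrow> s i - t i)"
proof -
  note d1 = remove_stripD[OF assms(1)] and d2 = remove_stripD[OF assms(2)]
  have b: "max (k (Suc i)) (n (Suc i)) \<le> l (Suc i)" "l (Suc i) \<le> min (k i) (n i)" for i
    using d1(1) d2(1) by (auto simp: hstrip_def)
  have b0: "max (k 0) (n 0) \<le> l 0" using d1(1) d2(1) by (auto simp: hstrip_def)
  have b': "max (k (Suc i)) (n (Suc i)) \<le> t i" "t i \<le> min (k i) (n i)" for i
    using b[of i] by (auto simp: t_def s_def)
  have st: "s i = l (Suc i) + t i" for i using b[of i] by (auto simp: t_def s_def)
  show "l = (\<lambda>i. case i of 0 \<Rightarrow> max (k 0) (n 0) + j | Suc i \<Rightarrow> s i - t i)"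
    using b0 st by (auto simp: j_def fun_eq_iff split: nat.splits)
  have h: "hstrip n t" "hstrip k t" using b' by (auto simp: hstrip_def)
  obtain L where L: "\<forall>i\<ge>L. l i = 0" using d1(2) by (auto simp: fin_supp_def)
  have Ln: "\<forall>i\<ge>L. n i = 0" using L d1(1) unfolding hstrip_def by (metis le_zero_eq)
  have Lk: "\<forall>i\<ge>L. k i = 0" using L d2(1) unfolding hstrip_def by (metis le_zero_eq)
  have Lt: "\<forall>i\<ge>L. t i = 0" using Ln h unfolding hstrip_def by (metis le_zero_eq)
  have up: "\<forall>i\<ge>L. f i = 0 \<Longrightarrow> \<forall>i\<ge>Suc L. f i = 0" for f :: "nat \<Rightarrow> nat" by auto
  have "fsize k + fsize n = (\<Sum>i<Suc L. max (k i) (n i)) + (\<Sum>i<L. min (k i) (n i))"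
    unfolding fsize_eq[OF Ln] fsize_eq[OF Lk] using Lk Ln
    by (simp add: sum.distrib[symmetric] max_min_shift)
  also have "\<dots> = max (k 0) (n 0) + (\<Sum>i<L. s i)"
    by (simp add: sum.lessThan_Suc_shift s_def sum.distrib del: sum.lessThan_Suc)
  also have "(\<Sum>i<L. s i) = (\<Sum>i<L. l (Suc i)) + fsize t"
    unfolding fsize_eq[OF Lt] st by (rule sum.distrib)
  also have "max (k 0) (n 0) = l 0 - j" using b0 by (simp add: j_def)
  finally have "fsize k + fsize n + j = l 0 + (\<Sum>i<L. l (Suc i)) + fsize t" using b0 by (simp add: j_def)
  also have "l 0 + (\<Sum>i<L. l (Suc i)) = fsize l"
    unfolding fsize_eq[OF up[OF L]] by (simp add: sum.lessThan_Suc_shift del: sum.lessThan_Suc)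
  finally have sz: "fsize k + fsize n + j = fsize l + fsize t" .
  have "fsize t \<le> fsize n" "fsize t \<le> fsize k"
    using h d1 d2 by (auto intro!: fsize_mono simp: hstrip_def)
  then show "j \<le> c" "j \<le> r" "t \<in> remove_strip n (c - j)" "t \<in> remove_strip k (r - j)"
    using sz d1 d2 h by (auto simp: remove_strip_def)
qed

text \<open>The inverse of \<open>local_rule_down\<close>: reflecting \<open>t\<close> in the same
  intervals recovers the lower rows, and \<open>j\<close> is put back as the excess of the first
  row.\<close>

lemma local_rule_up:
  assumes "j \<le> c" "j \<le> r" "t \<in> remove_strip n (c - j)" "t \<in> remove_strip k (r - j)"
  defines "s \<equiv> \<lambda>i. max (k (Suc i)) (n (Suc i)) + min (k i) (n i)"
  defines "l \<equiv> \<lambda>i. case i of 0 \<Rightarrow> max (k 0) (n 0) + j | Suc i \<Rightarrow> s i - t i"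
  shows "n \<in> remove_strip l r" "k \<in> remove_strip l c" "j = l 0 - max (k 0) (n 0)" "t = (\<lambda>i. s i - l (Suc i))"
proof -
  note d1 = remove_stripD[OF assms(3)] and d2 = remove_stripD[OF assms(4)]
  have b: "max (k (Suc i)) (n (Suc i)) \<le> t i" "t i \<le> min (k i) (n i)" for i
    using d1(1) d2(1) by (auto simp: hstrip_def)
  have b': "max (k (Suc i)) (n (Suc i)) \<le> l (Suc i)" "l (Suc i) \<le> min (k i) (n i)" for i
    using b[of i] by (auto simp: l_def s_def)
  have st: "s i = l (Suc i) + t i" for i using b[of i] by (auto simp: l_def s_def)
  show j: "j = l 0 - max (k 0) (n 0)" by (simp add: l_def)
  show "t = (\<lambda>i. s i - l (Suc i))" using st by auto
  have h: "hstrip l n" "hstrip l k"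
    unfolding hstrip_def
  proof -
    have "l (Suc i) \<le> n i \<and> n i \<le> l i \<and> l (Suc i) \<le> k i \<and> k i \<le> l i" for i
      using b'(2)[of i] b'(1)[of "i - 1"] by (cases i) (auto simp: l_def)
    then show "\<forall>i. l (Suc i) \<le> n i \<and> n i \<le> l i" "\<forall>i. l (Suc i) \<le> k i \<and> k i \<le> l i" by auto
  qed
  obtain L where L: "\<forall>i\<ge>L. n i = 0" "\<forall>i\<ge>L. k i = 0"
    using d1(2) d2(2) unfolding fin_supp_def by (metis nat_le_linear order_trans)
  have Lt: "\<forall>i\<ge>L. t i = 0" using L d1(1) unfolding hstrip_def by (metis le_zero_eq)
  have Ll: "\<forall>i\<ge>Suc L. l i = 0"
  proof (intro allI impI)
    fix i assume "Suc L \<le> i"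
    then obtain i' where i': "i = Suc i'" "L \<le> i'" by (metis Suc_le_D Suc_le_mono)
    have "l i \<le> n i'" using h(1) i' by (simp add: hstrip_def)
    then show "l i = 0" using L i' by simp
  qed
  have "fsize k + fsize n = (\<Sum>i<Suc L. max (k i) (n i)) + (\<Sum>i<L. min (k i) (n i))"
    unfolding fsize_eq[OF L(1)] fsize_eq[OF L(2)] using L
    by (simp add: sum.distrib[symmetric] max_min_shift)
  also have "\<dots> = max (k 0) (n 0) + (\<Sum>i<L. s i)"
    by (simp add: sum.lessThan_Suc_shift s_def sum.distrib del: sum.lessThan_Suc)
  also have "(\<Sum>i<L. s i) = (\<Sum>i<L. l (Suc i)) + fsize t"
    unfolding fsize_eq[OF Lt] st by (rule sum.distrib)
  finally have "fsize k + fsize n + j = l 0 + (\<Sum>i<L. l (Suc i)) + fsize t" by (simp add: l_def)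
  also have "l 0 + (\<Sum>i<L. l (Suc i)) = fsize l"
    unfolding fsize_eq[OF Ll] by (simp add: sum.lessThan_Suc_shift del: sum.lessThan_Suc)
  finally have sz: "fsize k + fsize n + j = fsize l + fsize t" .
  have "fin_supp l" using Ll by (auto simp: fin_supp_def)
  then show "n \<in> remove_strip l r" "k \<in> remove_strip l c"
    using sz d1 d2 h assms(1,2) by (auto simp: remove_strip_def)
qed

text \<open>With U_r adding and D_c removing a strip, this is D_c U_r = \<Sum> U_(r-j) D_(c-j). The
  two local rules are mutually inverse; the sum over \<open>j\<close> arises from the first row,
  which is unbounded when a strip is added.\<close>

lemma add_remove_commute:
  "(\<Sum>l\<in>add_strip n r. \<Sum>k\<in>remove_strip l c. F k) =
   (\<Sum>j\<le>min c r. \<Sum>t\<in>remove_strip n (c - j). \<Sum>k\<in>add_strip t (r - j). F k)"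
proof -
  define s where "s k = (\<lambda>i. max (k (Suc i)) (n (Suc i)) + min (k i) (n i))" for k :: "nat \<Rightarrow> nat"
  define up where "up = (\<lambda>((j, t), k). (\<lambda>i. case i of 0 \<Rightarrow> max (k 0) (n 0) + j | Suc i \<Rightarrow> s k i - t i, k))"
  define down where "down = (\<lambda>(l, k). ((l 0 - max (k 0) (n 0), \<lambda>i. s k i - l (Suc i)), k))"
  define A where "A = (SIGMA l:add_strip n r. remove_strip l c)"
  define B where "B = (SIGMA jt:(SIGMA j:{..min c r}. remove_strip n (c - j)). add_strip (snd jt) (r - fst jt))"
  have d: "up (down x) = x \<and> down x \<in> B" if x: "x \<in> A" for x
  proof -
    obtain l k where x': "x = (l, k)" by fastforce
    then have lk: "n \<in> remove_strip l r" "k \<in> remove_strip l c" using x by (auto simp: A_def add_strip_def)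
    note D = local_rule_down[OF lk]
    show ?thesis using D(1-4) D(5)[symmetric] by (simp add: x' up_def down_def s_def B_def add_strip_def)
  qed
  have u: "down (up x) = x \<and> up x \<in> A" if x: "x \<in> B" for x
  proof -
    obtain j t k where x': "x = ((j, t), k)" by (metis prod.exhaust)
    then have "j \<le> c" "j \<le> r" "t \<in> remove_strip n (c - j)" "t \<in> remove_strip k (r - j)"
      using x by (auto simp: B_def add_strip_def)
    note D = local_rule_up[OF this]
    show ?thesis using D(1,2) D(3,4)[symmetric] by (simp add: x' up_def down_def s_def A_def add_strip_def)
  qed
  have "(\<Sum>x\<in>A. F (snd x)) = (\<Sum>x\<in>B. F (snd x))"
    by (rule sum.reindex_bij_witness[of _ up down]) (use d u in \<open>auto simp: down_def\<close>)
  moreover have "(\<Sum>x\<in>A. F (snd x)) = (\<Sum>l\<in>add_strip n r. \<Sum>k\<in>remove_strip l c. F k)"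
    by (simp add: A_def sum.Sigma case_prod_unfold)
  moreover have "(\<Sum>x\<in>B. F (snd x)) =
      (\<Sum>jt\<in>(SIGMA j:{..min c r}. remove_strip n (c - j)). \<Sum>k\<in>add_strip (snd jt) (r - fst jt). F k)"
    unfolding B_def by (subst sum.Sigma) (auto simp: case_prod_unfold)
  moreover have "\<dots> = (\<Sum>j\<le>min c r. \<Sum>t\<in>remove_strip n (c - j). \<Sum>k\<in>add_strip t (r - j). F k)"
    by (subst sum.Sigma) (auto simp: case_prod_unfold)
  ultimately show ?thesis by simp
qed

subsection \<open>Tableaux as chains of horizontal strips\<close>

definition cells :: "(nat \<Rightarrow> nat) \<Rightarrow> (nat \<times> nat) set" where
  "cells g = {(i, j). j < g i}"

text \<open>Compared with \<open>ssyt\<close>, the entries are bounded by \<open>k\<close> and the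
  shape is a sequence, so that the cells with the largest entry can be peeled off by induction on
  \<open>k\<close>.\<close>

definition tab :: "(nat \<Rightarrow> nat) \<Rightarrow> (nat \<Rightarrow> nat) \<Rightarrow> nat \<Rightarrow> (nat \<times> nat \<Rightarrow> nat) set" where
  "tab g w k = {T \<in> cells g \<rightarrow>\<^sub>E {..<k}.
     (\<forall>i j j'. (i, j') \<in> cells g \<and> j < j' \<longrightarrow> T (i, j) \<le> T (i, j')) \<and>
     (\<forall>i i' j. (i, j) \<in> cells g \<and> (i', j) \<in> cells g \<and> i < i' \<longrightarrow> T (i, j) < T (i', j)) \<and>
     (\<forall>a<k. card {c \<in> cells g. T c = a} = w a)}"

text \<open>The last element of the list is the outermost strip, so appending an element corresponds
  to one more variable.\<close>

definition strip_chains :: "nat list \<Rightarrow> (nat \<Rightarrow> nat) \<Rightarrow> nat" where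
  "strip_chains xs = fold strip_sum xs (\<lambda>g. if g = (\<lambda>_. 0) then 1 else 0)"

lemma chains_Nil: "strip_chains [] g = (if g = (\<lambda>_. 0) then 1 else 0)"
  by (simp add: strip_chains_def)

lemma chains_snoc: "strip_chains (xs @ [a]) g = (\<Sum>k\<in>remove_strip g a. strip_chains xs k)"
  by (simp add: strip_chains_def strip_sum_def)

lemma chains_mset: assumes "mset xs = mset ys" shows "strip_chains xs = strip_chains ys"
proof -
  have "fold strip_sum xs = (fold strip_sum ys :: ((nat \<Rightarrow> nat) \<Rightarrow> nat) \<Rightarrow> _)"
    using assms by (intro fold_multiset_equiv) (auto simp: strip_sum_commute fun_eq_iff)
  then show ?thesis by (simp add: strip_chains_def)
qed

lemma card_cells:
  assumes "fin_supp g" shows "finite (cells g)" "card (cells g) = fsize g"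
proof -
  obtain L where L: "\<forall>i\<ge>L. g i = 0" using assms by (auto simp: fin_supp_def)
  have c: "cells g = (SIGMA i:{..<L}. {..<g i})"
    using L unfolding cells_def by (auto intro: leI)
  show "finite (cells g)" unfolding c by auto
  show "card (cells g) = fsize g" unfolding c fsize_eq[OF L] by simp
qed

lemma cells_inject: "cells g = cells h \<Longrightarrow> g = h"
proof
  fix i assume "cells g = cells h"
  then have "{..<g i} = {..<h i}" by (auto simp: cells_def set_eq_iff)
  then show "g i = h i" by simp
qed

lemma downward_closed_card:
  fixes S :: "nat set"
  assumes "finite S" "\<And>i j. j \<in> S \<Longrightarrow> i < j \<Longrightarrow> i \<in> S" shows "S = {..<card S}"
proof (cases "S = {}")
  case False
  have "S = {..Max S}"
  proof (intro equalityI subsetI)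
    fix x assume "x \<in> {..Max S}"
    then show "x \<in> S" using assms(2)[of "Max S" x] Max_in[OF assms(1) False] by (cases "x = Max S") auto
  qed (use assms(1) in auto)
  then show ?thesis by (metis card_atMost lessThan_Suc_atMost)
qed simp

definition inner_shape :: "(nat \<Rightarrow> nat) \<Rightarrow> nat \<Rightarrow> (nat \<times> nat \<Rightarrow> nat) \<Rightarrow> nat \<Rightarrow> nat" where
  "inner_shape g k T = (\<lambda>i. card {j. j < g i \<and> T (i, j) < k})"

text \<open>The cells with the largest entry form a horizontal strip because columns increase
  strictly: a cell of row \<open>Suc i\<close> forces a smaller entry, hence one below
  \<open>k\<close>, above it in row \<open>i\<close>.\<close>

lemma inner_shape:
  assumes g: "par g" and T: "T \<in> tab g w (Suc k)"
  defines "h \<equiv> inner_shape g k T"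
  shows "c \<in> cells h \<longleftrightarrow> c \<in> cells g \<and> T c < k" "h \<in> remove_strip g (w k)" "restrict T (cells h) \<in> tab h w k"
proof -
  have row: "T (i, j) \<le> T (i, j')" if "(i, j') \<in> cells g" "j < j'" for i j j' using T that by (auto simp: tab_def)
  have col: "T (i, j) < T (i', j)" if "(i, j) \<in> cells g" "(i', j) \<in> cells g" "i < i'" for i i' j
    using T that unfolding tab_def by blast
  have le: "T c \<le> k" if "c \<in> cells g" for c using T that PiE_mem[of T "cells g" "\<lambda>_. {..<Suc k}" c] by (simp add: tab_def)
  have "{j. j < g i \<and> T (i, j) < k} = {..<h i}" for i
    unfolding h_def inner_shape_def
    by (rule downward_closed_card) (auto simp: cells_def dest: row[unfolded cells_def, simplified])
  then have key: "j < h i \<longleftrightarrow> j < g i \<and> T (i, j) < k" for i j by blast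
  then show ch: "c \<in> cells h \<longleftrightarrow> c \<in> cells g \<and> T c < k" for c by (auto simp: cells_def)
  have hs: "hstrip g h"
    unfolding hstrip_def
  proof
    fix i
    have "{..<h i} \<subseteq> {..<g i}" using key by (intro subsetI) simp
    moreover have "{..<g (Suc i)} \<subseteq> {..<h i}"
    proof (rule subsetI)
      fix j assume "j \<in> {..<g (Suc i)}"
      then have j: "(Suc i, j) \<in> cells g" by (simp add: cells_def)
      then have j': "(i, j) \<in> cells g" using g unfolding cells_def par_def by (auto intro: less_le_trans)
      show "j \<in> {..<h i}" using col[OF j' j] le[OF j] j' key by (auto simp: cells_def)
    qed
    ultimately show "g (Suc i) \<le> h i \<and> h i \<le> g i" by simp
  qed
  have fs: "fin_supp g" "fin_supp h" using g fin_supp_le[of g h] hs by (auto simp: par_def hstrip_def)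
  have "cells g = cells h \<union> {c \<in> cells g. T c = k}" using ch le by (auto simp: le_less)
  moreover have "cells h \<inter> {c \<in> cells g. T c = k} = {}" using ch by auto
  ultimately have "card (cells g) = card (cells h) + card {c \<in> cells g. T c = k}"
    using card_cells(1)[OF fs(1)] card_cells(1)[OF fs(2)] by (metis (no_types, lifting) card_Un_disjoint finite_Un)
  moreover have "card {c \<in> cells g. T c = k} = w k" using T by (simp add: tab_def)
  ultimately show "h \<in> remove_strip g (w k)" using hs fs by (simp add: remove_strip_def card_cells)
  have "card {c \<in> cells h. restrict T (cells h) c = a} = w a" if "a < k" for a
  proof -
    have "{c \<in> cells h. restrict T (cells h) c = a} = {c \<in> cells g. T c = a}" using ch that by auto
    then show ?thesis using T that by (simp add: tab_def)
  qed
  moreover have "restrict T (cells h) (i, j) \<le> restrict T (cells h) (i, j')" if "(i, j') \<in> cells h" "j < j'" for i j j'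
    using row[of i j' j] that by (auto simp: ch) (auto simp: cells_def key)
  ultimately show "restrict T (cells h) \<in> tab h w k" using ch col by (auto simp: tab_def)
qed

text \<open>The value \<open>undefined\<close> outside the diagram keeps the filling in the
  extensional function space of \<open>tab\<close>.\<close>

definition outer_fill :: "(nat \<Rightarrow> nat) \<Rightarrow> nat \<Rightarrow> (nat \<Rightarrow> nat) \<Rightarrow> (nat \<times> nat \<Rightarrow> nat) \<Rightarrow> nat \<times> nat \<Rightarrow> nat" where
  "outer_fill g k h T = (\<lambda>c. if c \<in> cells h then T c else if c \<in> cells g then k else undefined)"

lemma outer_fill:
  assumes g: "par g" and h: "h \<in> remove_strip g (w k)" and T: "T \<in> tab h w k"
  defines "T' \<equiv> outer_fill g k h T"
  shows "T' \<in> tab g w (Suc k)" "inner_shape g k T' = h" "restrict T' (cells h) = T"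
proof -
  note d = remove_stripD[OF h]
  have sub: "cells h \<subseteq> cells g" using d(1) by (auto simp: cells_def hstrip_def intro: less_le_trans)
  have up: "(i, j) \<in> cells h" if "(i', j) \<in> cells g" "i < i'" for i i' j
  proof -
    have "g i' \<le> g (Suc i)" using par_antimono[OF g] that by simp
    also have "\<dots> \<le> h i" using d(1) by (simp add: hstrip_def)
    finally show ?thesis using that by (auto simp: cells_def)
  qed
  have left: "(i, j) \<in> cells h" if "(i, j') \<in> cells h" "j < j'" for i j j' using that by (auto simp: cells_def)
  have lt: "T c < k" if "c \<in> cells h" for c using T that by (auto simp: tab_def)
  have in': "T' c = T c" if "c \<in> cells h" for c using that by (simp add: T'_def outer_fill_def)
  have out: "T' c = k" if "c \<in> cells g" "c \<notin> cells h" for c using that by (simp add: T'_def outer_fill_def)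
  have "T' (i, j) \<le> T' (i, j')" if "(i, j') \<in> cells g" "j < j'" for i j j'
  proof (cases "(i, j') \<in> cells h")
    case True
    then show ?thesis using T left[OF True that(2)] that in' by (auto simp: tab_def)
  next
    case False
    have "(i, j) \<in> cells g" using that by (auto simp: cells_def)
    then have "T' (i, j) \<le> k" using in' out lt by (metis le_refl less_imp_le)
    then show ?thesis using out[OF that(1) False] by simp
  qed
  moreover have "T' (i, j) < T' (i', j)" if "(i', j) \<in> cells g" "i < i'" for i i' j
  proof (cases "(i', j) \<in> cells h")
    case True
    have "T (i, j) < T (i', j)" using T up[OF that] that(2) True unfolding tab_def by blast
    then show ?thesis using in' up[OF that] True by simp
  next
    case False
    then show ?thesis using out[OF that(1)] in'[OF up[OF that]] lt[OF up[OF that]] by simp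
  qed
  moreover have "card {c \<in> cells g. T' c = a} = w a" if "a < Suc k" for a
  proof (cases "a = k")
    case True
    have e: "{c \<in> cells g. T' c = a} = cells g - cells h" using True in' out lt by fastforce
    show ?thesis unfolding e using d sub by (simp add: card_Diff_subset card_cells True)
  next
    case False
    have "{c \<in> cells g. T' c = a} = {c \<in> cells h. T c = a}" using False in' out sub by fastforce
    then show ?thesis using T that False by (simp add: tab_def)
  qed
  moreover have "T' \<in> cells g \<rightarrow>\<^sub>E {..<Suc k}"
    using lt sub by (auto simp: T'_def outer_fill_def less_Suc_eq)
  ultimately show T': "T' \<in> tab g w (Suc k)" by (simp add: tab_def)
  show "inner_shape g k T' = h"
    by (rule cells_inject) (use in' out lt sub inner_shape(1)[OF g T'] in fastforce)
  show "restrict T' (cells h) = T" using T by (auto simp: T'_def outer_fill_def tab_def PiE_def extensional_def)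
qed

lemma card_tab_Suc:
  assumes g: "par g"
  shows "card (tab g w (Suc k)) = (\<Sum>h\<in>remove_strip g (w k). card (tab h w k))"
proof -
  have fin: "finite (tab h w k)" if "h \<in> remove_strip g (w k)" for h
    by (rule finite_subset[of _ "cells h \<rightarrow>\<^sub>E {..<k}"])
      (use remove_stripD(3)[OF that] in \<open>auto simp: tab_def intro!: finite_PiE card_cells(1)\<close>)
  have "card (tab g w (Suc k)) = card (SIGMA h:remove_strip g (w k). tab h w k)"
  proof (rule bij_betw_same_card)
    show "bij_betw (\<lambda>T. (inner_shape g k T, restrict T (cells (inner_shape g k T))))
        (tab g w (Suc k)) (SIGMA h:remove_strip g (w k). tab h w k)"
    proof (rule bij_betw_byWitness[where f' = "\<lambda>(h, T). outer_fill g k h T"])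
      show "\<forall>T\<in>tab g w (Suc k). (case (inner_shape g k T, restrict T (cells (inner_shape g k T))) of
          (h, T) \<Rightarrow> outer_fill g k h T) = T"
      proof
        fix T assume T: "T \<in> tab g w (Suc k)"
        have "T c < Suc k" if "c \<in> cells g" for c using T that by (auto simp: tab_def)
        moreover have "T c = undefined" if "c \<notin> cells g" for c using T that by (auto simp: tab_def)
        ultimately show "(case (inner_shape g k T, restrict T (cells (inner_shape g k T))) of
          (h, T) \<Rightarrow> outer_fill g k h T) = T"
          using inner_shape(1)[OF g T] by (auto simp: outer_fill_def fun_eq_iff less_Suc_eq)
      qed
    qed (use inner_shape(2,3)[OF g] outer_fill[OF g] in auto)
  qed
  also have "\<dots> = (\<Sum>h\<in>remove_strip g (w k). card (tab h w k))" using fin by simp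
  finally show ?thesis .
qed

lemma card_tab: "par g \<Longrightarrow> card (tab g w k) = strip_chains (map w [0..<k]) g"
proof (induction k arbitrary: g)
  case 0
  show ?case
  proof (cases "g = (\<lambda>_. 0)")
    case True
    then have "cells g = {}" by (simp add: cells_def)
    then have "tab g w 0 = {\<lambda>_. undefined}" by (auto simp: tab_def)
    then show ?thesis using True by (simp add: chains_Nil)
  next
    case False
    then obtain i where "g i \<noteq> 0" by auto
    then have "(i, 0) \<in> cells g" by (simp add: cells_def)
    then have "tab g w 0 = {}" by (auto simp: tab_def PiE_eq_empty_iff)
    then show ?thesis using False by (simp add: chains_Nil)
  qed
next
  case (Suc k)
  then show ?case by (simp add: card_tab_Suc chains_snoc remove_strip_par)
qed

lemma young_diagram_cells: "young_diagram lam = cells (part lam)"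
  by (auto simp: young_diagram_def cells_def part_def split: if_splits)

text \<open>An entry that occurs has positive multiplicity, so a content supported below
  \<open>k\<close> bounds all entries by \<open>k\<close>.\<close>

lemma ssyt_tab:
  assumes "vars m \<subseteq> {..<k}" shows "ssyt lam m = tab (part lam) (expo m) k"
proof -
  let ?Y = "cells (part lam)"
  have "fin_supp (part lam)" by (auto simp: fin_supp_def part_def intro!: exI[of _ "length lam"])
  then have fin: "finite ?Y" by (rule card_cells)
  have bound: "(\<forall>a. card {c \<in> ?Y. T c = a} = expo m a) \<longleftrightarrow>
      (\<forall>c\<in>?Y. T c < k) \<and> (\<forall>a<k. card {c \<in> ?Y. T c = a} = expo m a)" for T
  proof (intro iffI conjI allI ballI impI)
    fix c assume a: "\<forall>a. card {c \<in> ?Y. T c = a} = expo m a" and c: "c \<in> ?Y"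
    have "finite {c' \<in> ?Y. T c' = T c}" "c \<in> {c' \<in> ?Y. T c' = T c}" using fin c by auto
    then have "card {c' \<in> ?Y. T c' = T c} \<noteq> 0" by (metis card_0_eq empty_iff)
    then have "T c \<in> vars m" using a by (simp add: in_keys_iff)
    then show "T c < k" using assms by auto
  next
    fix a assume a: "(\<forall>c\<in>?Y. T c < k) \<and> (\<forall>a<k. card {c \<in> ?Y. T c = a} = expo m a)"
    show "card {c \<in> ?Y. T c = a} = expo m a"
    proof (cases "a < k")
      case False
      then have "{c \<in> ?Y. T c = a} = {}" "a \<notin> vars m" using a assms by auto
      then have "{c \<in> ?Y. T c = a} = {}" "expo m a = 0" by (simp_all add: in_keys_iff)
      then show ?thesis by (simp only: card.empty)
    qed (use a in auto)
  qed auto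
  have left: "(i, j) \<in> ?Y" if "(i, j') \<in> ?Y" "j < j'" for i j j' using that by (auto simp: cells_def)
  have pe: "T \<in> ?Y \<rightarrow>\<^sub>E {..<k} \<longleftrightarrow> T \<in> ?Y \<rightarrow>\<^sub>E UNIV \<and> (\<forall>c\<in>?Y. T c < k)" for T
    by (auto simp: PiE_def Pi_def)
  have rows: "(\<forall>i j j'. (i, j) \<in> ?Y \<and> (i, j') \<in> ?Y \<and> j < j' \<longrightarrow> T (i, j) \<le> T (i, j')) \<longleftrightarrow>
      (\<forall>i j j'. (i, j') \<in> ?Y \<and> j < j' \<longrightarrow> T (i, j) \<le> T (i, j'))" for T :: "nat \<times> nat \<Rightarrow> nat"
    using left by metis
  show ?thesis
    unfolding ssyt_def tab_def young_diagram_cells pe bound rows by (rule Collect_cong) (simp only: conj_ac)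
qed

lemma par_part: "lam \<in> partitions n \<Longrightarrow> par (part lam)"
  unfolding par_def fin_supp_def part_def partitions_def
  by (auto intro!: exI[of _ "length lam"] simp: sorted_wrt_iff_nth_less)

lemma card_ssyt:
  "lam \<in> partitions n \<Longrightarrow> vars m \<subseteq> {..<k} \<Longrightarrow> card (ssyt lam m) = strip_chains (map (expo m) [0..<k]) (part lam)"
  by (simp add: ssyt_tab card_tab par_part)



subsection \<open>Schur functions\<close>

lemma part_Nil [simp]: "part [] = (\<lambda>_. 0)"
  by (simp add: part_def fun_eq_iff)

lemma fsize_part: "fsize (part lam) = sum_list lam"
proof -
  have "fsize (part lam) = (\<Sum>i<length lam. part lam i)" by (rule fsize_eq) (simp add: part_def)
  also have "\<dots> = (\<Sum>i<length lam. lam ! i)" by (intro sum.cong) (auto simp: part_def)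
  also have "\<dots> = sum_list lam" by (simp add: sum_list_sum_nth lessThan_atLeast0)
  finally show ?thesis .
qed

lemma part_inject:
  assumes "lam \<in> partitions n" "mu \<in> partitions k" "part lam = part mu" shows "lam = mu"
proof -
  have nz: "part xs i = 0 \<longleftrightarrow> length xs \<le> i" if "0 \<notin> set xs" for xs i
  proof (cases "i < length xs")
    case True
    then have "xs ! i \<noteq> 0" using that nth_mem[of i xs] by metis
    then show ?thesis using True by (simp add: part_def)
  qed (simp add: part_def)
  have "0 \<notin> set lam" "0 \<notin> set mu" using assms by (auto simp: partitions_def)
  then have "length lam \<le> i \<longleftrightarrow> length mu \<le> i" for i using nz assms(3) by metis
  then have "length lam = length mu" by (meson le_antisym order_refl)
  moreover have "lam ! i = mu ! i" if "i < length lam" for i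
    using fun_cong[OF assms(3), of i] that calculation by (simp add: part_def)
  ultimately show ?thesis by (rule nth_equalityI)
qed

lemma ex_part: assumes "par g" obtains lam where "lam \<in> partitions (fsize g)" "part lam = g"
proof -
  define L where "L = (LEAST i. g i = 0)"
  have L: "g L = 0" unfolding L_def using par_zero_from[OF assms] by (rule LeastI)
  have nz: "g i \<noteq> 0" if "i < L" for i using not_less_Least that unfolding L_def by blast
  define lam where "lam = map g [0..<L]"
  have p: "part lam = g"
    using par_antimono[OF assms, of L] L by (auto simp: part_def lam_def fun_eq_iff)
  have "sorted_wrt (\<ge>) lam"
    by (auto simp: lam_def sorted_wrt_iff_nth_less intro: par_antimono[OF assms])
  moreover have "0 \<notin> set lam" using nz by (force simp: lam_def)
  ultimately have "lam \<in> partitions (fsize g)" using fsize_part[of lam] p by (simp add: partitions_def)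
  then show thesis using p by (rule that)
qed

lemma bij_part: "bij_betw part (partitions n) {g. par g \<and> fsize g = n}"
proof (rule bij_betwI')
  fix x y assume "x \<in> partitions n" "y \<in> partitions n"
  then show "(part x = part y) = (x = y)" using part_inject by blast
next
  fix x assume x: "x \<in> partitions n"
  then show "part x \<in> {g. par g \<and> fsize g = n}"
    using par_part[OF x] by (simp add: fsize_part) (simp add: partitions_def)
next
  fix y assume y: "y \<in> {g. par g \<and> fsize g = n}"
  then obtain x where "x \<in> partitions (fsize y)" "part x = y" using ex_part[of y] by blast
  then show "\<exists>x\<in>partitions n. y = part x" using y by (intro bexI[of _ x]) simp_all
qed

lemma chains_fsize: "strip_chains xs g \<noteq> 0 \<Longrightarrow> fsize g = sum_list xs"
proof (induction xs arbitrary: g rule: rev_induct)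
  case Nil
  then show ?case by (simp add: chains_Nil fsize_def split: if_splits)
next
  case (snoc a xs)
  then obtain k where "k \<in> remove_strip g a" "strip_chains xs k \<noteq> 0"
    unfolding chains_snoc by (meson sum.neutral)
  then show ?case using snoc.IH[of k] remove_stripD(4)[of k g a] by simp
qed

lemma chains_length: "strip_chains xs g \<noteq> 0 \<Longrightarrow> g (length xs) = 0"
proof (induction xs arbitrary: g rule: rev_induct)
  case Nil
  then show ?case by (simp add: chains_Nil split: if_splits)
next
  case (snoc a xs)
  then obtain k where k: "k \<in> remove_strip g a" "strip_chains xs k \<noteq> 0"
    unfolding chains_snoc by (meson sum.neutral)
  then have "k (length xs) = 0" by (rule_tac snoc.IH)
  moreover have "g (Suc (length xs)) \<le> k (length xs)" using remove_stripD(1)[OF k(1)] by (simp add: hstrip_def)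
  ultimately show ?case by simp
qed

definition raise_rows :: "nat \<Rightarrow> (nat \<Rightarrow> nat) \<Rightarrow> nat \<Rightarrow> nat" where
  "raise_rows N g = (\<lambda>i. if i < N then Suc (g i) else 0)"

lemma fsize_raise: assumes "\<forall>i\<ge>N. g i = 0" shows "fsize (raise_rows N g) = fsize g + N"
proof -
  have "fsize (raise_rows N g) = (\<Sum>i<N. Suc (g i))"
    by (subst fsize_eq[of N]) (auto simp: raise_rows_def)
  also have "\<dots> = fsize g + N" by (simp add: fsize_eq[OF assms] sum.distrib flip: add_Suc_right) (simp add: sum_Suc)
  finally show ?thesis .
qed

text \<open>When the outer shape has all \<open>N\<close> rows nonempty, interlacing makes the first
  N - 1 rows of the next inner shape nonempty, and by \<open>chains_length\<close> a chain with one
  strip fewer has no further row. So every shape of the chain carries a full column that can be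
  removed. In terms of Schur functions: with as many variables as rows, the product of all variables
  can be split off.\<close>

lemma chains_raise:
  assumes "\<forall>i\<ge>length xs. g i = 0"
  shows "strip_chains (map Suc xs) (raise_rows (length xs) g) = strip_chains xs g"
  using assms
proof (induction xs arbitrary: g rule: rev_induct)
  case Nil
  then have "g = (\<lambda>_. 0)" by auto
  then show ?case by (simp add: raise_rows_def)
next
  case (snoc a xs)
  define N where "N = length xs"
  let ?A = "{k \<in> remove_strip (raise_rows (Suc N) g) (Suc a). k N = 0}"
  let ?B = "{k \<in> remove_strip g a. k N = 0}"
  have g: "\<forall>i\<ge>Suc N. g i = 0" using snoc.prems by (simp add: N_def)
  have tail: "\<forall>i\<ge>N. k i = 0" if "k N = 0" "par k" for k
    using par_antimono[OF that(2), of N] that(1) by (metis le_zero_eq)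
  have tailA: "\<forall>i\<ge>N. k i = 0" if "k \<in> ?A" for k using that tail remove_strip_par by blast
  have tailB: "\<forall>i\<ge>N. k i = 0" if "k \<in> ?B" for k using that tail remove_strip_par by blast
  have "strip_chains (map Suc (xs @ [a])) (raise_rows (length (xs @ [a])) g) =
      (\<Sum>k\<in>remove_strip (raise_rows (Suc N) g) (Suc a). strip_chains (map Suc xs) k)"
    by (simp add: chains_snoc N_def)
  also have "\<dots> = (\<Sum>k\<in>?A. strip_chains (map Suc xs) k)"
    using chains_length[of "map Suc xs"] by (intro sum.mono_neutral_right) (auto simp: N_def)
  also have "\<dots> = (\<Sum>k\<in>?B. strip_chains (map Suc xs) (raise_rows N k))"
  proof (rule sum.reindex_bij_witness[of _ "raise_rows N" "\<lambda>k i. k i - 1"])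
    fix k assume k: "k \<in> ?A"
    then have kr: "k \<in> remove_strip (raise_rows (Suc N) g) (Suc a)" "k N = 0" by auto
    note d = remove_stripD[OF kr(1)]
    have pos: "k i \<ge> 1" if "i < N" for i
    proof -
      have "raise_rows (Suc N) g (Suc i) \<le> k i" using d(1) by (simp add: hstrip_def)
      then show ?thesis using that by (simp add: raise_rows_def)
    qed
    show e: "raise_rows N (\<lambda>i. k i - 1) = k"
      using pos tailA[OF k] by (auto simp: raise_rows_def fun_eq_iff Suc_le_eq)
    have "hstrip g (\<lambda>i. k i - 1)"
      unfolding hstrip_def
    proof
      fix i
      have "raise_rows (Suc N) g (Suc i) \<le> k i" "k i \<le> raise_rows (Suc N) g i"
        using d(1) by (auto simp: hstrip_def)
      then show "g (Suc i) \<le> k i - 1 \<and> k i - 1 \<le> g i"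
        using g by (auto simp: raise_rows_def split: if_splits)
    qed
    moreover have "fsize k = fsize (\<lambda>i. k i - 1) + N"
      using fsize_raise[of N "\<lambda>i. k i - 1"] tailA[OF k] unfolding e by simp
    moreover have "fsize (raise_rows (Suc N) g) = fsize g + Suc N" using g by (rule fsize_raise)
    moreover have "fin_supp g" using g by (auto simp: fin_supp_def)
    ultimately show "(\<lambda>i. k i - 1) \<in> ?B" using kr(2) d(4) by (simp add: remove_strip_def)
    show "strip_chains (map Suc xs) (raise_rows N (\<lambda>i. k i - 1)) = strip_chains (map Suc xs) k" by (simp only: e)
  next
    fix k assume k: "k \<in> ?B"
    then have kr: "k \<in> remove_strip g a" "k N = 0" by auto
    note d = remove_stripD[OF kr(1)]
    show "(\<lambda>i. raise_rows N k i - 1) = k" using tailB[OF k] by (auto simp: raise_rows_def fun_eq_iff)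
    have "hstrip (raise_rows (Suc N) g) (raise_rows N k)"
      unfolding hstrip_def
    proof
      fix i
      have "g (Suc i) \<le> k i" "k i \<le> g i" using d(1) by (auto simp: hstrip_def)
      then show "raise_rows (Suc N) g (Suc i) \<le> raise_rows N k i \<and> raise_rows N k i \<le> raise_rows (Suc N) g i"
        by (auto simp: raise_rows_def)
    qed
    moreover have "fsize (raise_rows N k) = fsize k + N" using tailB[OF k] by (rule fsize_raise)
    moreover have "fsize (raise_rows (Suc N) g) = fsize g + Suc N" using g by (rule fsize_raise)
    moreover have "fin_supp (raise_rows (Suc N) g)" by (auto simp: fin_supp_def raise_rows_def intro!: exI[of _ "Suc N"])
    moreover have "raise_rows N k N = 0" by (simp add: raise_rows_def)
    ultimately show "raise_rows N k \<in> ?A" using d(4) by (simp add: remove_strip_def)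
  qed
  also have "\<dots> = (\<Sum>k\<in>?B. strip_chains xs k)"
    using tailB by (intro sum.cong refl) (auto simp: N_def intro!: snoc.IH)
  also have "\<dots> = (\<Sum>k\<in>remove_strip g a. strip_chains xs k)"
    using chains_length[of xs] by (intro sum.mono_neutral_left) (auto simp: N_def)
  finally show ?case by (simp add: chains_snoc)
qed

text \<open>The orbit invariant of a monomial: exponent vectors arise from each other by renaming
  variables iff these multisets agree.\<close>

definition exponents :: "(nat \<Rightarrow>\<^sub>0 nat) \<Rightarrow> nat multiset" where
  "exponents m = image_mset (expo m) (mset_set (vars m))"

lemma exponents_map_key:
  assumes "bij \<pi>" shows "exponents (Poly_Mapping.map_key \<pi> m) = exponents m"
proof -
  have i: "inj \<pi>" using assms by (rule bij_is_inj)
  have "expo (Poly_Mapping.map_key \<pi> m) = expo m \<circ> \<pi>" by (auto simp: expo_map_key[OF i])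
  then have "exponents (Poly_Mapping.map_key \<pi> m) = image_mset (expo m) (image_mset \<pi> (mset_set (\<pi> -` vars m)))"
    by (simp add: exponents_def keys_map_key[OF i] image_mset.compositionality comp_def)
  also have "image_mset \<pi> (mset_set (\<pi> -` vars m)) = mset_set (\<pi> ` (\<pi> -` vars m))"
    using i by (intro image_mset_mset_set) (auto simp: inj_on_def)
  also have "\<pi> ` (\<pi> -` vars m) = vars m" using assms by (simp add: bij_is_surj surj_image_vimage_eq)
  finally show ?thesis by (simp add: exponents_def)
qed

lemma mset_exponents:
  assumes "vars m \<subseteq> {..<k}"
  shows "mset (map (expo m) [0..<k]) = exponents m + replicate_mset (k - card (vars m)) 0"
proof -
  have "mset (map (expo m) [0..<k]) = image_mset (expo m) (mset_set {..<k})"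
    by (simp add: mset_map lessThan_atLeast0 flip: mset_upt)
  also have "{..<k} = vars m \<union> ({..<k} - vars m)" using assms by auto
  also have "mset_set \<dots> = mset_set (vars m) + mset_set ({..<k} - vars m)" by (rule mset_set_Union) auto
  also have "image_mset (expo m) (mset_set (vars m) + mset_set ({..<k} - vars m)) =
      image_mset (expo m) (mset_set (vars m)) + image_mset (expo m) (mset_set ({..<k} - vars m))" by simp
  also have "image_mset (expo m) (mset_set ({..<k} - vars m)) = image_mset (\<lambda>_. 0) (mset_set ({..<k} - vars m))"
    by (intro image_mset_cong) (auto simp: in_keys_iff)
  also have "\<dots> = replicate_mset (k - card (vars m)) 0"
    using assms by (simp add: image_mset_const_eq card_Diff_subset)
  finally show ?thesis by (simp add: exponents_def)
qed

lemma size_exponents: "size (exponents m) = card (vars m)" by (simp add: exponents_def)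

lemma sum_exponents: "sum_mset (exponents m) = mdeg m"
  by (simp add: exponents_def mdeg_def sum_unfold_sum_mset)

lemma schur_chains:
  "lam \<in> partitions n \<Longrightarrow> vars m \<subseteq> {..<k} \<Longrightarrow>
    (schur lam m :: 'a::comm_ring_1) = of_nat (strip_chains (map (expo m) [0..<k]) (part lam))"
  by (simp add: schur_def card_ssyt)

lemma ex_vars_bound: obtains k where "vars m \<subseteq> {..<k}"
  using finite_nat_iff_bounded[of "vars m"] by auto

lemma symmetric_schur:
  assumes "lam \<in> partitions n" shows "symmetric_series (schur lam :: 'a::comm_ring_1 series)"
  unfolding symmetric_series_def
proof (intro allI impI)
  fix \<pi> :: "nat \<Rightarrow> nat" and m :: "nat \<Rightarrow>\<^sub>0 nat" assume p: "bij \<pi>"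
  let ?m' = "Poly_Mapping.map_key \<pi> m"
  obtain k where k: "vars m \<subseteq> {..<k}" "vars ?m' \<subseteq> {..<k}"
    using finite_nat_iff_bounded[of "vars m \<union> vars ?m'"] by auto
  have "card (vars ?m') = card (vars m)" using exponents_map_key[OF p] by (metis size_exponents)
  then have "mset (map (expo ?m') [0..<k]) = mset (map (expo m) [0..<k])"
    by (simp only: mset_exponents k exponents_map_key[OF p])
  from chains_mset[OF this] show "(schur lam ?m' :: 'a) = schur lam m"
    by (simp only: schur_chains[OF assms k(1)] schur_chains[OF assms k(2)])
qed

lemma homogeneous_schur:
  assumes "lam \<in> partitions n" shows "homogeneous n (schur lam :: 'a::comm_ring_1 series)"
  unfolding homogeneous_def
proof (intro allI impI)
  fix m assume nz: "(schur lam m :: 'a) \<noteq> 0"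
  obtain k where k: "vars m \<subseteq> {..<k}" by (rule ex_vars_bound)
  have "strip_chains (map (expo m) [0..<k]) (part lam) \<noteq> 0" using nz by (metis of_nat_0 schur_chains[OF assms k])
  then have "sum_list lam = sum_list (map (expo m) [0..<k])" by (metis chains_fsize fsize_part)
  also have "\<dots> = mdeg m" using k
    by (simp add: mdeg_eq[of "{..<k}"] sum_list_sum_nth lessThan_atLeast0)
  finally show "mdeg m = n" using assms by (simp add: partitions_def)
qed

lemma part_strip_col:
  assumes "lam \<in> partitions n" shows "part lam = raise_rows (length lam) (part (strip_col lam))"
proof
  fix i
  have l: "length (strip_col lam) \<le> length lam" by (rule strip_col_partition(2)[OF assms])
  define zs where "zs = strip_col lam @ replicate (length lam - length (strip_col lam)) 0"
  have lam: "map Suc zs = lam" using add_strip_col[OF assms] by (simp add: add_col_def zs_def)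
  have lz: "length zs = length lam" using l by (simp add: zs_def)
  have "lam ! i = Suc (part (strip_col lam) i)" if "i < length lam"
  proof -
    have "lam ! i = Suc (zs ! i)" using that lz nth_map[of i zs Suc] by (simp add: lam)
    also have "zs ! i = part (strip_col lam) i" using that by (simp add: zs_def part_def nth_append)
    finally show ?thesis .
  qed
  then show "part lam i = raise_rows (length lam) (part (strip_col lam)) i"
    by (simp add: part_def raise_rows_def)
qed

text \<open>Vanishing holds because a chain of k strips ends in a shape with at most k rows;
  stripping is \<open>chains_raise\<close> with as many variables as rows.\<close>

lemma strip_family_schur: "strip_family (schur :: nat list \<Rightarrow> 'a::comm_ring_1 series)"
proof
  fix lam n m assume lam: "lam \<in> partitions n"
  show "symmetric_series (schur lam :: 'a series)" using lam by (rule symmetric_schur)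
  show "homogeneous n (schur lam :: 'a series)" using lam by (rule homogeneous_schur)
  {
    assume lt: "card (vars m) < length lam"
    obtain \<pi> where p: "bij \<pi>" "vars (Poly_Mapping.map_key \<pi> m) = {..<card (vars m)}"
      by (rule ex_variables_initial)
    let ?m = "Poly_Mapping.map_key \<pi> m"
    have "0 \<notin> set lam" using lam by (simp add: partitions_def)
    then have "lam ! card (vars m) \<noteq> 0" using nth_mem[OF lt] by metis
    then have "part lam (card (vars m)) \<noteq> 0" using lt by (simp add: part_def)
    then have "strip_chains (map (expo ?m) [0..<card (vars m)]) (part lam) = 0"
      using chains_length[of "map (expo ?m) [0..<card (vars m)]" "part lam"]
      by (metis diff_zero length_map length_upt)
    then have "(schur lam ?m :: 'a) = 0"
      by (subst schur_chains[OF lam, of _ "card (vars m)"]) (use p in auto)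
    then show "(schur lam m :: 'a) = 0"
      using symmetric_schur[OF lam, where 'a = 'a] p(1) by (simp add: symmetric_series_def)
  }
  {
    let ?N = "length lam"
    assume v: "vars m \<subseteq> {..<?N}"
    have "strip_chains (map (expo (m + ind {..<?N})) [0..<?N]) (part lam) =
        strip_chains (map Suc (map (expo m) [0..<?N])) (raise_rows ?N (part (strip_col lam)))"
      unfolding part_strip_col[OF lam, symmetric]
      by (rule arg_cong2[where f = strip_chains]) (auto simp: lookup_add expo_ind)
    also have "\<dots> = strip_chains (map (expo m) [0..<?N]) (part (strip_col lam))"
      using chains_raise[of "map (expo m) [0..<?N]" "part (strip_col lam)"] strip_col_partition(2)[OF lam]
      by (simp add: part_def)
    finally show "(schur lam (m + ind {..<?N}) :: 'a) = schur (strip_col lam) m"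
      using v by (subst (1 2) schur_chains[where k = ?N]) (use lam strip_col_partition(1)[OF lam] in auto)
  }
next
  show "(schur [] 0 :: 'a) = 1"
    by (subst schur_chains[of _ 0 _ 0]) (auto simp: chains_Nil)
qed

subsection \<open>Complete symmetric functions and Kostka numbers\<close>

definition below :: "(nat \<Rightarrow>\<^sub>0 nat) \<Rightarrow> (nat \<Rightarrow>\<^sub>0 nat) set" where
  "below m = {a. \<forall>i. expo a i \<le> expo m i}"

text \<open>The product with the complete function h_r, whose coefficients in degree
  \<open>r\<close> are all 1, written as a sum over the divisors of a monomial.\<close>

definition mult_h :: "nat \<Rightarrow> 'a::comm_ring_1 series \<Rightarrow> 'a series" where
  "mult_h r f = (\<lambda>m. \<Sum>a | a \<in> below m \<and> mdeg a = r. f (m - a))"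

lemma finite_below [simp]: "finite (below m)"
proof (rule finite_imageD)
  obtain k where k: "vars m \<subseteq> {..<k}" by (rule ex_vars_bound)
  have "expo m i \<le> mdeg m" for i
    by (cases "i \<in> vars m") (auto simp: mdeg_def in_keys_iff intro: member_le_sum)
  then have le: "expo a i \<le> mdeg m" if "a \<in> below m" for a i
    using that by (auto simp: below_def intro: order_trans)
  have zero: "expo a i = 0" if "a \<in> below m" "k \<le> i" for a i
  proof -
    have "i \<notin> vars m" using k that by auto
    then have "expo m i = 0" by (simp add: in_keys_iff)
    then show ?thesis using that(1) unfolding below_def by (metis le_zero_eq mem_Collect_eq)
  qed
  show "finite (expo ` below m)"
    by (rule finite_subset[OF _ finite_bounded_functions[of "mdeg m" k]]) (use le zero in auto)
  show "inj_on expo (below m)" by (auto intro: inj_onI)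
qed

lemma vars_below: "a \<in> below m \<Longrightarrow> vars a \<subseteq> vars m"
proof
  fix i assume "a \<in> below m" "i \<in> vars a"
  then have "0 < expo a i" "expo a i \<le> expo m i" by (auto simp: below_def in_keys_iff)
  then have "0 < expo m i" by (rule less_le_trans)
  then show "i \<in> vars m" by (simp add: in_keys_iff)
qed

lemma mult_h_sum:
  "mult_h r (\<lambda>m. \<Sum>x\<in>A. c x * f x m) = (\<lambda>m. \<Sum>x\<in>A. c x * mult_h r (f x) m)"
  unfolding mult_h_def by (rule ext, subst sum.swap) (simp add: sum_distrib_left)

lemma sum_below_split:
  assumes "vars m \<subseteq> {..<k}"
  shows "(\<Sum>a | a \<in> below (m + Poly_Mapping.single k c) \<and> mdeg a = r. F a) =
    (\<Sum>j\<le>min c r. \<Sum>a | a \<in> below m \<and> mdeg a = r - j. F (a + Poly_Mapping.single k j))"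
proof -
  let ?s = "Poly_Mapping.single k"
  have mk: "expo m k = 0"
  proof -
    have "k \<notin> vars m" using assms by auto
    then show ?thesis by (simp add: in_keys_iff)
  qed
  define T where "T = (SIGMA j:{..min c r}. {a. a \<in> below m \<and> mdeg a = r - j})"
  have split: "a - ?s (expo a k) + ?s (expo a k) = a" for a
    by (rule poly_mapping_eqI) (simp add: lookup_add lookup_minus lookup_single when_def)
  have "(\<Sum>a | a \<in> below (m + ?s c) \<and> mdeg a = r. F a) = (\<Sum>x\<in>T. F (snd x + ?s (fst x)))"
  proof (rule sum.reindex_bij_witness[of _ "\<lambda>x. snd x + ?s (fst x)" "\<lambda>a. (expo a k, a - ?s (expo a k))"])
    fix a assume a: "a \<in> {a. a \<in> below (m + ?s c) \<and> mdeg a = r}"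
    then have le: "expo a i \<le> expo m i + (if i = k then c else 0)" for i
    proof -
      have "expo a i \<le> expo (m + ?s c) i" using a by (simp add: below_def)
      then show ?thesis by (simp add: lookup_add lookup_single when_def split: if_splits)
    qed
    have "expo a k \<le> c" using le[of k] mk by simp
    moreover have "mdeg (a - ?s (expo a k)) + expo a k = r"
      using a arg_cong[OF split[of a], of mdeg] by (simp add: mdeg_plus mdeg_single)
    moreover have "a - ?s (expo a k) \<in> below m"
    proof -
      have "expo (a - ?s (expo a k)) i \<le> expo m i" for i
        using le[of i] by (auto simp: lookup_minus lookup_single when_def)
      then show ?thesis by (simp add: below_def)
    qed
    ultimately show "(expo a k, a - ?s (expo a k)) \<in> T" by (auto simp: T_def)
  next
    fix x assume "x \<in> T"
    then obtain j a where x: "x = (j, a)" "j \<le> c" "j \<le> r" "a \<in> below m" "mdeg a = r - j" by (auto simp: T_def)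
    have ak: "expo a k = 0" using x(4) mk by (auto simp: below_def) (metis le_zero_eq)
    show "(expo (snd x + ?s (fst x)) k, snd x + ?s (fst x) - ?s (expo (snd x + ?s (fst x)) k)) = x"
      using ak by (simp add: x lookup_add)
    show "snd x + ?s (fst x) \<in> {a. a \<in> below (m + ?s c) \<and> mdeg a = r}"
      using x by (auto simp: below_def lookup_add lookup_single when_def mdeg_plus mdeg_single add_mono)
  qed (simp_all add: split)
  also have "\<dots> = (\<Sum>j\<le>min c r. \<Sum>a | a \<in> below m \<and> mdeg a = r - j. F (a + ?s j))"
    unfolding T_def by (subst sum.Sigma) (auto simp: case_prod_unfold)
  finally show ?thesis .
qed

lemma split_last_variable:
  assumes "vars m \<subseteq> {..<Suc k}"
  obtains m' c where "vars m' \<subseteq> {..<k}" "m = m' + Poly_Mapping.single k c"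
proof -
  let ?m' = "m - Poly_Mapping.single k (expo m k)"
  have "?m' + Poly_Mapping.single k (expo m k) = m"
    by (rule poly_mapping_eqI) (simp add: lookup_add lookup_minus lookup_single when_def)
  moreover have "vars ?m' \<subseteq> {..<k}"
    using assms by (auto simp: in_keys_iff lookup_minus lookup_single when_def less_Suc_eq split: if_splits)
      (metis in_keys_iff lessThan_iff less_SucE not_gr_zero subsetD)
  ultimately show thesis using that by metis
qed

text \<open>Induction on the number of variables. If the divisor contains the last variable to the
  power j, a strip of size \<open>c - j\<close> remains to be removed for it; after the induction
  hypothesis \<open>add_remove_commute\<close> moves this removal past the addition.\<close>

lemma chains_pieri:
  assumes "par n" "vars m \<subseteq> {..<k}"
  shows "(\<Sum>a | a \<in> below m \<and> mdeg a = r. strip_chains (map (expo (m - a)) [0..<k]) n) =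
    (\<Sum>l\<in>add_strip n r. strip_chains (map (expo m) [0..<k]) l)"
  using assms
proof (induction k arbitrary: n m r)
  case 0
  then have m: "m = 0" by simp
  have a0: "a = 0" if "a \<in> below m" for a
    using that by (intro poly_mapping_eqI) (simp add: below_def m)
  have b: "{a. a \<in> below m \<and> mdeg a = r} = (if r = 0 then {0} else {})"
  proof -
    have "0 \<in> below m" by (simp add: below_def)
    then have "below m = {0}" using a0 by blast
    then show ?thesis by auto
  qed
  have zero: "n = (\<lambda>_. 0) \<and> r = 0" if "(\<lambda>_. 0) \<in> add_strip n r"
    using that remove_stripD[of n "\<lambda>_. 0" r] by (auto simp: add_strip_def hstrip_def fsize_def)
  have "(\<lambda>_. 0) \<in> add_strip (\<lambda>_. 0) 0"
    by (auto simp: add_strip_def remove_strip_def hstrip_def fin_supp_def)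
  then have "(\<Sum>l\<in>add_strip n r. strip_chains [] l) = (if n = (\<lambda>_. 0) \<and> r = 0 then 1 else 0)"
    using zero by (auto simp: chains_Nil sum.delta intro!: sum.neutral)
  then show ?case by (simp add: b chains_Nil)
next
  case (Suc k)
  obtain m' c where m': "vars m' \<subseteq> {..<k}" "m = m' + Poly_Mapping.single k c"
    by (rule split_last_variable[OF Suc.prems(2)])
  let ?s = "Poly_Mapping.single k"
  have mk: "expo m' k = 0" using m'(1) by (metis in_keys_iff lessThan_iff less_irrefl subsetD)
  have ak: "expo a k = 0" if "a \<in> below m'" for a using that mk unfolding below_def by (metis le_zero_eq mem_Collect_eq)
  have last: "map (expo (m - (a + ?s j))) [0..<Suc k] = map (expo (m' - a)) [0..<k] @ [c - j]" if "a \<in> below m'" for a j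
    using ak[OF that] mk by (auto simp: m'(2) lookup_add lookup_minus lookup_single when_def)
  have "(\<Sum>a | a \<in> below m \<and> mdeg a = r. strip_chains (map (expo (m - a)) [0..<Suc k]) n) =
      (\<Sum>j\<le>min c r. \<Sum>a | a \<in> below m' \<and> mdeg a = r - j. \<Sum>t\<in>remove_strip n (c - j). strip_chains (map (expo (m' - a)) [0..<k]) t)"
    unfolding m'(2) sum_below_split[OF m'(1)] unfolding m'(2)[symmetric]
    by (intro sum.cong refl) (simp add: last chains_snoc del: upt_Suc)
  also have "\<dots> = (\<Sum>j\<le>min c r. \<Sum>t\<in>remove_strip n (c - j). \<Sum>a | a \<in> below m' \<and> mdeg a = r - j. strip_chains (map (expo (m' - a)) [0..<k]) t)"
    by (intro sum.cong refl sum.swap)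
  also have "\<dots> = (\<Sum>j\<le>min c r. \<Sum>t\<in>remove_strip n (c - j). \<Sum>l\<in>add_strip t (r - j). strip_chains (map (expo m') [0..<k]) l)"
    using m'(1) by (intro sum.cong refl Suc.IH) (auto dest: remove_strip_par)
  also have "\<dots> = (\<Sum>l\<in>add_strip n r. \<Sum>t\<in>remove_strip l c. strip_chains (map (expo m') [0..<k]) t)"
    by (rule add_remove_commute[symmetric])
  also have "\<dots> = (\<Sum>l\<in>add_strip n r. strip_chains (map (expo m) [0..<Suc k]) l)"
    using last[of 0 0] by (simp add: chains_snoc below_def del: upt_Suc)
  finally show ?case .
qed

lemma schur_pieri:
  assumes "nu \<in> partitions n"
  shows "mult_h r (schur nu :: 'a::comm_ring_1 series) =
    (\<lambda>m. \<Sum>lam | lam \<in> partitions (n + r) \<and> part nu \<in> remove_strip (part lam) r. schur lam m)"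
proof
  fix m
  obtain k where k: "vars m \<subseteq> {..<k}" by (rule ex_vars_bound)
  have "bij_betw part {lam \<in> partitions (n + r). part nu \<in> remove_strip (part lam) r}
      {g \<in> {g. par g \<and> fsize g = n + r}. part nu \<in> remove_strip g r}"
    by (rule bij_betw_subset[OF bij_part]) (use bij_part[of "n + r"] in \<open>auto simp: bij_betw_def\<close>)
  moreover have "{g \<in> {g. par g \<and> fsize g = n + r}. part nu \<in> remove_strip g r} = add_strip (part nu) r"
    using remove_strip_par remove_stripD(4) assms by (fastforce simp: add_strip_def fsize_part partitions_def)
  ultimately have bij: "bij_betw part {lam \<in> partitions (n + r). part nu \<in> remove_strip (part lam) r} (add_strip (part nu) r)"
    by simp
  have vm: "vars (m - a) \<subseteq> {..<k}" for a
    using k by (auto simp: in_keys_iff lookup_minus)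
      (metis in_keys_iff lessThan_iff less_nat_zero_code linorder_neqE_nat subsetD diff_is_0_eq' le0)
  have "mult_h r (schur nu :: 'a series) m =
      of_nat (\<Sum>a | a \<in> below m \<and> mdeg a = r. strip_chains (map (expo (m - a)) [0..<k]) (part nu))"
    unfolding mult_h_def of_nat_sum by (intro sum.cong refl schur_chains[OF assms vm])
  also have "\<dots> = of_nat (\<Sum>l\<in>add_strip (part nu) r. strip_chains (map (expo m) [0..<k]) l)"
    using chains_pieri[OF par_part[OF assms] k, of r] by simp
  also have "\<dots> = of_nat (\<Sum>lam | lam \<in> partitions (n + r) \<and> part nu \<in> remove_strip (part lam) r.
      strip_chains (map (expo m) [0..<k]) (part lam))"
    by (subst sum.reindex_bij_betw[OF bij, symmetric]) simp
  also have "\<dots> = (\<Sum>lam | lam \<in> partitions (n + r) \<and> part nu \<in> remove_strip (part lam) r. schur lam m)"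
    unfolding of_nat_sum by (intro sum.cong refl schur_chains[symmetric]) (use k in auto)
  finally show "mult_h r (schur nu :: 'a series) m =
    (\<Sum>lam | lam \<in> partitions (n + r) \<and> part nu \<in> remove_strip (part lam) r. schur lam m)" .
qed

definition h_prod :: "nat list \<Rightarrow> 'a::comm_ring_1 series" where
  "h_prod mu = fold mult_h mu series_one"

lemma kostka_chains:
  assumes "lam \<in> partitions n" shows "kostka lam mu = strip_chains mu (part lam)"
proof -
  have "vars (Poly_Mapping.nth mu) \<subseteq> {..<length mu}"
    by (auto simp: in_keys_iff lookup_nth nth_default_def simp del: keys_nth split: if_splits)
  then have "kostka lam mu = strip_chains (map (expo (Poly_Mapping.nth mu)) [0..<length mu]) (part lam)"
    unfolding kostka_def by (rule card_ssyt[OF assms])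
  also have "map (expo (Poly_Mapping.nth mu)) [0..<length mu] = mu"
    by (rule nth_equalityI) (auto simp: lookup_nth nth_default_def)
  finally show ?thesis .
qed

text \<open>Repeated Pieri steps build exactly the strip chains that the Kostka numbers
  count.\<close>

theorem h_prod_schur:
  "h_prod mu = (\<lambda>m. \<Sum>lam\<in>partitions (sum_list mu). of_nat (kostka lam mu) * (schur lam m :: 'a::comm_ring_1))"
proof (induction mu rule: rev_induct)
  case Nil
  have "schur [] m = (series_one m :: 'a)" for m
  proof (cases "m = 0")
    case True
    then show ?thesis using strip_family.base[OF strip_family_schur] by (simp add: series_one_def)
  next
    case False
    then have "mdeg m \<noteq> 0" by (simp add: mdeg_eq_0_iff)
    then show ?thesis using homogeneous_schur[of "[]" 0, where 'a = 'a] False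
      unfolding homogeneous_def series_one_def by auto
  qed
  moreover have "kostka [] [] = 1" by (subst kostka_chains[of _ 0]) (auto simp: chains_Nil)
  ultimately show ?case by (simp add: h_prod_def)
next
  case (snoc r mu)
  define n where "n = sum_list mu"
  let ?P = "\<lambda>nu lam. part nu \<in> remove_strip (part lam) r"
  have "h_prod (mu @ [r]) = (mult_h r (h_prod mu) :: 'a series)" by (simp add: h_prod_def)
  also have "\<dots> = (\<lambda>m. \<Sum>nu\<in>partitions n. of_nat (kostka nu mu) * mult_h r (schur nu) m)"
    unfolding snoc.IH by (simp add: mult_h_sum n_def)
  also have "\<dots> = (\<lambda>m. \<Sum>lam\<in>partitions (n + r). of_nat (kostka lam (mu @ [r])) * schur lam m)"
  proof
    fix m
    have k: "kostka lam (mu @ [r]) = (\<Sum>nu | nu \<in> partitions n \<and> ?P nu lam. kostka nu mu)"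
      if lam: "lam \<in> partitions (n + r)" for lam
    proof -
      have "bij_betw part {nu \<in> partitions n. ?P nu lam} {g \<in> {g. par g \<and> fsize g = n}. g \<in> remove_strip (part lam) r}"
        by (rule bij_betw_subset[OF bij_part]) (use bij_part[of n] in \<open>auto simp: bij_betw_def\<close>)
      moreover have "{g \<in> {g. par g \<and> fsize g = n}. g \<in> remove_strip (part lam) r} = remove_strip (part lam) r"
        using remove_strip_par remove_stripD(4) lam by (fastforce simp: fsize_part partitions_def)
      ultimately have bij: "bij_betw part {nu \<in> partitions n. ?P nu lam} (remove_strip (part lam) r)" by simp
      have "kostka lam (mu @ [r]) = (\<Sum>g\<in>remove_strip (part lam) r. strip_chains mu g)"
        by (simp add: kostka_chains[OF lam] chains_snoc)
      also have "\<dots> = (\<Sum>nu | nu \<in> partitions n \<and> ?P nu lam. strip_chains mu (part nu))"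
        by (subst sum.reindex_bij_betw[OF bij, symmetric]) simp
      also have "\<dots> = (\<Sum>nu | nu \<in> partitions n \<and> ?P nu lam. kostka nu mu)"
        by (intro sum.cong refl) (auto simp: kostka_chains)
      finally show ?thesis .
    qed
    have "(\<Sum>nu\<in>partitions n. of_nat (kostka nu mu) * mult_h r (schur nu) m) =
        (\<Sum>nu\<in>partitions n. \<Sum>lam | lam \<in> partitions (n + r) \<and> ?P nu lam. of_nat (kostka nu mu) * (schur lam m :: 'a))"
      by (intro sum.cong refl) (simp add: schur_pieri sum_distrib_left)
    also have "\<dots> = (\<Sum>lam\<in>partitions (n + r). \<Sum>nu | nu \<in> partitions n \<and> ?P nu lam. of_nat (kostka nu mu) * schur lam m)"
      by (rule sum.swap_restrict) auto
    also have "\<dots> = (\<Sum>lam\<in>partitions (n + r). of_nat (kostka lam (mu @ [r])) * schur lam m)"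
      by (intro sum.cong refl) (simp add: k sum_distrib_right)
    finally show "(\<Sum>nu\<in>partitions n. of_nat (kostka nu mu) * mult_h r (schur nu) m) =
      (\<Sum>lam\<in>partitions (n + r). of_nat (kostka lam (mu @ [r])) * (schur lam m :: 'a))" .
  qed
  finally show ?case by (simp add: n_def)
qed

lemma partition_eq_mset:
  assumes "lam \<in> partitions n" "mu \<in> partitions k" "mset lam = mset mu" shows "lam = mu"
proof -
  have "sorted (rev lam)" "sorted (rev mu)"
    using assms by (auto simp: partitions_def sorted_wrt_rev)
  then have "rev lam = rev mu" using assms(3) by (metis mset_rev properties_for_sort)
  then show ?thesis by simp
qed

lemma ex_partition_mset:
  assumes "0 \<notin># M" obtains lam where "lam \<in> partitions (sum_mset M)" "mset lam = M"
proof
  let ?l = "rev (sorted_list_of_multiset M)"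
  show "mset ?l = M" by simp
  have "sum_list ?l = sum_mset M" by (simp flip: sum_mset_sum_list)
  then show "?l \<in> partitions (sum_mset M)"
    using assms by (auto simp: partitions_def sorted_wrt_rev sorted_sorted_list_of_multiset)
qed

lemma nth_partition:
  assumes "0 \<notin> set mu"
  shows "vars (Poly_Mapping.nth mu) = {..<length mu}" "exponents (Poly_Mapping.nth mu) = mset mu"
    "mdeg (Poly_Mapping.nth mu) = sum_list mu"
proof -
  show v: "vars (Poly_Mapping.nth mu) = {..<length mu}"
  proof -
    have "mu ! i \<noteq> 0" if "i < length mu" for i using assms nth_mem[OF that] by metis
    then show ?thesis
      by (auto simp: in_keys_iff lookup_nth nth_default_def set_eq_iff simp del: keys_nth)
  qed
  have "map (expo (Poly_Mapping.nth mu)) [0..<length mu] = mu"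
    by (rule nth_equalityI) (auto simp: lookup_nth nth_default_def)
  then show e: "exponents (Poly_Mapping.nth mu) = mset mu"
    using mset_exponents[of "Poly_Mapping.nth mu" "length mu"] v by simp
  show "mdeg (Poly_Mapping.nth mu) = sum_list mu"
    using sum_exponents[of "Poly_Mapping.nth mu"] unfolding e by (simp add: sum_mset_sum_list)
qed

text \<open>The required renaming comes from a permutation of the variables that occur in
  \<open>m\<close>, extended to a bijection of all variables. Values at the monomials
  \<open>Poly_Mapping.nth mu\<close> therefore determine a symmetric series.\<close>

lemma symmetric_series_canonical:
  assumes "symmetric_series f" "0 \<notin> set mu" "mset mu = exponents m"
  shows "f m = f (Poly_Mapping.nth mu)"
proof -
  define L0 where "L0 = sorted_list_of_set (vars m)"
  have "mset mu = mset (map (expo m) L0)"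
    using assms(3) mset_set_set[of L0] by (simp add: exponents_def L0_def)
  then obtain p where p: "p permutes {..<length (map (expo m) L0)}" "permute_list p (map (expo m) L0) = mu"
    by (rule mset_eq_permutation)
  define L where "L = permute_list p L0"
  have map_L: "map (expo m) L = mu" using p by (simp add: L_def permute_list_map)
  have mL: "mset L = mset L0" unfolding L_def using p(1) by (intro mset_permute_list) simp
  then have "distinct L" by (metis L0_def distinct_sorted_list_of_set mset_eq_imp_distinct_iff)
  then obtain \<pi> where \<pi>: "bij \<pi>" "\<And>i. i < length L \<Longrightarrow> \<pi> i = L ! i"
    by (rule bij_extending_enumeration) blast
  have "set L = vars m" using mset_eq_setD[OF mL] by (simp add: L0_def)
  then have vm: "vars m = \<pi> ` {..<length L}"
    using \<pi>(2) by (auto simp: set_conv_nth image_iff)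
  have "Poly_Mapping.map_key \<pi> m = Poly_Mapping.nth mu"
  proof (rule poly_mapping_eqI)
    fix i
    have "expo m (\<pi> i) = nth_default 0 mu i"
    proof (cases "i < length L")
      case True
      then show ?thesis using \<pi>(2) by (simp add: nth_default_def flip: map_L)
    next
      case False
      then have "\<pi> i \<notin> vars m" using vm bij_is_inj[OF \<pi>(1)] by (auto simp: inj_def)
      then show ?thesis using False by (simp add: nth_default_def in_keys_iff flip: map_L)
    qed
    then show "expo (Poly_Mapping.map_key \<pi> m) i = expo (Poly_Mapping.nth mu) i"
      by (simp add: expo_map_key bij_is_inj[OF \<pi>(1)] lookup_nth)
  qed
  then show ?thesis using assms(1) \<pi>(1) unfolding symmetric_series_def by metis
qed

lemma zero_notin_exponents: "0 \<notin># exponents m"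
  by (auto simp: exponents_def in_keys_iff)

definition monomial_sym :: "nat list \<Rightarrow> 'a::comm_ring_1 series" where
  "monomial_sym mu = (\<lambda>m. if exponents m = mset mu then 1 else 0)"

lemma monomial_expansion:
  assumes "symmetric_series f" "homogeneous n f"
  shows "f = (\<lambda>m. \<Sum>mu\<in>partitions n. f (Poly_Mapping.nth mu) * monomial_sym mu m)"
proof
  fix m
  show "f m = (\<Sum>mu\<in>partitions n. f (Poly_Mapping.nth mu) * monomial_sym mu m)"
  proof (cases "mdeg m = n")
    case True
    obtain mu where mu: "mu \<in> partitions n" "mset mu = exponents m"
      using ex_partition_mset[OF zero_notin_exponents, of m] True by (metis sum_exponents)
    then have "0 \<notin> set mu" by (simp add: partitions_def)
    then have "f m = f (Poly_Mapping.nth mu)" using symmetric_series_canonical assms(1) mu(2) by blast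
    moreover have "(\<Sum>nu\<in>partitions n. f (Poly_Mapping.nth nu) * monomial_sym nu m) =
        (\<Sum>nu\<in>partitions n. if nu = mu then f (Poly_Mapping.nth mu) else 0)"
      by (intro sum.cong refl) (use mu partition_eq_mset in \<open>auto simp: monomial_sym_def\<close>)
    ultimately show ?thesis using mu(1) by simp
  next
    case False
    have "sum_mset (mset mu) = n" if "mu \<in> partitions n" for mu
      using that by (simp add: partitions_def sum_mset_sum_list)
    then have "monomial_sym mu m = (0 :: 'a)" if "mu \<in> partitions n" for mu
      using that False sum_exponents[of m] unfolding monomial_sym_def by metis
    moreover have "f m = 0" using assms(2) False by (auto simp: homogeneous_def)
    ultimately show ?thesis by simp
  qed
qed

lemma schur_nth: "schur lam (Poly_Mapping.nth mu) = of_nat (kostka lam mu)"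
  by (simp add: schur_def kostka_def)

text \<open>Monomial symmetric functions expand in Schur functions over any commutative ring, and
  Schur functions expand in monomial ones with Kostka coefficients. Composing the two expansions in
  both orders gives the two inverse identities.\<close>

theorem kostka_inverse:
  obtains M :: "nat list \<Rightarrow> nat list \<Rightarrow> 'a::comm_ring_1" where
    "\<And>lam nu. lam \<in> partitions n \<Longrightarrow> nu \<in> partitions n \<Longrightarrow>
      (\<Sum>mu\<in>partitions n. of_nat (kostka lam mu) * M mu nu) = (if lam = nu then 1 else 0)"
    "\<And>mu nu. mu \<in> partitions n \<Longrightarrow> nu \<in> partitions n \<Longrightarrow>
      (\<Sum>lam\<in>partitions n. M mu lam * of_nat (kostka lam nu)) = (if mu = nu then 1 else 0)"
proof -
  interpret schur: strip_family "schur :: nat list \<Rightarrow> 'a series" by (rule strip_family_schur)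
  have "\<exists>c. monomial_sym mu = (\<lambda>m. \<Sum>lam\<in>partitions n. c lam * (schur lam m :: 'a))" if mu: "mu \<in> partitions n" for mu
  proof -
    have "symmetric_series (monomial_sym mu :: 'a series)"
      by (simp add: symmetric_series_def monomial_sym_def exponents_map_key)
    moreover have "homogeneous n (monomial_sym mu :: 'a series)"
      unfolding homogeneous_def
    proof (intro allI impI)
      fix m assume "(monomial_sym mu m :: 'a) \<noteq> 0"
      then have "exponents m = mset mu" by (auto simp: monomial_sym_def split: if_splits)
      then have "mdeg m = sum_list mu" using sum_exponents[of m] by (simp add: sum_mset_sum_list)
      then show "mdeg m = n" using mu by (simp add: partitions_def)
    qed
    ultimately show ?thesis by (metis schur.expand)
  qed
  then obtain M where M: "\<And>mu. mu \<in> partitions n \<Longrightarrow>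
      monomial_sym mu = (\<lambda>m. \<Sum>lam\<in>partitions n. M mu lam * (schur lam m :: 'a))" by metis
  show thesis
  proof (rule that[of M])
    fix mu nu assume mu: "mu \<in> partitions n" and nu: "nu \<in> partitions n"
    have nz: "0 \<notin> set nu" using nu by (simp add: partitions_def)
    have "(\<Sum>lam\<in>partitions n. M mu lam * of_nat (kostka lam nu)) = monomial_sym mu (Poly_Mapping.nth nu)"
      by (simp add: M[OF mu] schur_nth)
    also have "\<dots> = (if mu = nu then 1 else 0)"
      using partition_eq_mset[OF nu mu] by (auto simp: monomial_sym_def nth_partition[OF nz])
    finally show "(\<Sum>lam\<in>partitions n. M mu lam * of_nat (kostka lam nu)) = (if mu = nu then 1 else 0)" .
  next
    fix lam nu assume lam: "lam \<in> partitions n" and nu: "nu \<in> partitions n"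
    have "(\<lambda>m. \<Sum>ka\<in>partitions n. (if lam = ka then 1 else 0) * (schur ka m :: 'a)) = schur lam"
      using lam by (simp add: fun_eq_iff if_distrib[of "\<lambda>x. x * _"] cong: if_cong)
    also have "\<dots> = (\<lambda>m. \<Sum>mu\<in>partitions n. of_nat (kostka lam mu) * monomial_sym mu m)"
      using monomial_expansion[OF symmetric_schur[OF lam] homogeneous_schur[OF lam], where 'a = 'a]
      by (simp only: schur_nth)
    also have "\<dots> = (\<lambda>m. \<Sum>ka\<in>partitions n. (\<Sum>mu\<in>partitions n. of_nat (kostka lam mu) * M mu ka) * schur ka m)"
      by (rule ext, simp add: M sum_distrib_left sum_distrib_right mult.assoc, rule sum.swap)
    finally have e: "(\<lambda>m. \<Sum>ka\<in>partitions n. (if lam = ka then 1 else 0) * (schur ka m :: 'a)) =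
      (\<lambda>m. \<Sum>ka\<in>partitions n. (\<Sum>mu\<in>partitions n. of_nat (kostka lam mu) * M mu ka) * schur ka m)" .
    show "(\<Sum>mu\<in>partitions n. of_nat (kostka lam mu) * M mu nu) = (if lam = nu then 1 else 0)"
      using schur.unique_coefficients[OF e nu] by simp
  qed
qed

subsection \<open>Elementary symmetric functions\<close>

text \<open>The product with e_r: only the squarefree divisors of degree \<open>r\<close>
  contribute.\<close>

definition mult_e :: "nat \<Rightarrow> 'a::comm_ring_1 series \<Rightarrow> 'a series" where
  "mult_e r f = (\<lambda>m. \<Sum>S | S \<subseteq> vars m \<and> card S = r. f (m - ind S))"

lemma mult_e_sum:
  "mult_e r (\<lambda>m. \<Sum>x\<in>A. c x * f x m) = (\<lambda>m. \<Sum>x\<in>A. c x * mult_e r (f x) m)"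
  unfolding mult_e_def by (rule ext, subst sum.swap) (simp add: sum_distrib_left)

lemma sum_alternating_subsets:
  assumes "finite V" "V \<noteq> {}" shows "(\<Sum>S\<in>Pow V. (- 1) ^ card S) = (0 :: 'a::comm_ring_1)"
proof -
  obtain x where x: "x \<in> V" using assms by blast
  let ?W = "V - {x}"
  have V: "V = insert x ?W" using x by auto
  have "(\<Sum>S\<in>Pow V. (- 1 :: 'a) ^ card S) = (\<Sum>S\<in>Pow ?W \<union> insert x ` Pow ?W. (- 1) ^ card S)"
    by (subst V, subst Pow_insert) simp
  also have "\<dots> = (\<Sum>S\<in>Pow ?W. (- 1) ^ card S) + (\<Sum>S\<in>insert x ` Pow ?W. (- 1) ^ card S)"
    using assms(1) by (intro sum.union_disjoint) auto
  also have "(\<Sum>S\<in>insert x ` Pow ?W. (- 1 :: 'a) ^ card S) = (\<Sum>S\<in>Pow ?W. (- 1) ^ card (insert x S))"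
    by (subst sum.reindex) (auto simp: inj_on_def)
  also have "\<dots> = (\<Sum>S\<in>Pow ?W. - ((- 1) ^ card S))"
  proof (intro sum.cong refl)
    fix S assume "S \<in> Pow ?W"
    then have "finite S" "x \<notin> S" using assms(1) by (auto intro: finite_subset)
    then show "(- 1 :: 'a) ^ card (insert x S) = - ((- 1) ^ card S)" by simp
  qed
  finally show ?thesis by (simp add: sum_negf)
qed

text \<open>Collect the terms by the total divisor b = a + \<open>ind S\<close>. For given b the set
  \<open>S\<close> runs over all subsets of the variables of b, and the signs cancel since b has
  degree \<open>r \<ge> 1\<close> and hence some variable.\<close>

theorem sum_elementary_complete:
  assumes "r \<ge> 1"
  shows "(\<Sum>i\<le>r. (- 1) ^ i * mult_e i (mult_h (r - i) f) m) = (0 :: 'a::comm_ring_1)"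
proof -
  define P where "P = (SIGMA i:{..r}. SIGMA S:{S. S \<subseteq> vars m \<and> card S = i}. {a. a \<in> below (m - ind S) \<and> mdeg a = r - i})"
  define Q where "Q = (SIGMA b:{b. b \<in> below m \<and> mdeg b = r}. Pow (vars b))"
  have fS: "finite {S. S \<subseteq> vars m \<and> card S = i}" for i
    by (rule finite_subset[of _ "Pow (vars m)"]) auto
  have fin: "finite S" if "S \<subseteq> vars m" for S using that finite_keys finite_subset by blast
  have "(\<Sum>i\<le>r. (- 1) ^ i * mult_e i (mult_h (r - i) f) m) =
      (\<Sum>i\<le>r. \<Sum>(S, a)\<in>(SIGMA S:{S. S \<subseteq> vars m \<and> card S = i}. {a. a \<in> below (m - ind S) \<and> mdeg a = r - i}).
        (- 1) ^ i * f (m - ind S - a))"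
    by (intro sum.cong refl) (simp add: mult_e_def mult_h_def sum_distrib_left sum.Sigma fS case_prod_unfold)
  also have "\<dots> = (\<Sum>x\<in>P. (- 1) ^ fst x * f (m - ind (fst (snd x)) - snd (snd x)))"
    unfolding P_def by (subst sum.Sigma) (auto simp: case_prod_unfold fS intro!: finite_SigmaI)
  also have "\<dots> = (\<Sum>(b, S)\<in>Q. (- 1) ^ card S * f (m - b))"
  proof (rule sum.reindex_bij_witness[of _ "\<lambda>(b, S). (card S, S, b - ind S)" "\<lambda>(i, S, a). (a + ind S, S)"])
    fix x assume "x \<in> P"
    then obtain i S a where x: "x = (i, S, a)" "i \<le> r" "S \<subseteq> vars m" "card S = i" "a \<in> below (m - ind S)" "mdeg a = r - i"
      by (auto simp: P_def)
    note fS' = fin[OF x(3)]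
    have pos: "expo m j > 0" if "j \<in> S" for j using x(3) that by (auto simp: in_keys_iff)
    have le: "expo a j \<le> expo m j - (if j \<in> S then 1 else 0)" for j
      using x(5) fS' by (auto simp: below_def lookup_minus expo_ind)
    have "expo (a + ind S) j \<le> expo m j" for j
      using le[of j] pos[of j] fS' by (auto simp: lookup_add expo_ind split: if_splits)
    then show "(case x of (i, S, a) \<Rightarrow> (a + ind S, S)) \<in> Q"
      using x fS' by (auto simp: Q_def below_def mdeg_plus mdeg_ind)
    have "m - (a + ind S) = m - ind S - a" by (rule poly_mapping_eqI) (simp add: lookup_minus lookup_add)
    then show "(case case x of (i, S, a) \<Rightarrow> (a + ind S, S) of (b, S) \<Rightarrow> (- 1) ^ card S * f (m - b)) =
      (- 1) ^ fst x * f (m - ind (fst (snd x)) - snd (snd x))"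
      using x by simp
    show "(case case x of (i, S, a) \<Rightarrow> (a + ind S, S) of (b, S) \<Rightarrow> (card S, S, b - ind S)) = x"
      using x by simp
  next
    fix y assume "y \<in> Q"
    then obtain b S where y: "y = (b, S)" "b \<in> below m" "mdeg b = r" "S \<subseteq> vars b" by (auto simp: Q_def)
    have Sm: "S \<subseteq> vars m" using y vars_below by blast
    note fS' = fin[OF Sm]
    have pos: "expo b j > 0" if "j \<in> S" for j using y(4) that by (auto simp: in_keys_iff)
    have bS: "b - ind S + ind S = b"
      using pos fS' by (intro poly_mapping_eqI) (auto simp: lookup_minus lookup_add expo_ind Suc_le_eq)
    then have "mdeg (b - ind S) + card S = r" using y(3) fS' by (metis mdeg_ind mdeg_plus)
    moreover have "b - ind S \<in> below (m - ind S)"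
      using y(2) by (auto simp: below_def lookup_minus diff_le_mono)
    ultimately show "(case y of (b, S) \<Rightarrow> (card S, S, b - ind S)) \<in> P"
      using y Sm by (auto simp: P_def)
    show "(case case y of (b, S) \<Rightarrow> (card S, S, b - ind S) of (i, S, a) \<Rightarrow> (a + ind S, S)) = y"
      using y bS by simp
  qed
  also have "\<dots> = (\<Sum>b | b \<in> below m \<and> mdeg b = r. (\<Sum>S\<in>Pow (vars b). (- 1) ^ card S) * f (m - b))"
    unfolding Q_def by (subst sum.Sigma[symmetric]) (auto simp: sum_distrib_right)
  also have "\<dots> = 0"
  proof (intro sum.neutral ballI)
    fix b assume "b \<in> {b. b \<in> below m \<and> mdeg b = r}"
    then have "vars b \<noteq> {}" using assms by (auto simp: mdeg_def)
    then show "(\<Sum>S\<in>Pow (vars b). (- 1) ^ card S) * f (m - b) = 0"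
      by (subst sum_alternating_subsets) auto
  qed
  finally show ?thesis .
qed

subsection \<open>Gaussian binomial coefficients\<close>

text \<open>Defined by the q-Pascal recursion and not as a quotient, so that it lives in every
  commutative ring: it occurs in Z[t], in the fraction field and at the real numbers q and
  1/q.\<close>

fun gbinom :: "'a::comm_ring_1 \<Rightarrow> nat \<Rightarrow> nat \<Rightarrow> 'a" where
  "gbinom q n 0 = 1"
| "gbinom q 0 (Suc k) = 0"
| "gbinom q (Suc n) (Suc k) = gbinom q n k + q ^ Suc k * gbinom q n (Suc k)"

lemma gbinom_eq_0: "n < k \<Longrightarrow> gbinom q n k = 0"
  by (induction q n k rule: gbinom.induct) auto

lemma gbinom_self [simp]: "gbinom q n n = 1"
  by (induction n) (auto simp: gbinom_eq_0)

text \<open>The factor v_m(t) in the normalization of the Hall-Littlewood polynomials.\<close>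

definition qfact :: "'a::field \<Rightarrow> nat \<Rightarrow> 'a" where
  "qfact t m = (\<Prod>k = 1..m. (1 - t ^ k) / (1 - t))"

lemma qfact_0 [simp]: "qfact t 0 = 1" by (simp add: qfact_def)

lemma qfact_Suc: "qfact t (Suc m) = qfact t m * ((1 - t ^ Suc m) / (1 - t))"
  by (simp add: qfact_def)

lemma gbinom_qfact:
  assumes "t \<noteq> 1" "k \<le> n"
  shows "gbinom t n k * qfact t k * qfact t (n - k) = qfact t n"
  using assms(2)
proof (induction n arbitrary: k)
  case (Suc n)
  show ?case
  proof (cases k)
    case (Suc j)
    show ?thesis
    proof (cases "j = n")
      case True
      then show ?thesis using Suc by simp
    next
      case False
      then have jn: "j < n" using Suc Suc.prems by simp
      then obtain d where d: "n = Suc (j + d)" using less_imp_Suc_add by blast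
      define u where "u = (1 - t ^ Suc j) / (1 - t)"
      define v where "v = (1 - t ^ Suc d) / (1 - t)"
      have b: "1 - t \<noteq> 0" using assms(1) by simp
      have 1: "gbinom t n j * qfact t j * qfact t (n - j) = qfact t n"
        and 2: "gbinom t n (Suc j) * qfact t (Suc j) * qfact t (n - Suc j) = qfact t n"
        using Suc.IH[of j] Suc.IH[of "Suc j"] jn by auto
      have nj: "n - j = Suc d" "n - Suc j = d" using d by auto
      have qj: "qfact t (Suc j) = qfact t j * u" and qd: "qfact t (Suc d) = qfact t d * v"
        by (simp_all only: qfact_Suc u_def v_def)
      have "gbinom t (Suc n) (Suc j) * qfact t (Suc j) * qfact t (Suc n - Suc j) =
          (gbinom t n j + t ^ Suc j * gbinom t n (Suc j)) * (qfact t j * u) * (qfact t d * v)"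
        by (simp only: gbinom.simps diff_Suc_Suc nj qj qd)
      also have "\<dots> = (gbinom t n j * qfact t j * qfact t (n - j)) * u
          + t ^ Suc j * (gbinom t n (Suc j) * qfact t (Suc j) * qfact t (n - Suc j)) * v"
        unfolding nj qj qd by (simp only: algebra_simps)
      also have "\<dots> = qfact t n * (u + t ^ Suc j * v)"
        unfolding 1 2 by (simp only: algebra_simps)
      also have "u + t ^ Suc j * v = ((1 - t ^ Suc j) + t ^ Suc j * (1 - t ^ Suc d)) / (1 - t)"
        by (simp only: u_def v_def add_divide_distrib times_divide_eq_right)
      also have "(1 - t ^ Suc j) + t ^ Suc j * (1 - t ^ Suc d) = 1 - t ^ Suc n"
        unfolding d by (simp add: algebra_simps power_add)
      finally show ?thesis using Suc by (simp only: qfact_Suc)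
    qed
  qed simp
qed simp

subsection \<open>Symmetrization in a field\<close>

text \<open>The left side is the top coefficient of the Lagrange interpolation polynomial on the
  nodes \<open>A\<close>, and by the degree bound this polynomial is \<open>g\<close>
  itself.\<close>

lemma lagrange_leading_coeff:
  fixes g :: "'a::field poly"
  assumes A: "finite A" and d: "Suc (degree g) \<le> card A"
  shows "(\<Sum>a\<in>A. poly g a / (\<Prod>b\<in>A - {a}. a - b)) = coeff g (card A - 1)"
proof -
  define l where "l a = (\<Prod>b\<in>A - {a}. [:- b, 1:])" for a
  define L where "L = (\<Sum>a\<in>A. Polynomial.smult (poly g a / (\<Prod>b\<in>A - {a}. a - b)) (l a))"
  have dl: "degree (l a) = card A - 1" "lead_coeff (l a) = 1" if "a \<in> A" for a
  proof -
    show "degree (l a) = card A - 1"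
      unfolding l_def using that A by (subst degree_prod_sum_eq) auto
    show "lead_coeff (l a) = 1" unfolding l_def lead_coeff_prod by simp
  qed
  have "poly L a = poly g a" if a: "a \<in> A" for a
  proof -
    have "poly (l c) a = 0" if "c \<in> A" "c \<noteq> a" for c
      using a that A by (auto simp: l_def poly_prod intro!: prod_zero)
    then have "poly L a = (\<Sum>c\<in>A. if c = a then poly g a / (\<Prod>b\<in>A - {a}. a - b) * poly (l a) a else 0)"
      unfolding L_def poly_sum by (intro sum.cong) auto
    also have "\<dots> = poly g a / (\<Prod>b\<in>A - {a}. a - b) * (\<Prod>b\<in>A - {a}. a - b)"
      using a A by (simp add: l_def poly_prod)
    also have "\<dots> = poly g a" using A by simp
    finally show ?thesis .
  qed
  moreover have "degree L \<le> card A - 1"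
    unfolding L_def using dl A by (intro degree_sum_le) (auto intro: order_trans[OF degree_smult_le])
  then have "degree L < card A" using d by linarith
  ultimately have Lg: "g = L" using d by (intro poly_eqI_degree[of A]) auto
  have "coeff L (card A - 1) = (\<Sum>a\<in>A. coeff (Polynomial.smult (poly g a / (\<Prod>b\<in>A - {a}. a - b)) (l a)) (card A - 1))"
    by (simp only: L_def coeff_sum)
  also have "\<dots> = (\<Sum>a\<in>A. poly g a / (\<Prod>b\<in>A - {a}. a - b))"
    by (intro sum.cong refl) (use dl in force)
  finally show ?thesis unfolding Lg[symmetric] ..
qed

text \<open>An instance of \<open>lagrange_leading_coeff\<close> for g(z) = \<Prod> (t z - x_i) with
  the nodes x_i and the additional node 0: the coefficient of z^N is t^N, the node 0 contributes 1,
  and the node x_b contributes t - 1 times the summand of index \<open>b\<close>.\<close>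

lemma sum_poincare:
  fixes x :: "nat \<Rightarrow> 'a::field"
  assumes inj: "inj_on x {..<N}" and nz: "\<And>i. i < N \<Longrightarrow> x i \<noteq> 0" and t: "t \<noteq> 1"
  shows "(\<Sum>b<N. \<Prod>i\<in>{..<N} - {b}. (x i - t * x b) / (x i - x b)) = (1 - t ^ N) / (1 - t)"
proof -
  define X where "X = x ` {..<N}"
  define A where "A = insert 0 X"
  define g where "g = (\<Prod>a\<in>X. [:- a, t:])"
  have X: "finite X" "card X = N" "0 \<notin> X" using inj nz by (auto simp: X_def card_image)
  have A: "finite A" "card A = Suc N" using X by (auto simp: A_def)
  have "degree g \<le> (\<Sum>a\<in>X. degree [:- a, t:])" unfolding g_def by (rule degree_prod_sum_le[OF X(1), unfolded comp_def])
  also have "\<dots> \<le> (\<Sum>a\<in>X. 1)" by (intro sum_mono) simp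
  finally have dg: "degree g \<le> N" using X by simp
  have cg: "coeff g N = t ^ N"
  proof -
    have "coeff (\<Prod>a\<in>Y. [:- a, t:]) (card Y) = t ^ card Y \<and> degree (\<Prod>a\<in>Y. [:- a, t:]) \<le> card Y"
      if "finite Y" for Y :: "'a set"
      using that
    proof (induction Y)
      case (insert y Y)
      then have "coeff (\<Prod>a\<in>Y. [:- a, t:]) (Suc (card Y)) = 0" by (intro coeff_eq_0) simp
      moreover have "degree ([:- y, t:] * (\<Prod>a\<in>Y. [:- a, t:])) \<le> Suc (card Y)"
        using insert by (intro order_trans[OF degree_mult_le]) (auto intro: order_trans[OF add_mono[of _ 1]])
      ultimately show ?case using insert by simp
    qed simp
    from this[OF X(1)] show ?thesis using X(2) by (simp add: g_def)
  qed
  have "t ^ N = (\<Sum>a\<in>A. poly g a / (\<Prod>b\<in>A - {a}. a - b))"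
    using lagrange_leading_coeff[of A g] A dg cg by simp
  also have "\<dots> = poly g 0 / (\<Prod>b\<in>X. 0 - b) + (\<Sum>a\<in>X. poly g a / (\<Prod>b\<in>A - {a}. a - b))"
    unfolding A_def using X by (subst sum.insert) auto
  also have "poly g 0 / (\<Prod>b\<in>X. 0 - b) = 1" using X by (auto simp: g_def poly_prod)
  also have "(\<Sum>a\<in>X. poly g a / (\<Prod>b\<in>A - {a}. a - b)) =
      (\<Sum>b<N. (t - 1) * (\<Prod>i\<in>{..<N} - {b}. (x i - t * x b) / (x i - x b)))"
    unfolding X_def sum.reindex[OF inj] comp_def
  proof (intro sum.cong refl)
    fix b assume b: "b \<in> {..<N}"
    have Ab: "A - {x b} = insert 0 (x ` ({..<N} - {b}))"
      using b inj nz by (auto simp: A_def X_def inj_on_def)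
    have i': "inj_on x ({..<N} - {b})" using inj by (rule inj_on_subset) auto
    have pp: "(\<Prod>c\<in>A - {x b}. x b - c) = x b * (\<Prod>i\<in>{..<N} - {b}. x b - x i)"
      unfolding Ab using nz b by (subst prod.insert) (auto simp: prod.reindex[OF i'])
    have "poly g (x b) = (\<Prod>i<N. t * x b - x i)"
      unfolding g_def poly_prod X_def by (subst prod.reindex[OF inj]) (simp add: mult.commute)
    then have pg: "poly g (x b) = (t * x b - x b) * (\<Prod>i\<in>{..<N} - {b}. t * x b - x i)"
      using b by (subst (asm) prod.remove[of _ b]) auto
    have "poly g (x b) / (\<Prod>c\<in>A - {x b}. x b - c) =
        (t - 1) * ((\<Prod>i\<in>{..<N} - {b}. t * x b - x i) / (\<Prod>i\<in>{..<N} - {b}. x b - x i))"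
    proof -
      have e: "t * x b - x b = x b * (t - 1)" by (simp add: algebra_simps)
      have "x b \<noteq> 0" using nz b by simp
      then show ?thesis
        unfolding pp pg e mult.assoc by simp
    qed
    also have "(\<Prod>i\<in>{..<N} - {b}. t * x b - x i) / (\<Prod>i\<in>{..<N} - {b}. x b - x i) =
        (\<Prod>i\<in>{..<N} - {b}. (t * x b - x i) / (x b - x i))" by (simp add: prod_dividef)
    also have "\<dots> = (\<Prod>i\<in>{..<N} - {b}. (x i - t * x b) / (x i - x b))"
      by (intro prod.cong refl) (metis minus_diff_eq minus_divide_divide)
    finally show "poly g (x b) / (\<Prod>c\<in>A - {x b}. x b - c) =
      (t - 1) * (\<Prod>i\<in>{..<N} - {b}. (x i - t * x b) / (x i - x b))" .
  qed
  finally have "t ^ N = 1 + (t - 1) * (\<Sum>b<N. \<Prod>i\<in>{..<N} - {b}. (x i - t * x b) / (x i - x b))"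
    by (simp add: sum_distrib_left)
  then have "(1 - t) * (\<Sum>b<N. \<Prod>i\<in>{..<N} - {b}. (x i - t * x b) / (x i - x b)) = 1 - t ^ N"
    by (simp add: algebra_simps)
  then show ?thesis using t by (simp add: eq_divide_eq mult.commute)
qed

definition hl_factor :: "'a::field \<Rightarrow> (nat \<Rightarrow> 'a) \<Rightarrow> nat \<Rightarrow> 'a" where
  "hl_factor t y N = (\<Prod>(i, j) | i < j \<and> j < N. (y i - t * y j) / (y i - y j))"

text \<open>The Hall-Littlewood numerator for an arbitrary exponent vector, since multiplication by
  e_r leads out of the weakly decreasing ones.\<close>

definition symmetrize :: "'a::field \<Rightarrow> (nat \<Rightarrow> 'a) \<Rightarrow> nat \<Rightarrow> (nat \<Rightarrow> nat) \<Rightarrow> 'a" where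
  "symmetrize t x N a = (\<Sum>w | w permutes {..<N}. (\<Prod>i<N. x (w i) ^ a i) * hl_factor t (x \<circ> w) N)"

lemma finite_pairs [simp]: "finite {(i, j). i < j \<and> j < (N::nat)}"
  by (rule finite_subset[of _ "{..<N} \<times> {..<N}"]) auto

lemma finite_perms [simp]: "finite {w. w permutes {..<N::nat}}"
  by (rule finite_permutations) simp

lemma hl_factor_Suc:
  "hl_factor t y (Suc N) = hl_factor t y N * (\<Prod>i<N. (y i - t * y N) / (y i - y N))"
proof -
  have "{(i, j). i < j \<and> j < Suc N} = {(i, j). i < j \<and> j < N} \<union> (\<lambda>i. (i, N)) ` {..<N}"
    by (auto simp: less_Suc_eq)
  then have "hl_factor t y (Suc N) = (\<Prod>(i, j)\<in>{(i, j). i < j \<and> j < N} \<union> (\<lambda>i. (i, N)) ` {..<N}. (y i - t * y j) / (y i - y j))"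
    by (simp add: hl_factor_def)
  also have "\<dots> = hl_factor t y N * (\<Prod>(i, j)\<in>(\<lambda>i. (i, N)) ` {..<N}. (y i - t * y j) / (y i - y j))"
    unfolding hl_factor_def by (rule prod.union_disjoint) auto
  also have "(\<Prod>(i, j)\<in>(\<lambda>i. (i, N)) ` {..<N}. (y i - t * y j) / (y i - y j)) = (\<Prod>i<N. (y i - t * y N) / (y i - y N))"
    by (subst prod.reindex) (auto simp: inj_on_def)
  finally show ?thesis .
qed

text \<open>Permutations are split by the image \<open>b\<close> of the last index. That index
  contributes a product over all i \<noteq> b, which does not depend on the order of the others;
  what remains is the same sum with one variable fewer. The products add up by
  \<open>sum_poincare\<close>.\<close>

lemma symmetrize_0:
  fixes x :: "nat \<Rightarrow> 'a::field"
  assumes "inj_on x {..<N}" "\<And>i. i < N \<Longrightarrow> x i \<noteq> 0" "t \<noteq> 1"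
  shows "symmetrize t x N (\<lambda>_. 0) = qfact t N"
  using assms(1,2)
proof (induction N arbitrary: x)
  case 0
  then show ?case by (simp add: symmetrize_def hl_factor_def)
next
  case (Suc N)
  have S: "{..<Suc N} = insert N {..<N}" by auto
  have "symmetrize t x (Suc N) (\<lambda>_. 0) =
      (\<Sum>b\<in>insert N {..<N}. \<Sum>q | q permutes {..<N}. hl_factor t (x \<circ> (Transposition.transpose N b \<circ> q)) (Suc N))"
    unfolding symmetrize_def S by (subst sum_over_permutations_insert) auto
  also have "\<dots> = (\<Sum>b<Suc N. (\<Prod>i\<in>{..<Suc N} - {b}. (x i - t * x b) / (x i - x b)) * qfact t N)"
    unfolding S[symmetric]
  proof (intro sum.cong refl)
    fix b assume b: "b \<in> {..<Suc N}"
    define \<tau> where "\<tau> = Transposition.transpose N b"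
    define y where "y = x \<circ> \<tau>"
    have \<tau>: "\<tau> permutes {..<Suc N}" unfolding \<tau>_def using b by (intro permutes_swap_id) auto
    have yinj: "inj_on y {..<Suc N}"
      unfolding y_def using Suc.prems(1) \<tau> by (intro comp_inj_on) (auto simp: permutes_image inj_on_subset[OF permutes_inj])
    have ynz: "y i \<noteq> 0" if "i < Suc N" for i
      using Suc.prems(2)[of "\<tau> i"] permutes_in_image[OF \<tau>, of i] that by (simp add: y_def)
    have "(\<Sum>q | q permutes {..<N}. hl_factor t (x \<circ> (\<tau> \<circ> q)) (Suc N)) =
        (\<Sum>q | q permutes {..<N}. (\<Prod>i<N. (y i - t * y N) / (y i - y N)) * hl_factor t (y \<circ> q) N)"
    proof (intro sum.cong refl)
      fix q assume "q \<in> {q. q permutes {..<N}}"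
      then have q: "q permutes {..<N}" by simp
      have "q N = N" using q by (simp add: permutes_not_in)
      then have "hl_factor t (x \<circ> (\<tau> \<circ> q)) (Suc N) = hl_factor t (y \<circ> q) N * (\<Prod>i<N. (y (q i) - t * y N) / (y (q i) - y N))"
        unfolding hl_factor_Suc by (simp add: y_def comp_assoc)
      also have "(\<Prod>i<N. (y (q i) - t * y N) / (y (q i) - y N)) = (\<Prod>i<N. (y i - t * y N) / (y i - y N))"
        by (rule prod.reindex_bij_betw[OF permutes_imp_bij[OF q]])
      finally show "hl_factor t (x \<circ> (\<tau> \<circ> q)) (Suc N) = (\<Prod>i<N. (y i - t * y N) / (y i - y N)) * hl_factor t (y \<circ> q) N"
        by (simp only: mult.commute)
    qed
    also have "\<dots> = (\<Prod>i<N. (y i - t * y N) / (y i - y N)) * symmetrize t y N (\<lambda>_. 0)"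
      by (simp add: symmetrize_def sum_distrib_left)
    also have "symmetrize t y N (\<lambda>_. 0) = qfact t N"
      using ynz by (intro Suc.IH inj_on_subset[OF yinj]) auto
    also have "(\<Prod>i<N. (y i - t * y N) / (y i - y N)) = (\<Prod>i\<in>{..<Suc N} - {b}. (x i - t * x b) / (x i - x b))"
    proof (rule prod.reindex_bij_witness[of _ \<tau> \<tau>])
      fix i assume i: "i \<in> {..<N}"
      then have "\<tau> i \<noteq> \<tau> N" using permutes_inj[OF \<tau>] by (auto simp: inj_def)
      moreover have "\<tau> N = b" by (simp add: \<tau>_def)
      ultimately show "\<tau> i \<in> {..<Suc N} - {b}" using permutes_in_image[OF \<tau>, of i] i by auto
      show "(x (\<tau> i) - t * x b) / (x (\<tau> i) - x b) = (y i - t * y N) / (y i - y N)"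
        by (simp add: y_def \<open>\<tau> N = b\<close>)
    next
      fix i assume i: "i \<in> {..<Suc N} - {b}"
      then have "\<tau> i \<noteq> \<tau> b" using permutes_inj[OF \<tau>] by (auto simp: inj_def)
      moreover have "\<tau> b = N" by (simp add: \<tau>_def)
      ultimately show "\<tau> i \<in> {..<N}" using permutes_in_image[OF \<tau>, of i] i by auto
    qed (auto simp: \<tau>_def)
    finally show "(\<Sum>q | q permutes {..<N}. hl_factor t (x \<circ> (Transposition.transpose N b \<circ> q)) (Suc N)) =
      (\<Prod>i\<in>{..<Suc N} - {b}. (x i - t * x b) / (x i - x b)) * qfact t N"
      by (simp only: \<tau>_def)
  qed
  also have "\<dots> = (1 - t ^ Suc N) / (1 - t) * qfact t N"
    by (simp only: sum_poincare[OF Suc.prems assms(3)] sum_distrib_right[symmetric])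
  finally show ?case by (simp add: qfact_Suc mult.commute)
qed

text \<open>Being symmetric, e_r may be written in the variables x_(w i) inside the summand of each
  permutation \<open>w\<close>.\<close>

lemma symmetrize_mult_e:
  fixes x :: "nat \<Rightarrow> 'a::field"
  shows "(\<Sum>S | S \<subseteq> {..<N} \<and> card S = r. \<Prod>i\<in>S. x i) * symmetrize t x N a =
    (\<Sum>S | S \<subseteq> {..<N} \<and> card S = r. symmetrize t x N (\<lambda>i. a i + (if i \<in> S then 1 else 0)))"
proof -
  let ?E = "{S. S \<subseteq> {..<N} \<and> card S = r}"
  have "(\<Sum>S\<in>?E. \<Prod>i\<in>S. x i) * ((\<Prod>i<N. x (w i) ^ a i) * hl_factor t (x \<circ> w) N) =
      (\<Sum>S\<in>?E. (\<Prod>i<N. x (w i) ^ (a i + (if i \<in> S then 1 else 0))) * hl_factor t (x \<circ> w) N)"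
    if "w permutes {..<N}" for w
  proof -
    have wi: "inj_on w S" for S using permutes_inj[OF that] by (rule inj_on_subset) simp
    have img: "w ` S \<subseteq> {..<N}" if "S \<subseteq> {..<N}" for S
      using permutes_image[OF \<open>w permutes _\<close>] that by blast
    have img': "inv_into UNIV w ` S \<subseteq> {..<N}" if "S \<subseteq> {..<N}" for S
      using permutes_image[OF permutes_inv[OF \<open>w permutes _\<close>]] that by blast
    have "(\<Sum>S\<in>?E. \<Prod>i\<in>S. x i) = (\<Sum>S\<in>?E. \<Prod>i\<in>S. x (w i))"
    proof (rule sum.reindex_bij_witness[of _ "\<lambda>S. w ` S" "\<lambda>S. inv_into UNIV w ` S"])
      fix S assume S: "S \<in> ?E"
      show "w ` inv_into UNIV w ` S = S" by (simp add: image_comp permutes_inv_o[OF that])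
      then show "(\<Prod>i\<in>inv_into UNIV w ` S. x (w i)) = (\<Prod>i\<in>S. x i)"
        by (subst prod.reindex[OF wi, unfolded comp_def, symmetric]) simp
      show "inv_into UNIV w ` S \<in> ?E" using S img' by (auto simp: card_image inj_on_subset[OF permutes_inj[OF permutes_inv[OF that]]])
    next
      fix S assume S: "S \<in> ?E"
      show "inv_into UNIV w ` w ` S = S" by (simp add: image_comp permutes_inv_o[OF that])
      show "w ` S \<in> ?E" using S img by (auto simp: card_image wi)
    qed
    moreover have "(\<Prod>i\<in>S. x (w i)) * (\<Prod>i<N. x (w i) ^ a i) = (\<Prod>i<N. x (w i) ^ (a i + (if i \<in> S then 1 else 0)))"
      if "S \<in> ?E" for S
    proof -
      have "(\<Prod>i\<in>S. x (w i)) = (\<Prod>i<N. if i \<in> S then x (w i) else 1)"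
        using that by (subst prod.inter_restrict[symmetric]) (auto simp: Int_absorb1)
      then show ?thesis by (simp add: prod.distrib[symmetric] power_add if_distrib mult.commute cong: if_cong)
    qed
    ultimately show ?thesis by (simp add: sum_distrib_right mult.assoc[symmetric])
  qed
  then show ?thesis
    unfolding symmetrize_def sum_distrib_left by (subst sum.swap) (auto intro!: sum.cong)
qed

text \<open>Straightening. In the difference of the two sides the terms of \<open>w\<close> and of
  \<open>w\<close> composed with the transposition cancel: monomials and the factor of the pair (k,
  k+1) combine to (Y - t X)(X - t Y) / (X - Y) and its negative. Neighbours with exponents v, v + 1
  are the only inversions created by raising entries of a decreasing list by at most 1.\<close>

lemma symmetrize_swap:
  fixes x :: "nat \<Rightarrow> 'a::field"
  assumes inj: "inj_on x {..<N}" and k: "Suc k < N" and ak: "a (Suc k) = Suc (a k)"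
  shows "symmetrize t x N a = t * symmetrize t x N (a \<circ> Transposition.transpose k (Suc k))"
proof -
  define \<tau> where "\<tau> = Transposition.transpose k (Suc k)"
  define W where "W = {w. w permutes {..<N}}"
  define I where "I = {(i, j). i < j \<and> j < N}"
  define \<phi> where "\<phi> w = (\<lambda>(i, j). (x (w i) - t * x (w j)) / (x (w i) - x (w j)))" for w :: "nat \<Rightarrow> nat"
  define f where "f w = (\<Prod>i<N. x (w i) ^ a i) * hl_factor t (x \<circ> w) N
      - t * ((\<Prod>i<N. x (w i) ^ a (\<tau> i)) * hl_factor t (x \<circ> w) N)" for w
  have \<tau>: "\<tau> permutes {..<N}" unfolding \<tau>_def using k by (intro permutes_swap_id) auto
  have \<tau>\<tau>: "\<tau> (\<tau> i) = i" for i by (simp add: \<tau>_def)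
  have W\<tau>: "w \<circ> \<tau> \<in> W" if "w \<in> W" for w using that \<tau> permutes_compose by (auto simp: W_def)
  have f0: "f w + f (w \<circ> \<tau>) = 0" if w: "w \<in> W" for w
  proof -
    define X where "X = x (w k)"
    define Y where "Y = x (w (Suc k))"
    have wp: "w permutes {..<N}" using w by (simp add: W_def)
    have "w k \<noteq> w (Suc k)" using injD[OF permutes_inj[OF wp], of k "Suc k"] by auto
    then have XY: "X \<noteq> Y" using inj permutes_in_image[OF wp] k by (auto simp: X_def Y_def inj_on_def)
    define C where "C = (\<Prod>i\<in>{..<N} - {k} - {Suc k}. x (w i) ^ a i)"
    define D where "D = (\<Prod>p\<in>I - {(k, Suc k)}. \<phi> w p)"
    have split: "(\<Prod>i<N. g i) = g k * (g (Suc k) * (\<Prod>i\<in>{..<N} - {k} - {Suc k}. g i))" for g :: "nat \<Rightarrow> 'a"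
      using k by (subst prod.remove[of _ k], simp, simp, subst prod.remove[of _ "Suc k"]) auto
    have rest: "\<tau> i = i" if "i \<in> {..<N} - {k} - {Suc k}" for i using that by (simp add: \<tau>_def)
    have \<tau>k: "\<tau> k = Suc k" "\<tau> (Suc k) = k" by (auto simp: \<tau>_def)
    have rest1: "(\<Prod>i\<in>{..<N} - {k} - {Suc k}. x (w i) ^ a (\<tau> i)) = C"
      and rest2: "(\<Prod>i\<in>{..<N} - {k} - {Suc k}. x (w (\<tau> i)) ^ a i) = C"
      and rest3: "(\<Prod>i\<in>{..<N} - {k} - {Suc k}. x (w (\<tau> i)) ^ a (\<tau> i)) = C"
      unfolding C_def using rest by (auto intro!: prod.cong)
    have m1: "(\<Prod>i<N. x (w i) ^ a i) = X ^ a k * Y ^ Suc (a k) * C"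
      unfolding split by (simp add: X_def Y_def C_def ak mult.assoc)
    have m2: "(\<Prod>i<N. x (w i) ^ a (\<tau> i)) = X ^ Suc (a k) * Y ^ a k * C"
      unfolding split \<tau>k rest1 by (simp add: X_def Y_def ak mult.assoc)
    have m3: "(\<Prod>i<N. x ((w \<circ> \<tau>) i) ^ a i) = Y ^ a k * X ^ Suc (a k) * C"
      unfolding split comp_def \<tau>k rest2 by (simp add: X_def Y_def ak mult.assoc)
    have m4: "(\<Prod>i<N. x ((w \<circ> \<tau>) i) ^ a (\<tau> i)) = Y ^ Suc (a k) * X ^ a k * C"
      unfolding split comp_def \<tau>k rest3 by (simp add: X_def Y_def ak mult.assoc)
    have kI: "(k, Suc k) \<in> I" "finite I" using k by (auto simp: I_def)
    define Z1 where "Z1 = (X - t * Y) / (X - Y)"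
    define Z2 where "Z2 = (Y - t * X) / (Y - X)"
    have d1: "hl_factor t (x \<circ> w) N = Z1 * D"
      using prod.remove[OF kI(2,1), of "\<phi> w"] by (simp add: hl_factor_def I_def \<phi>_def D_def X_def Y_def Z1_def)
    have "D = (\<Prod>p\<in>I - {(k, Suc k)}. \<phi> (w \<circ> \<tau>) p)"
      unfolding D_def
    proof (rule prod.reindex_bij_witness[of _ "\<lambda>(i, j). (\<tau> i, \<tau> j)" "\<lambda>(i, j). (\<tau> i, \<tau> j)"])
      have "(case p of (i, j) \<Rightarrow> (\<tau> i, \<tau> j)) \<in> I - {(k, Suc k)}" if p: "p \<in> I - {(k, Suc k)}" for p
      proof -
        obtain i j where p': "p = (i, j)" "i < j" "j < N" "(i, j) \<noteq> (k, Suc k)" using p by (auto simp: I_def)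
        have "\<tau> i < \<tau> j" "\<tau> j < N" using p' k by (auto simp: \<tau>_def Transposition.transpose_def)
        moreover have "(\<tau> i, \<tau> j) \<noteq> (k, Suc k)" using p' k by (auto simp: \<tau>_def Transposition.transpose_def split: if_splits)
        ultimately show ?thesis by (simp add: p' I_def)
      qed
      then show "\<And>p. p \<in> I - {(k, Suc k)} \<Longrightarrow> (case p of (i, j) \<Rightarrow> (\<tau> i, \<tau> j)) \<in> I - {(k, Suc k)}"
        "\<And>p. p \<in> I - {(k, Suc k)} \<Longrightarrow> (case p of (i, j) \<Rightarrow> (\<tau> i, \<tau> j)) \<in> I - {(k, Suc k)}" by auto
    qed (auto simp: \<tau>\<tau> \<phi>_def)
    then have d2: "hl_factor t (x \<circ> (w \<circ> \<tau>)) N = Z2 * D"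
      using prod.remove[OF kI(2,1), of "\<phi> (w \<circ> \<tau>)"]
      by (simp add: hl_factor_def I_def \<phi>_def \<tau>k X_def Y_def Z2_def)
    have "f w = X ^ a k * Y ^ a k * C * D * ((Y - t * X) * Z1)"
      unfolding f_def m1 m2 d1 by (simp add: algebra_simps)
    moreover have "f (w \<circ> \<tau>) = X ^ a k * Y ^ a k * C * D * ((X - t * Y) * Z2)"
      unfolding f_def m3 m4 d2 by (simp add: algebra_simps)
    moreover have "(Y - t * X) * Z1 + (X - t * Y) * Z2 = 0"
    proof -
      have "Z2 = - ((Y - t * X) / (X - Y))" unfolding Z2_def by (metis minus_diff_eq minus_divide_right)
      then show ?thesis by (simp add: Z1_def mult.commute)
    qed
    ultimately show ?thesis by (metis distrib_left mult_zero_right)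
  qed
  \<comment> \<open>The transposition exchanges the two halves of the symmetric group, so the sum
    vanishes in characteristic 2 as well.\<close>
  define W1 where "W1 = {w \<in> W. w k < w (Suc k)}"
  define W2 where "W2 = {w \<in> W. \<not> w k < w (Suc k)}"
  have finW: "finite W" by (simp add: W_def)
  have "sum f W = sum f W1 + sum f W2"
    using finW by (subst sum.union_disjoint[symmetric]) (auto simp: W1_def W2_def intro!: sum.cong)
  also have "sum f W2 = (\<Sum>w\<in>W1. f (w \<circ> \<tau>))"
  proof (rule sum.reindex_bij_witness[of _ "\<lambda>w. w \<circ> \<tau>" "\<lambda>w. w \<circ> \<tau>"])
    have ne: "w k \<noteq> w (Suc k)" if "w \<in> W" for w
      using injD[OF permutes_inj[of w "{..<N}"], of k "Suc k"] that by (auto simp: W_def)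
    have \<tau>k: "\<tau> k = Suc k" "\<tau> (Suc k) = k" by (auto simp: \<tau>_def)
    show "w \<circ> \<tau> \<in> W1" if "w \<in> W2" for w
      using W\<tau>[of w] ne[of w] that by (auto simp: W1_def W2_def \<tau>k)
    show "w \<circ> \<tau> \<in> W2" if "w \<in> W1" for w
      using W\<tau>[of w] that by (auto simp: W1_def W2_def \<tau>k)
  qed (auto simp: \<tau>\<tau> fun_eq_iff comp_def)
  also have "sum f W1 + (\<Sum>w\<in>W1. f (w \<circ> \<tau>)) = 0"
    using f0 by (subst sum.distrib[symmetric]) (auto simp: W1_def intro!: sum.neutral)
  finally have "sum f W = 0" .
  then show ?thesis
    by (simp add: f_def symmetrize_def W_def sum_subtractf sum_distrib_left \<tau>_def)
qed


section \<open>Raising entries of exponent lists\<close>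

fun incs :: "nat list \<Rightarrow> nat \<Rightarrow> nat list list" where
  "incs [] r = (if r = 0 then [[]] else [])"
| "incs (v # xs) r = map ((#) v) (incs xs r) @ (if r = 0 then [] else map ((#) (Suc v)) (incs xs (r - 1)))"

lemma sum_incs:
  fixes h :: "nat list \<Rightarrow> 'b::comm_monoid_add"
  shows "(\<Sum>S | S \<subseteq> {..<length xs} \<and> card S = r. h (map (\<lambda>i. xs ! i + (if i \<in> S then 1 else 0)) [0..<length xs])) =
    (\<Sum>ys\<leftarrow>incs xs r. h ys)"
proof (induction xs arbitrary: r h)
  case Nil
  have "{S :: nat set. S = {} \<and> card S = r} = (if r = 0 then {{}} else {})" by auto
  then show ?case by simp
next
  case (Cons v xs)
  let ?n = "length xs"
  define inc where "inc ys S = map (\<lambda>i. ys ! i + (if i \<in> S then 1 else 0)) [0..<length ys]"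
    for ys :: "nat list" and S :: "nat set"
  have mapSuc: "map g [0..<Suc n] = g 0 # map (\<lambda>i. g (Suc i)) [0..<n]" for g :: "nat \<Rightarrow> nat" and n
    by (simp add: upt_conv_Cons map_Suc_upt[symmetric] comp_def del: upt_Suc)
  have inc0: "inc (v # xs) (Suc ` S) = v # inc xs S" for S
    unfolding inc_def length_Cons mapSuc by (auto simp: image_iff)
  have inc1: "inc (v # xs) (insert 0 (Suc ` S)) = Suc v # inc xs S" for S
    unfolding inc_def length_Cons mapSuc by (auto simp: image_iff)
  let ?A = "\<lambda>n r. {S. S \<subseteq> {..<n} \<and> card S = r}"
  have fin: "finite (?A n r)" for n r :: nat by (rule finite_subset[of _ "Pow {..<n}"]) auto
  have fS: "finite S" if "S \<subseteq> {..<n}" for S and n :: nat using that finite_subset by blast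
  have dec: "S = (if 0 \<in> S then insert 0 (Suc ` {i. Suc i \<in> S}) else Suc ` {i. Suc i \<in> S})" for S
    by (auto simp: image_iff) (metis not0_implies_Suc)+
  have A: "?A (Suc ?n) r = (`) Suc ` ?A ?n r \<union> (if r = 0 then {} else (\<lambda>S. insert 0 (Suc ` S)) ` ?A ?n (r - 1))"
  proof (intro equalityI subsetI)
    fix S assume S: "S \<in> ?A (Suc ?n) r"
    let ?T = "{i. Suc i \<in> S}"
    have T: "?T \<subseteq> {..<?n}" using S by auto
    have c: "card (Suc ` ?T) = card ?T" by (simp add: card_image)
    show "S \<in> (`) Suc ` ?A ?n r \<union> (if r = 0 then {} else (\<lambda>S. insert 0 (Suc ` S)) ` ?A ?n (r - 1))"
    proof (cases "0 \<in> S")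
      case True
      then have e: "S = insert 0 (Suc ` ?T)" using dec[of S] by simp
      then have "card S = Suc (card ?T)" using fS[OF T] c by (metis card_insert_disjoint finite_imageI imageE nat.distinct(1))
      then have "?T \<in> ?A ?n (r - 1)" "r \<noteq> 0" using S T by auto
      then show ?thesis using e by auto
    next
      case False
      then have e: "S = Suc ` ?T" using dec[of S] by simp
      then have "?T \<in> ?A ?n r" using S T c by auto
      then show ?thesis using e by auto
    qed
  next
    fix S assume "S \<in> (`) Suc ` ?A ?n r \<union> (if r = 0 then {} else (\<lambda>S. insert 0 (Suc ` S)) ` ?A ?n (r - 1))"
    then consider T where "S = Suc ` T" "T \<subseteq> {..<?n}" "card T = r"
      | T where "S = insert 0 (Suc ` T)" "T \<subseteq> {..<?n}" "card T = r - 1" "r \<noteq> 0"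
      by (auto split: if_splits)
    then show "S \<in> ?A (Suc ?n) r"
    proof cases
      case (2 T)
      have "card (insert 0 (Suc ` T)) = Suc (card T)"
        using fS[OF 2(2)] by (subst card_insert_disjoint) (auto simp: card_image)
      then show ?thesis using 2 by auto
    qed (auto simp: card_image)
  qed
  have i0: "inj_on ((`) Suc) X" for X by (auto simp: inj_on_def inj_image_eq_iff)
  have i1: "inj_on (\<lambda>S. insert 0 (Suc ` S)) X" for X
  proof (rule inj_onI)
    fix S T assume "insert 0 (Suc ` S) = insert 0 (Suc ` T)"
    then have "Suc ` S = Suc ` T" by auto
    then show "S = T" by (simp add: inj_image_eq_iff)
  qed
  have "(\<Sum>S\<in>?A (Suc ?n) r. h (inc (v # xs) S)) =
      (\<Sum>S\<in>(`) Suc ` ?A ?n r. h (inc (v # xs) S)) +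
      (\<Sum>S\<in>(if r = 0 then {} else (\<lambda>S. insert 0 (Suc ` S)) ` ?A ?n (r - 1)). h (inc (v # xs) S))"
    unfolding A by (rule sum.union_disjoint) (auto simp: fin)
  also have "(\<Sum>S\<in>(`) Suc ` ?A ?n r. h (inc (v # xs) S)) = (\<Sum>S\<in>?A ?n r. h (v # inc xs S))"
    by (subst sum.reindex[OF i0]) (simp add: inc0)
  also have "(\<Sum>S\<in>(if r = 0 then {} else (\<lambda>S. insert 0 (Suc ` S)) ` ?A ?n (r - 1)). h (inc (v # xs) S)) =
      (if r = 0 then 0 else (\<Sum>S\<in>?A ?n (r - 1). h (Suc v # inc xs S)))"
    by (simp add: sum.reindex[OF i1] inc1)
  also have "(\<Sum>S\<in>?A ?n r. h (v # inc xs S)) = (\<Sum>ys\<leftarrow>incs xs r. h (v # ys))"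
    using Cons.IH[where r = r and h = "\<lambda>ys. h (v # ys)"] by (simp add: inc_def)
  also have "(\<Sum>S\<in>?A ?n (r - 1). h (Suc v # inc xs S)) = (\<Sum>ys\<leftarrow>incs xs (r - 1). h (Suc v # ys))"
    using Cons.IH[where r = "r - 1" and h = "\<lambda>ys. h (Suc v # ys)"] by (simp add: inc_def)
  finally show ?case by (simp add: inc_def comp_def)
qed

primrec blocks :: "(nat \<Rightarrow> nat) \<Rightarrow> nat \<Rightarrow> nat list" where
  "blocks m 0 = replicate (m 0) 0"
| "blocks m (Suc M) = replicate (m (Suc M)) (Suc M) @ blocks m M"

text \<open>In each block the raised entries stand first, so the list is weakly decreasing again and
  is of the form \<open>blocks\<close>.\<close>

primrec raised :: "(nat \<Rightarrow> nat) \<Rightarrow> (nat \<Rightarrow> nat) \<Rightarrow> nat \<Rightarrow> nat list" where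
  "raised m k 0 = replicate (k 0) 1 @ replicate (m 0 - k 0) 0"
| "raised m k (Suc M) = replicate (k (Suc M)) (Suc (Suc M)) @ replicate (m (Suc M) - k (Suc M)) (Suc M) @ raised m k M"

definition raises :: "(nat \<Rightarrow> nat) \<Rightarrow> nat \<Rightarrow> nat \<Rightarrow> (nat \<Rightarrow> nat) set" where
  "raises m M r = {k. (\<forall>v\<le>M. k v \<le> m v) \<and> (\<forall>v>M. k v = 0) \<and> (\<Sum>v\<le>M. k v) = r}"

lemma raised_cong: "(\<And>v. v \<le> M \<Longrightarrow> k v = k' v) \<Longrightarrow> raised m k M = raised m k' M"
  by (induction M) auto

lemma finite_raises [simp]: "finite (raises m M r)"
proof (rule finite_subset[OF _ finite_bounded_functions[of r "Suc M"]])
  show "raises m M r \<subseteq> {k. \<forall>i. k i \<le> r \<and> (Suc M \<le> i \<longrightarrow> k i = 0)}"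
  proof
    fix k assume k: "k \<in> raises m M r"
    have "k i \<le> r" for i
    proof (cases "i \<le> M")
      case True
      then have "k i \<le> (\<Sum>v\<le>M. k v)" by (intro member_le_sum) auto
      then show ?thesis using k by (simp add: raises_def)
    qed (use k in \<open>auto simp: raises_def\<close>)
    then show "k \<in> {k. \<forall>i. k i \<le> r \<and> (Suc M \<le> i \<longrightarrow> k i = 0)}" using k by (auto simp: raises_def)
  qed
qed

text \<open>The multiplicities of the values in the list \<open>raised m k M\<close>, see
  \<open>raised_blocks\<close>.\<close>

definition shifted :: "(nat \<Rightarrow> nat) \<Rightarrow> (nat \<Rightarrow> nat) \<Rightarrow> nat \<Rightarrow> nat" where
  "shifted m k v = m v - k v + (case v of 0 \<Rightarrow> 0 | Suc u \<Rightarrow> k u)"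

lemma raised_blocks_aux: "raised m k M = replicate (k M) (Suc M) @ blocks (shifted m k) M"
proof (induction M)
  case (Suc M)
  then show ?case by (simp add: shifted_def replicate_add)
qed (simp add: shifted_def)

lemma raised_blocks:
  assumes "m (Suc M) = 0" shows "raised m k M = blocks (shifted m k) (Suc M)"
  using assms by (simp add: raised_blocks_aux shifted_def)

lemma length_blocks: "length (blocks m M) = (\<Sum>v\<le>M. m v)"
  by (induction M) auto

text \<open>The coefficient of P_rho in e_r P_nu, with \<open>d\<close> and \<open>g\<close> the
  column lengths of rho and nu: \<open>d v - d (Suc v)\<close> is the multiplicity of the part v + 1
  in rho, and \<open>d v - g v\<close> is the number of strip cells in column \<open>v\<close>.
  Columns from \<open>fsize d\<close> on contribute factors 1.\<close>

definition pieri_coeff :: "'a::comm_ring_1 \<Rightarrow> (nat \<Rightarrow> nat) \<Rightarrow> (nat \<Rightarrow> nat) \<Rightarrow> 'a" where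
  "pieri_coeff q d g = (\<Prod>v<fsize d. gbinom q (d v - d (Suc v)) (d v - g v))"

text \<open>How often \<open>v\<close> occurs among the \<open>N\<close> parts, zeros included, of
  the partition with column lengths \<open>g\<close>.\<close>

definition multiplicities :: "nat \<Rightarrow> (nat \<Rightarrow> nat) \<Rightarrow> nat \<Rightarrow> nat" where
  "multiplicities N g v = (case v of 0 \<Rightarrow> N - g 0 | Suc u \<Rightarrow> g u - g (Suc u))"

lemma par_tail: "par g \<Longrightarrow> g M = 0 \<Longrightarrow> M \<le> i \<Longrightarrow> g i = 0"
  using par_antimono[of g M i] by simp

lemma sum_multiplicities:
  assumes "par g" "g M = 0" "g 0 \<le> N" shows "(\<Sum>v\<le>M. multiplicities N g v) = N"
proof -
  have "(\<Sum>v\<le>M. multiplicities N g v) = N - g M"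
  proof (induction M)
    case (Suc M)
    have "g (Suc M) \<le> g M" "g M \<le> g 0" using assms(1) par_antimono[OF assms(1), of 0 M] by (auto simp: par_def)
    then show ?case using Suc assms(3) by (simp add: multiplicities_def)
  qed (simp add: multiplicities_def)
  then show ?thesis using assms(2) by simp
qed

lemma prod_pieri_coeff:
  assumes "par d" "g \<in> remove_strip d r" "d M' = 0"
  shows "pieri_coeff q d g = (\<Prod>v<M'. gbinom q (d v - d (Suc v)) (d v - g v))"
proof -
  have "gbinom q (d v - d (Suc v)) (d v - g v) = 1" if "d v = 0" for v using that by simp
  then have "(\<Prod>v<K. gbinom q (d v - d (Suc v)) (d v - g v)) = (\<Prod>v | v < K \<and> d v \<noteq> 0. gbinom q (d v - d (Suc v)) (d v - g v))" for K
    by (intro prod.mono_neutral_right) auto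
  moreover have "{v. v < fsize d \<and> d v \<noteq> 0} = {v. v < M' \<and> d v \<noteq> 0}"
  proof -
    have "v < fsize d \<and> v < M'" if "d v \<noteq> 0" for v
      using that par_tail[OF assms(1) par_zero_from[OF assms(1)], of v] par_tail[OF assms(1,3), of v]
      by (meson not_le)
    then show ?thesis by auto
  qed
  ultimately show ?thesis by (simp add: pieri_coeff_def)
qed

section \<open>Pieri rule for the normalized symmetrizations\<close>

text \<open>What the Pieri rule uses of the fraction field: distinct nonzero variables, and a
  \<open>t\<close> for which the factors 1 - t^k with k \<ge> 1, and with them all normalizations
  \<open>qfact\<close>, are nonzero.\<close>

locale hl_field =
  fixes x :: "nat \<Rightarrow> 'a::field" and t :: 'a
  assumes inj_x: "inj x" and x_nonzero: "\<And>i. x i \<noteq> 0" and t_power: "\<And>k. t ^ Suc k \<noteq> 1"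
begin

lemma t_neq_1: "t \<noteq> 1" using t_power[of 0] by simp

lemma qfact_nonzero: "qfact t m \<noteq> 0"
proof -
  have "1 - t ^ k \<noteq> 0" if "k \<ge> 1" for k using t_power[of "k - 1"] that by (cases k) auto
  then show ?thesis using t_neq_1 by (auto simp: qfact_def)
qed

definition sym_list :: "nat list \<Rightarrow> 'a" where
  "sym_list xs = symmetrize t x (length xs) ((!) xs)"

definition elem :: "nat \<Rightarrow> nat \<Rightarrow> 'a" where
  "elem N r = (\<Sum>S | S \<subseteq> {..<N} \<and> card S = r. \<Prod>i\<in>S. x i)"

lemma symmetrize_list: "symmetrize t x N a = sym_list (map a [0..<N])"
  unfolding sym_list_def symmetrize_def by (intro sum.cong arg_cong2[where f = "(*)"] prod.cong) auto

lemma elem_sym_list: "elem (length xs) r * sym_list xs = (\<Sum>ys\<leftarrow>incs xs r. sym_list ys)"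
  using symmetrize_mult_e[of x "length xs" r t "(!) xs"] sum_incs[where xs = xs and r = r and h = sym_list]
  by (simp add: elem_def symmetrize_list map_nth)

lemma sym_list_swap: "sym_list (p @ v # Suc v # s) = t * sym_list (p @ Suc v # v # s)"
proof -
  let ?xs = "p @ v # Suc v # s" and ?k = "length p"
  have "sym_list ?xs = t * symmetrize t x (length ?xs) ((!) ?xs \<circ> Transposition.transpose ?k (Suc ?k))"
    unfolding sym_list_def by (rule symmetrize_swap) (auto simp: nth_append inj_on_subset[OF inj_x])
  also have "map ((!) ?xs \<circ> Transposition.transpose ?k (Suc ?k)) [0..<length ?xs] = p @ Suc v # v # s"
  proof (rule nth_equalityI)
    have nth: "(p @ a # b # s) ! i = (if i < ?k then p ! i else if i = ?k then a else if i = Suc ?k then b else s ! (i - ?k - 2))"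
      for a b i by (auto simp: nth_append nth_Cons')
    show "map ((!) ?xs \<circ> Transposition.transpose ?k (Suc ?k)) [0..<length ?xs] ! i = (p @ Suc v # v # s) ! i"
      if "i < length (map ((!) ?xs \<circ> Transposition.transpose ?k (Suc ?k)) [0..<length ?xs])" for i
      using that by (simp add: nth Transposition.transpose_def del: upt_Suc)
  qed simp
  then have "symmetrize t x (length ?xs) ((!) ?xs \<circ> Transposition.transpose ?k (Suc ?k)) = sym_list (p @ Suc v # v # s)"
    unfolding symmetrize_list by (rule arg_cong)
  finally show ?thesis .
qed

lemma sym_list_move: "sym_list (p @ v # replicate k (Suc v) @ s) = t ^ k * sym_list (p @ replicate k (Suc v) @ v # s)"
proof (induction k arbitrary: p)
  case (Suc k)
  show ?case using sym_list_swap[of p v "replicate k (Suc v) @ s"] Suc[of "p @ [Suc v]"] by simp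
qed simp

text \<open>The prefix \<open>p\<close> collects the entries already treated, so that blocks can be
  processed one after the other.\<close>

definition inc_sum :: "nat list \<Rightarrow> nat list \<Rightarrow> nat \<Rightarrow> 'a" where
  "inc_sum p xs r = (\<Sum>ys\<leftarrow>incs xs r. sym_list (p @ ys))"

lemma inc_sum_simps:
  "inc_sum p [] r = (if r = 0 then sym_list p else 0)"
  "inc_sum p (v # xs) 0 = inc_sum (p @ [v]) xs 0"
  "inc_sum p (v # xs) (Suc r) = inc_sum (p @ [v]) xs (Suc r) + inc_sum (p @ [Suc v]) xs r"
  by (simp_all add: inc_sum_def comp_def)

lemma inc_sum_move:
  "inc_sum (p @ v # replicate k (Suc v) @ q) s r = t ^ k * inc_sum (p @ replicate k (Suc v) @ v # q) s r"
  unfolding inc_sum_def using sym_list_move[of p v k] by (simp add: sum_list_const_mult)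

text \<open>The first entry of the block is either raised and stays in front, or it keeps the value
  \<open>v\<close> and has to move behind the \<open>k\<close> raised entries that follow, at the
  cost of t^k by \<open>inc_sum_move\<close>. This is the q-Pascal recursion.\<close>

lemma inc_sum_block:
  "inc_sum p (replicate m v @ s) r =
    (\<Sum>k\<le>r. gbinom t m k * inc_sum (p @ replicate k (Suc v) @ replicate (m - k) v) s (r - k))"
proof (induction m arbitrary: p r)
  case 0
  have "(\<Sum>k\<le>r. gbinom t 0 k * inc_sum (p @ replicate k (Suc v)) s (r - k)) =
      (\<Sum>k\<in>{0}. gbinom t 0 k * inc_sum (p @ replicate k (Suc v)) s (r - k))"
    by (intro sum.mono_neutral_right) (auto simp: gbinom_eq_0)
  then show ?case by simp
next
  case (Suc m)
  show ?case
  proof (cases r)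
    case 0
    then show ?thesis using Suc[of "p @ [v]" 0] by (simp add: inc_sum_simps)
  next
    case r: (Suc r')
    let ?T = "\<lambda>k. inc_sum (p @ replicate k (Suc v) @ replicate (Suc m - k) v) s (r - k)"
    have "inc_sum p (replicate (Suc m) v @ s) r =
        inc_sum (p @ [v]) (replicate m v @ s) r + inc_sum (p @ [Suc v]) (replicate m v @ s) r'"
      by (simp add: r inc_sum_simps)
    also have "inc_sum (p @ [v]) (replicate m v @ s) r = (\<Sum>k\<le>r. t ^ k * gbinom t m k * ?T k)"
      unfolding Suc
    proof (intro sum.cong refl)
      fix k
      show "gbinom t m k * inc_sum ((p @ [v]) @ replicate k (Suc v) @ replicate (m - k) v) s (r - k) =
          t ^ k * gbinom t m k * ?T k"
      proof (cases "k \<le> m")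
        case True
        then show ?thesis using inc_sum_move[of p v k "replicate (m - k) v" s "r - k"]
          by (simp add: Suc_diff_le)
      qed (simp add: gbinom_eq_0)
    qed
    also have "inc_sum (p @ [Suc v]) (replicate m v @ s) r' = (\<Sum>k\<le>r'. gbinom t m k * ?T (Suc k))"
      unfolding Suc by (simp add: r)
    also have "(\<Sum>k\<le>r. t ^ k * gbinom t m k * ?T k) =
        ?T 0 + (\<Sum>k\<le>r'. t ^ Suc k * gbinom t m (Suc k) * ?T (Suc k))"
      unfolding r by (subst sum.atMost_Suc_shift) simp
    finally have "inc_sum p (replicate (Suc m) v @ s) r =
        ?T 0 + (\<Sum>k\<le>r'. gbinom t (Suc m) (Suc k) * ?T (Suc k))"
      by (simp add: sum.distrib[symmetric] algebra_simps)
    then show ?thesis unfolding r by (subst sum.atMost_Suc_shift) simp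
  qed
qed

lemma inc_sum_blocks:
  "inc_sum p (blocks m M) r = (\<Sum>k\<in>raises m M r. (\<Prod>v\<le>M. gbinom t (m v) (k v)) * sym_list (p @ raised m k M))"
proof (induction M arbitrary: p r)
  case 0
  have "inc_sum p (blocks m 0) r = (\<Sum>k\<le>r. gbinom t (m 0) k * inc_sum (p @ replicate k 1 @ replicate (m 0 - k) 0) [] (r - k))"
    using inc_sum_block[of p "m 0" 0 "[]" r] by simp
  also have "\<dots> = (\<Sum>k\<in>{r}. gbinom t (m 0) k * inc_sum (p @ replicate k 1 @ replicate (m 0 - k) 0) [] (r - k))"
    by (intro sum.mono_neutral_right) (auto simp: inc_sum_simps)
  finally have 1: "inc_sum p (blocks m 0) r = gbinom t (m 0) r * sym_list (p @ replicate r 1 @ replicate (m 0 - r) 0)"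
    by (simp add: inc_sum_simps)
  have "raises m 0 r = (if r \<le> m 0 then {\<lambda>v. if v = 0 then r else 0} else {})"
    by (auto simp: raises_def fun_eq_iff)
  then show ?case unfolding 1 by (cases "r \<le> m 0") (simp_all add: gbinom_eq_0)
next
  case (Suc M)
  define c where "c k M = (\<Prod>v\<le>M. gbinom t (m v) (k v))" for k M
  define g where "g k = c k (Suc M) * sym_list (p @ raised m k (Suc M))" for k
  have "inc_sum p (blocks m (Suc M)) r =
      (\<Sum>j\<le>r. \<Sum>k\<in>raises m M (r - j). gbinom t (m (Suc M)) j * (c k M *
        sym_list (p @ replicate j (Suc (Suc M)) @ replicate (m (Suc M) - j) (Suc M) @ raised m k M)))"
    using inc_sum_block[of p "m (Suc M)" "Suc M" "blocks m M" r]
    by (simp add: Suc.IH sum_distrib_left c_def)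
  also have "\<dots> = (\<Sum>j\<le>r. \<Sum>k\<in>raises m M (r - j). g (k(Suc M := j)))"
  proof (intro sum.cong refl)
    fix j k
    have "c (k(Suc M := j)) (Suc M) = c k M * gbinom t (m (Suc M)) j"
      by (simp add: c_def)
    moreover have "raised m (k(Suc M := j)) M = raised m k M" by (rule raised_cong) simp
    ultimately show "gbinom t (m (Suc M)) j * (c k M *
        sym_list (p @ replicate j (Suc (Suc M)) @ replicate (m (Suc M) - j) (Suc M) @ raised m k M)) = g (k(Suc M := j))"
      by (simp add: g_def)
  qed
  also have "\<dots> = (\<Sum>jk\<in>(SIGMA j:{..r}. raises m M (r - j)). g ((snd jk)(Suc M := fst jk)))"
    by (subst sum.Sigma) (auto simp: case_prod_unfold)
  also have "\<dots> = (\<Sum>jk\<in>(SIGMA j:{..min r (m (Suc M))}. raises m M (r - j)). g ((snd jk)(Suc M := fst jk)))"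
    by (intro sum.mono_neutral_right finite_SigmaI) (auto simp: g_def c_def gbinom_eq_0)
  also have "\<dots> = (\<Sum>k\<in>raises m (Suc M) r. g k)"
    by (rule sum.reindex_bij_witness[of _ "\<lambda>k. (k (Suc M), k(Suc M := 0))" "\<lambda>jk. (snd jk)(Suc M := fst jk)"])
      (auto simp: raises_def fun_eq_iff)
  finally show ?case by (simp add: g_def c_def)
qed

text \<open>The value of P_lam in as many variables as there are parts, where lam is given by the
  multiplicities \<open>m\<close> of its parts, all at most \<open>M\<close>.\<close>

definition hl_norm :: "(nat \<Rightarrow> nat) \<Rightarrow> nat \<Rightarrow> 'a" where
  "hl_norm m M = sym_list (blocks m M) / (\<Prod>v\<le>M. qfact t (m v))"

text \<open>Normalization turns Gaussian binomials over the old multiplicities into ones over the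
  new: both products of \<open>qfact\<close> contain the factors for \<open>k v\<close> and for
  \<open>m v - k v\<close>, the latter merely with the index shifted by one.\<close>

lemma elem_hl_norm:
  assumes "m (Suc M) = 0"
  shows "elem (\<Sum>v\<le>M. m v) r * hl_norm m M =
    (\<Sum>k\<in>raises m M r. (\<Prod>v\<le>M. gbinom t (shifted m k (Suc v)) (k v)) * hl_norm (shifted m k) (Suc M))"
proof -
  have "elem (\<Sum>v\<le>M. m v) r * sym_list (blocks m M) = inc_sum [] (blocks m M) r"
    using elem_sym_list[of "blocks m M" r] by (simp add: length_blocks inc_sum_def)
  also have "\<dots> = (\<Sum>k\<in>raises m M r. (\<Prod>v\<le>M. gbinom t (m v) (k v)) * sym_list (blocks (shifted m k) (Suc M)))"
    unfolding inc_sum_blocks by (simp add: raised_blocks assms del: blocks.simps)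
  finally have "elem (\<Sum>v\<le>M. m v) r * hl_norm m M =
      (\<Sum>k\<in>raises m M r. (\<Prod>v\<le>M. gbinom t (m v) (k v)) * sym_list (blocks (shifted m k) (Suc M)) / (\<Prod>v\<le>M. qfact t (m v)))"
    by (simp add: hl_norm_def sum_divide_distrib del: blocks.simps)
  also have "\<dots> = (\<Sum>k\<in>raises m M r. (\<Prod>v\<le>M. gbinom t (shifted m k (Suc v)) (k v)) * hl_norm (shifted m k) (Suc M))"
  proof (intro sum.cong refl)
    fix k assume k: "k \<in> raises m M r"
    let ?q = "qfact t"
    have le: "k v \<le> m v" if "v \<le> M" for v using k that by (simp add: raises_def)
    have kz: "k (Suc M) = 0" using k by (simp add: raises_def)
    have q1: "gbinom t (m v) (k v) * (?q (k v) * ?q (m v - k v)) = ?q (m v)" if "v \<le> M" for v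
      using gbinom_qfact[OF t_neq_1 le[OF that]] by (simp add: mult.assoc)
    have q2: "gbinom t (shifted m k (Suc v)) (k v) * (?q (k v) * ?q (m (Suc v) - k (Suc v))) = ?q (shifted m k (Suc v))" for v
      using gbinom_qfact[OF t_neq_1, of "k v" "shifted m k (Suc v)"] by (simp add: mult.assoc shifted_def)
    define A where "A = (\<Prod>v\<le>M. gbinom t (m v) (k v))"
    define B where "B = (\<Prod>v\<le>M. gbinom t (shifted m k (Suc v)) (k v))"
    define Q where "Q = (\<Prod>v\<le>M. ?q (k v))"
    define Z where "Z = (\<Prod>v\<le>M. ?q (m v - k v))"
    define Z' where "Z' = (\<Prod>v\<le>M. ?q (m (Suc v) - k (Suc v)))"
    have "Z * ?q (m (Suc M) - k (Suc M)) = (\<Prod>v\<le>Suc M. ?q (m v - k v))" by (simp add: Z_def)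
    also have "\<dots> = ?q (m 0 - k 0) * Z'" unfolding Z'_def by (subst prod.atMost_Suc_shift) simp
    finally have ZZ: "Z = ?q (m 0 - k 0) * Z'" using assms by simp
    have e1: "(\<Prod>v\<le>M. ?q (m v)) = A * (Q * Z)"
      unfolding A_def Q_def Z_def prod.distrib[symmetric] by (intro prod.cong refl) (use q1 in auto)
    have e2: "(\<Prod>v\<le>M. ?q (shifted m k (Suc v))) = B * (Q * Z')"
      unfolding B_def Q_def Z'_def prod.distrib[symmetric] using q2 by (intro prod.cong refl) auto
    have e3: "(\<Prod>v\<le>Suc M. ?q (shifted m k v)) = ?q (m 0 - k 0) * (B * (Q * Z'))"
      unfolding e2[symmetric] by (subst prod.atMost_Suc_shift) (simp add: shifted_def)
    have nz: "A * (Q * Z) \<noteq> 0" "?q (m 0 - k 0) * (B * (Q * Z')) \<noteq> 0"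
      unfolding e1[symmetric] e3[symmetric] by (auto simp: qfact_nonzero)
    show "(\<Prod>v\<le>M. gbinom t (m v) (k v)) * sym_list (blocks (shifted m k) (Suc M)) / (\<Prod>v\<le>M. ?q (m v)) =
      (\<Prod>v\<le>M. gbinom t (shifted m k (Suc v)) (k v)) * hl_norm (shifted m k) (Suc M)"
      unfolding hl_norm_def e1 e3 A_def[symmetric] B_def[symmetric] ZZ using nz by (simp add: ZZ del: blocks.simps)
  qed
  finally show ?thesis .
qed

definition hl_value :: "nat \<Rightarrow> (nat \<Rightarrow> nat) \<Rightarrow> 'a" where
  "hl_value N g = hl_norm (multiplicities N g) (fsize g)"

lemma hl_norm_Suc: "m (Suc M) = 0 \<Longrightarrow> hl_norm m (Suc M) = hl_norm m M"
  by (simp add: hl_norm_def)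

lemma hl_value_eq:
  assumes "par g" "g M = 0" shows "hl_value N g = hl_norm (multiplicities N g) M"
proof -
  have z: "multiplicities N g (Suc K) = 0" if "g K = 0" for K
    using that by (simp add: multiplicities_def)
  have up: "hl_norm (multiplicities N g) K = hl_norm (multiplicities N g) L" if "g L = 0" "L \<le> K" for K L
    using that(2)
  proof (induction K rule: dec_induct)
    case (step K)
    then show ?case using hl_norm_Suc[of "multiplicities N g" K, OF z[of K]] par_tail[OF assms(1) that(1)] by simp
  qed simp
  show ?thesis unfolding hl_value_def
    using up[of M "fsize g"] up[of "fsize g" M] assms(2) par_zero_from[OF assms(1)] by (metis nat_le_linear)
qed

text \<open>Raising \<open>k v\<close> of the parts equal to \<open>v\<close> adds
  \<open>k v\<close> cells to column \<open>v\<close>. The choices of raised parts are therefore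
  exactly the vertical strips that leave at most \<open>N\<close> rows.\<close>

theorem elem_hl_value:
  assumes g: "par g" and N: "g 0 \<le> N"
  shows "elem N r * hl_value N g =
    (\<Sum>d | g \<in> remove_strip d r \<and> d 0 \<le> N. pieri_coeff t d g * hl_value N d)"
proof -
  define M where "M = fsize g"
  have gM: "g M = 0" using par_zero_from[OF g] by (simp add: M_def)
  let ?m = "multiplicities N g"
  have mM: "?m (Suc M) = 0" using gM by (simp add: multiplicities_def)
  have D: "k \<in> raises ?m M r \<longleftrightarrow> g \<in> remove_strip (\<lambda>v. g v + k v) r \<and> g 0 + k 0 \<le> N" for k
  proof -
    have tail: "(\<forall>i\<ge>Suc M. g i + k i = 0) \<longleftrightarrow> (\<forall>v>M. k v = 0)"
      using par_tail[OF g gM] by (auto simp: Suc_le_eq)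
    have sz: "fsize (\<lambda>v. g v + k v) = fsize g + (\<Sum>v\<le>M. k v)" if "\<forall>v>M. k v = 0"
    proof -
      have "fsize (\<lambda>v. g v + k v) = (\<Sum>v<Suc M. g v + k v)" using that tail by (intro fsize_eq) blast
      moreover have "fsize g = (\<Sum>v<Suc M. g v)" using par_tail[OF g gM] by (intro fsize_eq) auto
      ultimately show ?thesis by (simp only: sum.distrib lessThan_Suc_atMost)
    qed
    have zero_iff: "?thesis" if z: "\<forall>v>M. k v = 0"
    proof -
      have "(\<forall>v\<le>M. k v \<le> ?m v) \<longleftrightarrow> (\<forall>v. k v \<le> ?m v)" using z by (metis le0 not_le)
      also have "\<dots> \<longleftrightarrow> k 0 \<le> N - g 0 \<and> (\<forall>u. k (Suc u) \<le> g u - g (Suc u))"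
        by (auto simp: multiplicities_def split: nat.splits)
      also have "\<dots> \<longleftrightarrow> g 0 + k 0 \<le> N \<and> hstrip (\<lambda>v. g v + k v) g"
        using N g unfolding par_def hstrip_def by (auto simp: le_diff_conv2 add.commute)
      finally have 1: "(\<forall>v\<le>M. k v \<le> ?m v) \<longleftrightarrow> g 0 + k 0 \<le> N \<and> hstrip (\<lambda>v. g v + k v) g" .
      have "fin_supp (\<lambda>v. g v + k v)" using tail z unfolding fin_supp_def by blast
      then show ?thesis using 1 z sz[OF z] by (auto simp: raises_def remove_strip_def)
    qed
    moreover have ?thesis if nz: "\<not> (\<forall>v>M. k v = 0)"
    proof -
      have "\<not> hstrip (\<lambda>v. g v + k v) g"
      proof
        assume h: "hstrip (\<lambda>v. g v + k v) g"
        obtain v where v: "v > M" "k v \<noteq> 0" using nz by auto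
        then obtain u where u: "v = Suc u" "M \<le> u" by (cases v) auto
        have "g (Suc u) + k (Suc u) \<le> g u" using h by (simp add: hstrip_def)
        then show False using par_tail[OF g gM u(2)] v u by simp
      qed
      then show ?thesis using nz by (auto simp: raises_def remove_strip_def)
    qed
    ultimately show ?thesis by blast
  qed
  have "elem N r * hl_value N g =
      (\<Sum>k\<in>raises ?m M r. (\<Prod>v\<le>M. gbinom t (shifted ?m k (Suc v)) (k v)) * hl_norm (shifted ?m k) (Suc M))"
    using elem_hl_norm[of ?m M r, OF mM] sum_multiplicities[OF g gM N] hl_value_eq[OF g gM] by simp
  also have "\<dots> = (\<Sum>d | g \<in> remove_strip d r \<and> d 0 \<le> N. pieri_coeff t d g * hl_value N d)"
  proof (rule sum.reindex_bij_witness[of _ "\<lambda>d v. d v - g v" "\<lambda>k v. g v + k v"])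
    fix k assume k: "k \<in> raises ?m M r"
    let ?d = "\<lambda>v. g v + k v"
    have d: "g \<in> remove_strip ?d r" "?d 0 \<le> N" using D k by auto
    then show "?d \<in> {d. g \<in> remove_strip d r \<and> d 0 \<le> N}" by simp
    have pd: "par ?d" using d(1) remove_strip_par by blast
    have dM: "?d (Suc M) = 0" using par_tail[OF g gM, of "Suc M"] k by (simp add: raises_def)
    have sh: "shifted ?m k = multiplicities N ?d"
    proof
      fix v
      show "shifted ?m k v = multiplicities N ?d v"
      proof (cases v)
        case (Suc u)
        have "g (Suc u) + k (Suc u) \<le> g u" using remove_stripD(1)[OF d(1)] by (simp add: hstrip_def)
        then show ?thesis by (simp add: Suc shifted_def multiplicities_def)
      qed (simp add: shifted_def multiplicities_def)
    qed
    have "(\<Prod>v\<le>M. gbinom t (shifted ?m k (Suc v)) (k v)) = pieri_coeff t ?d g"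
      unfolding prod_pieri_coeff[OF pd d(1) dM] sh lessThan_Suc_atMost by (simp add: multiplicities_def)
    moreover have "hl_norm (shifted ?m k) (Suc M) = hl_value N ?d"
      unfolding sh using hl_value_eq[OF pd dM] by simp
    ultimately show "pieri_coeff t ?d g * hl_value N ?d =
        (\<Prod>v\<le>M. gbinom t (shifted ?m k (Suc v)) (k v)) * hl_norm (shifted ?m k) (Suc M)" by simp
    show "(\<lambda>v. ?d v - g v) = k" by simp
  next
    fix d assume "d \<in> {d. g \<in> remove_strip d r \<and> d 0 \<le> N}"
    then have d: "g \<in> remove_strip d r" "d 0 \<le> N" by auto
    have "g v \<le> d v" for v using remove_stripD(1)[OF d(1)] by (simp add: hstrip_def)
    then show e: "(\<lambda>v. g v + (d v - g v)) = d" by simp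
    show "(\<lambda>v. d v - g v) \<in> raises ?m M r" unfolding D using d e fun_cong[OF e, of 0] by simp
  qed
  finally show ?thesis .
qed

lemma hl_value_0: "hl_value N (\<lambda>_. 0) = 1"
proof -
  have "hl_value N (\<lambda>_. 0) = hl_norm (multiplicities N (\<lambda>_. 0)) 0"
    by (rule hl_value_eq) (auto simp: par_def fin_supp_def)
  also have "\<dots> = symmetrize t x N (\<lambda>_. 0) / qfact t N"
    by (simp add: hl_norm_def multiplicities_def symmetrize_list map_replicate_const)
  also have "\<dots> = 1"
    using symmetrize_0[of x N t] inj_on_subset[OF inj_x] x_nonzero t_neq_1 qfact_nonzero by simp
  finally show ?thesis .
qed

end

subsection \<open>Conjugate partitions\<close>

definition conj_par :: "(nat \<Rightarrow> nat) \<Rightarrow> nat \<Rightarrow> nat" where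
  "conj_par g j = card {i. j < g i}"

lemma less_conj_par: assumes "par g" shows "i < conj_par g j \<longleftrightarrow> j < g i"
proof -
  have "{i. j < g i} \<subseteq> {..<fsize g}"
    using par_tail[OF assms par_zero_from[OF assms]] by (auto simp: not_le[symmetric])
  then have "finite {i. j < g i}" by (rule finite_subset) simp
  moreover have "i' \<in> {i. j < g i}" if "i \<in> {i. j < g i}" "i' < i" for i i'
    using par_antimono[OF assms, of i' i] that by auto
  ultimately have "{i. j < g i} = {..<card {i. j < g i}}" by (rule downward_closed_card) blast
  then show ?thesis unfolding conj_par_def by blast
qed

lemma par_conj: assumes "par g" shows "par (conj_par g)"
proof -
  have "conj_par g (Suc j) \<le> conj_par g j" for j
    using less_conj_par[OF assms, of _ "Suc j"] less_conj_par[OF assms, of _ j]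
    by (meson Suc_lessD leI less_irrefl order_less_le_trans)
  moreover have "conj_par g j = 0" if "g 0 \<le> j" for j
    using less_conj_par[OF assms, of 0 j] that by auto
  ultimately show ?thesis by (auto simp: par_def fin_supp_def)
qed

lemma conj_conj: assumes "par g" shows "conj_par (conj_par g) = g"
proof
  fix i
  have "j < conj_par (conj_par g) i \<longleftrightarrow> j < g i" for j
    using less_conj_par[OF assms] less_conj_par[OF par_conj[OF assms]] by simp
  then show "conj_par (conj_par g) i = g i" by (meson linorder_neqE_nat less_irrefl)
qed

lemma fsize_conj: assumes "par g" shows "fsize (conj_par g) = fsize g"
proof -
  have "cells (conj_par g) = prod.swap ` cells g"
    using less_conj_par[OF assms] by (auto simp: cells_def image_iff)
  then have "card (cells (conj_par g)) = card (cells g)" by (simp add: card_image)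
  then show ?thesis using card_cells(2) assms par_conj[OF assms] by (simp add: par_def)
qed

definition columns :: "nat list \<Rightarrow> nat \<Rightarrow> nat" where
  "columns lam = conj_par (part lam)"

lemma columns_par:
  assumes "lam \<in> partitions n" shows "par (columns lam)" "fsize (columns lam) = n"
  using par_conj fsize_conj par_part[OF assms] assms by (auto simp: columns_def fsize_part partitions_def)

lemma bij_columns: "bij_betw columns (partitions n) {g. par g \<and> fsize g = n}"
proof -
  have "bij_betw conj_par {g. par g \<and> fsize g = n} {g. par g \<and> fsize g = n}"
    by (rule bij_betw_byWitness[where f' = conj_par]) (auto simp: conj_conj par_conj fsize_conj)
  then show ?thesis unfolding columns_def[abs_def] using bij_betw_trans[OF bij_part] by (auto simp: comp_def)
qed

lemma columns_inject: "lam \<in> partitions n \<Longrightarrow> mu \<in> partitions n \<Longrightarrow> columns lam = columns mu \<Longrightarrow> lam = mu"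
  using bij_columns[of n] by (auto simp: bij_betw_def inj_on_def)

lemma columns_0: assumes "lam \<in> partitions n" shows "columns lam 0 = length lam"
proof -
  have "0 < part lam i \<longleftrightarrow> i < length lam" for i
  proof (cases "i < length lam")
    case True
    have "0 \<notin> set lam" using assms by (simp add: partitions_def)
    then have "lam ! i \<noteq> 0" using nth_mem[OF True] by metis
    then show ?thesis using True by (simp add: part_def)
  qed (simp add: part_def)
  then have "{i. 0 < part lam i} = {..<length lam}" by auto
  then show ?thesis by (simp add: columns_def conj_par_def)
qed

lemma columns_strip:
  assumes "lam \<in> partitions n" shows "columns (strip_col lam) v = columns lam (Suc v)"
proof -
  have p: "par (part lam)" "par (part (strip_col lam))"
    using par_part assms strip_col_partition(1) by blast+
  have "part (strip_col lam) i = 0" if "length lam \<le> i" for i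
    using strip_col_partition(2)[OF assms] that by (simp add: part_def)
  then have "v < part (strip_col lam) i \<longleftrightarrow> Suc v < part lam i" for i
    unfolding part_strip_col[OF assms] by (cases "i < length lam") (auto simp: raise_rows_def)
  then show ?thesis by (simp add: columns_def conj_par_def)
qed

subsection \<open>Hall-Littlewood functions\<close>

abbreviation embed :: "hl_poly \<Rightarrow> hl_poly fract" where "embed a \<equiv> Fract a 1"

lemma embed_simps: "embed (a * b) = embed a * embed b" "embed (a + b) = embed a + embed b"
  "embed (a - b) = embed a - embed b" "embed 0 = 0" "embed 1 = 1"
  by (simp_all add: Zero_fract_def One_fract_def)

lemma embed_sum: "embed (\<Sum>i\<in>A. f i) = (\<Sum>i\<in>A. embed (f i))"
  by (induction A rule: infinite_finite_induct) (auto simp: embed_simps)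

lemma embed_prod: "embed (\<Prod>i\<in>A. f i) = (\<Prod>i\<in>A. embed (f i))"
  by (induction A rule: infinite_finite_induct) (auto simp: embed_simps)

lemma embed_eq_iff: "embed a = embed b \<longleftrightarrow> a = b"
  by (simp add: eq_fract)

abbreviation const :: "int poly \<Rightarrow> hl_poly fract" where
  "const c \<equiv> embed (Poly_Mapping.single 0 c)"

lemma const_simps: "const (a * b) = const a * const b" "const (a + b) = const a + const b"
  "const 0 = 0" "const 1 = 1"
proof -
  show "const (a * b) = const a * const b" by (simp add: mult_single flip: embed_simps(1))
  show "const (a + b) = const a + const b" by (simp add: single_add flip: embed_simps(2))
  show "const 0 = 0" "const 1 = 1" by (simp_all add: embed_simps(4,5))
qed

lemma const_power: "const (a ^ k) = const a ^ k"
  by (induction k) (auto simp: const_simps embed_simps(5))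

lemma const_gbinom: "const (gbinom [:0, 1:] m k) = gbinom hl_t m k"
  by (induction "[:0, 1:] :: int poly" m k rule: gbinom.induct)
    (auto simp: const_simps const_power hl_t_def embed_simps(4,5) simp del: power_Suc)

lemma const_pieri_coeff: "const (pieri_coeff [:0, 1:] d g) = pieri_coeff hl_t d g"
proof -
  have "const (\<Prod>v<n. gbinom [:0, 1:] (d v - d (Suc v)) (d v - g v)) = (\<Prod>v<n. gbinom hl_t (d v - d (Suc v)) (d v - g v))" for n
    by (induction n) (auto simp: const_simps const_gbinom embed_simps(5))
  then show ?thesis by (simp add: pieri_coeff_def)
qed

interpretation hl: hl_field hl_x hl_t
proof
  show "inj hl_x"
  proof (rule injI)
    fix i j assume "hl_x i = hl_x j"
    then have "Poly_Mapping.single (Poly_Mapping.single i (1::nat)) (1 :: int poly) = Poly_Mapping.single (Poly_Mapping.single j 1) 1"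
      by (simp add: hl_x_def embed_eq_iff)
    then have "Poly_Mapping.keys (Poly_Mapping.single (Poly_Mapping.single i (1::nat)) (1 :: int poly)) =
        Poly_Mapping.keys (Poly_Mapping.single (Poly_Mapping.single j (1::nat)) (1 :: int poly))" by simp
    then have "Poly_Mapping.single i (1::nat) = Poly_Mapping.single j 1" by simp
    then have "Poly_Mapping.keys (Poly_Mapping.single i (1::nat)) = Poly_Mapping.keys (Poly_Mapping.single j (1::nat))" by simp
    then show "i = j" by simp
  qed
  show "hl_x i \<noteq> 0" for i
  proof
    assume "hl_x i = 0"
    then have "Poly_Mapping.single (Poly_Mapping.single i (1::nat)) (1 :: int poly) = 0"
      unfolding hl_x_def using embed_eq_iff[of _ 0] embed_simps(4) by simp
    then show False by (metis lookup_single_eq lookup_zero one_neq_zero)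
  qed
  show "hl_t ^ Suc k \<noteq> 1" for k
  proof
    assume "hl_t ^ Suc k = 1"
    then have "const ([:0, 1:] ^ Suc k) = const 1" by (simp only: const_power const_simps hl_t_def)
    then have "[:0, 1:] ^ Suc k = (1 :: int poly)" by (metis embed_eq_iff lookup_single_eq)
    then have "degree ([:0, 1 :: int:] ^ Suc k) = 0" by simp
    then show False by (subst (asm) degree_power_eq) auto
  qed
qed

lemma sorted_rev_blocks: "sorted (rev (blocks m M)) \<and> set (blocks m M) \<subseteq> {..M}"
  by (induction M) (auto simp: sorted_append sorted_replicate)

lemma count_blocks: "count (mset (blocks m M)) v = (if v \<le> M then m v else 0)"
  by (induction M) (auto simp: le_Suc_eq)

lemma card_part_multiplicities:
  assumes "lam \<in> partitions n" "length lam \<le> N"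
  shows "card {r. r < N \<and> part lam r = v} = multiplicities N (columns lam) v"
proof -
  have p: "par (part lam)" using assms by (rule_tac par_part)
  have lt: "r < columns lam j \<longleftrightarrow> j < part lam r" for r j
    unfolding columns_def by (rule less_conj_par[OF p])
  show ?thesis
  proof (cases v)
    case 0
    have "{r. r < N \<and> part lam r = 0} = {..<N} - {..<columns lam 0}"
    proof -
      have "part lam r = 0 \<longleftrightarrow> \<not> r < columns lam 0" for r by (simp add: lt del: not_less)
      then show ?thesis by auto
    qed
    then show ?thesis using assms(2) columns_0[OF assms(1)] by (simp add: 0 multiplicities_def card_Diff_subset)
  next
    case (Suc u)
    have c: "columns lam u \<le> N" using par_antimono[OF columns_par(1)[OF assms(1)], of 0 u] assms(2) columns_0[OF assms(1)] by simp
    have "{r. r < N \<and> part lam r = v} = {..<columns lam u} - {..<columns lam (Suc u)}"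
    proof -
      have "part lam r = v \<longleftrightarrow> r < columns lam u \<and> \<not> r < columns lam (Suc u)" for r
        by (simp only: lt Suc) auto
      then have "{r. r < N \<and> part lam r = v} = {r. r < N \<and> r < columns lam u \<and> \<not> r < columns lam (Suc u)}"
        by (simp only:)
      also have "\<dots> = {..<columns lam u} - {..<columns lam (Suc u)}" using c by auto
      finally show ?thesis .
    qed
    moreover have "columns lam (Suc u) \<le> columns lam u" using columns_par(1)[OF assms(1)] by (simp add: par_def)
    ultimately show ?thesis by (simp add: Suc multiplicities_def card_Diff_subset)
  qed
qed

text \<open>The parts padded with zeros form the sorted list \<open>blocks\<close>, and values up to
  \<open>n\<close> that do not occur contribute a factor 1 to the normalization.\<close>

lemma hall_littlewood_vars_value:
  assumes lam: "lam \<in> partitions n" and len: "length lam \<le> N"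
  shows "hall_littlewood_vars N lam = hl.hl_value N (columns lam)"
proof -
  let ?m = "multiplicities N (columns lam)"
  note card = card_part_multiplicities[OF lam len]
  have bound: "part lam r \<le> n" for r using par_le_fsize[OF par_part[OF lam], of r] lam by (simp add: fsize_part partitions_def)
  have sorted: "sorted (rev (map (part lam) [0..<N]))"
    unfolding sorted_wrt_rev sorted_wrt_map
    by (auto simp: sorted_wrt_iff_nth_less intro: par_antimono[OF par_part[OF lam]])
  have "mset (map (part lam) [0..<N]) = mset (blocks ?m n)"
  proof (rule multiset_eqI)
    fix v
    have "count (mset (map (part lam) [0..<N])) v = card {r. r < N \<and> part lam r = v}" for N
    proof (induction N)
      case (Suc N)
      have "{r. r < Suc N \<and> part lam r = v} =
          (if part lam N = v then insert N {r. r < N \<and> part lam r = v} else {r. r < N \<and> part lam r = v})"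
        by (auto simp: less_Suc_eq)
      then show ?case using Suc by simp
    qed simp
    also have "card {r. r < N \<and> part lam r = v} = (if v \<le> n then ?m v else 0)"
    proof (cases "v \<le> n")
      case False
      then have "part lam r \<noteq> v" for r using bound[of r] by auto
      then have "{r. r < N \<and> part lam r = v} = {}" by auto
      then show ?thesis using False by (simp only: card.empty if_False)
    qed (simp add: card)
    finally show "count (mset (map (part lam) [0..<N])) v = count (mset (blocks ?m n)) v" by (simp add: count_blocks)
  qed
  then have "mset (rev (map (part lam) [0..<N])) = mset (rev (blocks ?m n))" by simp
  then have "rev (map (part lam) [0..<N]) = rev (blocks ?m n)"
    using sorted sorted_rev_blocks[of ?m n] by (metis properties_for_sort)
  then have eq: "map (part lam) [0..<N] = blocks ?m n" by simp
  have "hl_v N lam = (\<Prod>v\<in>insert 0 (set lam). qfact hl_t (?m v))"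
    by (simp only: hl_v_def qfact_def card)
  also have "\<dots> = (\<Prod>v\<le>n. qfact hl_t (?m v))"
  proof (rule prod.mono_neutral_left)
    show "insert 0 (set lam) \<subseteq> {..n}"
      using lam member_le_sum_list by (fastforce simp: partitions_def)
    show "\<forall>i\<in>{..n} - insert 0 (set lam). qfact hl_t (?m i) = 1"
    proof
      fix i assume i: "i \<in> {..n} - insert 0 (set lam)"
      then have "{r. r < N \<and> part lam r = i} = {}" using nth_mem by (auto simp: part_def)
      then have "?m i = 0" by (simp add: card[symmetric])
      then show "qfact hl_t (?m i) = 1" by simp
    qed
  qed simp
  finally have v: "hl_v N lam = (\<Prod>v\<le>n. qfact hl_t (?m v))" .
  have "hall_littlewood_vars N lam = symmetrize hl_t hl_x N (part lam) / hl_v N lam"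
    by (simp only: hall_littlewood_vars_def symmetrize_def hl_factor_def comp_def)
  then show ?thesis
    using columns_par(2)[OF lam] by (simp add: hl.hl_value_def hl.hl_norm_def hl.symmetrize_list eq v)
qed

text \<open>Bounded degree makes the support in finitely many variables finite, so that
  \<open>Abs_poly_mapping\<close> inside \<open>restrict_vars\<close> has its intended
  value.\<close>

definition bounded_degree :: "'a::zero series \<Rightarrow> bool" where
  "bounded_degree f \<longleftrightarrow> (\<exists>d. \<forall>m. f m \<noteq> 0 \<longrightarrow> mdeg m \<le> d)"

lemma homogeneous_bounded: "homogeneous n f \<Longrightarrow> bounded_degree f"
  by (auto simp: homogeneous_def bounded_degree_def)

lemma finite_monomials: "finite {m. vars m \<subseteq> {..<N} \<and> mdeg m \<le> d}"
proof (rule finite_imageD)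
  show "finite (expo ` {m. vars m \<subseteq> {..<N} \<and> mdeg m \<le> d})"
  proof (rule finite_subset[OF _ finite_bounded_functions[of d N]], safe)
    fix m i assume m: "vars m \<subseteq> {..<N}" "mdeg m \<le> d"
    have "expo m i \<le> mdeg m"
      by (cases "i \<in> vars m") (auto simp: mdeg_def in_keys_iff intro: member_le_sum)
    then show "expo m i \<le> d" using m by simp
    show "expo m i = 0" if "N \<le> i" using m that by (metis in_keys_iff lessThan_iff not_le subsetD)
  qed
  show "inj_on expo {m. vars m \<subseteq> {..<N} \<and> mdeg m \<le> d}" by (auto intro: inj_onI)
qed

lemma lookup_restrict_vars:
  assumes "bounded_degree f"
  shows "Poly_Mapping.lookup (restrict_vars N f) m = (if vars m \<subseteq> {..<N} then f m else 0)"
proof -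
  obtain d where d: "\<And>m. f m \<noteq> 0 \<Longrightarrow> mdeg m \<le> d" using assms by (auto simp: bounded_degree_def)
  have "finite {m. (if vars m \<subseteq> {..<N} then f m else 0) \<noteq> 0}"
    by (rule finite_subset[OF _ finite_monomials[of N d]]) (auto dest: d split: if_splits)
  then show ?thesis by (simp add: restrict_vars_def)
qed

lemma bounded_degree_sum:
  fixes f :: "'i \<Rightarrow> 'a::comm_ring_1 series"
  assumes "finite A" "\<And>x. x \<in> A \<Longrightarrow> bounded_degree (f x)"
  shows "bounded_degree (\<lambda>m. \<Sum>x\<in>A. c x * f x m)"
  using assms
proof (induction A)
  case empty
  then show ?case by (simp add: bounded_degree_def)
next
  case (insert x A)
  obtain d where d: "\<And>m. f x m \<noteq> 0 \<Longrightarrow> mdeg m \<le> d" using insert.prems by (auto simp: bounded_degree_def)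
  obtain e where e: "\<And>m. (\<Sum>x\<in>A. c x * f x m) \<noteq> 0 \<Longrightarrow> mdeg m \<le> e" using insert by (auto simp: bounded_degree_def)
  have "mdeg m \<le> max d e" if nz: "(\<Sum>x\<in>insert x A. c x * f x m) \<noteq> 0" for m
  proof -
    have "c x * f x m + (\<Sum>x\<in>A. c x * f x m) \<noteq> 0" using nz insert.hyps by simp
    then have "f x m \<noteq> 0 \<or> (\<Sum>x\<in>A. c x * f x m) \<noteq> 0" by auto
    then show ?thesis using d e by (auto simp: le_max_iff_disj)
  qed
  then show ?case unfolding bounded_degree_def by blast
qed

lemma sum_monomials: "(\<Sum>b\<in>Poly_Mapping.keys p. Poly_Mapping.single b (Poly_Mapping.lookup p b)) = p"
  by (rule poly_mapping_eqI) (simp add: Poly_Mapping.lookup_sum lookup_single when_def in_keys_iff)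

lemma lookup_single_times:
  fixes p :: hl_poly
  shows "Poly_Mapping.lookup (Poly_Mapping.single a c * p) m = (if a \<in> below m then c * Poly_Mapping.lookup p (m - a) else 0)"
proof -
  have "Poly_Mapping.single a c * p = Poly_Mapping.single a c * (\<Sum>b\<in>Poly_Mapping.keys p. Poly_Mapping.single b (Poly_Mapping.lookup p b))"
    by (simp only: sum_monomials)
  also have "\<dots> = (\<Sum>b\<in>Poly_Mapping.keys p. Poly_Mapping.single (a + b) (c * Poly_Mapping.lookup p b))"
    by (simp add: sum_distrib_left mult_single)
  finally have 1: "Poly_Mapping.lookup (Poly_Mapping.single a c * p) m = (\<Sum>b\<in>Poly_Mapping.keys p. if a + b = m then c * Poly_Mapping.lookup p b else 0)"
    by (simp add: Poly_Mapping.lookup_sum lookup_single when_def)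
  show ?thesis
  proof (cases "a \<in> below m")
    case True
    have "a + b = m \<longleftrightarrow> b = m - a" for b
    proof
      assume "b = m - a"
      then show "a + b = m" using True by (intro poly_mapping_eqI) (simp add: below_def lookup_add lookup_minus)
    qed auto
    then show ?thesis using True by (simp add: 1 in_keys_iff)
  next
    case False
    then have "a + b \<noteq> m" for b by (auto simp: below_def lookup_add)
    then show ?thesis using False by (simp add: 1)
  qed
qed

lemma restrict_vars_sum:
  fixes f :: "'i \<Rightarrow> int poly series"
  assumes "finite A" "\<And>x. x \<in> A \<Longrightarrow> bounded_degree (f x)"
  shows "embed (restrict_vars N (\<lambda>m. \<Sum>x\<in>A. c x * f x m)) = (\<Sum>x\<in>A. const (c x) * embed (restrict_vars N (f x)))"
proof -
  have single0: "Poly_Mapping.lookup (Poly_Mapping.single 0 a * p) m = a * Poly_Mapping.lookup p m" for a and p :: hl_poly and m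
    by (simp add: lookup_single_times below_def)
  have "restrict_vars N (\<lambda>m. \<Sum>x\<in>A. c x * f x m) = (\<Sum>x\<in>A. Poly_Mapping.single 0 (c x) * restrict_vars N (f x))"
    by (rule poly_mapping_eqI)
      (simp add: lookup_restrict_vars[OF bounded_degree_sum[OF assms]] Poly_Mapping.lookup_sum single0 lookup_restrict_vars assms(2))
  then show ?thesis by (simp only: embed_sum embed_simps(1))
qed

lemma embed_restrict_mult_e:
  fixes f :: "int poly series"
  assumes f: "bounded_degree f" and g: "bounded_degree (mult_e r f)"
  shows "embed (restrict_vars N (mult_e r f)) = hl.elem N r * embed (restrict_vars N f)"
proof -
  let ?E = "{S. S \<subseteq> {..<N} \<and> card S = r}"
  have finE: "finite ?E" by (rule finite_subset[of _ "Pow {..<N}"]) auto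
  have fS: "finite S" if "S \<subseteq> {..<N}" for S using that finite_subset by blast
  have "restrict_vars N (mult_e r f) = (\<Sum>S\<in>?E. Poly_Mapping.single (ind S) 1 * restrict_vars N f)"
  proof (rule poly_mapping_eqI)
    fix m
    have ib: "ind S \<in> below m \<longleftrightarrow> S \<subseteq> vars m" if "S \<in> ?E" for S
      using fS[of S] that by (force simp: below_def expo_ind in_keys_iff subset_iff Suc_le_eq)
    have "(\<Sum>S\<in>?E. Poly_Mapping.lookup (Poly_Mapping.single (ind S) 1 * restrict_vars N f) m) =
        (\<Sum>S\<in>?E. if S \<subseteq> vars m then (if vars (m - ind S) \<subseteq> {..<N} then f (m - ind S) else 0) else 0)"
      by (intro sum.cong refl) (simp add: lookup_single_times lookup_restrict_vars[OF f] ib)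
    also have "\<dots> = (if vars m \<subseteq> {..<N} then mult_e r f m else 0)"
    proof (cases "vars m \<subseteq> {..<N}")
      case True
      have sub: "vars (m - ind S) \<subseteq> {..<N}" for S
      proof
        fix i assume "i \<in> vars (m - ind S)"
        then have "i \<in> vars m" by (auto simp: in_keys_iff lookup_minus)
        then show "i \<in> {..<N}" using True by blast
      qed
      have "(\<Sum>S\<in>?E. if S \<subseteq> vars m then f (m - ind S) else 0) = (\<Sum>S | S \<subseteq> vars m \<and> card S = r. f (m - ind S))"
        using finE True by (intro sum.mono_neutral_cong_right) auto
      then show ?thesis using True by (simp add: sub mult_e_def cong: if_cong)
    next
      case False
      then obtain i where i: "i \<in> vars m" "\<not> i < N" by auto
      have "i \<in> vars (m - ind S)" if "S \<in> ?E" for S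
        using i that fS[of S] by (auto simp: in_keys_iff lookup_minus expo_ind)
      then have "\<not> vars (m - ind S) \<subseteq> {..<N}" if "S \<in> ?E" for S using that i(2) by blast
      then show ?thesis using False by (intro trans[OF sum.neutral]) auto
    qed
    finally show "Poly_Mapping.lookup (restrict_vars N (mult_e r f)) m =
        Poly_Mapping.lookup (\<Sum>S\<in>?E. Poly_Mapping.single (ind S) 1 * restrict_vars N f) m"
      by (simp add: Poly_Mapping.lookup_sum lookup_restrict_vars[OF g])
  qed
  moreover have "embed (Poly_Mapping.single (ind S) 1) = (\<Prod>i\<in>S. hl_x i)" if "S \<in> ?E" for S
  proof -
    have "Poly_Mapping.single (ind S) (1 :: int poly) = (\<Prod>i\<in>S. Poly_Mapping.single (Poly_Mapping.single i 1) 1)"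
      using fS[of S] that unfolding ind_def
    proof -
      have "finite S" using fS[of S] that by simp
      then show "Poly_Mapping.single (\<Sum>i\<in>S. Poly_Mapping.single i 1) (1 :: int poly) = (\<Prod>i\<in>S. Poly_Mapping.single (Poly_Mapping.single i 1) 1)"
      proof (induction S)
        case (insert x S)
        then show ?case by (simp add: mult_single flip: insert.IH)
      qed simp
    qed
    then show ?thesis by (simp add: embed_prod hl_x_def)
  qed
  ultimately show ?thesis by (simp add: embed_sum embed_simps hl.elem_def sum_distrib_right)
qed

text \<open>Each monomial involves finitely many variables, so its coefficient is visible in every
  restriction to sufficiently many variables.\<close>

lemma restrict_vars_inject:
  fixes f g :: "int poly series"
  assumes "bounded_degree f" "bounded_degree g" "\<And>N. N \<ge> L \<Longrightarrow> embed (restrict_vars N f) = embed (restrict_vars N g)"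
  shows "f = g"
proof
  fix m
  obtain k where k: "vars m \<subseteq> {..<k}" by (rule ex_vars_bound)
  then have "vars m \<subseteq> {..<max k L}" by auto
  moreover have "restrict_vars (max k L) f = restrict_vars (max k L) g" using assms(3)[of "max k L"] by (simp add: embed_eq_iff)
  ultimately show "f m = g m" using lookup_restrict_vars assms(1,2) by metis
qed

lemma symmetric_mult_e:
  assumes "symmetric_series f" shows "symmetric_series (mult_e r f)"
  unfolding symmetric_series_def
proof (intro allI impI)
  fix \<pi> :: "nat \<Rightarrow> nat" and m assume p: "bij \<pi>"
  note i = bij_is_inj[OF p]
  have "mult_e r f m = (\<Sum>S | S \<subseteq> vars m \<and> card S = r. f (Poly_Mapping.map_key \<pi> (m - ind S)))"
    using assms p by (simp add: mult_e_def symmetric_series_def)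
  also have "\<dots> = mult_e r f (Poly_Mapping.map_key \<pi> m)"
    unfolding mult_e_def
  proof (rule sum.reindex_bij_witness[of _ "\<lambda>S. \<pi> ` S" "\<lambda>S. \<pi> -` S"])
    fix S assume S: "S \<in> {S. S \<subseteq> vars m \<and> card S = r}"
    then have fin: "finite S" using finite_subset finite_keys by blast
    show "\<pi> ` (\<pi> -` S) = S" using p by (simp add: bij_is_surj surj_image_vimage_eq)
    then have "card (\<pi> -` S) = card S" using card_image[of \<pi> "\<pi> -` S"] inj_on_subset[OF i] by simp
    then show "\<pi> -` S \<in> {S. S \<subseteq> vars (Poly_Mapping.map_key \<pi> m) \<and> card S = r}"
      using S by (auto simp: keys_map_key[OF i])
    have "Poly_Mapping.map_key \<pi> m - ind (\<pi> -` S) = Poly_Mapping.map_key \<pi> (m - ind S)"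
      unfolding map_key_ind[OF p fin, symmetric]
      by (rule poly_mapping_eqI) (simp add: lookup_minus expo_map_key[OF i])
    then show "f (Poly_Mapping.map_key \<pi> m - ind (\<pi> -` S)) = f (Poly_Mapping.map_key \<pi> (m - ind S))" by simp
  next
    fix S assume S: "S \<in> {S. S \<subseteq> vars (Poly_Mapping.map_key \<pi> m) \<and> card S = r}"
    then show "\<pi> ` S \<in> {S. S \<subseteq> vars m \<and> card S = r}"
      using card_image[of \<pi> S] inj_on_subset[OF i] by (auto simp: keys_map_key[OF i])
    show "\<pi> -` (\<pi> ` S) = S" using i by (simp add: inj_vimage_image_eq)
  qed
  finally show "mult_e r f (Poly_Mapping.map_key \<pi> m) = mult_e r f m" ..
qed

lemma homogeneous_mult_e:
  assumes "homogeneous n f" shows "homogeneous (n + r) (mult_e r f)"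
  unfolding homogeneous_def
proof (intro allI impI)
  fix m assume "mult_e r f m \<noteq> 0"
  then obtain S where S: "S \<subseteq> vars m" "card S = r" "f (m - ind S) \<noteq> 0"
    unfolding mult_e_def by (auto elim: sum.not_neutral_contains_not_neutral)
  have fin: "finite S" using S(1) finite_subset finite_keys by blast
  have "m - ind S + ind S = m"
    using S(1) fin by (intro poly_mapping_eqI) (auto simp: lookup_add lookup_minus expo_ind in_keys_iff)
  then have "mdeg m = mdeg (m - ind S) + r" using mdeg_plus[of "m - ind S" "ind S"] mdeg_ind[OF fin] S(2) by simp
  then show "mdeg m = n + r" using assms S(3) by (simp add: homogeneous_def)
qed

lemma sum_columns:
  "(\<Sum>d | columns nu \<in> remove_strip d r \<and> P d. F d) =
    (\<Sum>rho | rho \<in> partitions (n + r) \<and> columns nu \<in> remove_strip (columns rho) r \<and> P (columns rho). F (columns rho))"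
  if nu: "nu \<in> partitions n"
proof (rule sum.reindex_bij_betw[symmetric])
  have "bij_betw columns {rho \<in> partitions (n + r). columns nu \<in> remove_strip (columns rho) r \<and> P (columns rho)}
      {g \<in> {g. par g \<and> fsize g = n + r}. columns nu \<in> remove_strip g r \<and> P g}"
    by (rule bij_betw_subset[OF bij_columns]) (use bij_columns[of "n + r"] in \<open>auto simp: bij_betw_def\<close>)
  moreover have "{g \<in> {g. par g \<and> fsize g = n + r}. columns nu \<in> remove_strip g r \<and> P g} =
      {d. columns nu \<in> remove_strip d r \<and> P d}"
    using remove_strip_par remove_stripD(4) columns_par(2)[OF nu] by fastforce
  ultimately show "bij_betw columns {rho. rho \<in> partitions (n + r) \<and> columns nu \<in> remove_strip (columns rho) r \<and> P (columns rho)}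
    {d. columns nu \<in> remove_strip d r \<and> P d}" by simp
qed

text \<open>Interlacing bounds column i + 1 of \<open>rho\<close> by column i + 1 of
  \<open>lam\<close>. If the first column were bounded too, equal sizes would force equality. So
  \<open>lam\<close> has the fewest rows among the terms of the Pieri rule for its stripped
  partition.\<close>

lemma vertical_strip_longer:
  assumes lam: "lam \<in> partitions n" and rho: "rho \<in> partitions n" "rho \<noteq> lam"
    and s: "columns (strip_col lam) \<in> remove_strip (columns rho) (length lam)"
  shows "length rho > length lam"
proof (rule ccontr)
  assume "\<not> ?thesis"
  then have le: "columns rho 0 \<le> columns lam 0" using columns_0 lam rho by simp
  have "columns rho (Suc i) \<le> columns lam (Suc i)" for i
    using remove_stripD(1)[OF s] by (simp add: hstrip_def columns_strip[OF lam])
  then have le': "columns rho i \<le> columns lam i" for i using le by (cases i) auto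
  have "fsize (columns rho) = fsize (columns lam)" using columns_par lam rho by simp
  moreover obtain L where L: "\<forall>i\<ge>L. columns lam i = 0" using columns_par(1)[OF lam] by (auto simp: par_def fin_supp_def)
  moreover have L': "\<forall>i\<ge>L. columns rho i = 0" using L le' by (metis le_zero_eq)
  ultimately have "(\<Sum>i<L. columns rho i) = (\<Sum>i<L. columns lam i)" by (simp add: fsize_eq)
  then have "columns rho i = columns lam i" if "i < L" for i
    using sum_mono_inv[of "columns rho" "{..<L}" "columns lam" i] le' that by auto
  then have "columns rho = columns lam" using L L' by (metis ext not_le)
  then show False using columns_inject[OF rho(1) lam] rho(2) by simp
qed

text \<open>Column \<open>v\<close> of the stripped partition is column v + 1 of \<open>lam\<close>,
  so every Gaussian binomial has equal arguments.\<close>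

lemma strip_col_vertical_strip:
  assumes lam: "lam \<in> partitions n"
  shows "columns (strip_col lam) \<in> remove_strip (columns lam) (length lam)"
    "pieri_coeff q (columns lam) (columns (strip_col lam)) = 1"
proof -
  have "fsize (columns lam) = fsize (columns (strip_col lam)) + length lam"
    using columns_par(2)[OF lam] columns_par(2)[OF strip_col_partition(1)[OF lam]] length_partition_le[OF lam] by simp
  then show "columns (strip_col lam) \<in> remove_strip (columns lam) (length lam)"
    using columns_par(1)[OF lam] by (auto simp: remove_strip_def hstrip_def columns_strip[OF lam] par_def)
  show "pieri_coeff q (columns lam) (columns (strip_col lam)) = 1"
    by (simp add: pieri_coeff_def columns_strip[OF lam])
qed

lemma embed_series_one: "embed (restrict_vars N series_one) = 1"
proof -
  have "bounded_degree (series_one :: int poly series)" by (auto simp: bounded_degree_def series_one_def)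
  then have "restrict_vars N (series_one :: int poly series) = 1"
    by (intro poly_mapping_eqI) (simp add: lookup_restrict_vars, simp add: series_one_def lookup_one when_def)
  then show ?thesis by (simp add: embed_simps)
qed

text \<open>The symmetrization formula does not show that its values for different \<open>N\<close>
  come from one series over Z[t]. The Pieri rule for e_l P_nu, where nu is the stripped partition
  and l the number of rows of \<open>lam\<close>, is therefore solved for P_lam: its coefficient
  there is 1, and all other terms have more rows. The outer induction is on the size, the inner one
  goes from many rows to few.\<close>

lemma ex_hall_littlewood:
  "lam \<in> partitions n \<Longrightarrow> \<exists>f. symmetric_series f \<and> homogeneous n f \<and>
    (\<forall>N. embed (restrict_vars N f) = (if length lam \<le> N then hl.hl_value N (columns lam) else 0))"
proof (induction n arbitrary: lam rule: less_induct)
  case (less n)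
  note outer = less.IH
  show ?case using less.prems
  proof (induction "n - length lam" arbitrary: lam rule: less_induct)
    case less
    note lam = less.prems and inner = less.hyps
    show ?case
    proof (cases "lam = []")
      case True
      then have "columns lam = (\<lambda>_. 0)" by (simp add: columns_def conj_par_def fun_eq_iff)
      moreover have "n = 0" using True lam by (simp add: partitions_def)
      moreover have "symmetric_series (series_one :: int poly series)"
        unfolding symmetric_series_def series_one_def by (metis mdeg_eq_0_iff mdeg_map_key)
      moreover have "homogeneous 0 (series_one :: int poly series)" by (auto simp: homogeneous_def series_one_def)
      ultimately show ?thesis using True by (intro exI[of _ series_one]) (simp add: embed_series_one hl.hl_value_0)
    next
      case False
      define l where "l = length lam"
      define nu where "nu = strip_col lam"
      have l: "1 \<le> l" "l \<le> n" using False length_partition_le[OF lam] by (auto simp: l_def Suc_le_eq)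
      have nu: "nu \<in> partitions (n - l)" "length nu \<le> l"
        unfolding nu_def l_def by (rule strip_col_partition[OF lam])+
      obtain h where h: "symmetric_series h" "homogeneous (n - l) h"
        "\<And>N. embed (restrict_vars N h) = (if length nu \<le> N then hl.hl_value N (columns nu) else 0)"
        using outer[of "n - l" nu] nu l by auto
      define A where "A = {rho \<in> partitions n. columns nu \<in> remove_strip (columns rho) l} - {lam}"
      have longer: "l < length rho" if "rho \<in> A" for rho
        using vertical_strip_longer[OF lam, of rho] that by (auto simp: A_def l_def nu_def)
      have "\<exists>f. symmetric_series f \<and> homogeneous n f \<and>
          (\<forall>N. embed (restrict_vars N f) = (if length rho \<le> N then hl.hl_value N (columns rho) else 0))" if "rho \<in> A" for rho
      proof (rule inner)
        show rho: "rho \<in> partitions n" using that by (simp add: A_def)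
        show "n - length rho < n - length lam"
          using longer[OF that] length_partition_le[OF rho] l by (simp add: l_def)
      qed
      then obtain F where F: "\<And>rho. rho \<in> A \<Longrightarrow> symmetric_series (F rho)" "\<And>rho. rho \<in> A \<Longrightarrow> homogeneous n (F rho)"
        "\<And>rho N. rho \<in> A \<Longrightarrow> embed (restrict_vars N (F rho)) = (if length rho \<le> N then hl.hl_value N (columns rho) else 0)"
        by metis
      have finA: "finite A" by (simp add: A_def)
      define c where "c rho = pieri_coeff [:0, 1 :: int:] (columns rho) (columns nu)" for rho
      define s where "s = (\<lambda>m. \<Sum>rho\<in>A. c rho * F rho m)"
      define f where "f = (\<lambda>m. mult_e l h m - s m)"
      have e: "symmetric_series (mult_e l h)" "homogeneous n (mult_e l h)"
        using symmetric_mult_e[OF h(1)] homogeneous_mult_e[OF h(2), of l] l by auto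
      have bs: "bounded_degree s"
        unfolding s_def using F(2) homogeneous_bounded by (intro bounded_degree_sum finA) blast
      have "s (Poly_Mapping.map_key \<pi> m) = s m" if "bij \<pi>" for \<pi> m
        unfolding s_def using F(1) that by (intro sum.cong refl) (auto simp: symmetric_series_def)
      then have fs: "symmetric_series f" using e(1) by (auto simp: symmetric_series_def f_def)
      have "s m = 0" if "mdeg m \<noteq> n" for m
        unfolding s_def using F(2) that unfolding homogeneous_def by (intro sum.neutral) (metis mult_zero_right)
      then have fh: "homogeneous n f" using e(2) by (auto simp: homogeneous_def f_def)
      have "embed (restrict_vars N f) = (if length lam \<le> N then hl.hl_value N (columns lam) else 0)" for N
      proof -
        have "restrict_vars N f = restrict_vars N (mult_e l h) - restrict_vars N s"
          by (rule poly_mapping_eqI)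
            (simp add: lookup_minus lookup_restrict_vars homogeneous_bounded[OF fh] homogeneous_bounded[OF e(2)] bs, simp add: f_def)
        then have 1: "embed (restrict_vars N f) = hl.elem N l * embed (restrict_vars N h) -
            (\<Sum>rho\<in>A. const (c rho) * embed (restrict_vars N (F rho)))"
        proof -
          have "embed (restrict_vars N s) = (\<Sum>rho\<in>A. const (c rho) * embed (restrict_vars N (F rho)))"
            unfolding s_def by (rule restrict_vars_sum[OF finA]) (rule homogeneous_bounded[OF F(2)])
          then show ?thesis
            unfolding \<open>restrict_vars N f = _\<close> embed_simps(3)
              embed_restrict_mult_e[OF homogeneous_bounded[OF h(2)] homogeneous_bounded[OF e(2)]] by simp
        qed
        show ?thesis
        proof (cases "l \<le> N")
          \<comment> \<open>With fewer than \<open>l\<close> variables e_l vanishes, and so do all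
            terms with more than \<open>l\<close> rows.\<close>
          case False
          have "S \<subseteq> {..<N} \<Longrightarrow> card S \<noteq> l" for S using False card_mono[of "{..<N}" S] by auto
          then have "{S. S \<subseteq> {..<N} \<and> card S = l} = {}" by blast
          then have "hl.elem N l = 0" unfolding hl.elem_def by (simp only: sum.empty)
          moreover have "(\<Sum>rho\<in>A. const (c rho) * embed (restrict_vars N (F rho))) = 0"
            using False by (intro sum.neutral ballI) (use F(3) longer in force)
          ultimately show ?thesis using 1 False by (simp add: l_def)
        next
          case True
          let ?R = "{rho. rho \<in> partitions (n - l + l) \<and> columns nu \<in> remove_strip (columns rho) l \<and> columns rho 0 \<le> N}"
          have R: "?R = insert lam {rho \<in> A. length rho \<le> N}"
            using True l lam strip_col_vertical_strip(1)[OF lam] columns_0 by (auto simp: A_def l_def nu_def)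
          have "hl.elem N l * embed (restrict_vars N h) = hl.elem N l * hl.hl_value N (columns nu)"
            using h(3)[of N] nu(2) True by simp
          also have "\<dots> = (\<Sum>d | columns nu \<in> remove_strip d l \<and> d 0 \<le> N. pieri_coeff hl_t d (columns nu) * hl.hl_value N d)"
            using nu True columns_0[OF nu(1)] by (intro hl.elem_hl_value columns_par(1)[OF nu(1)]) simp
          also have "\<dots> = (\<Sum>rho\<in>?R. pieri_coeff hl_t (columns rho) (columns nu) * hl.hl_value N (columns rho))"
            by (rule sum_columns[OF nu(1)])
          also have "\<dots> = hl.hl_value N (columns lam) +
              (\<Sum>rho\<in>{rho \<in> A. length rho \<le> N}. pieri_coeff hl_t (columns rho) (columns nu) * hl.hl_value N (columns rho))"
            unfolding R using finA by (subst sum.insert) (auto simp: A_def nu_def strip_col_vertical_strip(2)[OF lam])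
          also have "(\<Sum>rho\<in>{rho \<in> A. length rho \<le> N}. pieri_coeff hl_t (columns rho) (columns nu) * hl.hl_value N (columns rho)) =
              (\<Sum>rho\<in>A. const (c rho) * embed (restrict_vars N (F rho)))"
            using finA F(3) by (intro sum.mono_neutral_cong_left) (auto simp: c_def const_pieri_coeff)
          finally show ?thesis using 1 True by (simp add: l_def)
        qed
      qed
      then show ?thesis using fs fh by blast
    qed
  qed
qed

theorem hall_littlewood:
  assumes lam: "lam \<in> partitions n"
  shows "symmetric_series (hall_littlewood lam)" "homogeneous n (hall_littlewood lam)"
    "embed (restrict_vars N (hall_littlewood lam)) = (if length lam \<le> N then hl.hl_value N (columns lam) else 0)"
proof -
  obtain f where f: "symmetric_series f" "homogeneous n f"
    "\<And>N. embed (restrict_vars N f) = (if length lam \<le> N then hl.hl_value N (columns lam) else 0)"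
    using ex_hall_littlewood[OF lam] by auto
  have "hall_littlewood lam = f"
    unfolding hall_littlewood_def
  proof (rule the_equality)
    show "f \<in> symfuns \<and> (\<forall>N\<ge>length lam. embed (restrict_vars N f) = hall_littlewood_vars N lam)"
      using symfunsI[OF f(1,2)] f(3) hall_littlewood_vars_value[OF lam] by simp
    fix g assume g: "g \<in> symfuns \<and> (\<forall>N\<ge>length lam. embed (restrict_vars N g) = hall_littlewood_vars N lam)"
    then have "bounded_degree g" by (auto simp: symfuns_def bounded_degree_def)
    then show "g = f"
      using g f(3) hall_littlewood_vars_value[OF lam]
      by (intro restrict_vars_inject[OF _ homogeneous_bounded[OF f(2)], of g "length lam"]) auto
  qed
  then show "symmetric_series (hall_littlewood lam)" "homogeneous n (hall_littlewood lam)"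
    "embed (restrict_vars N (hall_littlewood lam)) = (if length lam \<le> N then hl.hl_value N (columns lam) else 0)"
    using f by auto
qed

text \<open>The identity holds in every sufficiently large number of variables, and its coefficients
  are images of elements of Z[t] by \<open>const_pieri_coeff\<close>; hence it lifts to
  series.\<close>

theorem hall_littlewood_pieri:
  assumes nu: "nu \<in> partitions n"
  shows "mult_e r (hall_littlewood nu) = (\<lambda>m. \<Sum>rho | rho \<in> partitions (n + r) \<and> columns nu \<in> remove_strip (columns rho) r.
    pieri_coeff [:0, 1:] (columns rho) (columns nu) * hall_littlewood rho m)"
proof (rule restrict_vars_inject[where L = "n"])
  let ?R = "{rho. rho \<in> partitions (n + r) \<and> columns nu \<in> remove_strip (columns rho) r}"
  have b: "bounded_degree (hall_littlewood rho)" if "rho \<in> partitions k" for rho k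
    using hall_littlewood(2)[OF that] by (rule homogeneous_bounded)
  have be: "bounded_degree (mult_e r (hall_littlewood nu))"
    using homogeneous_mult_e[OF hall_littlewood(2)[OF nu]] by (rule homogeneous_bounded)
  then show "bounded_degree (mult_e r (hall_littlewood nu))" .
  have finR: "finite ?R" by simp
  show "bounded_degree (\<lambda>m. \<Sum>rho\<in>?R. pieri_coeff [:0, 1:] (columns rho) (columns nu) * hall_littlewood rho m)"
    using b by (intro bounded_degree_sum finR) blast
  fix N assume "n \<le> N"
  then have len: "length nu \<le> N" using length_partition_le[OF nu] by simp
  have "embed (restrict_vars N (mult_e r (hall_littlewood nu))) = hl.elem N r * hl.hl_value N (columns nu)"
    using embed_restrict_mult_e[OF b[OF nu] be, of N] hall_littlewood(3)[OF nu, of N] len by simp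
  also have "\<dots> = (\<Sum>d | columns nu \<in> remove_strip d r \<and> d 0 \<le> N. pieri_coeff hl_t d (columns nu) * hl.hl_value N d)"
    using len columns_0[OF nu] by (intro hl.elem_hl_value columns_par(1)[OF nu]) simp
  also have "\<dots> = (\<Sum>rho | rho \<in> partitions (n + r) \<and> columns nu \<in> remove_strip (columns rho) r \<and> columns rho 0 \<le> N.
      pieri_coeff hl_t (columns rho) (columns nu) * hl.hl_value N (columns rho))"
    by (rule sum_columns[OF nu])
  also have "\<dots> = (\<Sum>rho\<in>?R. const (pieri_coeff [:0, 1:] (columns rho) (columns nu)) * embed (restrict_vars N (hall_littlewood rho)))"
    by (intro sum.mono_neutral_cong_left finR) (auto simp: hall_littlewood(3) const_pieri_coeff columns_0 split: if_splits)
  also have "\<dots> = embed (restrict_vars N (\<lambda>m. \<Sum>rho\<in>?R. pieri_coeff [:0, 1:] (columns rho) (columns nu) * hall_littlewood rho m))"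
    using b by (intro restrict_vars_sum[symmetric] finR) blast
  finally show "embed (restrict_vars N (mult_e r (hall_littlewood nu))) =
    embed (restrict_vars N (\<lambda>m. \<Sum>rho\<in>?R. pieri_coeff [:0, 1:] (columns rho) (columns nu) * hall_littlewood rho m))" .
qed

text \<open>For the axiom \<open>strip\<close>, take the Pieri rule at a monomial in exactly the
  first \<open>length lam\<close> variables: the elementary function of that degree acts there as
  the product of the variables, and all terms other than \<open>lam\<close> have more rows than
  there are variables.\<close>

lemma strip_family_hall_littlewood: "strip_family hall_littlewood"
proof
  fix lam n m assume lam: "lam \<in> partitions n"
  show s: "symmetric_series (hall_littlewood lam)" "homogeneous n (hall_littlewood lam)"
    using lam by (rule hall_littlewood)+
  have van: "hall_littlewood rho m' = 0" if rho: "rho \<in> partitions k" and lt: "card (vars m') < length rho" for rho k m'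
  proof -
    obtain \<pi> where p: "bij \<pi>" "vars (Poly_Mapping.map_key \<pi> m') = {..<card (vars m')}"
      by (rule ex_variables_initial)
    let ?N = "card (vars m')"
    have "embed (restrict_vars ?N (hall_littlewood rho)) = embed 0"
      using lt by (simp add: hall_littlewood(3)[OF rho] embed_simps(4))
    then have "restrict_vars ?N (hall_littlewood rho) = 0" by (simp add: embed_eq_iff)
    then have "hall_littlewood rho (Poly_Mapping.map_key \<pi> m') = 0"
      using lookup_restrict_vars[OF homogeneous_bounded[OF hall_littlewood(2)[OF rho]], of ?N "Poly_Mapping.map_key \<pi> m'"] p(2) by simp
    then show ?thesis using hall_littlewood(1)[OF rho] p(1) by (simp add: symmetric_series_def)
  qed
  show "hall_littlewood lam m = 0" if "card (vars m) < length lam" using van[OF lam that] .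
  {
    let ?N = "length lam"
    assume v: "vars m \<subseteq> {..<?N}"
    let ?m = "m + ind {..<?N}" and ?nu = "strip_col lam"
    have vm: "vars ?m = {..<?N}" using v by auto
    have nu: "?nu \<in> partitions (n - ?N)" using strip_col_partition(1)[OF lam] .
    have nN: "n - ?N + ?N = n" using length_partition_le[OF lam] by simp
    let ?R = "{rho. rho \<in> partitions n \<and> columns ?nu \<in> remove_strip (columns rho) ?N}"
    have "{S. S \<subseteq> vars ?m \<and> card S = ?N} = {{..<?N}}"
      unfolding vm using card_subset_eq[of "{..<?N}"] by auto
    then have "mult_e ?N (hall_littlewood ?nu) ?m = hall_littlewood ?nu (?m - ind {..<?N})"
      by (simp add: mult_e_def)
    also have "?m - ind {..<?N} = m" by simp
    finally have "hall_littlewood ?nu m = (\<Sum>rho\<in>?R. pieri_coeff [:0, 1:] (columns rho) (columns ?nu) * hall_littlewood rho ?m)"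
      using hall_littlewood_pieri[OF nu, of ?N] unfolding nN by simp
    also have "\<dots> = (\<Sum>rho\<in>{lam}. pieri_coeff [:0, 1:] (columns rho) (columns ?nu) * hall_littlewood rho ?m)"
    proof (rule sum.mono_neutral_right)
      show "\<forall>i\<in>?R - {lam}. pieri_coeff [:0, 1:] (columns i) (columns ?nu) * hall_littlewood i ?m = 0"
      proof
        fix rho assume rho: "rho \<in> ?R - {lam}"
        then have "?N < length rho" using vertical_strip_longer[OF lam, of rho] by auto
        then have "card (vars ?m) < length rho" unfolding vm by simp
        then show "pieri_coeff [:0, 1:] (columns rho) (columns ?nu) * hall_littlewood rho ?m = 0"
          using van[of rho n ?m] rho by simp
      qed
    qed (use strip_col_vertical_strip(1)[OF lam] lam in auto)
    also have "\<dots> = hall_littlewood lam ?m" by (simp add: strip_col_vertical_strip(2)[OF lam])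
    finally show "hall_littlewood lam ?m = hall_littlewood ?nu m" ..
  }
next
  have e: "columns [] = (\<lambda>_. 0)" by (simp add: columns_def conj_par_def fun_eq_iff)
  have "bounded_degree (series_one :: int poly series)" by (auto simp: bounded_degree_def series_one_def)
  then have "hall_littlewood [] = series_one"
    using hall_littlewood[of "[]" 0] homogeneous_bounded
    by (intro restrict_vars_inject[where L = 0]) (auto simp: embed_series_one e hl.hl_value_0)
  then show "hall_littlewood [] 0 = 1" by (simp add: series_one_def)
qed

subsection \<open>Counting subspaces over a finite field\<close>

locale finite_field_space = vector_space scale
  for scale :: "'k::{field,finite} \<Rightarrow> 'v::ab_group_add \<Rightarrow> 'v" +
  fixes q :: nat
  assumes q_card: "q = CARD('k)"
begin

lemma q_ge_2: "q \<ge> 2"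
proof -
  have "card {0, 1 :: 'k} \<le> q" unfolding q_card by (rule card_mono) auto
  then show ?thesis by simp
qed

lemma q_power_cancel: "q ^ a * x = q ^ b * x \<Longrightarrow> x \<noteq> 0 \<Longrightarrow> a = b"
  using q_ge_2 by simp

text \<open>Only finite subspaces are considered, since the space of all sequences, to which this is
  applied, is infinite. Dimensions are expressed by cardinalities, which are powers of
  \<open>q\<close>.\<close>

definition fsub :: "'v set \<Rightarrow> bool" where "fsub S \<longleftrightarrow> subspace S \<and> finite S"

lemma fsub_card_pos: "fsub S \<Longrightarrow> card S > 0"
  unfolding fsub_def by (metis card_gt_0_iff empty_iff subspace_0)

lemma fsub_nonempty: "fsub S \<Longrightarrow> card S \<noteq> 0"
  using fsub_card_pos by fastforce

lemma fsub_Int: "fsub A \<Longrightarrow> fsub B \<Longrightarrow> fsub (A \<inter> B)"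
  by (simp add: fsub_def subspace_inter)

lemma fsub_subset: "subspace B \<Longrightarrow> B \<subseteq> A \<Longrightarrow> fsub A \<Longrightarrow> fsub B"
  by (auto simp: fsub_def intro: finite_subset)

lemma fsub_zero: "fsub {0}" by (simp add: fsub_def)

definition ext :: "'v set \<Rightarrow> 'v \<Rightarrow> 'v set" where
  "ext B a = (\<lambda>(b, c). b + scale c a) ` (B \<times> UNIV)"

lemma extI: "b \<in> B \<Longrightarrow> b + scale c a \<in> ext B a"
  by (force simp: ext_def)

lemma extE: "x \<in> ext B a \<Longrightarrow> (\<And>b c. b \<in> B \<Longrightarrow> x = b + scale c a \<Longrightarrow> P) \<Longrightarrow> P"
  by (force simp: ext_def)

lemma fsub_ext: assumes "fsub B" shows "fsub (ext B a)"
proof -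
  have "subspace (ext B a)"
  proof (rule subspaceI)
    show "0 \<in> ext B a" using extI[of 0 B 0 a] assms by (simp add: fsub_def subspace_0)
    fix x y assume "x \<in> ext B a" "y \<in> ext B a"
    then obtain b c b' c' where "b \<in> B" "b' \<in> B" "x = b + scale c a" "y = b' + scale c' a" by (auto elim!: extE)
    then show "x + y \<in> ext B a"
      using extI[of "b + b'" B "c + c'" a] assms by (simp add: fsub_def subspace_add scale_left_distrib algebra_simps)
  next
    fix s x assume "x \<in> ext B a"
    then obtain b c where "b \<in> B" "x = b + scale c a" by (auto elim!: extE)
    then show "scale s x \<in> ext B a"
      using extI[of "scale s b" B "s * c" a] assms by (simp add: fsub_def subspace_scale scale_right_distrib)
  qed
  then show ?thesis using assms by (simp add: fsub_def ext_def)
qed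

lemma ext_superset: "fsub B \<Longrightarrow> B \<subseteq> ext B a" "fsub B \<Longrightarrow> a \<in> ext B a"
  using extI[of _ B 0 a] extI[of 0 B 1 a] by (auto simp: fsub_def subspace_0)

lemma ext_subset: assumes "subspace A" "B \<subseteq> A" "a \<in> A" shows "ext B a \<subseteq> A"
  using assms by (auto elim!: extE intro!: subspace_add subspace_scale)

lemma scale_mem_iff: assumes "subspace B" "c \<noteq> 0" shows "scale c a \<in> B \<longleftrightarrow> a \<in> B"
proof
  assume "scale c a \<in> B"
  then have "scale (inverse c) (scale c a) \<in> B" using assms(1) by (rule_tac subspace_scale)
  then show "a \<in> B" using assms(2) by simp
qed (use assms in \<open>auto intro: subspace_scale\<close>)

lemma card_ext: assumes B: "fsub B" and a: "a \<notin> B" shows "card (ext B a) = q * card B"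
proof -
  have sB: "subspace B" using B by (simp add: fsub_def)
  have "inj_on (\<lambda>(b, c). b + scale c a) (B \<times> UNIV)"
  proof (rule inj_onI, clarsimp)
    fix b c b' c' assume b: "b \<in> B" "b' \<in> B" and e: "b + scale c a = b' + scale c' a"
    have "scale (c - c') a = b' - b" using e by (simp add: scale_left_diff_distrib algebra_simps)
    then have "scale (c - c') a \<in> B" using b sB by (simp add: subspace_diff)
    then have "c = c'" using scale_mem_iff[OF sB, of "c - c'" a] a by auto
    then show "b = b' \<and> c = c'" using e by simp
  qed
  then show ?thesis unfolding ext_def by (simp add: card_image card_cartesian_product q_card)
qed

lemma ex_card_power:
  assumes "fsub A" "fsub B" "B \<subseteq> A" shows "\<exists>c. card A = q ^ c * card B"
  using assms(2,3)
proof (induction "card A - card B" arbitrary: B rule: less_induct)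
  case less
  show ?case
  proof (cases "B = A")
    case True
    then show ?thesis by (intro exI[of _ 0]) simp
  next
    case False
    then obtain a where a: "a \<in> A" "a \<notin> B" using less.prems by blast
    have sub: "ext B a \<subseteq> A" using assms(1) less.prems a by (intro ext_subset) (auto simp: fsub_def)
    have c: "card (ext B a) = q * card B" using card_ext less.prems a by simp
    have "card (ext B a) \<le> card A" using sub assms(1) by (intro card_mono) (auto simp: fsub_def)
    moreover have "card B < q * card B" using fsub_card_pos[OF less.prems(1)] q_ge_2 by simp
    ultimately have "card A - card (ext B a) < card A - card B" using c by linarith
    then obtain d where "card A = q ^ d * card (ext B a)" using less.hyps[of "ext B a"] fsub_ext less.prems sub by blast
    then show ?thesis using c by (intro exI[of _ "Suc d"]) simp
  qed
qed

lemma ex_hyperplane: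
  assumes "fsub A" "fsub U" "U \<subseteq> A" "card A = q ^ Suc m * card U"
  obtains H a where "fsub H" "U \<subseteq> H" "a \<notin> H" "A = ext H a" "card H = q ^ m * card U"
  using assms(2-)
proof (induction m arbitrary: U thesis)
  case 0
  then have "U \<noteq> A" using q_ge_2 fsub_card_pos[OF 0(2)] by auto
  then obtain a where a: "a \<in> A" "a \<notin> U" using 0 by blast
  have "ext U a \<subseteq> A" using assms(1) 0 a by (intro ext_subset) (auto simp: fsub_def)
  moreover have "card (ext U a) = card A" using card_ext 0 a by simp
  ultimately have "ext U a = A" using assms(1) card_subset_eq unfolding fsub_def by blast
  then show ?case using 0 a by (intro 0(1)[of U a]) auto
next
  case (Suc m)
  have "card U < q ^ Suc (Suc m) * card U"
  proof -
    have "1 < q ^ Suc (Suc m)" using q_ge_2 by (intro one_less_power) auto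
    then show ?thesis using fsub_card_pos[OF Suc(3)] by (intro n_less_m_mult_n) (simp_all only: One_nat_def)
  qed
  then have "U \<noteq> A" using Suc by auto
  then obtain a where a: "a \<in> A" "a \<notin> U" using Suc by blast
  have sub: "ext U a \<subseteq> A" using assms(1) Suc a by (intro ext_subset) (auto simp: fsub_def)
  have c: "card (ext U a) = q * card U" using card_ext Suc a by simp
  obtain H b where H: "fsub H" "ext U a \<subseteq> H" "b \<notin> H" "A = ext H b" "card H = q ^ m * card (ext U a)"
    using Suc.IH[of "ext U a"] fsub_ext[OF Suc(3)] sub c Suc.prems by auto
  show ?case using H ext_superset(1)[OF Suc(3)] c by (intro Suc.prems(1)[of H b]) auto
qed

text \<open>The fibres of the addition map on pairs are translates of the intersection.\<close>

lemma card_sum: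
  assumes X: "fsub X" and U: "fsub U"
  shows "card X * card U = card ((\<lambda>(x, u). x + u) ` (X \<times> U)) * card (X \<inter> U)"
proof -
  let ?f = "\<lambda>(x, u). x + u"
  have s: "subspace X" "subspace U" "finite X" "finite U" using X U by (auto simp: fsub_def)
  have "card (X \<times> U) = (\<Sum>y\<in>?f ` (X \<times> U). card {p \<in> X \<times> U. ?f p = y})"
    using sum.group[of "X \<times> U" "?f ` (X \<times> U)" ?f "\<lambda>_. 1 :: nat"] s by simp
  also have "\<dots> = (\<Sum>y\<in>?f ` (X \<times> U). card (X \<inter> U))"
  proof (intro sum.cong refl)
    fix y assume "y \<in> ?f ` (X \<times> U)"
    then obtain x u where y: "y = x + u" "x \<in> X" "u \<in> U" by auto
    have "bij_betw (\<lambda>z. (x + z, u - z)) (X \<inter> U) {p \<in> X \<times> U. ?f p = y}"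
    proof (rule bij_betw_imageI)
      show "inj_on (\<lambda>z. (x + z, u - z)) (X \<inter> U)" by (auto intro: inj_onI)
      show "(\<lambda>z. (x + z, u - z)) ` (X \<inter> U) = {p \<in> X \<times> U. ?f p = y}"
      proof
        show "(\<lambda>z. (x + z, u - z)) ` (X \<inter> U) \<subseteq> {p \<in> X \<times> U. ?f p = y}"
          using y s by (auto simp: subspace_add subspace_diff)
        show "{p \<in> X \<times> U. ?f p = y} \<subseteq> (\<lambda>z. (x + z, u - z)) ` (X \<inter> U)"
        proof
          fix p assume "p \<in> {p \<in> X \<times> U. ?f p = y}"
          then obtain x' u' where p: "p = (x', u')" "x' \<in> X" "u' \<in> U" "x' + u' = x + u" using y by auto
          have e: "x' - x = u - u'" using p(4) by (simp add: algebra_simps)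
          have "x' - x \<in> X \<inter> U" using p y s subspace_diff[of X x' x] subspace_diff[of U u u'] e by auto
          moreover have "p = (x + (x' - x), u - (x' - x))"
          proof -
            have "u - (x' - x) = u'" unfolding e by simp
            then show ?thesis by (simp only: p(1)) simp
          qed
          ultimately show "p \<in> (\<lambda>z. (x + z, u - z)) ` (X \<inter> U)" by (intro image_eqI)
        qed
      qed
    qed
    then show "card {p \<in> X \<times> U. ?f p = y} = card (X \<inter> U)" by (simp add: bij_betw_same_card)
  qed
  finally show ?thesis by (simp add: card_cartesian_product)
qed

text \<open>U / (U \<inter> B) embeds into A / (A \<inter> B), and the cokernel has dimension at
  most the codimension \<open>m\<close> of \<open>U\<close> in \<open>A\<close>.\<close>

lemma codim_intersection_bounds:
  assumes A: "fsub A" and U: "fsub U" "U \<subseteq> A" and B: "fsub B"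
    and m: "card A = q ^ m * card U" and c: "card U = q ^ c * card (U \<inter> B)" and e: "card A = q ^ e * card (A \<inter> B)"
  shows "c \<le> e" "e \<le> c + m"
proof -
  have q1: "q > 1" using q_ge_2 by simp
  let ?X = "A \<inter> B"
  have X: "fsub ?X" using A B by (rule fsub_Int)
  have XU: "?X \<inter> U = U \<inter> B" using U by auto
  have "(\<lambda>(x, u). x + u) ` (?X \<times> U) \<subseteq> A" using A U by (auto simp: fsub_def subspace_add)
  then have "card ((\<lambda>(x, u). x + u) ` (?X \<times> U)) \<le> card A" using A by (intro card_mono) (auto simp: fsub_def)
  then have "card ?X * card U \<le> card A * card (U \<inter> B)" using card_sum[OF X U(1)] XU by simp
  then have "card ?X * card (U \<inter> B) * q ^ c \<le> card ?X * card (U \<inter> B) * q ^ e" unfolding c e by (simp add: algebra_simps)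
  moreover have pos: "card ?X * card (U \<inter> B) > 0" using fsub_card_pos[OF X] fsub_card_pos[OF fsub_Int[OF U(1) B]] by simp
  ultimately have "q ^ c \<le> q ^ e" by simp
  then show "c \<le> e" using q1 by simp
  have "card (U \<inter> B) \<le> card ?X" using X U by (intro card_mono) (auto simp: fsub_def)
  then have "q ^ e * card (U \<inter> B) \<le> q ^ (c + m) * card (U \<inter> B)"
    using m c e by (metis mult.assoc mult.commute mult_le_mono2 power_add)
  then have "q ^ e \<le> q ^ (c + m)" using fsub_card_pos[OF fsub_Int[OF U(1) B]] by simp
  then show "e \<le> c + m" using q1 by simp
qed

text \<open>Such a subspace is the span of \<open>Y\<close> and some \<open>a + u\<close>, where \<open>u \<in> U\<close> matters modulo \<open>Y\<close> only.\<close>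

lemma card_hyperplane_complements:
  assumes U: "fsub U" and a: "a \<notin> U" and Y: "fsub Y" "Y \<subseteq> U" and c: "card U = q ^ c * card Y"
  defines "\<B> \<equiv> {B. fsub B \<and> B \<subseteq> ext U a \<and> B \<inter> U = Y \<and> \<not> B \<subseteq> U}"
  shows "card \<B> = q ^ c" "B \<in> \<B> \<Longrightarrow> card B = q * card Y"
proof -
  have sU: "subspace U" and sY: "subspace Y" using U Y by (auto simp: fsub_def)
  have au: "a + u \<notin> U" if "u \<in> U" for u using a that sU subspace_diff[OF sU, of "a + u" u] by auto
  have struct: "B = ext Y (a + u)" if B: "B \<in> \<B>" and u: "u \<in> U" "a + u \<in> B" for B u
  proof
    have fB: "fsub B" "B \<subseteq> ext U a" "B \<inter> U = Y" using B by (auto simp: \<B>_def)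
    have sB: "subspace B" using fB by (simp add: fsub_def)
    show "ext Y (a + u) \<subseteq> B" using fB u sB by (intro ext_subset) auto
    show "B \<subseteq> ext Y (a + u)"
    proof
      fix b assume b: "b \<in> B"
      then have "b \<in> ext U a" using fB by blast
      then obtain u' s where u': "u' \<in> U" "b = u' + scale s a" by (rule extE)
      have "b - scale s (a + u) \<in> B" using b u sB by (intro subspace_diff subspace_scale)
      moreover have e: "b - scale s (a + u) = u' - scale s u" by (simp add: u' scale_right_distrib)
      have "b - scale s (a + u) \<in> U" unfolding e using u u' sU by (simp add: subspace_diff subspace_scale)
      ultimately have "b - scale s (a + u) \<in> Y" using fB by blast
      from extI[OF this, of s "a + u"] show "b \<in> ext Y (a + u)" by simp
    qed
  qed
  have ex: "\<exists>u\<in>U. a + u \<in> B" if B: "B \<in> \<B>" for B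
  proof -
    have fB: "fsub B" "B \<subseteq> ext U a" "\<not> B \<subseteq> U" using B by (auto simp: \<B>_def)
    then obtain b where b: "b \<in> B" "b \<notin> U" by blast
    then have "b \<in> ext U a" using fB by blast
    then obtain u s where u: "u \<in> U" "b = u + scale s a" by (rule extE)
    then have s: "s \<noteq> 0" using b by auto
    have "scale (inverse s) b \<in> B" using fB b by (simp add: fsub_def subspace_scale)
    moreover have "scale (inverse s) b = a + scale (inverse s) u" using s by (simp add: u scale_right_distrib add.commute)
    ultimately show ?thesis using u sU by (metis subspace_scale)
  qed
  have mem: "ext Y (a + u) \<in> \<B>" if u: "u \<in> U" for u
  proof -
    have "ext Y (a + u) \<inter> U = Y"
    proof
      show "ext Y (a + u) \<inter> U \<subseteq> Y"
      proof
        fix x assume x: "x \<in> ext Y (a + u) \<inter> U"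
        then have "x \<in> ext Y (a + u)" by blast
        then obtain y s where y: "y \<in> Y" "x = y + scale s (a + u)" by (rule extE)
        then have "scale s (a + u) \<in> U" using x Y sU subspace_diff[OF sU, of x y] by auto
        then have "s = 0" using scale_mem_iff[OF sU] au[OF u] by blast
        then show "x \<in> Y" using y by simp
      qed
      show "Y \<subseteq> ext Y (a + u) \<inter> U" using Y ext_superset by blast
    qed
    moreover have "a + u \<in> ext U a" using extI[OF u, of 1 a] by (simp add: add.commute)
    then have "ext Y (a + u) \<subseteq> ext U a"
      using fsub_ext[OF U] Y ext_superset(1)[OF U] by (intro ext_subset) (auto simp: fsub_def)
    moreover have "\<not> ext Y (a + u) \<subseteq> U" using ext_superset(2)[OF Y(1), of "a + u"] au[OF u] by blast
    ultimately show ?thesis using fsub_ext[OF Y(1)] by (simp add: \<B>_def)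
  qed
  have "finite (ext U a)" using fsub_ext[OF U] by (simp add: fsub_def)
  then have finB: "finite \<B>" by (rule finite_subset[rotated, OF finite_Pow_iff[THEN iffD2]]) (auto simp: \<B>_def)
  have "card U = (\<Sum>B\<in>\<B>. card {u \<in> U. ext Y (a + u) = B})"
  proof -
    have "(\<lambda>u. ext Y (a + u)) ` U \<subseteq> \<B>" using mem by blast
    moreover have "finite U" using U by (simp add: fsub_def)
    ultimately show ?thesis using sum.group[of U \<B> "\<lambda>u. ext Y (a + u)" "\<lambda>_. 1 :: nat"] finB by simp
  qed
  also have "\<dots> = (\<Sum>B\<in>\<B>. card Y)"
  proof (intro sum.cong refl)
    fix B assume B: "B \<in> \<B>"
    obtain u0 where u0: "u0 \<in> U" "a + u0 \<in> B" using ex[OF B] by blast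
    have fB: "subspace B" "B \<inter> U = Y" using B by (auto simp: \<B>_def fsub_def)
    have "{u \<in> U. ext Y (a + u) = B} = (\<lambda>y. u0 + y) ` Y"
    proof
      show "{u \<in> U. ext Y (a + u) = B} \<subseteq> (\<lambda>y. u0 + y) ` Y"
      proof
        fix u assume "u \<in> {u \<in> U. ext Y (a + u) = B}"
        then have u: "u \<in> U" "a + u \<in> B" using ext_superset(2)[OF Y(1), of "a + u"] by auto
        have "u - u0 \<in> B" using subspace_diff[OF fB(1) u(2) u0(2)] by simp
        moreover have "u - u0 \<in> U" using u u0 sU by (simp add: subspace_diff)
        ultimately have "u - u0 \<in> Y" using fB by blast
        then show "u \<in> (\<lambda>y. u0 + y) ` Y" by (intro image_eqI[of _ _ "u - u0"]) auto
      qed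
      show "(\<lambda>y. u0 + y) ` Y \<subseteq> {u \<in> U. ext Y (a + u) = B}"
      proof
        fix u assume "u \<in> (\<lambda>y. u0 + y) ` Y"
        then obtain y where y: "y \<in> Y" "u = u0 + y" by blast
        then have u: "u \<in> U" using u0 Y sU by (auto intro: subspace_add)
        have "a + u0 + y \<in> B" using y fB subspace_add[OF fB(1) u0(2), of y] by auto
        then have "a + u \<in> B" using y by (simp add: algebra_simps)
        then show "u \<in> {u \<in> U. ext Y (a + u) = B}" using struct[OF B u] u by simp
      qed
    qed
    then show "card {u \<in> U. ext Y (a + u) = B} = card Y" by (simp add: card_image)
  qed
  finally show "card \<B> = q ^ c" using c fsub_card_pos[OF Y(1)] by simp
  show "card B = q * card Y" if B: "B \<in> \<B>"
  proof -
    obtain u where "u \<in> U" "a + u \<in> B" using ex[OF B] by blast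
    then show ?thesis using struct[OF B] card_ext[OF Y(1)] au Y by (metis subsetD)
  qed
qed

lemma finite_fsubs: "finite S \<Longrightarrow> finite {B. fsub B \<and> B \<subseteq> S \<and> P B}"
  by (rule finite_subset[of _ "Pow S"]) auto

text \<open>The subspaces are grouped by their intersection \<open>Y\<close> with the hyperplane
  \<open>H\<close>; the only one inside \<open>H\<close> is \<open>Y\<close> itself.\<close>

lemma sum_hyperplane_split:
  fixes F :: "'v set \<Rightarrow> 'b::comm_ring_1"
  assumes H: "fsub H" and a: "a \<notin> H"
  shows "(\<Sum>B | fsub B \<and> B \<subseteq> ext H a \<and> P (B \<inter> H). F B) =
    (\<Sum>Y | fsub Y \<and> Y \<subseteq> H \<and> P Y. F Y + (\<Sum>B | fsub B \<and> B \<subseteq> ext H a \<and> B \<inter> H = Y \<and> \<not> B \<subseteq> H. F B))"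
proof -
  let ?L = "{B. fsub B \<and> B \<subseteq> ext H a \<and> P (B \<inter> H)}"
  let ?Y = "{Y. fsub Y \<and> Y \<subseteq> H \<and> P Y}"
  have fin: "finite ?L" "finite ?Y" using finite_fsubs fsub_ext[OF H] H by (auto simp: fsub_def)
  have sub: "H \<subseteq> ext H a" using H by (rule ext_superset)
  have "(\<Sum>B\<in>?L. F B) = (\<Sum>Y\<in>?Y. \<Sum>B | B \<in> ?L \<and> B \<inter> H = Y. F B)"
    by (rule sum.group[symmetric]) (use fin fsub_Int H in auto)
  also have "\<dots> = (\<Sum>Y\<in>?Y. F Y + (\<Sum>B | fsub B \<and> B \<subseteq> ext H a \<and> B \<inter> H = Y \<and> \<not> B \<subseteq> H. F B))"
  proof (intro sum.cong refl)
    fix Y assume Y: "Y \<in> ?Y"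
    let ?R = "{B. fsub B \<and> B \<subseteq> ext H a \<and> B \<inter> H = Y \<and> \<not> B \<subseteq> H}"
    have "{B. B \<in> ?L \<and> B \<inter> H = Y} = insert Y ?R"
    proof -
      have "Y \<inter> H = Y" using Y by auto
      then show ?thesis using Y sub by auto
    qed
    moreover have "finite ?R" using finite_fsubs[of "ext H a"] fsub_ext[OF H] by (simp add: fsub_def)
    moreover have "Y \<notin> ?R" using Y by auto
    ultimately show "(\<Sum>B | B \<in> ?L \<and> B \<inter> H = Y. F B) = F Y + (\<Sum>B\<in>?R. F B)" by simp
  qed
  finally show ?thesis .
qed

lemma sum_indicator:
  "finite X \<Longrightarrow> (\<Sum>x\<in>X. if P x then c else 0) = of_nat (card {x \<in> X. P x}) * (c :: 'b::comm_ring_1)"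
  by (simp add: sum.inter_filter[symmetric])

text \<open>Such a \<open>B\<close> projects onto a subspace of codimension \<open>d\<close> in A /
  U, and over a given image it is the graph of a linear map into U / Y, which has dimension
  \<open>c\<close>. The induction enlarges \<open>A\<close> by one dimension at a time and
  reproduces the q-Pascal recursion.\<close>

lemma card_relative_complements:
  assumes "fsub A" "fsub U" "U \<subseteq> A" "card A = q ^ m * card U" and Y: "fsub Y" "Y \<subseteq> U" "card U = q ^ c * card Y"
  shows "of_nat (card {B. fsub B \<and> B \<subseteq> A \<and> B \<inter> U = Y \<and> card A = q ^ (c + d) * card B}) =
    gbinom (of_nat q) m d * (of_nat q ^ ((m - d) * c) :: 'b::{comm_ring_1,ring_char_0})"
  using assms(1-4)
proof (induction m arbitrary: A d)
  case 0
  then have AU: "U = A" using card_subset_eq[of A U] by (auto simp: fsub_def)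
  have "{B. fsub B \<and> B \<subseteq> A \<and> B \<inter> U = Y \<and> card A = q ^ (c + d) * card B} = (if d = 0 then {Y} else {})"
  proof -
    have cY: "card A = q ^ (c + d) * card Y \<longleftrightarrow> d = 0"
      using Y(3) q_power_cancel[of c "card Y" "c + d"] fsub_nonempty[OF Y(1)] AU by auto
    have BY: "B = Y" if "B \<subseteq> A" "B \<inter> U = Y" for B using that AU by auto
    show ?thesis
    proof (intro equalityI subsetI)
      fix B assume B: "B \<in> {B. fsub B \<and> B \<subseteq> A \<and> B \<inter> U = Y \<and> card A = q ^ (c + d) * card B}"
      then have "B = Y" using BY by blast
      then show "B \<in> (if d = 0 then {Y} else {})" using B cY by simp
    next
      fix B assume "B \<in> (if d = 0 then {Y} else {})"
      then have "B = Y" "d = 0" by (auto split: if_splits)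
      then show "B \<in> {B. fsub B \<and> B \<subseteq> A \<and> B \<inter> U = Y \<and> card A = q ^ (c + d) * card B}"
        using Y cY AU by auto
    qed
  qed
  then show ?case by (simp only:) (cases d; simp)
next
  case (Suc m)
  obtain H a where H: "fsub H" "U \<subseteq> H" "a \<notin> H" "A = ext H a" "card H = q ^ m * card U"
    by (rule ex_hyperplane[OF Suc.prems])
  have cA: "card A = q * card H" using card_ext H by simp
  have q0: "q > 0" using q_ge_2 by simp
  let ?X = "\<lambda>d. {B. fsub B \<and> B \<subseteq> H \<and> B \<inter> U = Y \<and> card H = q ^ (c + d) * card B}"
  let ?g = "\<lambda>d. gbinom (of_nat q) m d * (of_nat q ^ ((m - d) * c) :: 'b)"
  have IH: "of_nat (card (?X d)) = ?g d" for d using Suc.IH[OF H(1) Suc.prems(2) H(2) H(5)] .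
  have X: "{Z \<in> {Z. fsub Z \<and> Z \<subseteq> H \<and> Z \<inter> U = Y}. card H = q ^ (c + d) * card Z} = ?X d" for d by auto
  define ind where "ind B = (if card A = q ^ (c + d) * card B then 1 else 0 :: 'b)" for B :: "'v set"
  have fA: "finite A" "finite H" using Suc.prems H by (auto simp: fsub_def)
  have "of_nat (card {B. fsub B \<and> B \<subseteq> A \<and> B \<inter> U = Y \<and> card A = q ^ (c + d) * card B}) =
      (\<Sum>B | fsub B \<and> B \<subseteq> A \<and> B \<inter> U = Y. ind B)"
  proof -
    have "{B \<in> {B. fsub B \<and> B \<subseteq> A \<and> B \<inter> U = Y}. card A = q ^ (c + d) * card B} =
      {B. fsub B \<and> B \<subseteq> A \<and> B \<inter> U = Y \<and> card A = q ^ (c + d) * card B}" by auto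
    then show ?thesis unfolding ind_def by (subst sum_indicator[OF finite_fsubs[OF fA(1)]]) simp
  qed
  also have "\<dots> = (\<Sum>B | fsub B \<and> B \<subseteq> ext H a \<and> (B \<inter> H) \<inter> U = Y. ind B)"
    using H(2) by (intro sum.cong) (auto simp: H(4))
  also have "\<dots> = (\<Sum>Z | fsub Z \<and> Z \<subseteq> H \<and> Z \<inter> U = Y.
      ind Z + (\<Sum>B | fsub B \<and> B \<subseteq> ext H a \<and> B \<inter> H = Z \<and> \<not> B \<subseteq> H. ind B))"
    by (rule sum_hyperplane_split[OF H(1,3)])
  also have "\<dots> = (\<Sum>Z | fsub Z \<and> Z \<subseteq> H \<and> Z \<inter> U = Y. ind Z) +
      (\<Sum>Z | fsub Z \<and> Z \<subseteq> H \<and> Z \<inter> U = Y. if card H = q ^ (c + d) * card Z then of_nat q ^ (c + d) else 0)"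
    unfolding sum.distrib
  proof (intro arg_cong2[where f = "(+)"] refl sum.cong)
    fix Z assume "Z \<in> {Z. fsub Z \<and> Z \<subseteq> H \<and> Z \<inter> U = Y}"
    then have Z: "fsub Z" "Z \<subseteq> H" by auto
    let ?R = "{B. fsub B \<and> B \<subseteq> ext H a \<and> B \<inter> H = Z \<and> \<not> B \<subseteq> H}"
    obtain e where e: "card H = q ^ e * card Z" using ex_card_power[OF H(1) Z] by blast
    have "ind B = (if card H = q ^ (c + d) * card Z then 1 else 0)" if "B \<in> ?R" for B
      using card_hyperplane_complements(2)[OF H(1,3) Z e that] cA q0 by (simp add: ind_def)
    then have "(\<Sum>B\<in>?R. ind B) = (\<Sum>B\<in>?R. if card H = q ^ (c + d) * card Z then 1 else 0)" by simp
    also have "\<dots> = (if card H = q ^ (c + d) * card Z then of_nat (card ?R) else 0)" by simp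
    also have "card ?R = q ^ e" by (rule card_hyperplane_complements(1)[OF H(1,3) Z e])
    finally show "(\<Sum>B\<in>?R. ind B) = (if card H = q ^ (c + d) * card Z then of_nat q ^ (c + d) else 0)"
      using q_power_cancel[of e "card Z" "c + d"] e fsub_nonempty[OF Z(1)] by auto
  qed
  also have "(\<Sum>Z | fsub Z \<and> Z \<subseteq> H \<and> Z \<inter> U = Y. if card H = q ^ (c + d) * card Z then of_nat q ^ (c + d) else 0) =
      of_nat q ^ (c + d) * (of_nat (card (?X d)) :: 'b)"
    by (subst sum_indicator[OF finite_fsubs[OF fA(2)]], subst X) (rule mult.commute)
  \<comment> \<open>The codimension of a subspace of \<open>H\<close> is one less in
    \<open>H\<close> than in \<open>A\<close>; for \<open>d = 0\<close> it would be smaller than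
    \<open>c\<close>, the codimension of \<open>Y\<close> in \<open>U\<close>, which is
    impossible.\<close>
  also have "(\<Sum>Z | fsub Z \<and> Z \<subseteq> H \<and> Z \<inter> U = Y. ind Z) = (case d of 0 \<Rightarrow> 0 | Suc d' \<Rightarrow> of_nat (card (?X d')))"
  proof (cases d)
    case 0
    have "ind Z = 0" if Z: "fsub Z" "Z \<subseteq> H" "Z \<inter> U = Y" for Z
    proof (rule ccontr)
      assume "ind Z \<noteq> 0"
      then have e: "q * card H = q ^ c * card Z" using cA 0 by (simp add: ind_def split: if_splits)
      obtain e' where e': "card H = q ^ e' * card Z" using ex_card_power[OF H(1) Z(1,2)] by blast
      have "q ^ Suc e' * card Z = q ^ c * card Z" using e e' by auto
      then have "c = Suc e'" using q_power_cancel fsub_nonempty[OF Z(1)] by blast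
      moreover have "c \<le> e'"
        using codim_intersection_bounds(1)[OF H(1) Suc.prems(2) H(2) Z(1) H(5), of c e'] Y(3) Z e' by (simp add: Int_absorb1 Int_commute)
      ultimately show False by simp
    qed
    then show ?thesis using 0 by (auto intro!: sum.neutral)
  next
    case (Suc d')
    have "ind Z = (if card H = q ^ (c + d') * card Z then 1 else 0)" for Z
      using q0 unfolding ind_def cA Suc by simp
    then show ?thesis by (simp only: sum_indicator[OF finite_fsubs[OF fA(2)]] X Suc) simp
  qed
  finally have main: "of_nat (card {B. fsub B \<and> B \<subseteq> A \<and> B \<inter> U = Y \<and> card A = q ^ (c + d) * card B}) =
      (case d of 0 \<Rightarrow> 0 | Suc d' \<Rightarrow> ?g d') + of_nat q ^ (c + d) * ?g d"
    by (simp only: IH)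
  show ?case
  proof (cases d)
    case 0
    then show ?thesis unfolding main by (simp add: power_add)
  next
    case (Suc d')
    show ?thesis
    proof (cases "d \<le> m")
      case True
      then have "m - d' = Suc (m - d)" using Suc by simp
      then show ?thesis unfolding main using Suc by (simp add: algebra_simps power_add)
    next
      case False
      then have "gbinom (of_nat q :: 'b) m d = 0" by (intro gbinom_eq_0) simp
      then show ?thesis unfolding main using Suc by simp
    qed
  qed
qed

text \<open>\<open>B\<close> is built up through its intersections with the members of the chain,
  and each step is an instance of \<open>card_relative_complements\<close>. \<open>D v\<close> is
  the codimension of the intersection in \<open>A v\<close>, so step \<open>v\<close> involves the
  value reached before it.\<close>

theorem card_chain_subspaces:
  fixes A :: "nat \<Rightarrow> 'v set"
  assumes "\<And>v. fsub (A v)" "\<And>v. A v \<subseteq> A (Suc v)" "\<And>v. card (A (Suc v)) = q ^ m v * card (A v)"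
    and "D 0 = 0" "\<And>v. D (Suc v) = D v + d v"
  shows "of_nat (card {B. fsub B \<and> B \<subseteq> A K \<and> A 0 \<subseteq> B \<and> (\<forall>v\<le>K. card (A v) = q ^ D v * card (A v \<inter> B))}) =
    (\<Prod>v<K. gbinom (of_nat q) (m v) (d v) * (of_nat q ^ ((m v - d v) * D v) :: 'b::{comm_ring_1,ring_char_0}))"
proof (induction K)
  case 0
  have "{B. fsub B \<and> B \<subseteq> A 0 \<and> A 0 \<subseteq> B \<and> (\<forall>v\<le>0. card (A v) = q ^ D v * card (A v \<inter> B))} = {A 0}"
    using assms by auto
  then show ?case by simp
next
  case (Suc K)
  let ?X = "\<lambda>K. {B. fsub B \<and> B \<subseteq> A K \<and> A 0 \<subseteq> B \<and> (\<forall>v\<le>K. card (A v) = q ^ D v * card (A v \<inter> B))}"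
  let ?R = "\<lambda>Y. {B. fsub B \<and> B \<subseteq> A (Suc K) \<and> B \<inter> A K = Y \<and> card (A (Suc K)) = q ^ (D K + d K) * card B}"
  have mono: "A v \<subseteq> A w" if "v \<le> w" for v w using lift_Suc_mono_le[of A v w] assms(2) that by blast
  have fin: "finite (A v)" for v using assms(1) by (simp add: fsub_def)
  have finX: "finite (?X K)" for K by (rule finite_fsubs[OF fin])
  have memX: "B \<inter> A K \<in> ?X K" if "B \<in> ?X (Suc K)" for B
  proof -
    have "A v \<inter> (B \<inter> A K) = A v \<inter> B" if "v \<le> K" for v using mono[OF that] by auto
    then show ?thesis using that fsub_Int assms(1) mono[of 0 K] by auto
  qed
  have fib: "{B \<in> ?X (Suc K). B \<inter> A K = Y} = ?R Y" if Y: "Y \<in> ?X K" for Y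
  proof (intro equalityI subsetI)
    fix B assume B: "B \<in> {B \<in> ?X (Suc K). B \<inter> A K = Y}"
    then have "A (Suc K) \<inter> B = B" by auto
    then show "B \<in> ?R Y" using B assms(5) by auto
  next
    fix B assume B: "B \<in> ?R Y"
    have "card (A v) = q ^ D v * card (A v \<inter> B)" if v: "v \<le> Suc K" for v
    proof (cases "v = Suc K")
      case True
      have "A (Suc K) \<inter> B = B" using B by auto
      then show ?thesis using B True assms(5) by simp
    next
      case False
      then have vK: "v \<le> K" using v by simp
      have "A v \<inter> B = A v \<inter> Y" using mono[OF vK] B by auto
      then show ?thesis using Y vK by auto
    qed
    then show "B \<in> {B \<in> ?X (Suc K). B \<inter> A K = Y}" using B Y by auto
  qed
  have "card (?X (Suc K)) = (\<Sum>Y\<in>?X K. card {B \<in> ?X (Suc K). B \<inter> A K = Y})"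
  proof -
    have "(\<lambda>B. B \<inter> A K) ` ?X (Suc K) \<subseteq> ?X K" using memX by blast
    from sum.group[OF finX finX this, of "\<lambda>_. 1 :: nat"] show ?thesis by simp
  qed
  also have "\<dots> = (\<Sum>Y\<in>?X K. card (?R Y))" using fib by (intro sum.cong refl) simp
  finally have "of_nat (card (?X (Suc K))) = (\<Sum>Y\<in>?X K. of_nat (card (?R Y)) :: 'b)" by simp
  also have "\<dots> = (\<Sum>Y\<in>?X K. gbinom (of_nat q) (m K) (d K) * of_nat q ^ ((m K - d K) * D K))"
  proof (intro sum.cong refl)
    fix Y assume "Y \<in> ?X K"
    then have Y: "fsub Y" "Y \<subseteq> A K" "card (A K) = q ^ D K * card (A K \<inter> Y)" by auto
    then have "card (A K) = q ^ D K * card Y" by (simp add: Int_absorb1)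
    then show "of_nat (card (?R Y)) = gbinom (of_nat q) (m K) (d K) * (of_nat q ^ ((m K - d K) * D K) :: 'b)"
      by (intro card_relative_complements assms Y)
  qed
  finally show ?case using Suc.IH by (simp add: mult.commute)
qed

text \<open>The Moebius function of the lattice of subspaces, in terms of the codimension i. For a
  finite subspace \<open>B\<close> the index set has at most one element.\<close>

definition mobius :: "'v set \<Rightarrow> 'v set \<Rightarrow> real" where
  "mobius S B = (\<Sum>i | card S = q ^ i * card B. (- 1) ^ i * real q ^ (i choose 2))"

lemma mobius_eq: "fsub B \<Longrightarrow> card S = q ^ i * card B \<Longrightarrow> mobius S B = (- 1) ^ i * real q ^ (i choose 2)"
proof -
  assume a: "fsub B" "card S = q ^ i * card B"
  then have "{i. card S = q ^ i * card B} = {i}"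
    using q_power_cancel[of _ "card B" i] fsub_nonempty by fastforce
  then show ?thesis by (simp add: mobius_def)
qed

text \<open>Group by the intersection \<open>Y\<close> with a hyperplane \<open>H\<close> containing
  \<open>Q\<close>. If \<open>Y\<close> has codimension c in \<open>H\<close>, the term of
  \<open>Y\<close> itself, of codimension c + 1 in \<open>S\<close>, cancels the q^c terms of
  codimension c, because (c+1 choose 2) = c + (c choose 2).\<close>

theorem sum_mobius:
  assumes S: "fsub S" and Q: "fsub Q" "Q \<subseteq> S" "Q \<noteq> S"
  shows "(\<Sum>B | fsub B \<and> B \<subseteq> S \<and> Q \<subseteq> B. mobius S B) = 0"
proof -
  obtain k where k: "card S = q ^ k * card Q" using ex_card_power[OF S Q(1,2)] by blast
  have "k \<noteq> 0" using k Q S card_subset_eq[of S Q] by (auto simp: fsub_def)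
  then obtain m where "k = Suc m" by (cases k) auto
  then obtain H a where H: "fsub H" "Q \<subseteq> H" "a \<notin> H" "S = ext H a"
    using ex_hyperplane[OF S Q(1,2)] k by metis
  have cS: "card S = q * card H" using card_ext H by simp
  have "(\<Sum>B | fsub B \<and> B \<subseteq> S \<and> Q \<subseteq> B. mobius S B) = (\<Sum>B | fsub B \<and> B \<subseteq> ext H a \<and> Q \<subseteq> B \<inter> H. mobius S B)"
    using H by (intro sum.cong) auto
  also have "\<dots> = (\<Sum>Y | fsub Y \<and> Y \<subseteq> H \<and> Q \<subseteq> Y.
      mobius S Y + (\<Sum>B | fsub B \<and> B \<subseteq> ext H a \<and> B \<inter> H = Y \<and> \<not> B \<subseteq> H. mobius S B))"
    by (rule sum_hyperplane_split[OF H(1,3)])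
  also have "\<dots> = 0"
  proof (intro sum.neutral ballI)
    fix Y assume "Y \<in> {Y. fsub Y \<and> Y \<subseteq> H \<and> Q \<subseteq> Y}"
    then have Y: "fsub Y" "Y \<subseteq> H" by auto
    obtain c where c: "card H = q ^ c * card Y" using ex_card_power[OF H(1) Y] by blast
    let ?R = "{B. fsub B \<and> B \<subseteq> ext H a \<and> B \<inter> H = Y \<and> \<not> B \<subseteq> H}"
    have "mobius S B = (- 1) ^ c * real q ^ (c choose 2)" if B: "B \<in> ?R" for B
    proof (rule mobius_eq)
      show "card S = q ^ c * card B"
        using card_hyperplane_complements(2)[OF H(1,3) Y c B] cS c by simp
    qed (use B in auto)
    then have "(\<Sum>B\<in>?R. mobius S B) = real (card ?R) * ((- 1) ^ c * real q ^ (c choose 2))" by simp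
    also have "card ?R = q ^ c" by (rule card_hyperplane_complements(1)[OF H(1,3) Y c])
    also have "mobius S Y = (- 1) ^ Suc c * real q ^ (Suc c choose 2)"
      using cS c by (intro mobius_eq Y) simp
    moreover have "Suc c choose 2 = c + (c choose 2)" by (simp add: numeral_2_eq_2)
    ultimately show "mobius S Y + (\<Sum>B\<in>?R. mobius S B) = 0" by (simp add: power_add)
  qed
  finally show ?thesis .
qed

end

subsection \<open>Specialization of the parameter\<close>

definition eval_at :: "real \<Rightarrow> int poly \<Rightarrow> real" where
  "eval_at t p = poly (map_poly of_int p) t"

lemma eval_at_simps [simp]: "eval_at t 0 = 0" "eval_at t 1 = 1" "eval_at t (a + b) = eval_at t a + eval_at t b"
  "eval_at t (a * b) = eval_at t a * eval_at t b"
  by (simp_all add: eval_at_def hom_distribs)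

lemma eval_at_of_nat [simp]: "eval_at t (of_nat n) = of_nat n"
  by (induction n) auto

lemma eval_at_sum: "eval_at t (\<Sum>x\<in>A. f x) = (\<Sum>x\<in>A. eval_at t (f x))"
  by (induction A rule: infinite_finite_induct) auto

lemma eval_at_power [simp]: "eval_at t (a ^ k) = eval_at t a ^ k"
  by (induction k) auto

lemma eval_at_X [simp]: "eval_at t [:0, 1:] = t"
  by (simp add: eval_at_def)

lemma eval_at_gbinom: "eval_at t (gbinom [:0, 1:] m k) = gbinom t m k"
  by (induction t m k rule: gbinom.induct) (auto simp del: power_Suc)

lemma eval_at_pieri_coeff: "eval_at t (pieri_coeff [:0, 1:] d g) = pieri_coeff t d g"
proof -
  have "eval_at t (\<Prod>v<n. gbinom [:0, 1:] (d v - d (Suc v)) (d v - g v)) = (\<Prod>v<n. gbinom t (d v - d (Suc v)) (d v - g v))" for n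
    by (induction n) (auto simp: eval_at_gbinom)
  then show ?thesis by (simp add: pieri_coeff_def)
qed

lemma kostka_foulkes_at_eval: "kostka_foulkes_at lam rho t = eval_at t (kostka_foulkes lam rho)"
  by (simp add: kostka_foulkes_at_def eval_at_def)

text \<open>Coefficients in the Hall-Littlewood basis are unique on \<open>partitions n\<close>;
  extensionality fixes the rest, so the definite description is met by exactly one function.\<close>

lemma schur_kostka_foulkes:
  assumes lam: "lam \<in> partitions n"
  shows "schur lam = (\<lambda>m. \<Sum>rho\<in>partitions n. kostka_foulkes lam rho * hall_littlewood rho m)"
proof -
  interpret hl: strip_family hall_littlewood by (rule strip_family_hall_littlewood)
  have n: "sum_list lam = n" using lam by (simp add: partitions_def)
  obtain c where c: "schur lam = (\<lambda>m. \<Sum>rho\<in>partitions n. c rho * hall_littlewood rho m)"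
    by (rule hl.expand[OF symmetric_schur[OF lam] homogeneous_schur[OF lam]])
  let ?P = "\<lambda>K. K \<in> extensional (partitions n) \<and> schur lam = (\<lambda>m. \<Sum>rho\<in>partitions n. K rho * hall_littlewood rho m)"
  have "?P (restrict c (partitions n))" by (simp add: c)
  moreover have "K = restrict c (partitions n)" if K: "?P K" for K
  proof (rule extensionalityI[of _ "partitions n"])
    fix rho assume "rho \<in> partitions n"
    then show "K rho = restrict c (partitions n) rho"
      using hl.unique_coefficients[where n = n and c = K and d = c and lam = rho] K c by simp
  qed (use K in auto)
  ultimately have "?P (THE K. ?P K)" by (rule theI)
  then show ?thesis unfolding kostka_foulkes_def n by blast
qed

definition hl_real :: "real \<Rightarrow> nat list \<Rightarrow> real series" where
  "hl_real t rho = (\<lambda>m. eval_at t (hall_littlewood rho m))"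

text \<open>The axioms are equations between coefficients and survive a ring homomorphism. The
  specialized functions thus form a basis for every real \<open>t\<close>.\<close>

lemma strip_family_hl_real: "strip_family (hl_real t)"
proof -
  interpret hl: strip_family hall_littlewood by (rule strip_family_hall_littlewood)
  show ?thesis
  proof
    fix lam n m assume lam: "lam \<in> partitions n"
    show "symmetric_series (hl_real t lam)"
      using hl.sym[OF lam] by (simp add: symmetric_series_def hl_real_def)
    show "homogeneous n (hl_real t lam)"
      using hl.hom[OF lam] unfolding homogeneous_def hl_real_def by (metis eval_at_simps(1))
    show "hl_real t lam m = 0" if "card (vars m) < length lam"
      using hl.vanish[OF lam that] by (simp add: hl_real_def)
    show "hl_real t lam (m + ind {..<length lam}) = hl_real t (strip_col lam) m" if "vars m \<subseteq> {..<length lam}"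
      using hl.strip[OF lam that] by (simp add: hl_real_def)
  qed (simp add: hl_real_def hl.base)
qed

lemma schur_hl_real:
  assumes "lam \<in> partitions n"
  shows "schur lam = (\<lambda>m. \<Sum>rho\<in>partitions n. kostka_foulkes_at lam rho t * hl_real t rho m)"
proof
  fix m
  have "schur lam m = eval_at t (schur lam m)" by (simp add: schur_def)
  also have "\<dots> = (\<Sum>rho\<in>partitions n. kostka_foulkes_at lam rho t * hl_real t rho m)"
    by (simp add: schur_kostka_foulkes[OF assms] eval_at_sum kostka_foulkes_at_eval hl_real_def)
  finally show "schur lam m = (\<Sum>rho\<in>partitions n. kostka_foulkes_at lam rho t * hl_real t rho m)" .
qed

lemma hl_real_pieri:
  assumes "nu \<in> partitions n"
  shows "mult_e r (hl_real t nu) = (\<lambda>m. \<Sum>rho | rho \<in> partitions (n + r) \<and> columns nu \<in> remove_strip (columns rho) r.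
    pieri_coeff t (columns rho) (columns nu) * hl_real t rho m)"
proof
  fix m
  have "mult_e r (hl_real t nu) m = eval_at t (mult_e r (hall_littlewood nu) m)"
    by (simp add: mult_e_def hl_real_def eval_at_sum)
  then show "mult_e r (hl_real t nu) m = (\<Sum>rho | rho \<in> partitions (n + r) \<and> columns nu \<in> remove_strip (columns rho) r.
    pieri_coeff t (columns rho) (columns nu) * hl_real t rho m)"
    by (simp add: hall_littlewood_pieri[OF assms] eval_at_sum eval_at_pieri_coeff hl_real_def)
qed

text \<open>The coefficient of P_rho(x; t) in h_mu, by \<open>h_prod_hl\<close>.\<close>

definition h_coeff :: "real \<Rightarrow> nat list \<Rightarrow> nat list \<Rightarrow> real" where
  "h_coeff t mu rho = (\<Sum>lam\<in>partitions (sum_list mu). real (kostka lam mu) * kostka_foulkes_at lam rho t)"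

lemma h_prod_hl:
  "h_prod mu = (\<lambda>m. \<Sum>rho\<in>partitions (sum_list mu). h_coeff t mu rho * hl_real t rho m)"
proof
  fix m
  let ?P = "partitions (sum_list mu)"
  have "h_prod mu m = (\<Sum>lam\<in>?P. real (kostka lam mu) * schur lam m)" by (simp add: h_prod_schur)
  also have "\<dots> = (\<Sum>lam\<in>?P. \<Sum>rho\<in>?P. real (kostka lam mu) * kostka_foulkes_at lam rho t * hl_real t rho m)"
    by (intro sum.cong refl) (simp add: schur_hl_real[where t = t] sum_distrib_left mult.assoc)
  also have "\<dots> = (\<Sum>rho\<in>?P. h_coeff t mu rho * hl_real t rho m)"
    by (subst sum.swap) (simp add: h_coeff_def sum_distrib_right)
  finally show "h_prod mu m = (\<Sum>rho\<in>?P. h_coeff t mu rho * hl_real t rho m)" .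
qed

lemma h_coeff_Nil: "h_coeff t [] [] = 1"
proof -
  have "h_coeff t [] [] * hl_real t [] 0 = 1"
    using fun_cong[OF h_prod_hl[of "[]" t], of 0] by (simp add: h_prod_def series_one_def)
  then show ?thesis using strip_family.base[OF strip_family_hl_real] by simp
qed

lemma h_coeff_snoc_0: assumes "rho \<in> partitions (sum_list mu)" shows "h_coeff t (mu @ [0]) rho = h_coeff t mu rho"
proof -
  have "mult_h 0 f = (f :: real series)" for f
  proof
    fix m
    have "{a. a \<in> below m \<and> mdeg a = 0} = {0}" by (auto simp: mdeg_eq_0_iff below_def)
    then show "mult_h 0 f m = f m" by (simp add: mult_h_def)
  qed
  then have "h_prod (mu @ [0]) = (h_prod mu :: real series)" by (simp add: h_prod_def)
  then show ?thesis
    using strip_family.unique_coefficients[OF strip_family_hl_real, where n = "sum_list mu" and c = "h_coeff t (mu @ [0])"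
        and d = "h_coeff t mu" and lam = rho]
      h_prod_hl[of "mu @ [0]" t] h_prod_hl[of mu t] assms by simp
qed

text \<open>The coefficient of P_rho in \<Sum> (-1)^i e_i h_(r-i) h_mu = 0. Its term i = 0 is
  \<open>h_coeff t (mu @ [r]) rho\<close>, which is thereby expressed through smaller last
  parts.\<close>

lemma h_coeff_recursion:
  assumes r: "r \<ge> 1" and rho: "rho \<in> partitions (sum_list mu + r)"
  shows "(\<Sum>i\<le>r. (- 1) ^ i * (\<Sum>nu | nu \<in> partitions (sum_list mu + (r - i)) \<and> columns nu \<in> remove_strip (columns rho) i.
    pieri_coeff t (columns rho) (columns nu) * h_coeff t (mu @ [r - i]) nu)) = 0"
proof -
  let ?n = "sum_list mu"
  let ?Q = "\<lambda>i nu rho. columns nu \<in> remove_strip (columns rho) i"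
  let ?c = "\<lambda>rho. \<Sum>i\<le>r. (- 1) ^ i * (\<Sum>nu | nu \<in> partitions (?n + (r - i)) \<and> ?Q i nu rho.
    pieri_coeff t (columns rho) (columns nu) * h_coeff t (mu @ [r - i]) nu)"
  have "0 = (\<Sum>rho\<in>partitions (?n + r). ?c rho * hl_real t rho m)" for m
  proof -
    have e: "mult_e i (mult_h (r - i) (h_prod mu)) m =
        (\<Sum>rho\<in>partitions (?n + r). (\<Sum>nu | nu \<in> partitions (?n + (r - i)) \<and> ?Q i nu rho.
          pieri_coeff t (columns rho) (columns nu) * h_coeff t (mu @ [r - i]) nu) * hl_real t rho m)" if i: "i \<le> r" for i
    proof -
      have "mult_h (r - i) (h_prod mu) = (h_prod (mu @ [r - i]) :: real series)" by (simp add: h_prod_def)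
      also have "\<dots> = (\<lambda>m. \<Sum>nu\<in>partitions (?n + (r - i)). h_coeff t (mu @ [r - i]) nu * hl_real t nu m)"
        using h_prod_hl[of "mu @ [r - i]" t] by simp
      finally have "mult_e i (mult_h (r - i) (h_prod mu)) m =
          (\<Sum>nu\<in>partitions (?n + (r - i)). h_coeff t (mu @ [r - i]) nu * mult_e i (hl_real t nu) m)"
        by (simp add: mult_e_sum)
      also have "\<dots> = (\<Sum>nu\<in>partitions (?n + (r - i)). \<Sum>rho | rho \<in> partitions (?n + r) \<and> ?Q i nu rho.
          pieri_coeff t (columns rho) (columns nu) * h_coeff t (mu @ [r - i]) nu * hl_real t rho m)"
        using i by (intro sum.cong refl) (simp add: hl_real_pieri sum_distrib_left mult_ac)
      also have "\<dots> = (\<Sum>rho\<in>partitions (?n + r). \<Sum>nu | nu \<in> partitions (?n + (r - i)) \<and> ?Q i nu rho.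
          pieri_coeff t (columns rho) (columns nu) * h_coeff t (mu @ [r - i]) nu * hl_real t rho m)"
        by (rule sum.swap_restrict) auto
      finally show ?thesis by (simp add: sum_distrib_right)
    qed
    have "0 = (\<Sum>i\<le>r. (- 1) ^ i * mult_e i (mult_h (r - i) (h_prod mu)) m :: real)"
      by (rule sum_elementary_complete[OF r, symmetric])
    also have "\<dots> = (\<Sum>i\<le>r. \<Sum>rho\<in>partitions (?n + r). (- 1) ^ i * (\<Sum>nu | nu \<in> partitions (?n + (r - i)) \<and> ?Q i nu rho.
          pieri_coeff t (columns rho) (columns nu) * h_coeff t (mu @ [r - i]) nu) * hl_real t rho m)"
      by (intro sum.cong refl) (simp only: e atMost_iff, subst sum_distrib_left, simp only: mult.assoc)
    also have "\<dots> = (\<Sum>rho\<in>partitions (?n + r). ?c rho * hl_real t rho m)"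
      by (subst sum.swap) (simp add: sum_distrib_right)
    finally show ?thesis .
  qed
  then have "(\<lambda>m. \<Sum>rho\<in>partitions (?n + r). ?c rho * hl_real t rho m) = (\<lambda>m. \<Sum>rho\<in>partitions (?n + r). 0 * hl_real t rho m)"
    by (simp add: fun_eq_iff)
  from strip_family.unique_coefficients[OF strip_family_hl_real this rho] show ?thesis .
qed

definition from_columns :: "(nat \<Rightarrow> nat) \<Rightarrow> nat list" where
  "from_columns g = inv_into (partitions (fsize g)) columns g"

lemma from_columns:
  assumes "par g" shows "from_columns g \<in> partitions (fsize g)" "columns (from_columns g) = g"
proof -
  have "g \<in> columns ` partitions (fsize g)" using bij_columns[of "fsize g"] assms by (auto simp: bij_betw_def)
  then show "from_columns g \<in> partitions (fsize g)" "columns (from_columns g) = g"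
    by (auto simp: from_columns_def inv_into_into f_inv_into_f)
qed

lemma from_columns_columns: "lam \<in> partitions n \<Longrightarrow> from_columns (columns lam) = lam"
  using from_columns[OF columns_par(1), of lam n] columns_par(2)[of lam n] columns_inject by metis

text \<open>Indexed by column lengths, the form in which Jordan types arise from
  \<open>jtype\<close>.\<close>

definition h_col :: "real \<Rightarrow> nat list \<Rightarrow> (nat \<Rightarrow> nat) \<Rightarrow> real" where
  "h_col t mu g = h_coeff t mu (from_columns g)"

lemma h_col_recursion:
  assumes r: "r \<ge> 1" and d: "par d" "fsize d = sum_list mu + r"
  shows "(\<Sum>i\<le>r. (- 1) ^ i * (\<Sum>g\<in>remove_strip d i. pieri_coeff t d g * h_col t (mu @ [r - i]) g)) = 0"
proof -
  let ?rho = "from_columns d"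
  have rho: "?rho \<in> partitions (sum_list mu + r)" "columns ?rho = d" using from_columns[OF d(1)] d(2) by auto
  have "(\<Sum>g\<in>remove_strip d i. pieri_coeff t d g * h_col t (mu @ [r - i]) g) =
      (\<Sum>nu | nu \<in> partitions (sum_list mu + (r - i)) \<and> columns nu \<in> remove_strip d i.
        pieri_coeff t d (columns nu) * h_coeff t (mu @ [r - i]) nu)" if i: "i \<le> r" for i
  proof (rule sum.reindex_bij_witness[of _ columns from_columns])
    fix g assume g: "g \<in> remove_strip d i"
    then have "par g" "fsize g = sum_list mu + (r - i)" using remove_strip_par remove_stripD(4)[OF g] d(2) i by auto
    then show "from_columns g \<in> {nu. nu \<in> partitions (sum_list mu + (r - i)) \<and> columns nu \<in> remove_strip d i}"
      "columns (from_columns g) = g" using from_columns[of g] g by auto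
    then show "pieri_coeff t d (columns (from_columns g)) * h_coeff t (mu @ [r - i]) (from_columns g) =
        pieri_coeff t d g * h_col t (mu @ [r - i]) g" by (simp add: h_col_def)
  qed (auto simp: from_columns_columns)
  then show ?thesis using h_coeff_recursion[OF r rho(1), of t] by (simp add: rho(2))
qed

subsection \<open>Powers of the order of the field\<close>

text \<open>The statistic n(rho) read off from the columns of rho, see
  \<open>n_stat_columns\<close>.\<close>

definition nst :: "(nat \<Rightarrow> nat) \<Rightarrow> nat" where
  "nst g = (\<Sum>v<fsize g. g v choose 2)"

lemma nst_eq: assumes "par g" "g M = 0" shows "nst g = (\<Sum>v<M. g v choose 2)"
proof -
  have "(\<Sum>v<K. g v choose 2) = (\<Sum>v | v < K \<and> g v \<noteq> 0. g v choose 2)" for K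
    by (intro sum.mono_neutral_right) auto
  moreover have "{v. v < fsize g \<and> g v \<noteq> 0} = {v. v < M \<and> g v \<noteq> 0}"
  proof -
    have "v < fsize g \<and> v < M" if "g v \<noteq> 0" for v
      using that par_tail[OF assms(1) par_zero_from[OF assms(1)], of v] par_tail[OF assms, of v] by (meson not_le)
    then show ?thesis by auto
  qed
  ultimately show ?thesis by (simp add: nst_def)
qed

lemma choose_two_add: "(a + b choose 2) = (a choose 2) + (b choose 2) + a * b"
  by (induction b) (auto simp: numeral_2_eq_2)

text \<open>\<open>D\<close> adds up the strip sizes of the preceding columns. The identity compares
  n of the larger and of the smaller partition with the exponents of q that occur in counting
  subspaces. The form with partial sums is inductive; its boundary term \<open>g K * D K\<close>
  vanishes once \<open>g K = 0\<close>.\<close>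

lemma nst_exponent_identity:
  assumes "D 0 = 0" "\<And>v. D (Suc v) = D v + (g v - g' v)" "\<And>v. g (Suc v) \<le> g' v" "\<And>v. g' v \<le> g v"
  shows "(\<Sum>v<K. g v choose 2) + 0 =
    (D K choose 2) + (\<Sum>v<K. g' v choose 2) + (\<Sum>v<K. (g' v - g (Suc v)) * D (Suc v)) + g K * D K"
proof (induction K)
  case 0
  then show ?case using assms(1) by (simp add: numeral_2_eq_2)
next
  case (Suc K)
  obtain d where d: "g K = g' K + d" using assms(4) le_Suc_ex by blast
  obtain e where e: "g' K = g (Suc K) + e" using assms(3) le_Suc_ex by blast
  have D: "D (Suc K) = D K + d" using assms(2)[of K] d by simp
  show ?case using Suc unfolding sum.lessThan_Suc D
    by (simp add: d choose_two_add e algebra_simps)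
qed

lemma qfact_inverse:
  fixes q :: real assumes "q > 1"
  shows "qfact q m = q ^ (m choose 2) * qfact (1 / q) m"
proof (induction m)
  case (Suc m)
  have "(1 - q ^ Suc m) / (1 - q) = q ^ m * ((1 - (1 / q) ^ Suc m) / (1 - 1 / q))"
    using assms by (simp add: field_simps power_divide)
  then show ?case by (simp add: qfact_Suc Suc numeral_2_eq_2 power_add del: power_Suc)
qed (simp add: numeral_2_eq_2)

text \<open>Counting yields Gaussian binomials at q, Hall-Littlewood functions yield them at 1/q.
  The exponents from \<open>qfact_inverse\<close> combine to k (m - k) by
  \<open>choose_two_add\<close>.\<close>

lemma gbinom_inverse:
  fixes q :: real assumes q: "q > 1" and k: "k \<le> m"
  shows "gbinom q m k = q ^ (k * (m - k)) * gbinom (1 / q) m k"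
proof -
  have "(1 / q) ^ j < 1" if "j \<ge> 1" for j using q that by (simp add: power_divide)
  then have "qfact (1 / q) j \<noteq> 0" for j using q by (force simp: qfact_def)
  moreover have "1 / q \<noteq> 1" using q by simp
  ultimately have 1: "gbinom (1 / q) m k = qfact (1 / q) m / (qfact (1 / q) k * qfact (1 / q) (m - k))"
    using gbinom_qfact[of "1 / q" k m] k by (simp add: field_simps)
  have nz: "qfact q j \<noteq> 0" for j unfolding qfact_inverse[OF q] using \<open>\<And>j. qfact (1 / q) j \<noteq> 0\<close> q by simp
  have "gbinom q m k = qfact q m / (qfact q k * qfact q (m - k))"
    using gbinom_qfact[of q k m] k q nz by (simp add: field_simps)
  also have "\<dots> = q ^ (m choose 2) / (q ^ (k choose 2) * q ^ (m - k choose 2)) * gbinom (1 / q) m k"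
    unfolding 1 qfact_inverse[OF q] by simp
  also have "(m choose 2) = (k choose 2) + (m - k choose 2) + k * (m - k)"
    using choose_two_add[of k "m - k"] k by simp
  finally show ?thesis using q by (simp add: power_add)
qed

subsection \<open>Nilpotent endomorphisms\<close>

text \<open>Only linearity is assumed of \<open>N\<close>; nilpotency is a property of the
  individual subspace and part of \<open>stable\<close>.\<close>

locale nilpotent_space = finite_field_space scale q
  for scale :: "'k::{field,finite} \<Rightarrow> 'v::ab_group_add \<Rightarrow> 'v" and q +
  fixes N :: "'v \<Rightarrow> 'v"
  assumes N_add: "N (x + y) = N x + N y" and N_scale: "N (scale c x) = scale c (N x)"
begin

lemma pow_add: "(N ^^ i) (x + y) = (N ^^ i) x + (N ^^ i) y"
  by (induction i) (auto simp: N_add)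

lemma pow_scale: "(N ^^ i) (scale c x) = scale c ((N ^^ i) x)"
  by (induction i) (auto simp: N_scale)

lemma pow_zero: "(N ^^ i) 0 = 0"
  using pow_add[of i 0 0] by simp

lemma pow_diff: "(N ^^ i) (x - y) = (N ^^ i) x - (N ^^ i) y"
  using pow_add[of i "x - y" y] by simp

definition img :: "nat \<Rightarrow> 'v set \<Rightarrow> 'v set" where "img i S = (N ^^ i) ` S"

lemma img_0 [simp]: "img 0 S = S" by (simp add: img_def)

lemma img_Suc: "img (Suc i) S = N ` img i S" "img (Suc i) S = img i (N ` S)"
proof -
  show "img (Suc i) S = N ` img i S" by (simp add: img_def image_comp)
  show "img (Suc i) S = img i (N ` S)" by (simp only: img_def funpow_Suc_right image_comp)
qed

lemma fsub_img: assumes "fsub S" shows "fsub (img i S)"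
proof -
  have s: "subspace S" using assms by (simp add: fsub_def)
  have "subspace (img i S)"
  proof (rule subspaceI)
    show "0 \<in> img i S" using subspace_0[OF s] pow_zero[of i] unfolding img_def by force
    show "x + y \<in> img i S" if xy: "x \<in> img i S" "y \<in> img i S" for x y
    proof -
      obtain x' y' where "x' \<in> S" "y' \<in> S" "x = (N ^^ i) x'" "y = (N ^^ i) y'" using xy by (auto simp: img_def)
      then show ?thesis using subspace_add[OF s, of x' y'] by (auto simp: img_def pow_add[symmetric])
    qed
    show "scale c x \<in> img i S" if x: "x \<in> img i S" for c x
    proof -
      obtain x' where "x' \<in> S" "x = (N ^^ i) x'" using x by (auto simp: img_def)
      then show ?thesis using subspace_scale[OF s, of x' c] by (auto simp: img_def pow_scale[symmetric])
    qed
  qed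
  then show ?thesis using assms by (simp add: fsub_def img_def)
qed

lemma img_mono: "A \<subseteq> B \<Longrightarrow> img i A \<subseteq> img i B" by (auto simp: img_def)

lemma card_preimage:
  assumes A: "fsub A" and B: "B \<subseteq> img i A"
  shows "card {x \<in> A. (N ^^ i) x \<in> B} = card B * card {x \<in> A. (N ^^ i) x = 0}"
proof -
  have s: "subspace A" "finite A" using A by (auto simp: fsub_def)
  have finB: "finite B" using B s by (auto intro: finite_subset simp: img_def)
  let ?X = "{x \<in> A. (N ^^ i) x \<in> B}"
  have "(N ^^ i) ` ?X \<subseteq> B" by auto
  then have "card ?X = (\<Sum>y\<in>B. card {x \<in> ?X. (N ^^ i) x = y})"
    using sum.group[of ?X B "N ^^ i" "\<lambda>_. 1 :: nat"] s finB by simp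
  also have "\<dots> = (\<Sum>y\<in>B. card {x \<in> A. (N ^^ i) x = 0})"
  proof (intro sum.cong refl)
    fix y assume y: "y \<in> B"
    then obtain a where a: "a \<in> A" "y = (N ^^ i) a" using B by (auto simp: img_def)
    have "{x \<in> ?X. (N ^^ i) x = y} = (\<lambda>z. a + z) ` {x \<in> A. (N ^^ i) x = 0}"
    proof (intro equalityI subsetI)
      fix x assume "x \<in> {x \<in> ?X. (N ^^ i) x = y}"
      then have "x - a \<in> {x \<in> A. (N ^^ i) x = 0}" using a s by (simp add: subspace_diff pow_diff)
      then show "x \<in> (\<lambda>z. a + z) ` {x \<in> A. (N ^^ i) x = 0}" by (intro image_eqI[of _ _ "x - a"]) auto
    next
      fix x assume "x \<in> (\<lambda>z. a + z) ` {x \<in> A. (N ^^ i) x = 0}"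
      then show "x \<in> {x \<in> ?X. (N ^^ i) x = y}" using a s y by (auto simp: subspace_add pow_add)
    qed
    then show "card {x \<in> ?X. (N ^^ i) x = y} = card {x \<in> A. (N ^^ i) x = 0}" by (simp add: card_image)
  qed
  finally show ?thesis by simp
qed

lemma card_img: "fsub A \<Longrightarrow> card A = card (img i A) * card {x \<in> A. (N ^^ i) x = 0}"
proof -
  assume A: "fsub A"
  have "{x \<in> A. (N ^^ i) x \<in> img i A} = A" by (auto simp: img_def)
  then show ?thesis using card_preimage[OF A order_refl, of i] by simp
qed

section \<open>Jordan types of subspaces\<close>

definition stable :: "'v set \<Rightarrow> bool" where
  "stable S \<longleftrightarrow> fsub S \<and> N ` S \<subseteq> S \<and> (\<exists>K. img K S \<subseteq> {0})"

lemma stable_fsub: "stable S \<Longrightarrow> fsub S" by (simp add: stable_def)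

lemma img_decreasing: "stable S \<Longrightarrow> img (Suc i) S \<subseteq> img i S"
  unfolding img_Suc(2) by (intro img_mono) (simp add: stable_def)

text \<open>The dimension of N^i S / N^(i+1) S, which is the number of Jordan blocks of size greater
  than \<open>i\<close>: these are the column lengths of the Jordan type.\<close>

definition jtype :: "'v set \<Rightarrow> nat \<Rightarrow> nat" where
  "jtype S i = (THE c. card (img i S) = q ^ c * card (img (Suc i) S))"

lemma jtype: assumes "stable S" shows "card (img i S) = q ^ jtype S i * card (img (Suc i) S)"
proof -
  have f: "fsub (img i S)" "fsub (img (Suc i) S)" using fsub_img stable_fsub assms by blast+
  obtain c where c: "card (img i S) = q ^ c * card (img (Suc i) S)"
    using ex_card_power[OF f img_decreasing[OF assms]] by blast
  then have "jtype S i = c" unfolding jtype_def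
    using q_power_cancel[of _ "card (img (Suc i) S)" c] fsub_nonempty[OF f(2)] by (intro the_equality) auto
  then show ?thesis using c by simp
qed

text \<open>For stable \<open>S\<close> this is the sum of N S and the kernel of N^v in
  \<open>S\<close>, so the layers form a chain from N S up to \<open>S\<close>. A subspace between N
  S and \<open>S\<close> has its type determined by its position relative to this chain.\<close>

definition layer :: "'v set \<Rightarrow> nat \<Rightarrow> 'v set" where
  "layer S v = {x \<in> S. (N ^^ v) x \<in> img (Suc v) S}"

lemma layer_subset: "layer S v \<subseteq> S" by (auto simp: layer_def)

lemma fsub_layer: assumes "fsub S" shows "fsub (layer S v)"
proof -
  have s: "subspace S" "subspace (img (Suc v) S)" using assms fsub_img[OF assms] by (auto simp: fsub_def)
  have "subspace (layer S v)"
    using s unfolding layer_def by (intro subspaceI) (auto simp: subspace_0 subspace_add subspace_scale pow_add pow_scale pow_zero)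
  then show ?thesis using fsub_subset[OF _ layer_subset assms] by simp
qed

lemma layer_0: "N ` S \<subseteq> S \<Longrightarrow> layer S 0 = N ` S"
  by (auto simp: layer_def img_def)

lemma layer_mono: "layer S v \<subseteq> layer S (Suc v)"
proof
  fix x assume "x \<in> layer S v"
  then have x: "x \<in> S" "(N ^^ v) x \<in> img (Suc v) S" by (auto simp: layer_def)
  then have "N ((N ^^ v) x) \<in> N ` img (Suc v) S" by blast
  then show "x \<in> layer S (Suc v)" using x(1) img_Suc(1)[of "Suc v" S] by (simp add: layer_def)
qed

lemma card_layer: assumes "stable S" shows "card S = q ^ jtype S v * card (layer S v)"
proof -
  have f: "fsub S" using assms by (rule stable_fsub)
  have "card (layer S v) = card (img (Suc v) S) * card {x \<in> S. (N ^^ v) x = 0}"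
    unfolding layer_def by (rule card_preimage[OF f img_decreasing[OF assms]])
  then show ?thesis using card_img[OF f, of v] jtype[OF assms, of v] by (simp add: mult.assoc)
qed

lemma jtype_layer:
  assumes "stable S"
  shows "jtype S (Suc v) \<le> jtype S v" "card (layer S (Suc v)) = q ^ (jtype S v - jtype S (Suc v)) * card (layer S v)"
proof -
  have f: "fsub S" using assms by (rule stable_fsub)
  obtain m where m: "card (layer S (Suc v)) = q ^ m * card (layer S v)"
    using ex_card_power[OF fsub_layer[OF f] fsub_layer[OF f] layer_mono] by blast
  have "q ^ (jtype S (Suc v) + m) * card (layer S v) = q ^ jtype S v * card (layer S v)"
    using card_layer[OF assms, of v] card_layer[OF assms, of "Suc v"] m by (simp add: power_add mult.assoc)
  then have "jtype S (Suc v) + m = jtype S v" using q_power_cancel fsub_nonempty[OF fsub_layer[OF f]] by blast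
  then have "jtype S (Suc v) \<le> jtype S v \<and> m = jtype S v - jtype S (Suc v)" by simp
  then show "jtype S (Suc v) \<le> jtype S v" "card (layer S (Suc v)) = q ^ (jtype S v - jtype S (Suc v)) * card (layer S v)"
    using m by simp_all
qed

lemma img_trivial: assumes "stable S" "img K S \<subseteq> {0}" "K \<le> v" shows "img v S = {0}"
  using assms(3)
proof (induction v rule: dec_induct)
  case base
  then show ?case using assms(2) fsub_nonempty[OF fsub_img[OF stable_fsub[OF assms(1)], of K]] by (metis card.empty subset_singletonD)
next
  case (step v)
  then show ?case using pow_zero[of 1] by (simp add: img_Suc(1))
qed

lemma jtype_zero: assumes "stable S" "img K S \<subseteq> {0}" "K \<le> v" shows "jtype S v = 0"
proof -
  have "1 = q ^ jtype S v" using jtype[OF assms(1), of v] img_trivial[OF assms] img_trivial[OF assms(1,2), of "Suc v"] assms(3) by simp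
  then show ?thesis using q_ge_2 by (metis One_nat_def Suc_1 le_zero_eq not_less_eq_eq one_less_power nat_neq_iff not_gr_zero Suc_le_lessD)
qed

lemma par_jtype: assumes "stable S" shows "par (jtype S)"
proof -
  obtain K where "img K S \<subseteq> {0}" using assms by (auto simp: stable_def)
  then have "fin_supp (jtype S)" using jtype_zero[OF assms] by (auto simp: fin_supp_def)
  then show ?thesis using jtype_layer(1)[OF assms] by (simp add: par_def)
qed

lemma card_fsize_jtype: assumes "stable S" shows "card S = q ^ fsize (jtype S)"
proof -
  obtain K where K: "img K S \<subseteq> {0}" using assms by (auto simp: stable_def)
  have "card S = q ^ (\<Sum>v<n. jtype S v) * card (img n S)" for n
  proof (induction n)
    case (Suc n)
    then show ?case using jtype[OF assms, of n] by (simp add: power_add mult.assoc)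
  qed simp
  from this[of K] have "card S = q ^ (\<Sum>v<K. jtype S v)" using img_trivial[OF assms K] by simp
  moreover have "fsize (jtype S) = (\<Sum>v<K. jtype S v)" using jtype_zero[OF assms K] by (intro fsize_eq) auto
  ultimately show ?thesis by simp
qed

lemma stable_between:
  assumes "stable S" "fsub B" "N ` S \<subseteq> B" "B \<subseteq> S" shows "stable B"
proof -
  obtain K where "img K S \<subseteq> {0}" using assms(1) by (auto simp: stable_def)
  then have "img K B \<subseteq> {0}" using img_mono[OF assms(4), of K] by (rule order_trans[rotated])
  moreover have "N ` B \<subseteq> B" using image_mono[OF assms(4), of N] assms(3) by (rule order_trans)
  ultimately show ?thesis using assms(2) by (auto simp: stable_def)
qed

text \<open>Since N S lies in \<open>B\<close>, the power N^v maps both \<open>layer S v\<close> and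
  its intersection with \<open>B\<close> onto N^(v+1) S. So \<open>D v\<close> is the codimension of
  the kernel of N^v in \<open>B\<close> inside its kernel in \<open>S\<close>, and together with the
  codimension \<open>c v\<close> of N^v B in N^v S it adds up to the codimension \<open>c 0\<close>
  of \<open>B\<close>.\<close>

lemma jtype_between:
  assumes S: "stable S" and B: "fsub B" "N ` S \<subseteq> B" "B \<subseteq> S"
  obtains D where "D 0 = 0" "\<And>v. card (layer S v) = q ^ D v * card (layer S v \<inter> B)"
    "\<And>v. D (Suc v) + jtype B v = D v + jtype S v" "\<And>v. D v \<le> D (Suc v)" "\<And>v. D (Suc v) \<le> D v + (jtype S v - jtype S (Suc v))"
proof -
  have sB: "stable B" by (rule stable_between[OF assms])
  have fS: "fsub S" using S by (rule stable_fsub)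
  have NS: "N ` S \<subseteq> S" using S by (simp add: stable_def)
  have "\<exists>c. card (img v S) = q ^ c * card (img v B)" for v
    using ex_card_power fsub_img[OF fS] fsub_img[OF B(1)] img_mono[OF B(3)] by blast
  then obtain c where c: "\<And>v. card (img v S) = q ^ c v * card (img v B)" by metis
  have "\<exists>D. card (layer S v) = q ^ D * card (layer S v \<inter> B)" for v
    using ex_card_power fsub_layer[OF fS] fsub_Int[OF fsub_layer[OF fS] B(1)] by blast
  then obtain D where D: "\<And>v. card (layer S v) = q ^ D v * card (layer S v \<inter> B)" by metis
  have rel: "c 0 = D v + c v" for v
  proof -
    let ?I = "card (img (Suc v) S)"
    have sub: "img (Suc v) S \<subseteq> img v B" unfolding img_Suc(2) by (rule img_mono[OF B(2)])
    have "layer S v \<inter> B = {x \<in> B. (N ^^ v) x \<in> img (Suc v) S}" using B(3) by (auto simp: layer_def)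
    then have 1: "card (layer S v \<inter> B) = ?I * card {x \<in> B. (N ^^ v) x = 0}" using card_preimage[OF B(1) sub] by simp
    have 2: "card (layer S v) = ?I * card {x \<in> S. (N ^^ v) x = 0}"
      unfolding layer_def by (rule card_preimage[OF fS img_decreasing[OF S]])
    let ?a = "card {x \<in> B. (N ^^ v) x = 0}" and ?b = "card {x \<in> S. (N ^^ v) x = 0}"
    have Inz: "?I \<noteq> 0" by (rule fsub_nonempty[OF fsub_img[OF fS]])
    have ba: "?b = q ^ D v * ?a" using D[of v] 1 2 Inz by simp
    have "q ^ c 0 * card B = card (img v S) * ?b" using c[of 0] card_img[OF fS, of v] by simp
    also have "\<dots> = q ^ (D v + c v) * (card (img v B) * ?a)" unfolding ba c[of v] by (simp add: power_add)
    also have "card (img v B) * ?a = card B" using card_img[OF B(1), of v] by simp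
    finally show ?thesis using q_power_cancel fsub_nonempty[OF B(1)] by blast
  qed
  have rel2: "jtype S v + c (Suc v) = c v + jtype B v" for v
  proof -
    have "q ^ (jtype S v + c (Suc v)) * card (img (Suc v) B) = q ^ (c v + jtype B v) * card (img (Suc v) B)"
      using jtype[OF S, of v] jtype[OF sB, of v] c[of v] c[of "Suc v"] by (auto simp: power_add mult_ac)
    then show ?thesis using q_power_cancel fsub_nonempty[OF fsub_img[OF B(1)]] by blast
  qed
  show thesis
  proof (rule that[of D])
    have "layer S 0 \<inter> B = layer S 0" using layer_0[OF NS] B(2) by auto
    then have "q ^ 0 * card (layer S 0) = q ^ D 0 * card (layer S 0)" using D[of 0] by simp
    then show "D 0 = 0" using q_power_cancel[of 0 "card (layer S 0)" "D 0"] fsub_nonempty[OF fsub_layer[OF fS]] by simp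
    show "card (layer S v) = q ^ D v * card (layer S v \<inter> B)" for v by (rule D)
    show "D (Suc v) + jtype B v = D v + jtype S v" for v
      using rel[of v] rel[of "Suc v"] rel2[of v] by simp
    show "D v \<le> D (Suc v)" "D (Suc v) \<le> D v + (jtype S v - jtype S (Suc v))" for v
      using codim_intersection_bounds[OF fsub_layer[OF fS] fsub_layer[OF fS] layer_mono B(1) jtype_layer(2)[OF S] D D] by auto
  qed
qed

text \<open>The increments of \<open>D\<close> are the differences of the two types, and the bounds
  on them say precisely that the types interlace.\<close>

lemma jtype_remove_strip:
  assumes S: "stable S" and B: "fsub B" "N ` S \<subseteq> B" "B \<subseteq> S" and i: "card S = q ^ i * card B"
  shows "jtype B \<in> remove_strip (jtype S) i"
proof -
  have sB: "stable B" by (rule stable_between[OF S B])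
  obtain D where D: "\<And>v. D (Suc v) + jtype B v = D v + jtype S v" "\<And>v. D v \<le> D (Suc v)" "\<And>v. D (Suc v) \<le> D v + (jtype S v - jtype S (Suc v))"
    by (rule jtype_between[OF S B]) blast
  have "jtype S (Suc v) \<le> jtype B v \<and> jtype B v \<le> jtype S v" for v
    using D(1)[of v] D(2)[of v] D(3)[of v] jtype_layer(1)[OF S, of v] by linarith
  moreover have "q ^ fsize (jtype S) * 1 = q ^ (fsize (jtype B) + i) * 1"
    using card_fsize_jtype[OF S] card_fsize_jtype[OF sB] i by (simp add: power_add mult.commute)
  then have "fsize (jtype S) = fsize (jtype B) + i" using q_power_cancel by blast
  ultimately show ?thesis using par_jtype[OF S] by (simp add: remove_strip_def hstrip_def par_def)
qed

text \<open>Prescribing the type \<open>g\<close> prescribes all codimensions relative to the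
  layers, so \<open>card_chain_subspaces\<close> applies; \<open>gbinom_inverse\<close> and
  \<open>nst_exponent_identity\<close> then account for the powers of q. Two of these stand on the
  left so that all exponents are natural numbers, and the factor q^(i choose 2) is the one occurring
  in the Moebius function.\<close>

lemma card_jtype:
  assumes S: "stable S" and g: "g \<in> remove_strip (jtype S) i"
  shows "real q ^ (i choose 2) * real (card {B. fsub B \<and> N ` S \<subseteq> B \<and> B \<subseteq> S \<and> jtype B = g}) * real q ^ nst g =
    real q ^ nst (jtype S) * pieri_coeff (1 / real q) (jtype S) g"
proof -
  let ?l = "jtype S"
  have fS: "fsub S" using S by (rule stable_fsub)
  have NS: "N ` S \<subseteq> S" using S by (simp add: stable_def)
  note dg = remove_stripD[OF g]
  have gl: "?l (Suc v) \<le> g v" "g v \<le> ?l v" for v using dg(1) by (auto simp: hstrip_def)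
  obtain K where K: "img K S \<subseteq> {0}" using S by (auto simp: stable_def)
  have lK: "?l v = 0" if "K \<le> v" for v by (rule jtype_zero[OF S K that])
  then have gK: "g v = 0" if "K \<le> v" for v using gl(2)[of v] that by simp
  define D where "D v = (\<Sum>u<v. ?l u - g u)" for v
  have D: "D 0 = 0" "\<And>v. D (Suc v) = D v + (?l v - g v)" by (simp_all add: D_def)
  define m where "m v = ?l v - ?l (Suc v)" for v
  define d where "d v = ?l v - g v" for v
  have layerK: "layer S K = S"
  proof -
    have "(N ^^ K) x \<in> img (Suc K) S" if "x \<in> S" for x
      using img_trivial[OF S K, of K] img_trivial[OF S K, of "Suc K"] that by (auto simp: img_def)
    then show ?thesis by (auto simp: layer_def)
  qed
  \<comment> \<open>From index \<open>K\<close> on the layer is all of \<open>S\<close> and the type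
    vanishes, so finitely many conditions describe the type.\<close>
  have "{B. fsub B \<and> N ` S \<subseteq> B \<and> B \<subseteq> S \<and> jtype B = g} =
      {B. fsub B \<and> B \<subseteq> layer S K \<and> layer S 0 \<subseteq> B \<and> (\<forall>v\<le>K. card (layer S v) = q ^ D v * card (layer S v \<inter> B))}"
    (is "?X = ?Y")
  proof (intro equalityI subsetI)
    fix B assume "B \<in> ?X"
    then have B: "fsub B" "N ` S \<subseteq> B" "B \<subseteq> S" "jtype B = g" by auto
    obtain D' where D': "D' 0 = 0" "\<And>v. card (layer S v) = q ^ D' v * card (layer S v \<inter> B)"
      "\<And>v. D' (Suc v) + jtype B v = D' v + jtype S v"
      by (rule jtype_between[OF S B(1-3)]) blast
    have "D' v = D v" for v
    proof (induction v)
      case (Suc v)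
      then show ?case using D'(3)[of v] D(2)[of v] gl(2)[of v] B(4) by simp
    qed (simp add: D D')
    then show "B \<in> ?Y" using B D'(2) layerK layer_0[OF NS] by auto
  next
    fix B assume "B \<in> ?Y"
    then have B: "fsub B" "N ` S \<subseteq> B" "B \<subseteq> S" "\<And>v. v \<le> K \<Longrightarrow> card (layer S v) = q ^ D v * card (layer S v \<inter> B)"
      using layerK layer_0[OF NS] by auto
    obtain D' where D': "D' 0 = 0" "\<And>v. card (layer S v) = q ^ D' v * card (layer S v \<inter> B)"
      "\<And>v. D' (Suc v) + jtype B v = D' v + jtype S v" "\<And>v. D' v \<le> D' (Suc v)"
      by (rule jtype_between[OF S B(1-3)]) blast
    have DD: "D' v = D v" if "v \<le> K" for v
    proof -
      have "q ^ D' v * card (layer S v \<inter> B) = q ^ D v * card (layer S v \<inter> B)" using B(4)[OF that] D'(2)[of v] by simp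
      then show ?thesis using q_power_cancel fsub_nonempty[OF fsub_Int[OF fsub_layer[OF fS] B(1)]] by blast
    qed
    have "jtype B v = g v" for v
    proof (cases "v < K")
      case True
      then show ?thesis using D'(3)[of v] DD[of v] DD[of "Suc v"] D(2)[of v] gl(2)[of v] by simp
    next
      case False
      then have "jtype S v = 0" "g v = 0" using lK gK by auto
      then show ?thesis using D'(3)[of v] D'(4)[of v] by simp
    qed
    then show "B \<in> ?X" using B by auto
  qed
  then have "real (card ?X) = (\<Prod>v<K. gbinom (real q) (m v) (d v) * real q ^ ((m v - d v) * D v))"
    using card_chain_subspaces[of "layer S" m D d K, where 'b = real] fsub_layer[OF fS] layer_mono jtype_layer(2)[OF S] D
    by (simp add: m_def d_def)
  also have "\<dots> = (\<Prod>v<K. real q ^ ((m v - d v) * D (Suc v)) * gbinom (1 / real q) (m v) (d v))"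
  proof (intro prod.cong refl)
    fix v
    have q1: "real q > 1" using q_ge_2 by simp
    have "d v \<le> m v" using gl[of v] by (simp add: d_def m_def)
    then have "gbinom (real q) (m v) (d v) = real q ^ (d v * (m v - d v)) * gbinom (1 / real q) (m v) (d v)"
      by (rule gbinom_inverse[OF q1])
    moreover have "(m v - d v) * D (Suc v) = d v * (m v - d v) + (m v - d v) * D v"
      unfolding D(2) d_def[symmetric] by (simp add: algebra_simps)
    ultimately show "gbinom (real q) (m v) (d v) * real q ^ ((m v - d v) * D v) =
        real q ^ ((m v - d v) * D (Suc v)) * gbinom (1 / real q) (m v) (d v)" by (simp add: power_add)
  qed
  also have "\<dots> = real q ^ (\<Sum>v<K. (m v - d v) * D (Suc v)) * (\<Prod>v<K. gbinom (1 / real q) (m v) (d v))"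
    by (simp add: prod.distrib power_sum)
  also have "(\<Prod>v<K. gbinom (1 / real q) (m v) (d v)) = pieri_coeff (1 / real q) ?l g"
    by (simp add: prod_pieri_coeff[OF par_jtype[OF S] g lK[OF order_refl]] m_def d_def)
  finally have 1: "real (card ?X) = real q ^ (\<Sum>v<K. (m v - d v) * D (Suc v)) * pieri_coeff (1 / real q) ?l g" .
  have DK: "D K = i"
  proof -
    have "fsize ?l = (\<Sum>v<K. ?l v)" by (rule fsize_eq) (use lK in blast)
    moreover have "fsize g = (\<Sum>v<K. g v)" by (rule fsize_eq) (use gK in blast)
    moreover have "(\<Sum>v<K. ?l v) = (\<Sum>v<K. g v) + D K"
      unfolding D_def sum.distrib[symmetric] using gl(2) by (intro sum.cong) auto
    ultimately show ?thesis using dg(4) by simp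
  qed
  have md: "m v - d v = g v - ?l (Suc v)" for v using gl[of v] by (simp add: m_def d_def)
  have pg: "par g" using remove_strip_par[OF g] by simp
  have "nst ?l = (i choose 2) + nst g + (\<Sum>v<K. (m v - d v) * D (Suc v))"
    using nst_exponent_identity[of D ?l g K, OF D gl] lK[of K] DK
    by (simp add: nst_eq[OF par_jtype[OF S] lK[OF order_refl]] nst_eq[OF pg gK[OF order_refl]] md)
  then show ?thesis unfolding 1 by (simp add: power_add)
qed

section \<open>Counting stable flags\<close>

text \<open>The head of the list is the codimension of the top member: flags are built from above,
  which is why \<open>rev mu\<close> appears in \<open>flags_h_col\<close>.\<close>

fun flags :: "nat list \<Rightarrow> 'v set \<Rightarrow> nat" where
  "flags [] S = (if S = {0} then 1 else 0)"
| "flags (r # rs) S = (\<Sum>B | fsub B \<and> B \<subseteq> S \<and> N ` B \<subseteq> B \<and> card S = q ^ r * card B. flags rs B)"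

lemma finite_subspaces: "fsub S \<Longrightarrow> finite {B. fsub B \<and> B \<subseteq> S \<and> P B}"
  by (rule finite_fsubs) (simp add: fsub_def)

lemma eq_of_card: "fsub S \<Longrightarrow> B \<subseteq> S \<Longrightarrow> card S = card B \<Longrightarrow> B = S"
  by (simp add: fsub_def card_subset_eq)

definition plus_set :: "'v set \<Rightarrow> 'v set \<Rightarrow> 'v set" where
  "plus_set A B = (\<lambda>(x, y). x + y) ` (A \<times> B)"

lemma fsub_plus_set: assumes "fsub A" "fsub B" shows "fsub (plus_set A B)"
proof -
  have s: "subspace A" "subspace B" "finite A" "finite B" using assms by (auto simp: fsub_def)
  have "plus_set A B = {x + y | x y. x \<in> A \<and> y \<in> B}" by (auto simp: plus_set_def)
  then have "subspace (plus_set A B)" using subspace_sums[OF s(1,2)] by simp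
  then show ?thesis using s by (simp add: fsub_def plus_set_def)
qed

text \<open>Iterating S = N S + B gives S = N^j S + B for all j, and N^j S is eventually
  trivial.\<close>

lemma nakayama:
  assumes S: "stable S" and B: "fsub B" "B \<subseteq> S" "N ` B \<subseteq> B" and e: "plus_set (N ` S) B = S"
  shows "B = S"
proof -
  have sB: "subspace B" using B by (simp add: fsub_def)
  obtain K where K: "img K S \<subseteq> {0}" using S by (auto simp: stable_def)
  have "\<exists>y\<in>B. x - y \<in> img j S" if "x \<in> S" for x j
    using that
  proof (induction j arbitrary: x)
    case 0
    then show ?case using subspace_0[OF sB] by (intro bexI[of _ 0]) auto
  next
    case (Suc j)
    then have "x \<in> plus_set (N ` S) B" using e by simp
    then obtain z y where zy: "z \<in> S" "y \<in> B" "x = N z + y" by (auto simp: plus_set_def)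
    obtain y' where y': "y' \<in> B" "z - y' \<in> img j S" using Suc.IH[OF zy(1)] by blast
    have "N (z - y') = N z - N y'" using pow_diff[of 1] by simp
    then have "x - (y + N y') = N (z - y')" by (simp add: zy(3))
    then have "x - (y + N y') \<in> img (Suc j) S" using y'(2) by (simp add: img_Suc(1))
    moreover have "y + N y' \<in> B" using zy y' B sB by (auto intro: subspace_add)
    ultimately show ?case by blast
  qed
  from this[of _ K] show ?thesis using K B(2) by fastforce
qed

text \<open>Exchange the sums and fix the member C of codimension \<open>r\<close> from which the
  rest of the flag is built. The subspaces \<open>B\<close> then run over the interval from N S + C
  to \<open>S\<close>; by \<open>nakayama\<close> it does not consist of \<open>S\<close> alone,
  since \<open>r \<ge> 1\<close>, so its Moebius sum vanishes.\<close>

lemma sum_flags_mobius: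
  assumes S: "stable S" and r: "r \<ge> 1"
  shows "(\<Sum>i\<le>r. (- 1) ^ i * real q ^ (i choose 2) *
    (\<Sum>B | fsub B \<and> B \<subseteq> S \<and> N ` S \<subseteq> B \<and> card S = q ^ i * card B. real (flags ((r - i) # rs) B))) = 0"
proof -
  have fS: "fsub S" using S by (rule stable_fsub)
  have NS: "N ` S \<subseteq> S" using S by (simp add: stable_def)
  let ?I = "{B. fsub B \<and> B \<subseteq> S \<and> N ` S \<subseteq> B}"
  let ?C = "{C. fsub C \<and> C \<subseteq> S \<and> N ` C \<subseteq> C \<and> card S = q ^ r * card C}"
  have finI: "finite ?I" and finC: "finite ?C" using finite_subspaces[OF fS] by auto
  have "(\<Sum>i\<le>r. (- 1) ^ i * real q ^ (i choose 2) *
      (\<Sum>B | fsub B \<and> B \<subseteq> S \<and> N ` S \<subseteq> B \<and> card S = q ^ i * card B. real (flags ((r - i) # rs) B))) =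
    (\<Sum>i\<le>r. \<Sum>B | B \<in> ?I \<and> card S = q ^ i * card B. \<Sum>C | C \<in> ?C \<and> C \<subseteq> B. mobius S B * real (flags rs C))"
    unfolding sum_distrib_left
  proof (intro sum.cong refl)
    fix i assume i: "i \<in> {..r}"
    show "{B. fsub B \<and> B \<subseteq> S \<and> N ` S \<subseteq> B \<and> card S = q ^ i * card B} = {B. B \<in> ?I \<and> card S = q ^ i * card B}" by auto
    fix B assume B: "B \<in> {B. B \<in> ?I \<and> card S = q ^ i * card B}"
    have "{C. fsub C \<and> C \<subseteq> B \<and> N ` C \<subseteq> C \<and> card B = q ^ (r - i) * card C} = {C. C \<in> ?C \<and> C \<subseteq> B}"
    proof -
      have "card B = q ^ (r - i) * card C \<longleftrightarrow> card S = q ^ r * card C" for C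
      proof -
        have "q ^ r = q ^ i * q ^ (r - i)" using i by (simp add: power_add[symmetric])
        then have "card S = q ^ r * card C \<longleftrightarrow> q ^ i * card B = q ^ i * (q ^ (r - i) * card C)" using B by (simp add: mult.assoc)
        then show ?thesis using q_ge_2 by simp
      qed
      then show ?thesis using B by auto
    qed
    then have "real (flags ((r - i) # rs) B) = (\<Sum>C | C \<in> ?C \<and> C \<subseteq> B. real (flags rs C))" by simp
    moreover have "mobius S B = (- 1) ^ i * real q ^ (i choose 2)" using B by (intro mobius_eq) auto
    ultimately show "(- 1) ^ i * real q ^ (i choose 2) * real (flags ((r - i) # rs) B) =
        (\<Sum>C | C \<in> ?C \<and> C \<subseteq> B. mobius S B * real (flags rs C))" by (simp add: sum_distrib_left)
  qed
  also have "\<dots> = (\<Sum>B\<in>?I. \<Sum>C | C \<in> ?C \<and> C \<subseteq> B. mobius S B * real (flags rs C))"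
  proof -
    let ?F = "\<lambda>B. \<Sum>C | C \<in> ?C \<and> C \<subseteq> B. mobius S B * real (flags rs C)"
    define I' where "I' = {B \<in> ?I. \<exists>i\<le>r. card S = q ^ i * card B}"
    have I'_iff: "B \<in> I' \<longleftrightarrow> B \<in> ?I \<and> (\<exists>i\<le>r. card S = q ^ i * card B)" for B by (simp only: I'_def mem_Collect_eq)
    define codim where "codim B = (THE i. card S = q ^ i * card B)" for B :: "'v set"
    have cod: "codim B = i" if "fsub B" "card S = q ^ i * card B" for B i
      unfolding codim_def using that q_power_cancel[of _ "card B" i] fsub_nonempty[OF that(1)] by (intro the_equality) auto
    \<comment> \<open>A \<open>B\<close> of codimension greater than \<open>r\<close> contains no C
      of codimension \<open>r\<close>, so these terms may be dropped.\<close>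
    have "(\<Sum>B\<in>?I. ?F B) = (\<Sum>B\<in>I'. ?F B)"
    proof (rule sum.mono_neutral_right[OF finI])
      show "\<forall>B\<in>?I - I'. ?F B = 0"
      proof
        fix B assume B: "B \<in> ?I - I'"
        have "C \<notin> ?C" if C: "C \<subseteq> B" for C
        proof
          assume CC: "C \<in> ?C"
          obtain i where i: "card S = q ^ i * card B" using ex_card_power[OF fS, of B] B by blast
          obtain j where j: "card B = q ^ j * card C" using ex_card_power[of B C] B CC C by blast
          have "q ^ (i + j) * card C = q ^ r * card C" using i j CC by (simp add: power_add mult.assoc)
          then have "i + j = r" using q_power_cancel fsub_nonempty CC by blast
          then have "i \<le> r" by simp
          then have "B \<in> I'" using I'_iff B i by blast
          then show False using B by blast
        qed
        then have "{C. C \<in> ?C \<and> C \<subseteq> B} = {}" by blast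
        then show "?F B = 0" by (simp only: sum.empty)
      qed
    qed (auto simp: I'_def)
    also have "\<dots> = (\<Sum>i\<le>r. \<Sum>B\<in>{B \<in> I'. codim B = i}. ?F B)"
    proof (rule sum.group[symmetric])
      show "finite I'" unfolding I'_def by (rule finite_subset[OF _ finI]) auto
      show "codim ` I' \<subseteq> {..r}"
      proof (rule image_subsetI)
        fix B assume B: "B \<in> I'"
        then obtain i where i: "i \<le> r" "card S = q ^ i * card B" using I'_iff by blast
        have "fsub B" using B by (simp add: I'_def)
        then have "codim B = i" using i(2) by (rule cod)
        then show "codim B \<in> {..r}" using i(1) by simp
      qed
    qed simp
    also have "\<dots> = (\<Sum>i\<le>r. \<Sum>B | B \<in> ?I \<and> card S = q ^ i * card B. ?F B)"
    proof (intro sum.cong refl)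
      fix i assume i: "i \<in> {..r}"
      show "{B \<in> I'. codim B = i} = {B. B \<in> ?I \<and> card S = q ^ i * card B}"
      proof (intro equalityI subsetI)
        fix B assume "B \<in> {B \<in> I'. codim B = i}"
        then have B: "B \<in> I'" "codim B = i" by auto
        then obtain j where j: "card S = q ^ j * card B" using I'_iff by blast
        have "fsub B" "B \<in> ?I" using B by (simp_all add: I'_def)
        then have "j = i" using cod[OF _ j] B(2) by simp
        then show "B \<in> {B. B \<in> ?I \<and> card S = q ^ i * card B}" using j \<open>B \<in> ?I\<close> by simp
      next
        fix B assume "B \<in> {B. B \<in> ?I \<and> card S = q ^ i * card B}"
        then have B: "B \<in> ?I" "fsub B" "card S = q ^ i * card B" by simp_all
        have "codim B = i" by (rule cod[OF B(2,3)])
        moreover have "B \<in> I'" using I'_iff B(1,3) i by blast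
        ultimately show "B \<in> {B \<in> I'. codim B = i}" by simp
      qed
    qed
    finally show ?thesis ..
  qed
  also have "\<dots> = (\<Sum>C\<in>?C. \<Sum>B | B \<in> ?I \<and> C \<subseteq> B. mobius S B * real (flags rs C))"
    by (rule sum.swap_restrict[OF finI finC])
  also have "\<dots> = 0"
  proof (rule sum.neutral, rule ballI)
    fix C assume C: "C \<in> ?C"
    let ?Q = "plus_set (N ` S) C"
    have fN: "fsub (N ` S)" using fsub_img[OF fS, of 1] by (simp add: img_def)
    have fQ: "fsub ?Q" using fN C by (intro fsub_plus_set) auto
    have QS: "?Q \<subseteq> S" using NS C fS by (auto simp: plus_set_def fsub_def intro!: subspace_add)
    have "?Q \<noteq> S"
    proof
      assume "?Q = S"
      then have "C = S" using nakayama[OF S, of C] C by auto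
      then have "q ^ 0 * card S = q ^ r * card S" using C by auto
      then have "0 = r" using q_power_cancel fsub_nonempty[OF fS] by blast
      then show False using r by simp
    qed
    have zN: "0 \<in> N ` S" "0 \<in> C" using fN C by (auto simp: fsub_def subspace_0)
    have "?Q \<subseteq> B \<longleftrightarrow> N ` S \<subseteq> B \<and> C \<subseteq> B" if B: "fsub B" for B
    proof
      assume "?Q \<subseteq> B"
      moreover have "x \<in> ?Q" if "x \<in> N ` S" for x
        unfolding plus_set_def using zN that by (intro image_eqI[of _ _ "(x, 0)"]) auto
      moreover have "x \<in> ?Q" if "x \<in> C" for x
        unfolding plus_set_def using zN that by (intro image_eqI[of _ _ "(0, x)"]) auto
      ultimately show "N ` S \<subseteq> B \<and> C \<subseteq> B" by blast
    next
      assume "N ` S \<subseteq> B \<and> C \<subseteq> B"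
      then show "?Q \<subseteq> B" using B by (auto simp: plus_set_def fsub_def intro!: subspace_add)
    qed
    then have eq: "{B. B \<in> ?I \<and> C \<subseteq> B} = {B. fsub B \<and> B \<subseteq> S \<and> ?Q \<subseteq> B}" by blast
    have "(\<Sum>B | B \<in> ?I \<and> C \<subseteq> B. mobius S B) = 0"
      unfolding eq by (rule sum_mobius[OF fS fQ QS \<open>?Q \<noteq> S\<close>])
    then show "(\<Sum>B | B \<in> ?I \<and> C \<subseteq> B. mobius S B * real (flags rs C)) = 0"
      by (simp only: sum_distrib_right[symmetric] mult_zero_left)
  qed
  finally show ?thesis .
qed

text \<open>Stated for all stable subspaces because the recursion passes from \<open>S\<close> to
  subspaces between N S and \<open>S\<close>. The outer induction is on the list, the inner one on
  its last part; in both recursions the term i = 0 is the quantity sought.\<close>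

theorem flags_h_col:
  assumes "stable S" "card S = q ^ sum_list mu"
  shows "real (flags (rev mu) S) = real q ^ nst (jtype S) * h_col (1 / real q) mu (jtype S)"
  using assms
proof (induction mu arbitrary: S rule: rev_induct)
  case Nil
  have one: "card S = 1" using Nil by simp
  then obtain x where x: "S = {x}" by (rule card_1_singletonE)
  then have S0: "S = {0}" using Nil(1) subspace_0[of S] by (auto simp: stable_def fsub_def)
  have "q ^ fsize (jtype S) * 1 = q ^ 0 * 1" using card_fsize_jtype[OF Nil(1)] one by simp
  then have "fsize (jtype S) = 0" using q_power_cancel one_neq_zero by blast
  then have "from_columns (jtype S) = []" "nst (jtype S) = 0"
    using from_columns(1)[OF par_jtype[OF Nil(1)]] by (auto simp: nst_def)
  then show ?case by (simp add: S0[symmetric] h_col_def h_coeff_Nil)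
next
  case (snoc r mu)
  note IH = snoc.IH
  show ?case using snoc.prems
  proof (induction r arbitrary: S rule: less_induct)
    case (less r)
    note S = less.prems(1) and cS = less.prems(2)
    have fS: "fsub S" using S by (rule stable_fsub)
    have NS: "N ` S \<subseteq> S" using S by (simp add: stable_def)
    let ?l = "jtype S"
    have "q ^ fsize ?l * 1 = q ^ (sum_list mu + r) * 1" using card_fsize_jtype[OF S] cS by simp
    then have sz: "fsize ?l = sum_list mu + r" using q_power_cancel one_neq_zero by blast
    show ?case
    proof (cases "r = 0")
      case True
      have "{B. fsub B \<and> B \<subseteq> S \<and> N ` B \<subseteq> B \<and> card S = q ^ r * card B} = {S}"
        using fS NS True eq_of_card by auto
      then have "flags (rev (mu @ [r])) S = flags (rev mu) S" by simp
      moreover have "h_col t (mu @ [0]) ?l = h_col t mu ?l" for t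
        unfolding h_col_def using from_columns(1)[OF par_jtype[OF S]] sz True by (intro h_coeff_snoc_0) simp
      ultimately show ?thesis using IH[OF S] cS True by simp
    next
      case False
      let ?B = "\<lambda>i. {B. fsub B \<and> B \<subseteq> S \<and> N ` S \<subseteq> B \<and> card S = q ^ i * card B}"
      let ?t = "1 / real q"
      let ?E = "\<lambda>i. real q ^ (i choose 2) * (\<Sum>B\<in>?B i. real (flags ((r - i) # rev mu) B))"
      let ?P = "\<lambda>i. \<Sum>g\<in>remove_strip ?l i. pieri_coeff ?t ?l g * h_col ?t (mu @ [r - i]) g"
      \<comment> \<open>For i \<ge> 1 the last part drops to r - i, so the induction hypothesis
        applies to every \<open>B\<close>. Grouping by \<open>jtype B\<close> brings in
        \<open>card_jtype\<close>, which absorbs q^(i choose 2).\<close>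
      have E: "?E i = real q ^ nst ?l * ?P i" if i: "i \<in> {1..r}" for i
      proof -
        have "(\<Sum>B\<in>?B i. real (flags ((r - i) # rev mu) B)) =
            (\<Sum>B\<in>?B i. real q ^ nst (jtype B) * h_col ?t (mu @ [r - i]) (jtype B))"
        proof (intro sum.cong refl)
          fix B assume B: "B \<in> ?B i"
          have sB: "stable B" using stable_between[OF S] B by auto
          have "q ^ i * card B = q ^ i * q ^ (sum_list mu + (r - i))"
            using B cS i by (simp add: power_add[symmetric])
          then have "card B = q ^ (sum_list mu + (r - i))" using q_ge_2 by simp
          then show "real (flags ((r - i) # rev mu) B) = real q ^ nst (jtype B) * h_col ?t (mu @ [r - i]) (jtype B)"
            using less.IH[of "r - i" B] sB i by simp
        qed
        also have "\<dots> = (\<Sum>g\<in>remove_strip ?l i. \<Sum>B\<in>{B \<in> ?B i. jtype B = g}. real q ^ nst (jtype B) * h_col ?t (mu @ [r - i]) (jtype B))"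
          by (rule sum.group[symmetric]) (use finite_subspaces[OF fS] jtype_remove_strip[OF S] in auto)
        also have "\<dots> = (\<Sum>g\<in>remove_strip ?l i. real (card {B. fsub B \<and> N ` S \<subseteq> B \<and> B \<subseteq> S \<and> jtype B = g}) *
            (real q ^ nst g * h_col ?t (mu @ [r - i]) g))"
        proof (intro sum.cong refl)
          fix g assume g: "g \<in> remove_strip ?l i"
          have "card S = q ^ i * card B" if B: "fsub B" "N ` S \<subseteq> B" "B \<subseteq> S" "jtype B = g" for B
            using card_fsize_jtype[OF S] card_fsize_jtype[OF stable_between[OF S B(1-3)]] remove_stripD(4)[OF g] B(4)
            by (simp add: power_add)
          then have "{B \<in> ?B i. jtype B = g} = {B. fsub B \<and> N ` S \<subseteq> B \<and> B \<subseteq> S \<and> jtype B = g}" by auto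
          then show "(\<Sum>B\<in>{B \<in> ?B i. jtype B = g}. real q ^ nst (jtype B) * h_col ?t (mu @ [r - i]) (jtype B)) =
            real (card {B. fsub B \<and> N ` S \<subseteq> B \<and> B \<subseteq> S \<and> jtype B = g}) * (real q ^ nst g * h_col ?t (mu @ [r - i]) g)"
            by simp
        qed
        finally have "?E i = (\<Sum>g\<in>remove_strip ?l i. (real q ^ (i choose 2) *
            real (card {B. fsub B \<and> N ` S \<subseteq> B \<and> B \<subseteq> S \<and> jtype B = g}) * real q ^ nst g) * h_col ?t (mu @ [r - i]) g)"
          by (simp add: sum_distrib_left mult_ac)
        also have "\<dots> = (\<Sum>g\<in>remove_strip ?l i. real q ^ nst ?l * (pieri_coeff ?t ?l g * h_col ?t (mu @ [r - i]) g))"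
          by (intro sum.cong refl) (simp only: card_jtype[OF S] mult.assoc[symmetric])
        finally show ?thesis by (simp add: sum_distrib_left)
      qed
      have r1: "1 \<le> r" using False by simp
      have split: "(\<Sum>i\<le>r. f i) = f 0 + (\<Sum>i\<in>{1..r}. f i)" for f :: "nat \<Rightarrow> real"
        by (simp add: sum.atMost_shift sum.atLeast1_atMost_eq lessThan_atLeast0)
      have B0: "?B 0 = {S}" using fS NS eq_of_card by auto
      have "0 = ?E 0 + (\<Sum>i\<in>{1..r}. (- 1) ^ i * ?E i)"
        using sum_flags_mobius[OF S r1, of "rev mu"] unfolding split by (simp add: mult.assoc)
      also have "?E 0 = real (flags (rev (mu @ [r])) S)" unfolding B0 by (simp add: numeral_2_eq_2)
      also have "(\<Sum>i\<in>{1..r}. (- 1) ^ i * ?E i) = (\<Sum>i\<in>{1..r}. (- 1) ^ i * (real q ^ nst ?l * ?P i))"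
        by (intro sum.cong refl) (simp only: E)
      finally have 1: "real (flags (rev (mu @ [r])) S) = - (real q ^ nst ?l * (\<Sum>i\<in>{1..r}. (- 1) ^ i * ?P i))"
        by (simp add: sum_distrib_left mult_ac)
      have "remove_strip ?l 0 = {?l}"
      proof (intro equalityI subsetI)
        fix g assume g: "g \<in> remove_strip ?l 0"
        note dg = remove_stripD[OF g]
        obtain L where L: "\<forall>v\<ge>L. ?l v = 0" using dg(2) by (auto simp: fin_supp_def)
        have le: "g v \<le> ?l v" for v using dg(1) by (simp add: hstrip_def)
        then have L': "\<forall>v\<ge>L. g v = 0" using L by (metis le_zero_eq)
        have "(\<Sum>v<L. g v) = (\<Sum>v<L. ?l v)" using dg(4) fsize_eq[OF L] fsize_eq[OF L'] by simp
        then have "g v = ?l v" if "v < L" for v using sum_mono_inv[of g "{..<L}" ?l v] le that by auto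
        then have "g = ?l" using L L' by (metis ext not_le)
        then show "g \<in> {?l}" by simp
      next
        fix g assume "g \<in> {?l}"
        then show "g \<in> remove_strip ?l 0" using par_jtype[OF S] by (auto simp: remove_strip_def par_def hstrip_def)
      qed
      then have "?P 0 = h_col ?t (mu @ [r]) ?l" by (simp add: pieri_coeff_def)
      moreover have "0 = ?P 0 + (\<Sum>i\<in>{1..r}. (- 1) ^ i * ?P i)"
        using h_col_recursion[OF r1 par_jtype[OF S] sz, of ?t] unfolding split by simp
      ultimately have "h_col ?t (mu @ [r]) ?l = - (\<Sum>i\<in>{1..r}. (- 1) ^ i * ?P i)" by linarith
      then show ?thesis unfolding 1 by (simp only: mult_minus_right)
    qed
  qed
qed

end

subsection \<open>Flags and parabolic subgroups\<close>

text \<open>Vectors are sequences, so that the coordinate subspaces of all dimensions lie in one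
  type; the product is cut off at the number of rows.\<close>

definition act :: "'k::field mat \<Rightarrow> (nat \<Rightarrow> 'k) \<Rightarrow> nat \<Rightarrow> 'k" where
  "act A f = (\<lambda>i. if i < dim_row A then \<Sum>j<dim_col A. A $$ (i, j) * f j else 0)"

definition coords :: "nat \<Rightarrow> (nat \<Rightarrow> 'k::zero) set" where
  "coords n = {f. \<forall>i\<ge>n. f i = 0}"

definition unit_fun :: "nat \<Rightarrow> nat \<Rightarrow> 'k::zero_neq_one" where
  "unit_fun j = (\<lambda>i. if i = j then 1 else 0)"

definition fscale :: "'k::field \<Rightarrow> (nat \<Rightarrow> 'k) \<Rightarrow> nat \<Rightarrow> 'k" where
  "fscale c f = (\<lambda>i. c * f i)"

interpretation coord_space: finite_field_space "fscale :: 'k::{field,finite} \<Rightarrow> _" "CARD('k)"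
  by unfold_locales (auto simp: fscale_def fun_eq_iff algebra_simps)

lemma act_add: "act A (f + g) = act A f + act A g"
  by (auto simp: act_def fun_eq_iff algebra_simps sum.distrib)

lemma act_scale: "act A (fscale c f) = fscale c (act A f)"
  by (auto simp: act_def fscale_def fun_eq_iff sum_distrib_left intro!: sum.cong)

lemma act_mult:
  assumes "A \<in> carrier_mat n n" "B \<in> carrier_mat n n" shows "act (A * B) f = act A (act B f)"
proof
  fix i
  have "(\<Sum>j<n. (\<Sum>k<n. A $$ (i, k) * B $$ (k, j)) * f j) = (\<Sum>k<n. A $$ (i, k) * (\<Sum>j<n. B $$ (k, j) * f j))"
    by (simp add: sum_distrib_left sum_distrib_right mult.assoc) (rule sum.swap)
  moreover have "(A * B) $$ (i, j) = (\<Sum>k<n. A $$ (i, k) * B $$ (k, j))" if "i < n" "j < n" for j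
    using assms that by (simp add: scalar_prod_def atLeast0LessThan)
  ultimately show "act (A * B) f i = act A (act B f) i"
    using assms by (auto simp: act_def)
qed

lemma act_one: assumes "f \<in> coords n" shows "act (1\<^sub>m n) f = f"
proof
  fix i
  have "(\<Sum>j<n. (1\<^sub>m n $$ (i, j)) * f j) = (\<Sum>j<n. if j = i then f j else 0)" if "i < n"
    using that by (intro sum.cong) auto
  then show "act (1\<^sub>m n) f i = f i" using assms by (auto simp: act_def coords_def)
qed

lemma act_coords: "A \<in> carrier_mat n n \<Longrightarrow> act A f \<in> coords n"
  by (auto simp: act_def coords_def)

lemma act_unit:
  assumes "A \<in> carrier_mat n n" "j < n" shows "act A (unit_fun j) = (\<lambda>i. if i < n then A $$ (i, j) else 0)"
proof
  fix i
  have "(\<Sum>k<n. A $$ (i, k) * unit_fun j k) = (\<Sum>k<n. if k = j then A $$ (i, k) else 0)"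
    by (intro sum.cong) (auto simp: unit_fun_def)
  then show "act A (unit_fun j) i = (if i < n then A $$ (i, j) else 0)" using assms by (auto simp: act_def)
qed

lemma unit_coords: "j < n \<Longrightarrow> unit_fun j \<in> coords n"
  by (auto simp: unit_fun_def coords_def)

lemma coords_mono: "m \<le> n \<Longrightarrow> coords m \<subseteq> coords n"
  by (auto simp: coords_def)

lemma coords_0: "coords 0 = {0}"
  by (auto simp: coords_def fun_eq_iff)

lemma coords_Suc: "coords (Suc d) = coord_space.ext (coords d) (unit_fun d :: nat \<Rightarrow> 'k::{field,finite})"
proof (intro equalityI subsetI)
  fix f :: "nat \<Rightarrow> 'k" assume f: "f \<in> coords (Suc d)"
  have "f = f(d := 0) + fscale (f d) (unit_fun d)" by (auto simp: fun_eq_iff fscale_def unit_fun_def)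
  moreover have "f(d := 0) \<in> coords d" using f by (auto simp: coords_def)
  ultimately show "f \<in> coord_space.ext (coords d) (unit_fun d)" by (metis coord_space.extI)
next
  fix f :: "nat \<Rightarrow> 'k" assume "f \<in> coord_space.ext (coords d) (unit_fun d)"
  then show "f \<in> coords (Suc d)"
    by (auto elim!: coord_space.extE simp: coords_def fscale_def unit_fun_def)
qed

lemma fsub_coords: "coord_space.fsub (coords n :: (nat \<Rightarrow> 'k::{field,finite}) set)"
proof (induction n)
  case 0
  then show ?case using coord_space.fsub_zero by (simp add: coords_0)
next
  case (Suc n)
  then show ?case by (simp add: coords_Suc coord_space.fsub_ext)
qed

lemma card_coords: "card (coords n :: (nat \<Rightarrow> 'k::{field,finite}) set) = CARD('k) ^ n"
proof (induction n)
  case (Suc n)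
  have "(unit_fun n :: nat \<Rightarrow> 'k) \<notin> coords n" by (auto simp: coords_def unit_fun_def)
  then show ?case using Suc by (simp add: coords_Suc coord_space.card_ext[OF fsub_coords])
qed (simp add: coords_0)

lemma carrier_GL: "x \<in> carrier (GL n) \<longleftrightarrow> x \<in> carrier_mat n n \<and> (\<exists>y\<in>carrier_mat n n. x * y = 1\<^sub>m n \<and> y * x = 1\<^sub>m n)"
  by (auto simp: GL_def units_of_def Units_def ring_mat_def)

lemma mult_GL: "x \<otimes>\<^bsub>GL n\<^esub> y = x * y" and one_GL: "\<one>\<^bsub>GL n\<^esub> = 1\<^sub>m n"
  by (simp_all add: GL_def units_of_def ring_mat_def)

lemma group_GL: "group (GL n :: 'k::field mat monoid)"
proof -
  interpret semiring "ring_mat TYPE('k) n ()" by (rule semiring_mat)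
  show ?thesis unfolding GL_def by (rule units_group)
qed

lemma GL_mat: "x \<in> carrier (GL n) \<Longrightarrow> x \<in> carrier_mat n n"
  by (simp add: carrier_GL)

lemma inv_GL:
  fixes x :: "'k::field mat"
  assumes "x \<in> carrier (GL n)"
  shows "inv\<^bsub>GL n\<^esub> x \<in> carrier (GL n)" "x * inv\<^bsub>GL n\<^esub> x = 1\<^sub>m n" "inv\<^bsub>GL n\<^esub> x * x = 1\<^sub>m n"
proof -
  interpret group "GL n :: 'k mat monoid" by (rule group_GL)
  show "inv\<^bsub>GL n\<^esub> x \<in> carrier (GL n)" using assms by simp
  show "x * inv\<^bsub>GL n\<^esub> x = 1\<^sub>m n" "inv\<^bsub>GL n\<^esub> x * x = 1\<^sub>m n"
    using r_inv[OF assms] l_inv[OF assms] by (simp_all add: mult_GL one_GL)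
qed

lemma act_inv:
  assumes "x \<in> carrier (GL n)" "f \<in> coords n"
  shows "act x (act (inv\<^bsub>GL n\<^esub> x) f) = f" "act (inv\<^bsub>GL n\<^esub> x) (act x f) = f"
proof -
  have m: "x \<in> carrier_mat n n" "inv\<^bsub>GL n\<^esub> x \<in> carrier_mat n n" using assms(1) inv_GL(1) by (auto intro: GL_mat)
  show "act x (act (inv\<^bsub>GL n\<^esub> x) f) = f" "act (inv\<^bsub>GL n\<^esub> x) (act x f) = f"
    using act_mult[OF m, of f] act_mult[OF m(2,1), of f] inv_GL[OF assms(1)] act_one[OF assms(2)] by simp_all
qed

lemma inj_act: "x \<in> carrier (GL n) \<Longrightarrow> inj_on (act x) (coords n)"
  by (rule inj_on_inverseI[of _ "act (inv\<^bsub>GL n\<^esub> x)"]) (simp add: act_inv)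

lemma act_GL_coords: assumes x: "x \<in> carrier (GL n)" shows "act x ` coords n = coords n"
proof (intro equalityI subsetI)
  fix f :: "nat \<Rightarrow> 'a" assume "f \<in> coords n"
  then have "f = act x (act (inv\<^bsub>GL n\<^esub> x) f)" "act (inv\<^bsub>GL n\<^esub> x) f \<in> coords n"
    using act_inv(1)[OF x] act_coords[OF GL_mat[OF inv_GL(1)[OF x]]] by simp_all
  then show "f \<in> act x ` coords n" by blast
qed (use act_coords[OF GL_mat[OF x]] in auto)

lemma finite_GL: "finite (carrier (GL n :: 'k::{field,finite} mat monoid))"
proof -
  let ?f = "\<lambda>A :: 'k mat. restrict (\<lambda>p. A $$ p) ({..<n} \<times> {..<n})"
  have "inj_on ?f (carrier_mat n n)"
  proof (rule inj_onI)
    fix A B :: "'k mat" assume A: "A \<in> carrier_mat n n" "B \<in> carrier_mat n n" "?f A = ?f B"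
    show "A = B"
    proof (rule eq_matI)
      fix i j assume "i < dim_row B" "j < dim_col B"
      then show "A $$ (i, j) = B $$ (i, j)" using fun_cong[OF A(3), of "(i, j)"] A(2) by simp
    qed (use A in auto)
  qed
  moreover have "finite (?f ` carrier_mat n n)"
  proof (rule finite_subset)
    show "?f ` carrier_mat n n \<subseteq> ({..<n} \<times> {..<n}) \<rightarrow>\<^sub>E UNIV"
      by (rule image_subsetI) (simp only: restrict_PiE_iff UNIV_I, blast)
  qed (auto intro!: finite_PiE)
  ultimately have "finite (carrier_mat n n :: 'k mat set)" by (rule finite_imageD[rotated])
  then show ?thesis by (rule rev_finite_subset) (auto intro: GL_mat)
qed

section \<open>Adapted bases and the standard flag\<close>

fun lspan :: "(nat \<Rightarrow> nat \<Rightarrow> 'k::{field,finite}) \<Rightarrow> nat \<Rightarrow> (nat \<Rightarrow> 'k) set" where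
  "lspan b 0 = {0}"
| "lspan b (Suc d) = coord_space.ext (lspan b d) (b d)"

lemma lspan_cong: "(\<And>j. j < d \<Longrightarrow> b j = b' j) \<Longrightarrow> lspan b d = lspan b' d"
  by (induction d) auto

lemma fsub_lspan: "coord_space.fsub (lspan b d)"
  by (induction d) (auto simp: coord_space.fsub_zero coord_space.fsub_ext)

lemma act_ext: "act x ` coord_space.ext B a = coord_space.ext (act x ` B) (act x a)"
  by (force simp: coord_space.ext_def image_image act_add act_scale)

lemma act_0: "act x 0 = 0"
  using act_add[of x 0 0] by simp

lemma act_lspan: "(\<And>j. j < d \<Longrightarrow> act x (unit_fun j) = b j) \<Longrightarrow> act x ` coords d = lspan b d"
  by (induction d) (auto simp: coords_0 act_0 coords_Suc act_ext)

text \<open>Going from one member of a flag to the next leaves the earlier basis vectors, hence the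
  earlier spans, unchanged.\<close>

lemma lspan_extend:
  fixes b :: "nat \<Rightarrow> nat \<Rightarrow> 'k::{field,finite}"
  assumes "coord_space.fsub S" "lspan b m \<subseteq> S" "card (lspan b m) = CARD('k) ^ m" "card S = CARD('k) ^ (m + r)"
  shows "\<exists>b'. (\<forall>j<m. b' j = b j) \<and> lspan b' (m + r) = S"
  using assms
proof (induction r arbitrary: b m)
  case 0
  then have "lspan b m = S" by (simp add: coord_space.fsub_def card_subset_eq)
  then show ?case by auto
next
  case (Suc r)
  have "lspan b m \<noteq> S" 
  proof
    assume "lspan b m = S"
    then have "CARD('k) ^ m = CARD('k) ^ (m + Suc r)" using Suc.prems(3,4) by simp
    moreover have "2 \<le> CARD('k)" by (rule coord_space.q_ge_2)
    then have "CARD('k) ^ m < CARD('k) ^ (m + Suc r)" by (intro power_strict_increasing) auto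
    ultimately show False by simp
  qed
  then obtain a where a: "a \<in> S" "a \<notin> lspan b m" using Suc.prems(2) by blast
  let ?b = "b(m := a)"
  have l: "lspan ?b m = lspan b m" by (rule lspan_cong) auto
  have "lspan ?b (Suc m) \<subseteq> S"
    using Suc.prems(1,2) a(1) coord_space.ext_subset[of S "lspan b m" a] by (simp add: l coord_space.fsub_def)
  moreover have "card (lspan ?b (Suc m)) = CARD('k) ^ Suc m"
    using a(2) Suc.prems(3) by (simp add: l coord_space.card_ext fsub_lspan)
  ultimately obtain b' where b': "\<forall>j<Suc m. b' j = ?b j" "lspan b' (Suc m + r) = S"
    using Suc.IH[of ?b "Suc m"] Suc.prems(1,4) unfolding add_Suc_right add_Suc by blast
  then have "\<forall>j<m. b' j = b j" by auto
  then show ?case using b'(2) by auto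
qed

text \<open>The witness is the matrix with columns \<open>b\<close>. It maps onto
  \<open>coords n\<close>, and preimages of the unit vectors are the columns of an inverse.\<close>

lemma ex_GL_lspan:
  assumes "lspan b n = coords n"
  shows "\<exists>x\<in>carrier (GL n). \<forall>d\<le>n. act x ` coords d = lspan b d"
proof -
  have sub: "lspan b d \<subseteq> lspan b n" if "d \<le> n" for d using that
    by (induction n rule: dec_induct) (auto dest: subsetD[OF coord_space.ext_superset(1)[OF fsub_lspan]])
  have b: "b j \<in> coords n" if "j < n" for j
    using sub[of "Suc j"] that coord_space.ext_superset(2)[OF fsub_lspan[of b j]] assms by auto
  define x where "x = mat n n (\<lambda>(i, j). b j i)"
  have x: "x \<in> carrier_mat n n" by (simp add: x_def)
  have u: "act x (unit_fun j) = b j" if "j < n" for j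
    unfolding act_unit[OF x that] using b[OF that] that by (auto simp: x_def fun_eq_iff coords_def)
  have l: "act x ` coords d = lspan b d" if "d \<le> n" for d using u that by (intro act_lspan) auto
  have "\<exists>f. f \<in> coords n \<and> act x f = unit_fun j" if "j < n" for j
    using l[of n] assms unit_coords[OF that] by (metis imageE order_refl)
  then obtain f where f: "\<And>j. j < n \<Longrightarrow> f j \<in> coords n" "\<And>j. j < n \<Longrightarrow> act x (f j) = unit_fun j" by metis
  define y where "y = mat n n (\<lambda>(i, j). f j i)"
  have y: "y \<in> carrier_mat n n" by (simp add: y_def)
  have uy: "act y (unit_fun j) = f j" if "j < n" for j
    unfolding act_unit[OF y that] using f(1)[OF that] that by (auto simp: y_def fun_eq_iff coords_def)
  have "x * y = 1\<^sub>m n"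
  proof (rule eq_matI)
    fix i j assume ij: "i < dim_row (1\<^sub>m n)" "j < dim_col (1\<^sub>m n)"
    have "act (x * y) (unit_fun j) i = unit_fun j i" using ij act_mult[OF x y, of "unit_fun j"] uy f(2) by simp
    then show "(x * y) $$ (i, j) = 1\<^sub>m n $$ (i, j)"
      using ij x y act_unit[of "x * y" n j] by (simp add: unit_fun_def split: if_splits)
  qed (use x y in auto)
  then have "x \<in> carrier (GL n)" using x y mat_mult_left_right_inverse[OF x y] by (auto simp: carrier_GL)
  then show ?thesis using l by blast
qed

text \<open>The dimensions of the members of a flag of type \<open>rs\<close> other than the whole
  space, from the largest down to the final 0.\<close>

fun dims :: "nat list \<Rightarrow> nat list" where
  "dims [] = []"
| "dims (r # rs) = sum_list rs # dims rs"

lemma dims_le: "d \<in> set (dims rs) \<Longrightarrow> d \<le> sum_list rs"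
  by (induction rs) auto

lemma set_dims: "set (dims (rev mu)) = (\<lambda>r. sum_list (take r mu)) ` {..<length mu}"
proof (induction mu rule: rev_induct)
  case (snoc r mu)
  have "(\<lambda>r'. sum_list (take r' (mu @ [r]))) ` {..<length mu} = (\<lambda>r. sum_list (take r mu)) ` {..<length mu}"
    by (intro image_cong) auto
  then show ?case using snoc by (simp add: lessThan_Suc)
qed simp

text \<open>The elements of \<open>dims (rev mu)\<close> are the block boundaries, together with 0,
  which separates nothing. The block of \<open>j\<close> precedes that of \<open>i\<close> exactly
  when a boundary separates them.\<close>

lemma block_of_less:
  assumes "i < sum_list mu" "j < sum_list mu"
  shows "block_of mu j < block_of mu i \<longleftrightarrow> (\<exists>d\<in>set (dims (rev mu)). j < d \<and> d \<le> i)"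
proof -
  let ?s = "\<lambda>r. sum_list (take r mu)"
  have mono: "?s a \<le> ?s b" if "a \<le> b" for a b
  proof -
    have "take b mu = take a mu @ take (b - a) (drop a mu)" using that by (metis le_add_diff_inverse take_add)
    then show ?thesis by simp
  qed
  have ex: "k < ?s (Suc (length mu))" if "k < sum_list mu" for k using that by simp
  have L: "k < ?s (Suc (block_of mu k))" if "k < sum_list mu" for k
    unfolding block_of_def by (rule LeastI[where P = "\<lambda>r. k < ?s (Suc r)", OF ex[OF that]])
  have Lle: "block_of mu k \<le> r" if "k < ?s (Suc r)" for k r
    unfolding block_of_def using that by (rule Least_le)
  show ?thesis
  proof
    assume lt: "block_of mu j < block_of mu i"
    let ?r = "Suc (block_of mu j)"
    have le: "?s ?r \<le> i" using Lle[of i "block_of mu j"] lt by (meson not_le)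
    have "?r < length mu" using le assms(1) by (metis not_less take_all linorder_not_less)
    then show "\<exists>d\<in>set (dims (rev mu)). j < d \<and> d \<le> i"
      unfolding set_dims using le L[OF assms(2)] by blast
  next
    assume "\<exists>d\<in>set (dims (rev mu)). j < d \<and> d \<le> i"
    then obtain r where r: "j < ?s r" "?s r \<le> i" unfolding set_dims by blast
    have r0: "r \<noteq> 0" using r(1) by (cases r) auto
    then have "block_of mu j \<le> r - 1" using Lle[of j "r - 1"] r(1) by simp
    moreover have "r \<le> block_of mu i" using L[OF assms(1)] r(2) mono[of "Suc (block_of mu i)" r] by (meson le_less_trans less_le_trans not_le not_less_eq_eq less_irrefl)
    ultimately show "block_of mu j < block_of mu i" using r0 by simp
  qed
qed

lemma act_coords_subset_iff:
  assumes "A \<in> carrier_mat n n" "d \<le> n"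
  shows "act A ` coords d \<subseteq> coords d \<longleftrightarrow> (\<forall>i<n. \<forall>j<n. j < d \<and> d \<le> i \<longrightarrow> A $$ (i, j) = 0)"
proof
  assume s: "act A ` coords d \<subseteq> coords d"
  show "\<forall>i<n. \<forall>j<n. j < d \<and> d \<le> i \<longrightarrow> A $$ (i, j) = 0"
  proof (intro allI impI)
    fix i j assume ij: "i < n" "j < n" "j < d \<and> d \<le> i"
    have "act A (unit_fun j) \<in> coords d" using s unit_coords[of j d] ij by blast
    then have "act A (unit_fun j) i = 0" using ij by (simp add: coords_def)
    then show "A $$ (i, j) = 0" using act_unit[OF assms(1) ij(2)] ij by simp
  qed
next
  assume s: "\<forall>i<n. \<forall>j<n. j < d \<and> d \<le> i \<longrightarrow> A $$ (i, j) = 0"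
  show "act A ` coords d \<subseteq> coords d"
  proof
    fix g assume "g \<in> act A ` coords d"
    then obtain f where f: "f \<in> coords d" "g = act A f" by blast
    have "(\<Sum>j<n. A $$ (i, j) * f j) = 0" if "d \<le> i" "i < n" for i
    proof (rule sum.neutral, rule ballI)
      fix j assume "j \<in> {..<n}"
      then show "A $$ (i, j) * f j = 0" using s f(1) that by (cases "j < d") (auto simp: coords_def)
    qed
    then show "g \<in> coords d" using f assms by (auto simp: coords_def act_def)
  qed
qed

text \<open>The prescribed zeros say that every coordinate subspace ending at a block boundary is
  preserved, so the parabolic subgroup is the stabilizer of the standard flag.\<close>

lemma parabolic_iff:
  "(parabolic mu :: 'k::field mat set) = {p \<in> carrier (GL (sum_list mu)). \<forall>d\<in>set (dims (rev mu)). act p ` coords d \<subseteq> coords d}"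
proof -
  have "(\<forall>i<sum_list mu. \<forall>j<sum_list mu. block_of mu j < block_of mu i \<longrightarrow> p $$ (i, j) = 0) \<longleftrightarrow>
      (\<forall>d\<in>set (dims (rev mu)). act p ` coords d \<subseteq> coords d)" (is "?l \<longleftrightarrow> ?r") if "p \<in> carrier (GL (sum_list mu))" for p :: "'k mat"
  proof -
    have "?r \<longleftrightarrow> (\<forall>d\<in>set (dims (rev mu)). \<forall>i<sum_list mu. \<forall>j<sum_list mu. j < d \<and> d \<le> i \<longrightarrow> p $$ (i, j) = 0)"
      using act_coords_subset_iff[OF GL_mat[OF that]] dims_le[of _ "rev mu"] by (intro ball_cong) auto
    also have "\<dots> \<longleftrightarrow> ?l" using block_of_less[of _ mu] by blast
    finally show ?thesis ..
  qed
  then show ?thesis unfolding parabolic_def by blast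
qed

lemma nilpotent_act: "nilpotent_space (fscale :: 'k::{field,finite} \<Rightarrow> _) CARD('k) (act A)"
  by (intro nilpotent_space.intro nilpotent_space_axioms.intro act_add act_scale coord_space.finite_field_space_axioms)

context nilpotent_space
begin

text \<open>The flags that \<open>flags\<close> merely counts; as points they are the values of the
  map whose fibres are cosets of the parabolic subgroup.\<close>

fun flagset :: "nat list \<Rightarrow> 'v set \<Rightarrow> 'v set list set" where
  "flagset [] S = (if S = {0} then {[]} else {})"
| "flagset (r # rs) S = (\<Union>B\<in>{B. fsub B \<and> B \<subseteq> S \<and> N ` B \<subseteq> B \<and> card S = q ^ r * card B}. (#) B ` flagset rs B)"

lemma card_flagset: "fsub S \<Longrightarrow> finite (flagset rs S) \<and> card (flagset rs S) = flags rs S"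
proof (induction rs arbitrary: S)
  case (Cons r rs)
  let ?X = "{B. fsub B \<and> B \<subseteq> S \<and> N ` B \<subseteq> B \<and> card S = q ^ r * card B}"
  have fin: "finite ?X" using finite_subspaces[OF Cons.prems] by auto
  have f: "finite (flagset rs B)" "card ((#) B ` flagset rs B) = flags rs B" if "B \<in> ?X" for B
    using Cons.IH[of B] that by (auto simp: card_image)
  have "card (flagset (r # rs) S) = (\<Sum>B\<in>?X. card ((#) B ` flagset rs B))"
    unfolding flagset.simps using fin f(1) by (intro card_UN_disjoint) auto
  then show ?case using fin f by simp
qed auto

lemma flagset_stable:
  "F \<in> flagset rs S \<Longrightarrow> B \<in> set F \<Longrightarrow> N ` B \<subseteq> B"
proof (induction rs arbitrary: S F)
  case (Cons r rs)
  then obtain C F' where C: "F = C # F'" "F' \<in> flagset rs C" "N ` C \<subseteq> C" by auto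
  show ?case using Cons.IH[OF C(2)] Cons.prems(2) C(1,3) by (cases "B = C") simp_all
qed (simp split: if_splits)

end

context
  fixes u :: "'k::{field,finite} mat" and n :: nat
  assumes u: "u \<in> carrier (GL n)"
begin

interpretation nilpotent_space "fscale :: 'k \<Rightarrow> _" "CARD('k)" "act (u - 1\<^sub>m n)"
  by (rule nilpotent_act)

lemma fsub_act: "coord_space.fsub (S :: (nat \<Rightarrow> 'k) set) \<Longrightarrow> coord_space.fsub (act x ` S)"
  using nilpotent_space.fsub_img[OF nilpotent_act[of x], of S 1]
  unfolding nilpotent_space.img_def[OF nilpotent_act] by simp

lemma card_act: fixes x :: "'k mat" assumes "x \<in> carrier (GL n)" "d \<le> n" shows "card (act x ` coords d) = CARD('k) ^ d"
  using card_image[OF inj_on_subset[OF inj_act[OF assms(1)] coords_mono[OF assms(2)]]] by (simp add: card_coords)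

definition flag_of :: "nat list \<Rightarrow> 'k mat \<Rightarrow> (nat \<Rightarrow> 'k) set list" where
  "flag_of rs x = map (\<lambda>d. act x ` coords d) (dims rs)"

lemma flag_of_flagset:
  fixes x :: "'k mat"
  assumes x: "x \<in> carrier (GL n)" and "sum_list rs \<le> n"
    and "\<And>d. d \<in> set (dims rs) \<Longrightarrow> act (u - 1\<^sub>m n) ` act x ` coords d \<subseteq> act x ` coords d"
  shows "flag_of rs x \<in> flagset rs (act x ` coords (sum_list rs))"
  using assms(2,3)
proof (induction rs)
  case Nil
  then show ?case
    by (simp only: flag_of_def dims.simps list.map coords_0 sum_list.Nil image_insert act_0 image_empty flagset.simps simp_thms if_True singletonI)
next
  case (Cons r rs)
  let ?B = "act x ` coords (sum_list rs)"
  let ?S = "act x ` coords (sum_list (r # rs))"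
  have F: "flag_of rs x \<in> flagset rs ?B" using Cons by simp
  have "?B \<subseteq> ?S" by (intro image_mono coords_mono) simp
  moreover have "card ?S = CARD('k) ^ r * card ?B"
    using Cons.prems(1) card_act[OF x, of "sum_list rs"] card_act[OF x, of "sum_list (r # rs)"] by (simp add: power_add)
  moreover have "act (u - 1\<^sub>m n) ` ?B \<subseteq> ?B" using Cons.prems(2)[of "sum_list rs"] by simp
  ultimately have "?B \<in> {B. coord_space.fsub B \<and> B \<subseteq> ?S \<and> act (u - 1\<^sub>m n) ` B \<subseteq> B \<and> card ?S = CARD('k) ^ r * card B}"
    using fsub_act[OF fsub_coords, of x "sum_list rs"] by blast
  moreover have "flag_of (r # rs) x = ?B # flag_of rs x" by (simp add: flag_of_def)
  ultimately show ?case unfolding flagset.simps using F by blast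
qed

text \<open>Every flag has an adapted basis, constructed from its smallest member upward; with
  \<open>ex_GL_lspan\<close> this yields transitivity on flags.\<close>

lemma flagset_lspan:
  assumes "F \<in> flagset rs S" "coord_space.fsub S" "card S = CARD('k) ^ sum_list rs"
  shows "\<exists>b. lspan b (sum_list rs) = S \<and> map (lspan b) (dims rs) = F"
  using assms
proof (induction rs arbitrary: S F)
  case Nil
  then show ?case by (auto split: if_splits)
next
  case (Cons r rs)
  obtain B F' where B: "F = B # F'" "F' \<in> flagset rs B" "coord_space.fsub B" "B \<subseteq> S" "card S = CARD('k) ^ r * card B"
    using Cons.prems(1) by auto
  have cB: "card B = CARD('k) ^ sum_list rs" using B(5) Cons.prems(3) coord_space.q_ge_2 by (simp add: power_add)
  obtain b where b: "lspan b (sum_list rs) = B" "map (lspan b) (dims rs) = F'"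
    using Cons.IH[OF B(2,3) cB] by blast
  obtain b' where b': "\<forall>j<sum_list rs. b' j = b j" "lspan b' (sum_list rs + r) = S"
    using lspan_extend[of S b "sum_list rs" r] Cons.prems(2,3) B(4) b(1) cB by (auto simp: add.commute)
  have "lspan b' d = lspan b d" if "d \<le> sum_list rs" for d using b'(1) that by (intro lspan_cong) auto
  then have "map (lspan b') (dims (r # rs)) = F" using b B(1) dims_le by (auto simp: map_eq_conv)
  then show ?case using b'(2) by (auto simp: add.commute)
qed

lemma act_mem_iff:
  fixes x :: "'k mat"
  assumes x: "x \<in> carrier (GL n)" and "S \<subseteq> coords n" "f \<in> coords n"
  shows "act (inv\<^bsub>GL n\<^esub> x) f \<in> S \<longleftrightarrow> f \<in> act x ` S"
  using act_inv[OF x] assms(2,3) by (metis (no_types, lifting) image_iff subsetD)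

text \<open>A subspace is preserved by \<open>u\<close> iff it is preserved by u - 1, since the two
  differ by the identity; the rest is transport by \<open>x\<close>.\<close>

lemma stable_iff:
  fixes x :: "'k mat"
  assumes x: "x \<in> carrier (GL n)" and d: "d \<le> n"
  shows "act (inv\<^bsub>GL n\<^esub> x * u * x) ` coords d \<subseteq> coords d \<longleftrightarrow> act (u - 1\<^sub>m n) ` act x ` coords d \<subseteq> act x ` coords d"
proof -
  let ?y = "inv\<^bsub>GL n\<^esub> x"
  have m: "x \<in> carrier_mat n n" "?y \<in> carrier_mat n n" "u \<in> carrier_mat n n"
    using x u inv_GL(1) by (auto intro: GL_mat)
  have sub: "coord_space.subspace (act x ` coords d)" using fsub_act[OF fsub_coords] by (simp add: coord_space.fsub_def)
  have "act (?y * u * x) f \<in> coords d \<longleftrightarrow> act (u - 1\<^sub>m n) (act x f) \<in> act x ` coords d" if f: "f \<in> coords d" for f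
  proof -
    have fn: "act x f \<in> coords n" by (rule act_coords[OF m(1)])
    have "act (?y * u * x) f = act ?y (act u (act x f))"
      using m by (simp add: act_mult[of _ n])
    then have "act (?y * u * x) f \<in> coords d \<longleftrightarrow> act u (act x f) \<in> act x ` coords d"
      using act_mem_iff[OF x coords_mono[OF d] act_coords[OF m(3)]] by simp
    moreover have "act u (act x f) = act (u - 1\<^sub>m n + 1\<^sub>m n) (act x f)" using m(3) by (intro arg_cong2[of _ _ _ _ act] eq_matI) auto
    moreover have "act (u - 1\<^sub>m n + 1\<^sub>m n) g = act (u - 1\<^sub>m n) g + act (1\<^sub>m n) g" for g
      using m(3) by (auto simp: act_def fun_eq_iff algebra_simps sum.distrib[symmetric] intro!: sum.cong)
    ultimately have "act (?y * u * x) f \<in> coords d \<longleftrightarrow> act (u - 1\<^sub>m n) (act x f) + act x f \<in> act x ` coords d"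
      using act_one[OF fn] by simp
    also have "\<dots> \<longleftrightarrow> act (u - 1\<^sub>m n) (act x f) \<in> act x ` coords d"
      using f coord_space.subspace_add[OF sub] coord_space.subspace_diff[OF sub] by (metis add_diff_cancel_right' imageI)
    finally show ?thesis .
  qed
  then show ?thesis by blast
qed

text \<open>The induced character counts those x for which the x-translate of the standard flag is
  stable under u - 1. The map sending x to this translate has left cosets of the parabolic subgroup
  as fibres and, by adapted bases, reaches every stable flag; the order of the subgroup
  cancels.\<close>

lemma parabolic_char_flags:
  assumes n: "n = sum_list mu"
  shows "parabolic_char mu u = of_nat (flags (rev mu) (coords n))"
proof -
  interpret G: group "GL n :: 'k mat monoid" by (rule group_GL)
  let ?rs = "rev mu"
  let ?P = "parabolic mu :: 'k mat set"
  have sum: "sum_list ?rs = n" using n by simp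
  have dn: "d \<le> n" if "d \<in> set (dims ?rs)" for d using dims_le[OF that] sum by simp
  define X where "X = {x \<in> carrier (GL n :: 'k mat monoid). \<forall>d\<in>set (dims ?rs). act (u - 1\<^sub>m n) ` act x ` coords d \<subseteq> act x ` coords d}"
  have finX: "finite X" by (simp add: X_def finite_GL)
  have P: "p \<in> ?P \<longleftrightarrow> p \<in> carrier (GL n) \<and> (\<forall>d\<in>set (dims ?rs). act p ` coords d \<subseteq> coords d)" for p
    by (simp add: parabolic_iff n)
  have Peq: "act p ` coords d = coords d" if "p \<in> ?P" "d \<in> set (dims ?rs)" for p d
    using that P card_act[OF _ dn] fsub_coords[of d]
    by (intro card_subset_eq) (auto simp: coord_space.fsub_def card_coords)
  have "{x. x \<in> carrier (GL n) \<and> inv\<^bsub>GL n\<^esub> x \<otimes>\<^bsub>GL n\<^esub> u \<otimes>\<^bsub>GL n\<^esub> x \<in> ?P} = X"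
  proof -
    have "inv\<^bsub>GL n\<^esub> x \<otimes>\<^bsub>GL n\<^esub> u \<otimes>\<^bsub>GL n\<^esub> x \<in> ?P \<longleftrightarrow> x \<in> X" if x: "x \<in> carrier (GL n)" for x
      using stable_iff[OF x dn] x u G.m_closed[OF G.m_closed[OF G.inv_closed[OF x] u] x]
      unfolding P X_def mult_GL by auto
    moreover have "X \<subseteq> carrier (GL n)" by (auto simp: X_def)
    ultimately show ?thesis by blast
  qed
  then have "parabolic_char mu u = of_nat (card X) / of_nat (card ?P)"
    unfolding parabolic_char_def induced_char_def n[symmetric] by simp
  moreover have "card X = flags ?rs (coords n) * card ?P"
  proof -
    let ?Fs = "flagset ?rs (coords n)"
    have "flag_of ?rs ` X \<subseteq> ?Fs"
    proof (rule image_subsetI)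
      fix x assume "x \<in> X"
      then show "flag_of ?rs x \<in> ?Fs"
        using flag_of_flagset[of x ?rs] act_GL_coords[of x n] sum by (simp add: X_def)
    qed
    then have "card X = (\<Sum>F\<in>?Fs. card {x \<in> X. flag_of ?rs x = F})"
      using sum.group[of X ?Fs "flag_of ?rs" "\<lambda>_. 1 :: nat"] finX card_flagset[OF fsub_coords] by simp
    also have "\<dots> = (\<Sum>F\<in>?Fs. card ?P)"
    proof (intro sum.cong refl)
      fix F assume F: "F \<in> ?Fs"
      obtain b where b: "lspan b n = coords n" "map (lspan b) (dims ?rs) = F"
        using flagset_lspan[OF F fsub_coords] sum by (auto simp: card_coords)
      obtain y where y: "y \<in> carrier (GL n)" "\<And>d. d \<le> n \<Longrightarrow> act y ` coords d = lspan b d"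
        using ex_GL_lspan[OF b(1)] by blast
      have Fy: "flag_of ?rs y = F" using y(2) dn b(2) by (auto simp: flag_of_def)
      have ym: "y \<in> carrier_mat n n" using y(1) by (rule GL_mat)
      have "bij_betw (\<lambda>p. y * p) ?P {x \<in> X. flag_of ?rs x = F}"
      proof (rule bij_betwI[where g = "\<lambda>x. inv\<^bsub>GL n\<^esub> y * x"])
        show "(\<lambda>p. y * p) \<in> ?P \<rightarrow> {x \<in> X. flag_of ?rs x = F}"
        proof
          fix p assume p: "p \<in> ?P"
          then have pG: "p \<in> carrier (GL n)" by (simp add: P)
          have G: "y * p \<in> carrier (GL n)" using G.m_closed[OF y(1) pG] by (simp add: mult_GL)
          have im: "act (y * p) ` coords d = act y ` coords d" if "d \<in> set (dims ?rs)" for d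
            using Peq[OF p that] by (simp add: act_mult[OF ym GL_mat[OF pG]] image_image[symmetric])
          then have fl: "flag_of ?rs (y * p) = F" using Fy by (auto simp: flag_of_def)
          then have "\<forall>d\<in>set (dims ?rs). act (y * p) ` coords d \<in> set F" by (auto simp: flag_of_def)
          then show "y * p \<in> {x \<in> X. flag_of ?rs x = F}"
            using G fl flagset_stable[OF F] by (simp add: X_def)
        qed
        show "(\<lambda>x. inv\<^bsub>GL n\<^esub> y * x) \<in> {x \<in> X. flag_of ?rs x = F} \<rightarrow> ?P"
        proof
          fix x assume x: "x \<in> {x \<in> X. flag_of ?rs x = F}"
          then have xG: "x \<in> carrier (GL n)" by (simp add: X_def)
          have im: "act x ` coords d = act y ` coords d" if "d \<in> set (dims ?rs)" for d
          proof -
            have "flag_of ?rs x = flag_of ?rs y" using x Fy by simp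
            then show ?thesis using that by (simp add: flag_of_def)
          qed
          have "act (inv\<^bsub>GL n\<^esub> y * x) ` coords d \<subseteq> coords d" if d: "d \<in> set (dims ?rs)" for d
          proof -
            have "act (inv\<^bsub>GL n\<^esub> y * x) ` coords d = act (inv\<^bsub>GL n\<^esub> y) ` act y ` coords d"
              by (simp add: act_mult[OF GL_mat[OF inv_GL(1)[OF y(1)]] GL_mat[OF xG]] image_image[symmetric] im[OF d])
            also have "\<dots> = coords d" using act_inv(2)[OF y(1)] coords_mono[OF dn[OF d]]
              unfolding image_image by (subst image_cong[of _ "coords d" _ "\<lambda>f. f"]) auto
            finally show ?thesis by simp
          qed
          then show "inv\<^bsub>GL n\<^esub> y * x \<in> ?P"
            using G.m_closed[OF G.inv_closed[OF y(1)] xG] by (simp add: P mult_GL)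
        qed
      next
        fix p assume "p \<in> ?P"
        then have p: "p \<in> carrier (GL n)" "p \<in> carrier_mat n n" by (auto simp: P intro: GL_mat)
        then show "inv\<^bsub>GL n\<^esub> y * (y * p) = p"
          using G.m_assoc[OF G.inv_closed[OF y(1)] y(1) p(1)] inv_GL(3)[OF y(1)] by (simp add: mult_GL)
      next
        fix x assume "x \<in> {x \<in> X. flag_of ?rs x = F}"
        then have x: "x \<in> carrier (GL n)" "x \<in> carrier_mat n n" by (auto simp: X_def intro: GL_mat)
        then show "y * (inv\<^bsub>GL n\<^esub> y * x) = x"
          using G.m_assoc[OF y(1) G.inv_closed[OF y(1)] x(1)] inv_GL(2)[OF y(1)] by (simp add: mult_GL)
      qed
      then show "card {x \<in> X. flag_of ?rs x = F} = card ?P" by (simp add: bij_betw_same_card)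
    qed
    finally show ?thesis using card_flagset[OF fsub_coords] by simp
  qed
  moreover have "card ?P \<noteq> 0"
  proof -
    have "1\<^sub>m n \<in> ?P" using G.one_closed by (auto simp: P one_GL act_one coords_mono[OF dn, THEN subsetD])
    moreover have "finite ?P" by (rule rev_finite_subset[OF finite_GL[of n]]) (auto simp: P)
    ultimately show ?thesis by auto
  qed
  ultimately show ?thesis by simp
qed

end

subsection \<open>Unipotent matrices of a given Jordan type\<close>

text \<open>The number of rows that follow row \<open>a\<close> inside its Jordan block. Entries and
  powers of the nilpotent part are expressed through it alone.\<close>

fun row_remainder :: "nat list \<Rightarrow> nat \<Rightarrow> nat" where
  "row_remainder [] a = 0"
| "row_remainder (k # ks) a = (if a < k then k - 1 - a else row_remainder ks (a - k))"

lemma row_remainder_less: "a < sum_list rho \<Longrightarrow> a + row_remainder rho a < sum_list rho"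
proof (induction rho arbitrary: a)
  case (Cons k ks)
  show ?case
  proof (cases "a < k")
    case False
    then have "a - k < sum_list ks" using Cons.prems by simp
    then have "a - k + row_remainder ks (a - k) < sum_list ks" by (rule Cons.IH)
    then show ?thesis using False by simp
  qed auto
qed simp

lemma row_remainder_Suc: "row_remainder rho a > 0 \<Longrightarrow> row_remainder rho (Suc a) = row_remainder rho a - 1"
proof (induction rho arbitrary: a)
  case (Cons k ks)
  then show ?case using Cons.IH[of "a - k"] by (cases "a < k") (auto simp: Suc_diff_le)
qed simp

text \<open>Each block with more than \<open>i\<close> rows has exactly one row that is followed by
  \<open>i\<close> others.\<close>

lemma card_row_remainder: "card {a. a < sum_list rho \<and> row_remainder rho a = i} = length (filter (\<lambda>k. i < k) rho)"
proof (induction rho)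
  case (Cons k ks)
  let ?A = "if i < k then {k - 1 - i} else {}" and ?B = "(+) k ` {a. a < sum_list ks \<and> row_remainder ks a = i}"
  have "{a. a < sum_list (k # ks) \<and> row_remainder (k # ks) a = i} = ?A \<union> ?B"
  proof (intro equalityI subsetI)
    fix a assume a: "a \<in> {a. a < sum_list (k # ks) \<and> row_remainder (k # ks) a = i}"
    show "a \<in> ?A \<union> ?B"
    proof (cases "a < k")
      case False
      then have "a = k + (a - k)" "a - k < sum_list ks" "row_remainder ks (a - k) = i" using a by auto
      then show ?thesis by blast
    qed (use a in auto)
  qed (auto split: if_splits)
  moreover have "?A \<inter> ?B = {}" by auto
  moreover have "card ?B = length (filter (\<lambda>k. i < k) ks)" using Cons.IH by (simp add: card_image)
  ultimately show ?case by (simp add: card_Un_disjoint)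
qed simp

abbreviation unipotent_jordan :: "nat list \<Rightarrow> 'k::field mat" where
  "unipotent_jordan rho \<equiv> jordan_matrix (map (\<lambda>r. (r, 1)) rho)"

lemma jordan_dim: "sum_list (map fst (map (\<lambda>r. (r, 1 :: 'k::field)) rho)) = sum_list rho"
  by (induction rho) auto

lemma unipotent_jordan_carrier: "unipotent_jordan rho \<in> carrier_mat (sum_list rho) (sum_list rho)"
  by (intro carrier_matI) (simp_all only: jordan_matrix_dim jordan_dim)

lemma unipotent_jordan_index:
  "a < sum_list rho \<Longrightarrow> b < sum_list rho \<Longrightarrow>
    unipotent_jordan rho $$ (a, b) = (if a = b \<or> Suc a = b \<and> row_remainder rho a > 0 then 1 else 0)"
proof (induction rho arbitrary: a b)
  case (Cons k ks)
  have dim: "dim_row (unipotent_jordan ks :: 'a mat) = sum_list ks" "dim_col (unipotent_jordan ks :: 'a mat) = sum_list ks"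
    using unipotent_jordan_carrier[of ks] by (rule carrier_matD)+
  have e: "(unipotent_jordan (k # ks) :: 'a mat) = four_block_mat (jordan_block k 1)
      (0\<^sub>m k (sum_list ks)) (0\<^sub>m (sum_list ks) k) (unipotent_jordan ks)"
  proof -
    have "(unipotent_jordan (k # ks) :: 'a mat) = (let B = unipotent_jordan ks in four_block_mat (jordan_block k 1)
        (0\<^sub>m (dim_row (jordan_block k (1 :: 'a))) (dim_col B)) (0\<^sub>m (dim_row B) (dim_col (jordan_block k (1 :: 'a)))) B)"
      unfolding jordan_matrix_def list.map prod.case diag_block_mat.simps by (rule refl)
    then show ?thesis by (simp only: Let_def dim jordan_block_index)
  qed
  have IH: "(unipotent_jordan ks :: 'a mat) $$ (a - k, b - k) =
      (if a - k = b - k \<or> Suc (a - k) = b - k \<and> row_remainder ks (a - k) > 0 then 1 else 0)"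
    if "\<not> a < k" "\<not> b < k" using Cons.IH[of "a - k" "b - k"] Cons.prems that by auto
  show ?case
    unfolding e using Cons.prems IH by (subst index_mat_four_block(1)) (auto simp: dim simp del: jordan_matrix_dim)
qed simp

lemma act_jordan:
  assumes n: "n = sum_list rho"
  shows "act (unipotent_jordan rho - 1\<^sub>m n) f = (\<lambda>a. if a < n \<and> row_remainder rho a > 0 then f (Suc a) else 0)"
proof
  fix a
  let ?M = "unipotent_jordan rho - 1\<^sub>m n"
  have J: "unipotent_jordan rho \<in> carrier_mat n n" unfolding n by (rule unipotent_jordan_carrier)
  show "act ?M f a = (if a < n \<and> row_remainder rho a > 0 then f (Suc a) else 0)"
  proof (cases "a < n")
    case True
    have "(\<Sum>b<n. ?M $$ (a, b) * f b) = (\<Sum>b<n. if b = Suc a then (if row_remainder rho a > 0 then f b else 0) else 0)"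
    proof (rule sum.cong[OF refl])
      fix b assume "b \<in> {..<n}"
      then have b: "b < n" by simp
      have "?M $$ (a, b) = unipotent_jordan rho $$ (a, b) - 1\<^sub>m n $$ (a, b)" using J True b by simp
      then show "?M $$ (a, b) * f b = (if b = Suc a then (if row_remainder rho a > 0 then f b else 0) else 0)"
        using unipotent_jordan_index[of a rho b] True b n by auto
    qed
    also have "\<dots> = (if row_remainder rho a > 0 then f (Suc a) else 0)"
      using row_remainder_less[of a rho] True n by simp
    finally show ?thesis using J True by (simp add: act_def)
  qed (use J in \<open>simp add: act_def\<close>)
qed

lemma act_jordan_power:
  assumes n: "n = sum_list rho" and f: "f \<in> coords n"
  shows "(act (unipotent_jordan rho - 1\<^sub>m n) ^^ i) f = (\<lambda>a. if a < n \<and> i \<le> row_remainder rho a then f (a + i) else 0)"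
proof (induction i)
  case 0
  show ?case using f by (auto simp: coords_def fun_eq_iff)
next
  case (Suc i)
  show ?case
  proof
    fix a
    have "Suc a < n" if "a < n" "row_remainder rho a > 0" using row_remainder_less[of a rho] that n by simp
    moreover have "i \<le> row_remainder rho (Suc a) \<longleftrightarrow> Suc i \<le> row_remainder rho a" if "row_remainder rho a > 0"
      using row_remainder_Suc[OF that] that by auto
    ultimately show "(act (unipotent_jordan rho - 1\<^sub>m n) ^^ Suc i) f a =
        (if a < n \<and> Suc i \<le> row_remainder rho a then f (a + Suc i) else 0)"
      by (simp add: Suc.IH act_jordan[OF n])
  qed
qed

definition supported :: "nat set \<Rightarrow> (nat \<Rightarrow> 'k::zero) set" where
  "supported A = {f. \<forall>i. i \<notin> A \<longrightarrow> f i = 0}"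

lemma card_supported:
  assumes "finite A"
  shows "coord_space.fsub (supported A :: (nat \<Rightarrow> 'k::{field,finite}) set) \<and>
    card (supported A :: (nat \<Rightarrow> 'k) set) = CARD('k) ^ card A"
  using assms
proof induction
  case empty
  have "supported {} = {0 :: nat \<Rightarrow> 'k}" by (auto simp: supported_def fun_eq_iff)
  then show ?case using coord_space.fsub_zero by simp
next
  case (insert a A)
  have "supported (insert a A) = coord_space.ext (supported A) (unit_fun a :: nat \<Rightarrow> 'k)"
  proof (intro equalityI subsetI)
    fix f :: "nat \<Rightarrow> 'k" assume f: "f \<in> supported (insert a A)"
    have "f = f(a := 0) + fscale (f a) (unit_fun a)" by (auto simp: fun_eq_iff fscale_def unit_fun_def)
    moreover have "f(a := 0) \<in> supported A" using f by (auto simp: supported_def)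
    ultimately show "f \<in> coord_space.ext (supported A) (unit_fun a)" by (metis coord_space.extI)
  next
    fix f :: "nat \<Rightarrow> 'k" assume "f \<in> coord_space.ext (supported A) (unit_fun a)"
    then show "f \<in> supported (insert a A)"
      by (auto elim!: coord_space.extE simp: supported_def fscale_def unit_fun_def)
  qed
  moreover have "(unit_fun a :: nat \<Rightarrow> 'k) \<notin> supported A" using insert.hyps by (auto simp: supported_def unit_fun_def)
  ultimately show ?case using insert by (simp add: coord_space.fsub_ext coord_space.card_ext)
qed

lemma image_act_jordan_power:
  assumes n: "n = sum_list rho"
  shows "(act (unipotent_jordan rho - 1\<^sub>m n) ^^ i) ` coords n =
    supported {a. a < n \<and> i \<le> row_remainder rho a}"
proof (intro equalityI subsetI)
  fix g assume "g \<in> (act (unipotent_jordan rho - 1\<^sub>m n) ^^ i) ` coords n"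
  then show "g \<in> supported {a. a < n \<and> i \<le> row_remainder rho a}"
    by (auto simp: act_jordan_power[OF n] supported_def)
next
  fix g :: "nat \<Rightarrow> 'a" assume g: "g \<in> supported {a. a < n \<and> i \<le> row_remainder rho a}"
  \<comment> \<open>The preimage shifts \<open>g\<close> back by \<open>i\<close> positions inside
    the blocks.\<close>
  define f where "f = (\<lambda>b. if i \<le> b \<and> b - i < n \<and> i \<le> row_remainder rho (b - i) then g (b - i) else 0)"
  have f: "f \<in> coords n"
  proof -
    have "b < n" if "i \<le> b" "b - i < n" "i \<le> row_remainder rho (b - i)" for b
      using row_remainder_less[of "b - i" rho] that n by simp
    then show ?thesis unfolding coords_def f_def by (force simp: not_less[symmetric])
  qed
  moreover have "(act (unipotent_jordan rho - 1\<^sub>m n) ^^ i) f = g"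
    unfolding act_jordan_power[OF n f] using g by (auto simp: f_def supported_def fun_eq_iff)
  ultimately show "g \<in> (act (unipotent_jordan rho - 1\<^sub>m n) ^^ i) ` coords n" by blast
qed

lemma act_similar_power:
  assumes "similar_mat_wit u J P Q" "u \<in> carrier_mat n n" "f \<in> coords n"
  shows "(act (u - 1\<^sub>m n) ^^ i) f = act P ((act (J - 1\<^sub>m n) ^^ i) (act Q f))"
proof -
  have s: "P * Q = 1\<^sub>m n" "Q * P = 1\<^sub>m n" "u = P * J * Q"
    and J: "J \<in> carrier_mat n n" and P: "P \<in> carrier_mat n n" and Q: "Q \<in> carrier_mat n n"
    using similar_mat_witD2[OF assms(2,1)] by auto
  have J1: "J - 1\<^sub>m n \<in> carrier_mat n n" using J by (intro minus_carrier_mat) simp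
  have "u - 1\<^sub>m n = P * (J - 1\<^sub>m n) * Q"
  proof -
    have "P * (J - 1\<^sub>m n) * Q = (P * J - P * 1\<^sub>m n) * Q" using P J by (subst mult_minus_distrib_mat) auto
    also have "\<dots> = P * J * Q - P * 1\<^sub>m n * Q" using P J Q by (subst minus_mult_distrib_mat) auto
    finally show ?thesis using s P by simp
  qed
  then have N: "act (u - 1\<^sub>m n) g = act P (act (J - 1\<^sub>m n) (act Q g))" for g
    using P J1 Q by (simp add: act_mult[of _ n])
  show ?thesis
  proof (induction i)
    case 0
    then show ?case using act_mult[OF P Q, of f] s(1) act_one[OF assms(3)] by simp
  next
    case (Suc i)
    have "act Q (act P g) = g" if "g \<in> coords n" for g using act_mult[OF Q P, of g] s(2) act_one[OF that] by simp
    moreover have "(act (J - 1\<^sub>m n) ^^ i) (act Q f) \<in> coords n"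
      using act_coords[OF J1] act_coords[OF Q] by (cases i) auto
    moreover have "(act (u - 1\<^sub>m n) ^^ Suc i) f = act (u - 1\<^sub>m n) (act P ((act (J - 1\<^sub>m n) ^^ i) (act Q f)))"
      using Suc.IH by simp
    ultimately show ?case unfolding N by simp
  qed
qed

lemma image_act_power:
  assumes u: "u \<in> carrier (GL n)" and rho: "rho \<in> partitions n" and jt: "has_jordan_type u rho"
  obtains P where "P \<in> carrier (GL n)"
    "\<And>i. (act (u - 1\<^sub>m n) ^^ i) ` coords n = act P ` supported {a. a < n \<and> i \<le> row_remainder rho a}"
proof -
  have n: "n = sum_list rho" using rho by (simp add: partitions_def)
  have um: "u \<in> carrier_mat n n" using u by (rule GL_mat)
  obtain P Q where w: "similar_mat_wit u (unipotent_jordan rho) P Q"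
    using jt unfolding has_jordan_type_def jordan_nf_def similar_mat_def by blast
  have s: "P * Q = 1\<^sub>m n" "Q * P = 1\<^sub>m n" "P \<in> carrier_mat n n" "Q \<in> carrier_mat n n"
    using similar_mat_witD2[OF um w] by auto
  have P: "P \<in> carrier (GL n)" and Q: "Q \<in> carrier (GL n)" using s by (auto simp: carrier_GL)
  have "(act (u - 1\<^sub>m n) ^^ i) ` coords n = act P ` supported {a. a < n \<and> i \<le> row_remainder rho a}" for i
  proof -
    have "(act (u - 1\<^sub>m n) ^^ i) ` coords n = act P ` (act (unipotent_jordan rho - 1\<^sub>m n) ^^ i) ` (act Q ` coords n)"
      unfolding image_image by (rule image_cong[OF refl]) (rule act_similar_power[OF w um])
    then show ?thesis by (simp only: act_GL_coords[OF Q] image_act_jordan_power[OF n])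
  qed
  then show thesis using that P by blast
qed

lemma columns_conv_filter:
  assumes "rho \<in> partitions n" shows "columns rho i = length (filter (\<lambda>k. i < k) rho)"
proof -
  have "{j. i < part rho j} = {j. j < length rho \<and> i < rho ! j}" by (auto simp: part_def split: if_splits)
  then show ?thesis by (simp add: columns_def conj_par_def length_filter_conv_card)
qed

text \<open>Let every cell contribute the index of its row. Summing along rows gives
  \<open>n_stat\<close>; a column of height c gives 0 + ... + (c - 1) = (c choose 2).\<close>

lemma n_stat_columns: assumes "rho \<in> partitions n" shows "n_stat rho = nst (columns rho)"
proof -
  have choose: "m choose 2 = (\<Sum>j<m. j)" for m :: nat
    by (induction m) (simp_all add: numeral_2_eq_2)
  have less: "j < columns rho v \<longleftrightarrow> v < part rho j" for j v
    unfolding columns_def by (rule less_conj_par[OF par_part[OF assms]])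
  have n: "n = sum_list rho" using assms by (simp add: partitions_def)
  have "nst (columns rho) = (\<Sum>v<n. \<Sum>j<columns rho v. j)"
    unfolding nst_def columns_par[OF assms] choose ..
  also have "\<dots> = (\<Sum>v<n. \<Sum>j<length rho. if v < rho ! j then j else 0)"
  proof (rule sum.cong[OF refl])
    fix v
    have "{j \<in> {..<length rho}. v < rho ! j} = {..<columns rho v}"
      by (auto simp: less part_def split: if_splits)
    then show "(\<Sum>j<columns rho v. j) = (\<Sum>j<length rho. if v < rho ! j then j else 0)"
      by (simp add: sum.inter_filter[symmetric])
  qed
  also have "\<dots> = (\<Sum>j<length rho. \<Sum>v<n. if v < rho ! j then j else 0)" by (rule sum.swap)
  also have "\<dots> = (\<Sum>j<length rho. j * rho ! j)"
  proof (rule sum.cong[OF refl])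
    fix j assume "j \<in> {..<length rho}"
    then have "rho ! j \<le> n" using n by (simp add: elem_le_sum_list)
    then have "{v \<in> {..<n}. v < rho ! j} = {..<rho ! j}" by auto
    then show "(\<Sum>v<n. if v < rho ! j then j else 0) = j * rho ! j" by (simp add: sum.inter_filter[symmetric])
  qed
  finally show ?thesis by (simp add: n_stat_def)
qed

lemma parabolic_char_unipotent:
  fixes u :: "'k::{field,finite} mat"
  assumes u: "u \<in> carrier (GL n)" and rho: "rho \<in> partitions n" and jt: "has_jordan_type u rho"
    and mu: "n = sum_list mu"
  shows "parabolic_char mu u = of_real (real CARD('k) ^ n_stat rho * h_coeff (1 / real CARD('k)) mu rho)"
proof -
  interpret nilpotent_space "fscale :: 'k \<Rightarrow> _" "CARD('k)" "act (u - 1\<^sub>m n)"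
    by (rule nilpotent_act)
  have n: "n = sum_list rho" using rho by (simp add: partitions_def)
  have um: "u - 1\<^sub>m n \<in> carrier_mat n n" using u by (intro minus_carrier_mat) simp
  let ?A = "\<lambda>i. {a. a < n \<and> i \<le> row_remainder rho a}"
  obtain P where P: "P \<in> carrier (GL n)" "\<And>i. (act (u - 1\<^sub>m n) ^^ i) ` coords n = act P ` supported (?A i)"
    using image_act_power[OF u rho jt] by blast
  have card_img: "card (img i (coords n)) = CARD('k) ^ card (?A i)" for i
  proof -
    have "supported (?A i) \<subseteq> coords n" by (auto simp: supported_def coords_def)
    then have "card (act P ` supported (?A i)) = card (supported (?A i) :: (nat \<Rightarrow> 'k) set)"
      by (intro card_image inj_on_subset[OF inj_act[OF P(1)]])
    also have "\<dots> = CARD('k) ^ card (?A i)" by (intro conjunct2[OF card_supported]) simp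
    finally show ?thesis by (simp add: img_def P(2))
  qed
  have stable: "stable (coords n)" unfolding stable_def
  proof (intro conjI exI)
    show "act (u - 1\<^sub>m n) ` coords n \<subseteq> coords n" using act_coords[OF um] by blast
    have "?A n = {}" using row_remainder_less[of _ rho] n by force
    then have "img n (coords n) = act P ` supported {}" by (simp only: img_def P(2))
    also have "supported {} = {0 :: nat \<Rightarrow> 'k}" by (auto simp: supported_def fun_eq_iff)
    finally show "img n (coords n) \<subseteq> {0}" by (simp only: image_insert image_empty act_0)
  qed (rule fsub_coords)
  \<comment> \<open>The drop between consecutive ranks counts the rows that are followed by exactly
    \<open>i\<close> rows in their block, one for each block of size greater than
    \<open>i\<close>.\<close>
  have "jtype (coords n) = columns rho"
  proof
    fix i
    let ?B = "{a. a < n \<and> row_remainder rho a = i}"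
    have "?A i = ?B \<union> ?A (Suc i)" "?B \<inter> ?A (Suc i) = {}" by auto
    moreover have "card (?B \<union> ?A (Suc i)) = card ?B + card (?A (Suc i))" by (rule card_Un_disjoint) auto
    ultimately have "card (?A i) = card ?B + card (?A (Suc i))" by (simp only:)
    then have "CARD('k) ^ (jtype (coords n) i + card (?A (Suc i))) * 1 = CARD('k) ^ (card ?B + card (?A (Suc i))) * 1"
      using jtype[OF stable, of i] by (simp only: card_img power_add mult_1_right)
    then have "jtype (coords n) i + card (?A (Suc i)) = card ?B + card (?A (Suc i))"
      by (rule coord_space.q_power_cancel) simp
    then have "jtype (coords n) i = card ?B" by simp
    then show "jtype (coords n) i = columns rho i"
      by (simp only: columns_conv_filter[OF rho] card_row_remainder n)
  qed
  moreover have "real (flags (rev mu) (coords n)) =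
      real CARD('k) ^ nst (jtype (coords n)) * h_col (1 / real CARD('k)) mu (jtype (coords n))"
    by (rule flags_h_col[OF stable]) (simp add: card_coords mu)
  ultimately have "real (flags (rev mu) (coords n)) = real CARD('k) ^ n_stat rho * h_coeff (1 / real CARD('k)) mu rho"
    by (simp only: n_stat_columns[OF rho] h_col_def from_columns_columns[OF rho])
  then show ?thesis using parabolic_char_flags[OF u mu] by (metis of_real_of_nat_eq)
qed

text \<open>The Jordan matrix itself is a witness. For (ii) every partition of \<open>n\<close> has
  to be represented by a unipotent class.\<close>

lemma ex_unipotent_jordan_type:
  assumes rho: "rho \<in> partitions n"
  shows "\<exists>u :: 'k::field mat. unipotent_mat n u \<and> has_jordan_type u rho"
proof (intro exI conjI)
  let ?J = "unipotent_jordan rho :: 'k mat"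
  have n: "n = sum_list rho" using rho by (simp add: partitions_def)
  have J: "?J \<in> carrier_mat n n" unfolding n by (rule unipotent_jordan_carrier)
  have idx: "?J $$ (a, b) = (if a = b \<or> Suc a = b \<and> row_remainder rho a > 0 then 1 else 0)" if "a < n" "b < n" for a b
    using unipotent_jordan_index[of a rho b] that n by simp
  have "upper_triangular ?J" unfolding upper_triangular_def using J idx by auto
  then have "det ?J = 1" using idx carrier_matD(1)[OF J]
    by (simp add: det_upper_triangular[OF _ J] prod_list_diag_prod del: jordan_matrix_dim)
  then have GL: "?J \<in> carrier (GL n)" using det_non_zero_imp_unit[OF J] by (simp add: GL_def units_of_def)
  let ?M = "?J - 1\<^sub>m n"
  have M: "?M \<in> carrier_mat n n" using J by (intro minus_carrier_mat) simp
  have pow: "act (?M ^\<^sub>m i) f = (act ?M ^^ i) f" if "f \<in> coords n" for i f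
    using that
  proof (induction i arbitrary: f)
    case 0
    then show ?case using M by (simp add: act_one del: index_minus_mat)
  next
    case (Suc i)
    have "act (?M ^\<^sub>m Suc i) f = act (?M ^\<^sub>m i) (act ?M f)"
      using act_mult[OF pow_carrier_mat[OF M] M] by simp
    then show ?case using Suc.IH[OF act_coords[OF M]] by (simp add: funpow_swap1)
  qed
  have "?M ^\<^sub>m n = 0\<^sub>m n n"
  proof (rule eq_matI)
    fix i j assume ij: "i < dim_row (0\<^sub>m n n :: 'k mat)" "j < dim_col (0\<^sub>m n n :: 'k mat)"
    have u: "unit_fun j \<in> coords n" using ij by (intro unit_coords) simp
    have "(act ?M ^^ n) (unit_fun j) i = 0"
      unfolding act_jordan_power[OF n u] using row_remainder_less[of i rho] n by auto
    then show "(?M ^\<^sub>m n) $$ (i, j) = 0\<^sub>m n n $$ (i, j)"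
      using pow[OF u, of n] act_unit[OF pow_carrier_mat[OF M], of j n] ij by simp
  qed (use pow_carrier_mat[OF M, of n] in auto)
  then show "unipotent_mat n ?J" unfolding unipotent_mat_def using GL by blast
  have "0 \<notin> set rho" using rho by (simp add: partitions_def)
  then show "has_jordan_type ?J rho"
    unfolding has_jordan_type_def jordan_nf_def using similar_mat_refl[OF J] by auto
qed

subsection \<open>Specializations of symmetric functions\<close>

lemma pair_sum_below: "{(a, b). a + b = m} = (\<lambda>a. (a, m - a)) ` below m"
proof (intro equalityI subsetI)
  fix p assume "p \<in> {(a, b). a + b = m}"
  then obtain a b where "p = (a, b)" "a + b = m" by auto
  then show "p \<in> (\<lambda>a. (a, m - a)) ` below m" by (auto simp: below_def lookup_add image_iff)
next
  fix p assume "p \<in> (\<lambda>a. (a, m - a)) ` below m"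
  then show "p \<in> {(a, b). a + b = m}" by (auto simp: below_def intro!: poly_mapping_eqI simp: lookup_add lookup_minus)
qed

lemma series_mult_below: "series_mult f g m = (\<Sum>a\<in>below m. f a * g (m - a))"
proof -
  have "inj_on (\<lambda>a. (a, m - a)) (below m)" by (auto simp: inj_on_def)
  then show ?thesis unfolding series_mult_def pair_sum_below by (simp add: sum.reindex)
qed

lemma mult_h_below: "mult_h r f m = (\<Sum>a\<in>below m. if mdeg a = r then f (m - a) else 0)"
  unfolding mult_h_def by (simp add: sum.inter_filter[symmetric])

lemma sum_below_swap:
  "(\<Sum>b\<in>below m. \<Sum>a\<in>below (m - b). F a b) = (\<Sum>a\<in>below m. \<Sum>b\<in>below (m - a). F a b)"
proof -
  have iff: "a \<in> below (m - b) \<longleftrightarrow> b \<in> below (m - a)" if "a \<in> below m" "b \<in> below m" for a b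
  proof -
    have "expo a i \<le> expo m i - expo b i \<longleftrightarrow> expo b i \<le> expo m i - expo a i" for i
    proof -
      have "expo a i \<le> expo m i" "expo b i \<le> expo m i" using that by (auto simp: below_def)
      then show ?thesis by linarith
    qed
    then show ?thesis by (simp add: below_def lookup_minus)
  qed
  have sub: "below (m - b) \<subseteq> below m" for b
    by (auto simp: below_def lookup_minus intro: order_trans)
  have "below (m - b) = {a. a \<in> below m \<and> a \<in> below (m - b)}" for b using sub by auto
  then have "(\<Sum>b\<in>below m. \<Sum>a\<in>below (m - b). F a b) = (\<Sum>b\<in>below m. \<Sum>a | a \<in> below m \<and> a \<in> below (m - b). F a b)"
    by simp
  also have "\<dots> = (\<Sum>a\<in>below m. \<Sum>b | b \<in> below m \<and> a \<in> below (m - b). F a b)"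
    by (rule sum.swap_restrict) auto
  also have "\<dots> = (\<Sum>a\<in>below m. \<Sum>b\<in>below (m - a). F a b)"
  proof (rule sum.cong[OF refl], rule sum.cong[OF _ refl])
    fix a assume "a \<in> below m"
    then show "{b. b \<in> below m \<and> a \<in> below (m - b)} = below (m - a)" using iff sub by blast
  qed
  finally show ?thesis .
qed

lemma mult_h_commute: "mult_h r (mult_h s f) = mult_h s (mult_h r f)"
proof
  fix m
  have "mult_h r (mult_h s f) m =
      (\<Sum>b\<in>below m. \<Sum>a\<in>below (m - b). if mdeg a = s \<and> mdeg b = r then f (m - b - a) else 0)"
    unfolding mult_h_below by (intro sum.cong refl) auto
  also have "\<dots> = (\<Sum>a\<in>below m. \<Sum>b\<in>below (m - a). if mdeg a = s \<and> mdeg b = r then f (m - b - a) else 0)"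
    by (rule sum_below_swap)
  also have "\<dots> = mult_h s (mult_h r f) m"
    unfolding mult_h_below by (intro sum.cong refl) (auto simp: diff_diff_eq add.commute intro!: sum.cong)
  finally show "mult_h r (mult_h s f) m = mult_h s (mult_h r f) m" .
qed

lemma mult_h_series_mult: "mult_h r (series_mult f g) = series_mult f (mult_h r g)"
proof
  fix m
  have "mult_h r (series_mult f g) m =
      (\<Sum>b\<in>below m. \<Sum>a\<in>below (m - b). if mdeg b = r then f a * g (m - b - a) else 0)"
    unfolding mult_h_below series_mult_below by (intro sum.cong refl) auto
  also have "\<dots> = (\<Sum>a\<in>below m. \<Sum>b\<in>below (m - a). if mdeg b = r then f a * g (m - b - a) else 0)"
    by (rule sum_below_swap)
  also have "\<dots> = series_mult f (mult_h r g) m"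
    unfolding mult_h_below series_mult_below sum_distrib_left
    by (intro sum.cong refl) (auto simp: diff_diff_eq add.commute)
  finally show "mult_h r (series_mult f g) m = series_mult f (mult_h r g) m" .
qed

lemma below_refl: "m \<in> below m"
  by (simp add: below_def)

lemma series_mult_one: "series_mult f series_one = f"
proof
  fix m
  have "a = m" if "a \<in> below m" "m - a = 0" for a
  proof (rule poly_mapping_eqI)
    fix i
    have "expo a i \<le> expo m i" using that(1) by (simp add: below_def)
    moreover have "expo m i - expo a i = 0" using that(2) by (metis lookup_minus lookup_zero)
    ultimately show "expo a i = expo m i" by simp
  qed
  then have "series_mult f series_one m = (\<Sum>a\<in>below m. if a = m then f m else 0)"
    unfolding series_mult_below series_one_def by (intro sum.cong refl) auto
  then show "series_mult f series_one m = f m" using below_refl[of m] by simp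
qed

lemma fold_mult_h: "fold mult_h nu f = series_mult f (h_prod nu)"
proof (induction nu rule: rev_induct)
  case Nil
  then show ?case by (simp add: h_prod_def series_mult_one)
next
  case (snoc r nu)
  then show ?case by (simp add: h_prod_def mult_h_series_mult)
qed

lemma h_prod_append: "h_prod (mu @ nu) = series_mult (h_prod mu) (h_prod nu)"
  unfolding fold_mult_h[symmetric] by (simp add: h_prod_def)

lemma h_prod_mset: "mset mu = mset nu \<Longrightarrow> h_prod mu = h_prod nu"
  unfolding h_prod_def
  by (rule arg_cong[where f = "\<lambda>F. F series_one"], rule fold_multiset_equiv)
    (rule ext, simp only: o_apply, rule mult_h_commute, assumption)

lemma h_prod_single: "h_prod [r] m = (if mdeg m = r then 1 else 0)"
proof -
  have "m - a = 0 \<longleftrightarrow> a = m" if "a \<in> below m" for a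
  proof
    assume z: "m - a = 0"
    show "a = m"
    proof (rule poly_mapping_eqI)
      fix i
      have "expo a i \<le> expo m i" using that by (simp add: below_def)
      moreover have "expo m i - expo a i = 0" using z by (metis lookup_minus lookup_zero)
      ultimately show "expo a i = expo m i" by simp
    qed
  qed simp
  then have "h_prod [r] m = (\<Sum>a\<in>below m. if a = m then (if mdeg m = r then 1 else 0) else 0)"
    unfolding h_prod_def fold.simps o_def id_def mult_h_below series_one_def by (intro sum.cong refl) auto
  then show ?thesis using below_refl[of m] by simp
qed

lemma h_prod_0: "h_prod [0] = series_one"
  by (auto simp: h_prod_single series_one_def mdeg_eq_0_iff fun_eq_iff)

lemma symfuns_sum:
  assumes "finite A" "\<And>x. x \<in> A \<Longrightarrow> f x \<in> symfuns"
  shows "(\<lambda>m. \<Sum>x\<in>A. c x * f x m) \<in> symfuns"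
proof -
  have "\<exists>d. \<forall>x\<in>A. \<forall>m. f x m \<noteq> 0 \<longrightarrow> mdeg m \<le> d"
    using assms
  proof induction
    case (insert y A)
    obtain d where d: "\<forall>x\<in>A. \<forall>m. f x m \<noteq> 0 \<longrightarrow> mdeg m \<le> d" using insert.IH insert.prems by blast
    obtain d' where d': "\<forall>m. f y m \<noteq> 0 \<longrightarrow> mdeg m \<le> d'"
      using insert.prems[of y] by (auto simp: symfuns_def)
    have "\<forall>x\<in>insert y A. \<forall>m. f x m \<noteq> 0 \<longrightarrow> mdeg m \<le> max d d'" using d d' by (auto simp: le_max_iff_disj)
    then show ?case by blast
  qed simp
  then obtain d where d: "\<And>x m. x \<in> A \<Longrightarrow> f x m \<noteq> 0 \<Longrightarrow> mdeg m \<le> d" by blast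
  have "mdeg m \<le> d" if nz: "(\<Sum>x\<in>A. c x * f x m) \<noteq> 0" for m
  proof -
    obtain x where "x \<in> A" "c x * f x m \<noteq> 0" using sum.not_neutral_contains_not_neutral[OF nz] by blast
    moreover from this have "f x m \<noteq> 0" by (metis mult_zero_right)
    ultimately show ?thesis using d by blast
  qed
  moreover have "f x (Poly_Mapping.map_key p m) = f x m" if "bij p" "x \<in> A" for x p m
    using assms(2)[OF that(2)] that(1) by (simp add: symfuns_def)
  ultimately show ?thesis unfolding symfuns_def by (auto intro!: sum.cong)
qed

lemma schur_symfuns: "lam \<in> partitions n \<Longrightarrow> schur lam \<in> symfuns"
  using strip_family.sym[OF strip_family_schur] strip_family.hom[OF strip_family_schur] by (rule symfunsI)

lemma h_prod_symfuns: "h_prod mu \<in> symfuns"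
  unfolding h_prod_schur by (rule symfuns_sum) (auto intro: schur_symfuns)

lemma power_sum_symfuns: "power_sum k \<in> symfuns"
proof (rule symfunsI)
  show "homogeneous k (power_sum k)" by (auto simp: homogeneous_def power_sum_def mdeg_single)
  show "symmetric_series (power_sum k)" unfolding symmetric_series_def
  proof (intro allI impI)
    fix p :: "nat \<Rightarrow> nat" and m assume p: "bij p"
    have "Poly_Mapping.map_key p m = Poly_Mapping.single i k \<longleftrightarrow> m = Poly_Mapping.single (p i) k" for i
    proof
      assume e: "Poly_Mapping.map_key p m = Poly_Mapping.single i k"
      show "m = Poly_Mapping.single (p i) k"
      proof (rule poly_mapping_eqI)
        fix j
        obtain l where l: "j = p l" using p by (meson bij_pointE)
        show "expo m j = expo (Poly_Mapping.single (p i) k) j"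
          using expo_map_key[OF bij_is_inj[OF p], of m l] e p by (simp add: l lookup_single when_def inj_eq bij_is_inj)
      qed
    next
      assume e: "m = Poly_Mapping.single (p i) k"
      show "Poly_Mapping.map_key p m = Poly_Mapping.single i k"
        by (rule poly_mapping_eqI) (use p in \<open>simp add: expo_map_key bij_is_inj e lookup_single when_def inj_eq\<close>)
    qed
    then have "(\<exists>i. Poly_Mapping.map_key p m = Poly_Mapping.single i k) \<longleftrightarrow> (\<exists>i. m = Poly_Mapping.single i k)"
      using p by (metis bij_pointE)
    then show "power_sum k (Poly_Mapping.map_key p m) = power_sum k m" by (simp add: power_sum_def)
  qed
qed

text \<open>The coefficients of \<open>p\<^sub>i h\<^bsub>r-i\<^esub>\<close> count, for each monomial of degree \<open>r\<close>, the variables of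
  exponent at least \<open>i\<close>.\<close>

theorem newton_complete:
  "(\<lambda>m. \<Sum>i = 1..r. series_mult (power_sum i) (h_prod [r - i]) m) = (\<lambda>m. of_nat r * h_prod [r] m)"
proof
  fix m
  have deg: "mdeg m = mdeg a + mdeg (m - a)" if "a \<in> below m" for a
  proof -
    have "a + (m - a) = m" using that
      by (intro poly_mapping_eqI) (simp add: lookup_add lookup_minus below_def)
    then show ?thesis using mdeg_plus[of a "m - a"] by simp
  qed
  have count: "series_mult (power_sum i) (h_prod [r - i]) m =
      (if mdeg m = r then of_nat (card {j \<in> vars m. i \<le> expo m j}) else 0)" if i: "i \<in> {1..r}" for i
  proof -
    let ?A = "{a \<in> below m. \<exists>j. a = Poly_Mapping.single j i}"
    have "mdeg (m - a) = r - i \<longleftrightarrow> mdeg m = r" if "a \<in> ?A" for a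
      using deg[of a] that i by (auto simp: mdeg_single)
    then have "series_mult (power_sum i) (h_prod [r - i]) m = (\<Sum>a\<in>?A. if mdeg m = r then 1 else 0)"
      unfolding series_mult_below sum.inter_filter[OF finite_below]
      by (intro sum.cong refl) (auto simp: power_sum_def h_prod_single)
    moreover have "card ?A = card {j \<in> vars m. i \<le> expo m j}"
    proof -
      have le: "Poly_Mapping.single j i \<in> below m \<longleftrightarrow> i \<le> expo m j" for j
        by (auto simp: below_def lookup_single when_def)
      have "?A = (\<lambda>j. Poly_Mapping.single j i) ` {j \<in> vars m. i \<le> expo m j}"
        using i le by (auto simp: in_keys_iff)
      moreover have "inj_on (\<lambda>j. Poly_Mapping.single j i) {j \<in> vars m. i \<le> expo m j}"
        using i by (intro inj_onI) (metis lookup_single_eq lookup_single_not_eq atLeastAtMost_iff not_one_le_zero)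
      ultimately show ?thesis by (simp add: card_image)
    qed
    ultimately show ?thesis by (cases "mdeg m = r") simp_all
  qed
  have "(\<Sum>i = 1..r. card {j \<in> vars m. i \<le> expo m j}) = r" if "mdeg m = r"
  proof -
    have "(\<Sum>i = 1..r. card {j \<in> vars m. i \<le> expo m j}) = (\<Sum>i = 1..r. \<Sum>j\<in>vars m. if i \<le> expo m j then 1 else 0)"
      by (simp add: sum.inter_filter[symmetric])
    also have "\<dots> = (\<Sum>j\<in>vars m. \<Sum>i = 1..r. if i \<le> expo m j then 1 else 0)" by (rule sum.swap)
    also have "\<dots> = (\<Sum>j\<in>vars m. expo m j)"
    proof (rule sum.cong[OF refl])
      fix j assume "j \<in> vars m"
      then have "expo m j \<le> r" using that by (auto simp: mdeg_def intro: member_le_sum)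
      then have "{i \<in> {1..r}. i \<le> expo m j} = {1..expo m j}" by auto
      then show "(\<Sum>i = 1..r. if i \<le> expo m j then 1 else 0) = expo m j" by (simp add: sum.inter_filter[symmetric])
    qed
    finally show ?thesis using that by (simp add: mdeg_def)
  qed
  then have "(\<Sum>i = 1..r. if mdeg m = r then of_nat (card {j \<in> vars m. i \<le> expo m j}) else 0) =
      (of_nat r * h_prod [r] m :: 'a)"
    by (simp add: h_prod_single flip: of_nat_sum)
  then show "(\<Sum>i = 1..r. series_mult (power_sum i) (h_prod [r - i]) m) = (of_nat r * h_prod [r] m :: 'a)"
    by (simp add: count)
qed

definition partitions_upto :: "nat \<Rightarrow> nat list set" where
  "partitions_upto d = (\<Union>n\<le>d. partitions n)"

lemma finite_partitions_upto [simp]: "finite (partitions_upto d)"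
  by (simp add: partitions_upto_def)

lemma sum_partitions_upto: "(\<Sum>mu\<in>partitions_upto d. F mu) = (\<Sum>n\<le>d. \<Sum>mu\<in>partitions n. F mu)"
  unfolding partitions_upto_def 
  by (rule sum.UNION_disjoint) (simp, simp, auto simp: partitions_def)

text \<open>Homogeneous components are expanded in Schur functions, and the inverse Kostka matrix
  passes from these to the products h_mu.\<close>

lemma h_prod_span:
  assumes f: "(f :: real series) \<in> symfuns"
  obtains b d where "f = (\<lambda>m. \<Sum>mu\<in>partitions_upto d. b mu * h_prod mu m)"
proof -
  obtain d where d: "\<And>m. f m \<noteq> 0 \<Longrightarrow> mdeg m \<le> d" using f by (auto simp: symfuns_def)
  define comp where "comp n = (\<lambda>m. if mdeg m = n then f m else 0)" for n
  have "\<exists>b. comp n = (\<lambda>m. \<Sum>mu\<in>partitions n. b mu * h_prod mu m)" for n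
  proof -
    have "symmetric_series (comp n)" "homogeneous n (comp n)"
      using f by (auto simp: symmetric_series_def homogeneous_def comp_def symfuns_def mdeg_map_key)
    then obtain c where c: "comp n = (\<lambda>m. \<Sum>lam\<in>partitions n. c lam * schur lam m)"
      using strip_family.expand[OF strip_family_schur] by blast
    obtain M :: "nat list \<Rightarrow> nat list \<Rightarrow> real" where M: "\<And>lam nu. lam \<in> partitions n \<Longrightarrow> nu \<in> partitions n \<Longrightarrow>
        (\<Sum>mu\<in>partitions n. of_nat (kostka lam mu) * M mu nu) = (if lam = nu then 1 else 0)"
      "\<And>mu nu. mu \<in> partitions n \<Longrightarrow> nu \<in> partitions n \<Longrightarrow>
        (\<Sum>lam\<in>partitions n. M mu lam * of_nat (kostka lam nu)) = (if mu = nu then 1 else 0)"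
      using kostka_inverse[of n] by blast
    have "(\<Sum>mu\<in>partitions n. M mu nu * h_prod mu m) = schur nu m" if nu: "nu \<in> partitions n" for nu m
    proof -
      have "(\<Sum>mu\<in>partitions n. M mu nu * h_prod mu m) =
          (\<Sum>mu\<in>partitions n. \<Sum>lam\<in>partitions n. (of_nat (kostka lam mu) * M mu nu) * schur lam m)"
        by (intro sum.cong refl) (simp add: h_prod_schur partitions_def sum_distrib_left mult_ac)
      also have "\<dots> = (\<Sum>lam\<in>partitions n. (\<Sum>mu\<in>partitions n. of_nat (kostka lam mu) * M mu nu) * schur lam m)"
        by (subst sum.swap) (simp add: sum_distrib_right)
      also have "\<dots> = (\<Sum>lam\<in>partitions n. if lam = nu then schur lam m else 0)"
        using nu by (intro sum.cong refl) (simp add: M(1))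
      finally show ?thesis using nu by simp
    qed
    then have "comp n = (\<lambda>m. \<Sum>nu\<in>partitions n. c nu * (\<Sum>mu\<in>partitions n. M mu nu * h_prod mu m))"
      unfolding c by (intro ext sum.cong refl) simp
    also have "\<dots> = (\<lambda>m. \<Sum>mu\<in>partitions n. (\<Sum>nu\<in>partitions n. c nu * M mu nu) * h_prod mu m)"
      unfolding sum_distrib_left sum_distrib_right by (subst sum.swap) (simp add: mult_ac)
    finally show ?thesis by (rule exI[where x = "\<lambda>mu. \<Sum>nu\<in>partitions n. c nu * M mu nu"])
  qed
  then obtain b where b: "\<And>n. comp n = (\<lambda>m. \<Sum>mu\<in>partitions n. b n mu * h_prod mu m)" by metis
  have "f m = (\<Sum>mu\<in>partitions_upto d. b (sum_list mu) mu * h_prod mu m)" for m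
  proof -
    have "f m = (\<Sum>n\<le>d. comp n m)" using d[of m] by (cases "f m = 0") (auto simp: comp_def)
    also have "\<dots> = (\<Sum>n\<le>d. \<Sum>mu\<in>partitions n. b (sum_list mu) mu * h_prod mu m)"
      unfolding b by (intro sum.cong refl) (simp add: partitions_def)
    finally show ?thesis by (simp add: sum_partitions_upto)
  qed
  then show thesis by (intro that ext)
qed

lemma series_mult_sum:
  "series_mult (\<lambda>m. \<Sum>x\<in>A. c x * f x m) (\<lambda>m. \<Sum>y\<in>B. d y * g y m) =
    (\<lambda>m. \<Sum>p\<in>A \<times> B. (c (fst p) * d (snd p)) * series_mult (f (fst p)) (g (snd p)) m)"
proof
  fix m
  have "series_mult (\<lambda>m. \<Sum>x\<in>A. c x * f x m) (\<lambda>m. \<Sum>y\<in>B. d y * g y m) m =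
      (\<Sum>a\<in>below m. \<Sum>p\<in>A \<times> B. (c (fst p) * d (snd p)) * (f (fst p) a * g (snd p) (m - a)))"
    unfolding series_mult_below sum_product sum.cartesian_product
    by (intro sum.cong refl) (auto simp: mult_ac)
  then show "series_mult (\<lambda>m. \<Sum>x\<in>A. c x * f x m) (\<lambda>m. \<Sum>y\<in>B. d y * g y m) m =
      (\<Sum>p\<in>A \<times> B. (c (fst p) * d (snd p)) * series_mult (f (fst p)) (g (snd p)) m)"
    unfolding series_mult_below sum_distrib_left by (subst sum.swap) simp
qed

lemma series_mult_symfuns:
  assumes "(f :: real series) \<in> symfuns" "g \<in> symfuns" shows "series_mult f g \<in> symfuns"
proof -
  obtain b d where f: "f = (\<lambda>m. \<Sum>mu\<in>partitions_upto d. b mu * h_prod mu m)" using h_prod_span[OF assms(1)] .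
  obtain b' d' where g: "g = (\<lambda>m. \<Sum>mu\<in>partitions_upto d'. b' mu * h_prod mu m)" using h_prod_span[OF assms(2)] .
  show ?thesis unfolding f g series_mult_sum h_prod_append[symmetric]
    by (rule symfuns_sum) (auto intro: h_prod_symfuns)
qed

section \<open>Linear functionals and algebra homomorphisms\<close>

definition symfun_linear :: "(real series \<Rightarrow> real) \<Rightarrow> bool" where
  "symfun_linear \<phi> \<longleftrightarrow> (\<forall>f\<in>symfuns. \<forall>g\<in>symfuns. \<phi> (\<lambda>m. f m + g m) = \<phi> f + \<phi> g) \<and>
     (\<forall>c. \<forall>f\<in>symfuns. \<phi> (\<lambda>m. c * f m) = c * \<phi> f)"

lemma alg_hom_linear: "symfun_alg_hom \<phi> \<Longrightarrow> symfun_linear \<phi>"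
  by (simp add: symfun_alg_hom_def symfun_linear_def)

lemma linear_add: "symfun_linear \<phi> \<Longrightarrow> f \<in> symfuns \<Longrightarrow> g \<in> symfuns \<Longrightarrow> \<phi> (\<lambda>m. f m + g m) = \<phi> f + \<phi> g"
  by (simp add: symfun_linear_def)

lemma linear_scale: "symfun_linear \<phi> \<Longrightarrow> f \<in> symfuns \<Longrightarrow> \<phi> (\<lambda>m. c * f m) = c * \<phi> f"
  by (simp add: symfun_linear_def)

lemma alg_hom_mult: "symfun_alg_hom \<phi> \<Longrightarrow> f \<in> symfuns \<Longrightarrow> g \<in> symfuns \<Longrightarrow> \<phi> (series_mult f g) = \<phi> f * \<phi> g"
  by (simp add: symfun_alg_hom_def)

lemma linear_sum:
  assumes "symfun_linear \<phi>" "finite A" "\<And>x. x \<in> A \<Longrightarrow> f x \<in> symfuns"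
  shows "\<phi> (\<lambda>m. \<Sum>x\<in>A. c x * f x m) = (\<Sum>x\<in>A. c x * \<phi> (f x))"
  using assms(2,3)
proof induction
  case empty
  have "\<phi> (\<lambda>m. 0 * h_prod [] m) = 0 * \<phi> (h_prod [])"
    by (rule linear_scale[OF assms(1) h_prod_symfuns])
  then show ?case by simp
next
  case (insert y A)
  have "(\<lambda>m. c y * f y m) \<in> symfuns" using symfuns_sum[of "{y}" f c] insert.prems by simp
  moreover have "(\<lambda>m. \<Sum>x\<in>A. c x * f x m) \<in> symfuns" using insert by (intro symfuns_sum) auto
  ultimately have "\<phi> (\<lambda>m. c y * f y m + (\<Sum>x\<in>A. c x * f x m)) = \<phi> (\<lambda>m. c y * f y m) + \<phi> (\<lambda>m. \<Sum>x\<in>A. c x * f x m)"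
    by (rule linear_add[OF assms(1)])
  moreover have "\<phi> (\<lambda>m. c y * f y m) = c y * \<phi> (f y)" using insert.prems by (intro linear_scale[OF assms(1)]) simp
  moreover have "\<phi> (\<lambda>m. \<Sum>x\<in>A. c x * f x m) = (\<Sum>x\<in>A. c x * \<phi> (f x))" using insert by simp
  ultimately show ?case using insert.hyps by simp
qed

lemma alg_hom_newton:
  assumes "symfun_alg_hom \<phi>"
  shows "real r * \<phi> (h_prod [r]) = (\<Sum>i = 1..r. \<phi> (power_sum i) * \<phi> (h_prod [r - i]))"
proof -
  have lin: "symfun_linear \<phi>" using assms by (rule alg_hom_linear)
  have m: "(series_mult (power_sum i) (h_prod [r - i]) :: real series) \<in> symfuns" for i
    by (intro series_mult_symfuns power_sum_symfuns h_prod_symfuns)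
  have "real r * \<phi> (h_prod [r]) = \<phi> (\<lambda>m. real r * h_prod [r] m)"
    by (rule linear_scale[OF lin h_prod_symfuns, symmetric])
  also have "\<dots> = \<phi> (\<lambda>m. \<Sum>i = 1..r. 1 * series_mult (power_sum i) (h_prod [r - i]) m)"
    using newton_complete[of r, where 'a = real] by simp
  also have "\<dots> = (\<Sum>i = 1..r. 1 * \<phi> (series_mult (power_sum i) (h_prod [r - i])))"
    using lin m by (intro linear_sum) auto
  also have "\<dots> = (\<Sum>i = 1..r. \<phi> (power_sum i) * \<phi> (h_prod [r - i]))"
    by (simp add: alg_hom_mult[OF assms power_sum_symfuns h_prod_symfuns])
  finally show ?thesis .
qed

text \<open>Over the reals the Newton identities can be solved for h_r, so the values on power sums
  fix those on all h_mu, which span.\<close>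

lemma alg_hom_unique:
  assumes "symfun_alg_hom \<phi>" "symfun_alg_hom \<psi>" "\<And>k. k \<ge> 1 \<Longrightarrow> \<phi> (power_sum k) = \<psi> (power_sum k)"
    and f: "f \<in> symfuns"
  shows "\<phi> f = \<psi> f"
proof -
  have single: "\<phi> (h_prod [r]) = \<psi> (h_prod [r])" for r
  proof (induction r rule: less_induct)
    case (less r)
    show ?case
    proof (cases "r = 0")
      case True
      then show ?thesis using assms(1,2) by (simp add: h_prod_0 symfun_alg_hom_def)
    next
      case False
      have "(\<Sum>i = 1..r. \<phi> (power_sum i) * \<phi> (h_prod [r - i])) = (\<Sum>i = 1..r. \<psi> (power_sum i) * \<psi> (h_prod [r - i]))"
        using assms(3) less by (intro sum.cong refl) auto
      then have "real r * \<phi> (h_prod [r]) = real r * \<psi> (h_prod [r])"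
        using alg_hom_newton[OF assms(1)] alg_hom_newton[OF assms(2)] by simp
      then show ?thesis using False by simp
    qed
  qed
  have h: "\<phi> (h_prod mu) = \<psi> (h_prod mu)" for mu
  proof (induction mu)
    case Nil
    then show ?case using assms(1,2) by (simp add: h_prod_def symfun_alg_hom_def)
  next
    case (Cons r mu)
    have "(h_prod (r # mu) :: real series) = series_mult (h_prod [r]) (h_prod mu)" using h_prod_append[of "[r]" mu] by simp
    then show ?case
      using Cons single[of r] by (simp add: alg_hom_mult[OF assms(1) h_prod_symfuns h_prod_symfuns]
          alg_hom_mult[OF assms(2) h_prod_symfuns h_prod_symfuns])
  qed
  obtain b d where e: "f = (\<lambda>m. \<Sum>mu\<in>partitions_upto d. b mu * h_prod mu m)" using h_prod_span[OF f] .
  show ?thesis unfolding e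
    using linear_sum[OF alg_hom_linear[OF assms(1)] finite_partitions_upto h_prod_symfuns]
      linear_sum[OF alg_hom_linear[OF assms(2)] finite_partitions_upto h_prod_symfuns] h by simp
qed

text \<open>The solution of the Newton identities for h_r when p_i takes the value \<theta>
  i.\<close>

fun complete_value :: "(nat \<Rightarrow> real) \<Rightarrow> nat \<Rightarrow> real" where
  "complete_value \<theta> 0 = 1"
| "complete_value \<theta> (Suc r) = (\<Sum>j\<le>r. \<theta> (Suc r - j) * complete_value \<theta> j) / real (Suc r)"

lemma complete_value_newton:
  "real r * complete_value \<theta> r = (\<Sum>i = 1..r. \<theta> i * complete_value \<theta> (r - i))"
proof (cases r)
  case (Suc s)
  have "(\<Sum>j\<le>s. \<theta> (Suc s - j) * complete_value \<theta> j) = (\<Sum>i = 1..Suc s. \<theta> i * complete_value \<theta> (Suc s - i))"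
    by (rule sum.reindex_bij_witness[where i = "\<lambda>i. Suc s - i" and j = "\<lambda>j. Suc s - j"]) auto
  then show ?thesis by (simp add: Suc del: sum.cl_ivl_Suc)
qed simp

definition h_value :: "(nat \<Rightarrow> real) \<Rightarrow> nat list \<Rightarrow> real" where
  "h_value \<theta> mu = prod_list (map (complete_value \<theta>) mu)"

text \<open>The sum is infinite, hence 0, for most series outside \<open>symfuns\<close>.\<close>

definition monomial_functional :: "(nat list \<Rightarrow> real) \<Rightarrow> real series \<Rightarrow> real" where
  "monomial_functional w f =
     (\<Sum>mu | mu \<in> (\<Union>n. partitions n) \<and> f (Poly_Mapping.nth mu) \<noteq> 0. f (Poly_Mapping.nth mu) * w mu)"

lemma monomial_functional_eq:
  assumes "\<And>m. f m \<noteq> 0 \<Longrightarrow> mdeg m \<le> d"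
  shows "monomial_functional w f = (\<Sum>mu\<in>partitions_upto d. f (Poly_Mapping.nth mu) * w mu)"
  unfolding monomial_functional_def
proof (rule sum.mono_neutral_left)
  show "{mu. mu \<in> (\<Union>n. partitions n) \<and> f (Poly_Mapping.nth mu) \<noteq> 0} \<subseteq> partitions_upto d"
  proof
    fix mu assume mu: "mu \<in> {mu. mu \<in> (\<Union>n. partitions n) \<and> f (Poly_Mapping.nth mu) \<noteq> 0}"
    then obtain n where n: "mu \<in> partitions n" by auto
    then have "sum_list mu \<le> d" using assms[of "Poly_Mapping.nth mu"] nth_partition(3)[of mu] mu by (auto simp: partitions_def)
    then show "mu \<in> partitions_upto d" using n by (auto simp: partitions_upto_def partitions_def)
  qed
qed (auto simp: partitions_upto_def)

lemma monomial_functional_linear: "symfun_linear (monomial_functional w)"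
  unfolding symfun_linear_def
proof (intro conjI ballI allI)
  fix f g :: "real series" assume f: "f \<in> symfuns" and g: "g \<in> symfuns"
  obtain d where d: "\<And>m. f m \<noteq> 0 \<Longrightarrow> mdeg m \<le> d" using f by (auto simp: symfuns_def)
  obtain d' where d': "\<And>m. g m \<noteq> 0 \<Longrightarrow> mdeg m \<le> d'" using g by (auto simp: symfuns_def)
  let ?D = "max d d'"
  have b: "f m \<noteq> 0 \<Longrightarrow> mdeg m \<le> ?D" "g m \<noteq> 0 \<Longrightarrow> mdeg m \<le> ?D" for m using d[of m] d'[of m] by auto
  have "f m + g m \<noteq> 0 \<Longrightarrow> mdeg m \<le> ?D" for m using b[of m] by (cases "f m = 0") auto
  then have "monomial_functional w (\<lambda>m. f m + g m) = (\<Sum>mu\<in>partitions_upto ?D. (f (Poly_Mapping.nth mu) + g (Poly_Mapping.nth mu)) * w mu)"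
    by (rule monomial_functional_eq)
  then show "monomial_functional w (\<lambda>m. f m + g m) = monomial_functional w f + monomial_functional w g"
    by (simp add: monomial_functional_eq[of f ?D, OF b(1)] monomial_functional_eq[of g ?D, OF b(2)] distrib_right sum.distrib)
next
  fix c and f :: "real series" assume f: "f \<in> symfuns"
  obtain d where d: "\<And>m. f m \<noteq> 0 \<Longrightarrow> mdeg m \<le> d" using f by (auto simp: symfuns_def)
  then have "c * f m \<noteq> 0 \<Longrightarrow> mdeg m \<le> d" for m by auto
  then have "monomial_functional w (\<lambda>m. c * f m) = (\<Sum>mu\<in>partitions_upto d. c * f (Poly_Mapping.nth mu) * w mu)"
    by (rule monomial_functional_eq)
  then show "monomial_functional w (\<lambda>m. c * f m) = c * monomial_functional w f"
    by (simp add: monomial_functional_eq[of f d, OF d] sum_distrib_left mult.assoc)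
qed

text \<open>In the monomial basis h_mu has the coefficients \<Sum> K_(lam,mu) K_(lam,nu), a product
  of two invertible matrices, so values on the h_mu can be prescribed freely. In the proof
  \<open>s\<close> and \<open>w\<close> undo the two factors one after the other.\<close>

lemma ex_functional_h_value:
  "\<exists>\<phi>. symfun_linear \<phi> \<and> (\<forall>n. \<forall>mu\<in>partitions n. \<phi> (h_prod mu) = v mu)"
proof -
  have "\<exists>w. \<forall>mu\<in>partitions n. (\<Sum>nu\<in>partitions n. h_prod mu (Poly_Mapping.nth nu) * w nu) = v mu" for n
  proof -
    obtain M :: "nat list \<Rightarrow> nat list \<Rightarrow> real" where M: "\<And>lam nu. lam \<in> partitions n \<Longrightarrow> nu \<in> partitions n \<Longrightarrow>
        (\<Sum>mu\<in>partitions n. of_nat (kostka lam mu) * M mu nu) = (if lam = nu then 1 else 0)"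
      "\<And>mu nu. mu \<in> partitions n \<Longrightarrow> nu \<in> partitions n \<Longrightarrow>
        (\<Sum>lam\<in>partitions n. M mu lam * of_nat (kostka lam nu)) = (if mu = nu then 1 else 0)"
      using kostka_inverse[of n] by blast
    let ?P = "partitions n"
    define s where "s lam = (\<Sum>mu\<in>?P. M mu lam * v mu)" for lam
    define w where "w nu = (\<Sum>lam\<in>?P. M nu lam * s lam)" for nu
    have Kw: "(\<Sum>nu\<in>?P. real (kostka lam nu) * w nu) = s lam" if "lam \<in> ?P" for lam
    proof -
      have "(\<Sum>nu\<in>?P. real (kostka lam nu) * w nu) = (\<Sum>lam'\<in>?P. (\<Sum>nu\<in>?P. real (kostka lam nu) * M nu lam') * s lam')"
        unfolding w_def sum_distrib_left sum_distrib_right by (subst sum.swap) (simp add: mult.assoc)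
      also have "\<dots> = (\<Sum>lam'\<in>?P. if lam' = lam then s lam' else 0)"
        using that by (intro sum.cong refl) (simp add: M(1))
      finally show ?thesis using that by simp
    qed
    have "(\<Sum>nu\<in>?P. h_prod mu (Poly_Mapping.nth nu) * w nu) = v mu" if mu: "mu \<in> ?P" for mu
    proof -
      have "h_prod mu (Poly_Mapping.nth nu) = (\<Sum>lam\<in>?P. real (kostka lam mu) * real (kostka lam nu))" for nu
        using mu by (simp add: h_prod_schur schur_nth partitions_def)
      then have "(\<Sum>nu\<in>?P. h_prod mu (Poly_Mapping.nth nu) * w nu) =
          (\<Sum>lam\<in>?P. real (kostka lam mu) * (\<Sum>nu\<in>?P. real (kostka lam nu) * w nu))"
        unfolding sum_distrib_left by (simp add: sum_distrib_right) (subst sum.swap, simp add: mult.assoc)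
      also have "\<dots> = (\<Sum>lam\<in>?P. real (kostka lam mu) * s lam)" by (intro sum.cong refl) (simp add: Kw)
      also have "\<dots> = (\<Sum>mu'\<in>?P. (\<Sum>lam\<in>?P. M mu' lam * real (kostka lam mu)) * v mu')"
        unfolding s_def sum_distrib_left sum_distrib_right by (subst sum.swap) (simp add: mult_ac)
      also have "\<dots> = (\<Sum>mu'\<in>?P. if mu' = mu then v mu' else 0)"
        using mu by (intro sum.cong refl) (simp add: M(2))
      finally show ?thesis using mu by simp
    qed
    then show ?thesis by blast
  qed
  then obtain w where w: "\<And>n mu. mu \<in> partitions n \<Longrightarrow> (\<Sum>nu\<in>partitions n. h_prod mu (Poly_Mapping.nth nu) * w n nu) = v mu"
    by metis
  let ?\<phi> = "monomial_functional (\<lambda>nu. w (sum_list nu) nu)"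
  have "?\<phi> (h_prod mu) = v mu" if mu: "mu \<in> partitions n" for mu n
  proof -
    have deg: "mdeg m = n" if nz: "h_prod mu m \<noteq> (0 :: real)" for m
    proof -
      have s: "sum_list mu = n" using mu by (simp add: partitions_def)
      obtain lam where lam: "lam \<in> partitions n" "real (kostka lam mu) * schur lam m \<noteq> 0"
        by (rule sum.not_neutral_contains_not_neutral[OF nz[unfolded h_prod_schur s]])
      have "homogeneous n (schur lam :: real series)" by (rule strip_family.hom[OF strip_family_schur lam(1)])
      moreover have "schur lam m \<noteq> (0 :: real)" using lam(2) by simp
      ultimately show ?thesis by (simp add: homogeneous_def)
    qed
    then have "?\<phi> (h_prod mu) = (\<Sum>nu\<in>partitions_upto n. h_prod mu (Poly_Mapping.nth nu) * w (sum_list nu) nu)"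
      by (intro monomial_functional_eq) simp
    also have "\<dots> = (\<Sum>nu\<in>partitions n. h_prod mu (Poly_Mapping.nth nu) * w (sum_list nu) nu)"
    proof (rule sum.mono_neutral_right)
      show "partitions n \<subseteq> partitions_upto n" by (auto simp: partitions_upto_def)
      show "\<forall>nu\<in>partitions_upto n - partitions n. h_prod mu (Poly_Mapping.nth nu) * w (sum_list nu) nu = 0"
      proof
        fix nu assume nu: "nu \<in> partitions_upto n - partitions n"
        then obtain k where k: "nu \<in> partitions k" "k \<noteq> n" by (auto simp: partitions_upto_def)
        then have "mdeg (Poly_Mapping.nth nu) \<noteq> n" using nth_partition(3)[of nu] by (auto simp: partitions_def)
        then show "h_prod mu (Poly_Mapping.nth nu) * w (sum_list nu) nu = 0" using deg by fastforce
      qed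
    qed simp
    also have "\<dots> = (\<Sum>nu\<in>partitions n. h_prod mu (Poly_Mapping.nth nu) * w n nu)"
      by (intro sum.cong refl) (simp add: partitions_def)
    finally show ?thesis using w[OF mu] by simp
  qed
  then show ?thesis using monomial_functional_linear by blast
qed

text \<open>Concatenation of lists corresponds to multiplication of the h_mu. As these span, a
  linear functional with multiplicative values on them is an algebra homomorphism; its values on
  power sums are then recovered inductively from the Newton identities.\<close>

theorem ex_alg_hom:
  "\<exists>\<phi>. symfun_alg_hom \<phi> \<and> (\<forall>k\<ge>1. \<phi> (power_sum k) = \<theta> k)"
proof -
  obtain \<phi> where lin: "symfun_linear \<phi>" and v: "\<And>n mu. mu \<in> partitions n \<Longrightarrow> \<phi> (h_prod mu) = h_value \<theta> mu"
    using ex_functional_h_value[of "h_value \<theta>"] by blast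
  have h: "\<phi> (h_prod mu) = h_value \<theta> mu" if nz: "0 \<notin> set mu" for mu
  proof -
    obtain lam where lam: "lam \<in> partitions (sum_mset (mset mu))" "mset lam = mset mu"
      using ex_partition_mset[of "mset mu"] nz by auto
    have "h_value \<theta> lam = h_value \<theta> mu"
      using lam(2) unfolding h_value_def by (metis mset_map prod_mset_prod_list)
    then show ?thesis using v[OF lam(1)] h_prod_mset[OF lam(2)] by metis
  qed
  have app: "\<phi> (h_prod (mu @ nu)) = \<phi> (h_prod mu) * \<phi> (h_prod nu)" if "mu \<in> partitions_upto d" "nu \<in> partitions_upto d'" for mu nu d d'
    using that h[of mu] h[of nu] h[of "mu @ nu"] by (auto simp: partitions_upto_def partitions_def h_value_def)
  have mult: "\<phi> (series_mult f g) = \<phi> f * \<phi> g" if fg: "f \<in> symfuns" "g \<in> symfuns" for f g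
  proof -
    obtain b d where f: "f = (\<lambda>m. \<Sum>mu\<in>partitions_upto d. b mu * h_prod mu m)" using h_prod_span[OF fg(1)] .
    obtain b' d' where g: "g = (\<lambda>m. \<Sum>mu\<in>partitions_upto d'. b' mu * h_prod mu m)" using h_prod_span[OF fg(2)] .
    have "\<phi> (series_mult f g) =
        (\<Sum>p\<in>partitions_upto d \<times> partitions_upto d'. (b (fst p) * b' (snd p)) * \<phi> (h_prod (fst p @ snd p)))"
      unfolding f g series_mult_sum h_prod_append[symmetric]
      by (rule linear_sum[OF lin]) (auto intro: h_prod_symfuns)
    also have "\<dots> = (\<Sum>p\<in>partitions_upto d \<times> partitions_upto d'. (b (fst p) * \<phi> (h_prod (fst p))) * (b' (snd p) * \<phi> (h_prod (snd p))))"
      using app by (intro sum.cong refl) auto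
    also have "\<dots> = (\<Sum>mu\<in>partitions_upto d. b mu * \<phi> (h_prod mu)) * (\<Sum>mu\<in>partitions_upto d'. b' mu * \<phi> (h_prod mu))"
      unfolding sum_product sum.cartesian_product by (simp add: case_prod_beta)
    also have "\<dots> = \<phi> f * \<phi> g"
      unfolding f g by (simp only: linear_sum[OF lin finite_partitions_upto h_prod_symfuns])
    finally show ?thesis .
  qed
  have one: "\<phi> series_one = 1" using h[of "[]"] by (simp add: h_prod_def h_value_def)
  have hom: "symfun_alg_hom \<phi>" using lin mult one by (simp add: symfun_alg_hom_def symfun_linear_def)
  have single: "\<phi> (h_prod [r]) = complete_value \<theta> r" for r
    using h[of "[r]"] one by (cases "r = 0") (auto simp: h_value_def h_prod_0)
  have "\<phi> (power_sum k) = \<theta> k" if "k \<ge> 1" for k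
    using that
  proof (induction k rule: less_induct)
    case (less k)
    have split: "{1..k} = insert k {1..<k}" using less.prems by auto
    have "(\<Sum>i = 1..k. \<phi> (power_sum i) * complete_value \<theta> (k - i)) = (\<Sum>i = 1..k. \<theta> i * complete_value \<theta> (k - i))"
      using alg_hom_newton[OF hom, of k] complete_value_newton[of k \<theta>] by (simp only: single)
    moreover have "(\<Sum>i = 1..<k. \<phi> (power_sum i) * complete_value \<theta> (k - i)) = (\<Sum>i = 1..<k. \<theta> i * complete_value \<theta> (k - i))"
      using less.IH by (intro sum.cong refl) auto
    ultimately show ?case unfolding split by simp
  qed
  then show ?thesis using hom by blast
qed

text \<open>\<open>ex_alg_hom\<close> and \<open>alg_hom_unique\<close> justify the definite
  description; restriction to \<open>symfuns\<close> supplies the extensional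
  representative.\<close>

theorem thoma_eval_alg_hom: "symfun_alg_hom (thoma_eval \<omega>)"
proof -
  let ?Q = "\<lambda>\<phi>. \<phi> \<in> extensional symfuns \<and> symfun_alg_hom \<phi> \<and> (\<forall>k\<ge>1. \<phi> (power_sum k) = thoma_power_sum \<omega> k)"
  obtain \<phi> where \<phi>: "symfun_alg_hom \<phi>" "\<forall>k\<ge>1. \<phi> (power_sum k) = thoma_power_sum \<omega> k"
    using ex_alg_hom by blast
  let ?\<psi> = "restrict \<phi> symfuns"
  have cl: "(\<lambda>m. f m + g m) \<in> symfuns" "(\<lambda>m. c * f m) \<in> symfuns"
    if "f \<in> symfuns" "g \<in> symfuns" for f g :: "real series" and c
  proof -
    show "(\<lambda>m. f m + g m) \<in> symfuns" using symfuns_sum[of "UNIV :: bool set" "\<lambda>b. if b then f else g" "\<lambda>_. 1"] that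
      by (simp add: UNIV_bool add.commute)
    show "(\<lambda>m. c * f m) \<in> symfuns" using symfuns_sum[of "{f}" "\<lambda>f. f" "\<lambda>_. c"] that by simp
  qed
  have "series_one \<in> (symfuns :: real series set)" using h_prod_symfuns[of "[]"] by (simp add: h_prod_def)
  then have "?Q ?\<psi>"
    using \<phi> cl series_mult_symfuns unfolding symfun_alg_hom_def by (simp add: power_sum_symfuns)
  moreover have "\<phi>' = ?\<psi>" if "?Q \<phi>'" for \<phi>'
  proof (rule ext)
    fix f show "\<phi>' f = ?\<psi> f"
    proof (cases "f \<in> symfuns")
      case True
      then show ?thesis using alg_hom_unique[of \<phi>' \<phi> f] that \<phi> by simp
    next
      case False
      then show ?thesis using that by (simp add: extensional_def)
    qed
  qed
  ultimately have "?Q (thoma_eval \<omega>)" unfolding thoma_eval_def by (rule theI)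
  then show ?thesis by blast
qed

lemmas thoma_eval_sum = linear_sum[OF alg_hom_linear[OF thoma_eval_alg_hom]]

subsection \<open>Values of the unipotent characters\<close>

text \<open>Apply the inverse Kostka matrix. This yields the uniqueness of the unipotent characters
  and later the extraction of their values.\<close>

lemma kostka_solve:
  fixes x y :: "nat list \<Rightarrow> 'a::comm_ring_1"
  assumes eq: "\<And>mu. mu \<in> partitions n \<Longrightarrow>
    (\<Sum>lam\<in>partitions n. of_nat (kostka lam mu) * x lam) = (\<Sum>lam\<in>partitions n. of_nat (kostka lam mu) * y lam)"
    and nu: "nu \<in> partitions n"
  shows "x nu = y nu"
proof -
  let ?P = "partitions n"
  obtain M :: "nat list \<Rightarrow> nat list \<Rightarrow> 'a" where M: "\<And>lam nu. lam \<in> ?P \<Longrightarrow> nu \<in> ?P \<Longrightarrow>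
      (\<Sum>mu\<in>?P. of_nat (kostka lam mu) * M mu nu) = (if lam = nu then 1 else 0)"
    "\<And>mu nu. mu \<in> ?P \<Longrightarrow> nu \<in> ?P \<Longrightarrow>
      (\<Sum>lam\<in>?P. M mu lam * of_nat (kostka lam nu)) = (if mu = nu then 1 else 0)"
    using kostka_inverse[of n] by blast
  have inv: "(\<Sum>mu\<in>?P. M mu nu * (\<Sum>lam\<in>?P. of_nat (kostka lam mu) * z lam)) = z nu" for z
  proof -
    have "(\<Sum>mu\<in>?P. M mu nu * (\<Sum>lam\<in>?P. of_nat (kostka lam mu) * z lam)) =
        (\<Sum>lam\<in>?P. (\<Sum>mu\<in>?P. of_nat (kostka lam mu) * M mu nu) * z lam)"
      unfolding sum_distrib_left sum_distrib_right by (subst sum.swap) (simp add: mult_ac)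
    also have "\<dots> = (\<Sum>lam\<in>?P. if lam = nu then z lam else 0)"
      using nu by (intro sum.cong refl) (simp add: M(1))
    finally show ?thesis using nu by simp
  qed
  have "(\<Sum>mu\<in>?P. M mu nu * (\<Sum>lam\<in>?P. of_nat (kostka lam mu) * x lam)) =
      (\<Sum>mu\<in>?P. M mu nu * (\<Sum>lam\<in>?P. of_nat (kostka lam mu) * y lam))"
    by (intro sum.cong refl) (simp add: eq)
  then show ?thesis by (simp only: inv)
qed

text \<open>The inverse Kostka matrix applied to the parabolic characters gives a family of the
  required kind, and \<open>kostka_solve\<close> its uniqueness.\<close>

lemma parabolic_char_unipotent_char:
  assumes "mu \<in> partitions n" "g \<in> carrier (GL n :: 'k::{field,finite} mat monoid)"
  shows "parabolic_char mu g = (\<Sum>lam\<in>partitions n. of_nat (kostka lam mu) * unipotent_char n lam g)"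
proof -
  let ?P = "partitions n" and ?G = "carrier (GL n :: 'k mat monoid)"
  let ?Q = "\<lambda>X. X \<in> ?P \<rightarrow>\<^sub>E extensional ?G \<and>
     (\<forall>mu\<in>?P. \<forall>g\<in>?G. parabolic_char mu g = (\<Sum>lam\<in>?P. of_nat (kostka lam mu) * X lam g))"
  obtain M :: "nat list \<Rightarrow> nat list \<Rightarrow> complex" where M: "\<And>lam nu. lam \<in> ?P \<Longrightarrow> nu \<in> ?P \<Longrightarrow>
      (\<Sum>mu\<in>?P. of_nat (kostka lam mu) * M mu nu) = (if lam = nu then 1 else 0)"
    "\<And>mu nu. mu \<in> ?P \<Longrightarrow> nu \<in> ?P \<Longrightarrow>
      (\<Sum>lam\<in>?P. M mu lam * of_nat (kostka lam nu)) = (if mu = nu then 1 else 0)"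
    using kostka_inverse[of n] by blast
  define X where "X = restrict (\<lambda>lam. restrict (\<lambda>g. \<Sum>mu\<in>?P. M mu lam * parabolic_char mu g) ?G) ?P"
  have "X \<in> ?P \<rightarrow>\<^sub>E extensional ?G" by (auto simp: X_def)
  moreover have "parabolic_char nu g = (\<Sum>lam\<in>?P. of_nat (kostka lam nu) * X lam g)"
    if nu: "nu \<in> ?P" and g: "g \<in> ?G" for nu g
  proof -
    have "(\<Sum>lam\<in>?P. of_nat (kostka lam nu) * X lam g) =
        (\<Sum>lam\<in>?P. of_nat (kostka lam nu) * (\<Sum>mu\<in>?P. M mu lam * parabolic_char mu g))"
      using g by (intro sum.cong refl) (simp add: X_def)
    also have "\<dots> = (\<Sum>mu\<in>?P. (\<Sum>lam\<in>?P. M mu lam * of_nat (kostka lam nu)) * parabolic_char mu g)"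
      unfolding sum_distrib_left sum_distrib_right by (subst sum.swap) (simp add: mult_ac)
    also have "\<dots> = (\<Sum>mu\<in>?P. if mu = nu then parabolic_char mu g else 0)"
      using nu by (intro sum.cong refl) (simp add: M(2))
    finally show ?thesis using nu by simp
  qed
  ultimately have QX: "?Q X" by blast
  have "Y = X" if Y: "?Q Y" for Y
  proof (rule ext)
    fix lam show "Y lam = X lam"
    proof (cases "lam \<in> ?P")
      case True
      show ?thesis
      proof (rule extensionalityI)
        show "Y lam \<in> extensional ?G" "X lam \<in> extensional ?G" using Y QX True by (auto simp: PiE_iff)
        fix g assume g: "g \<in> ?G"
        have "(\<Sum>lam\<in>?P. of_nat (kostka lam mu) * Y lam g) = (\<Sum>lam\<in>?P. of_nat (kostka lam mu) * X lam g)"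
          if "mu \<in> ?P" for mu using Y QX that g by metis
        then show "Y lam g = X lam g" using True by (rule kostka_solve)
      qed
    next
      case False
      then show ?thesis using Y QX by (auto simp: PiE_iff extensional_def)
    qed
  qed
  with QX have "?Q (unipotent_char n)" unfolding unipotent_char_def by (rule theI)
  then show ?thesis using assms by blast
qed

text \<open>Summed against the Kostka numbers of any mu, both sides give the parabolic character at
  \<open>u\<close>: the left one by construction, the right one by
  \<open>parabolic_char_unipotent\<close> and the definition of \<open>h_coeff\<close>.\<close>

lemma unipotent_char_value:
  fixes u :: "'k::{field,finite} mat"
  assumes u: "u \<in> carrier (GL n)" and rho: "rho \<in> partitions n" and jt: "has_jordan_type u rho"
    and lam: "lam \<in> partitions n"
  shows "unipotent_char n lam u =
    of_real (real CARD('k) ^ n_stat rho * kostka_foulkes_at lam rho (1 / real CARD('k)))"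
  using _ lam
proof (rule kostka_solve)
  fix mu assume mu: "mu \<in> partitions n"
  then have s: "n = sum_list mu" by (simp add: partitions_def)
  have "(\<Sum>lam\<in>partitions n. of_nat (kostka lam mu) * unipotent_char n lam u) = parabolic_char mu u"
    by (rule parabolic_char_unipotent_char[OF mu u, symmetric])
  also have "\<dots> = of_real (real CARD('k) ^ n_stat rho * h_coeff (1 / real CARD('k)) mu rho)"
    by (rule parabolic_char_unipotent[OF u rho jt s])
  also have "\<dots> = (\<Sum>lam\<in>partitions n. of_nat (kostka lam mu) *
      of_real (real CARD('k) ^ n_stat rho * kostka_foulkes_at lam rho (1 / real CARD('k))))"
    unfolding h_coeff_def s[symmetric] sum_distrib_left of_real_sum by (intro sum.cong refl) (simp add: mult_ac)
  finally show "(\<Sum>lam\<in>partitions n. of_nat (kostka lam mu) * unipotent_char n lam u) =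
    (\<Sum>lam\<in>partitions n. of_nat (kostka lam mu) *
      of_real (real CARD('k) ^ n_stat rho * kostka_foulkes_at lam rho (1 / real CARD('k))))" .
qed

lemma GLB_char_unipotent:
  fixes u :: "'k::{field,finite} mat"
  assumes "u \<in> carrier (GL n)" "rho \<in> partitions n" "has_jordan_type u rho"
  shows "GLB_char \<omega> n u = of_real (real CARD('k) ^ n_stat rho *
    (\<Sum>lam\<in>partitions n. kostka_foulkes_at lam rho (1 / real CARD('k)) * thoma_eval \<omega> (schur lam)))"
  unfolding GLB_char_def sum_distrib_left of_real_sum
  by (intro sum.cong refl) (simp add: unipotent_char_value[OF assms])

lemma thoma_eval_r_fun:
  assumes "rho \<in> partitions n"
  shows "thoma_eval \<omega> (r_fun t rho) = t powi (- int (n_stat rho)) *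
    (\<Sum>lam\<in>partitions n. kostka_foulkes_at lam rho t * thoma_eval \<omega> (schur lam))"
proof -
  have n: "sum_list rho = n" using assms by (simp add: partitions_def)
  have "r_fun t rho = (\<lambda>m. \<Sum>lam\<in>partitions n. (t powi (- int (n_stat rho)) * kostka_foulkes_at lam rho t) * schur lam m)"
    unfolding r_fun_def n sum_distrib_left by (simp add: mult.assoc)
  then have "thoma_eval \<omega> (r_fun t rho) =
      (\<Sum>lam\<in>partitions n. (t powi (- int (n_stat rho)) * kostka_foulkes_at lam rho t) * thoma_eval \<omega> (schur lam))"
    by (simp only: thoma_eval_sum[OF finite_partitions schur_symfuns])
  then show ?thesis by (simp add: sum_distrib_left mult.assoc)
qed

text \<open>Expanding P_rho back into Schur functions gives a one-sided inverse of the
  Kostka-Foulkes matrix at \<open>t\<close>, on the side where it is to be cancelled.\<close>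

lemma kostka_foulkes_solve:
  assumes eq: "\<And>rho. rho \<in> partitions n \<Longrightarrow>
    (\<Sum>lam\<in>partitions n. kostka_foulkes_at lam rho t * x lam) = (\<Sum>lam\<in>partitions n. kostka_foulkes_at lam rho t * y lam)"
    and nu: "nu \<in> partitions n"
  shows "x nu = y nu"
proof -
  let ?P = "partitions n"
  interpret hl: strip_family "hl_real t" by (rule strip_family_hl_real)
  interpret schur: strip_family "schur :: nat list \<Rightarrow> real series" by (rule strip_family_schur)
  have "\<exists>b. hl_real t rho = (\<lambda>m. \<Sum>lam\<in>?P. b lam * schur lam m)" if "rho \<in> ?P" for rho
    using schur.expand[OF hl.sym[OF that] hl.hom[OF that]] by blast
  then obtain B where B: "\<And>rho. rho \<in> ?P \<Longrightarrow> hl_real t rho = (\<lambda>m. \<Sum>lam\<in>?P. B rho lam * schur lam m)" by metis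
  have KB: "(\<Sum>rho\<in>?P. kostka_foulkes_at lam rho t * B rho nu) = (if lam = nu then 1 else 0)" if lam: "lam \<in> ?P" for lam
  proof -
    have "(\<lambda>m. \<Sum>nu\<in>?P. (\<Sum>rho\<in>?P. kostka_foulkes_at lam rho t * B rho nu) * schur nu m) =
        (\<lambda>m. \<Sum>nu\<in>?P. (if lam = nu then 1 else 0) * schur nu m)"
    proof
      fix m
      have "(\<Sum>nu\<in>?P. (\<Sum>rho\<in>?P. kostka_foulkes_at lam rho t * B rho nu) * schur nu m) =
          (\<Sum>rho\<in>?P. kostka_foulkes_at lam rho t * (\<Sum>nu\<in>?P. B rho nu * schur nu m))"
        unfolding sum_distrib_left sum_distrib_right by (subst sum.swap) (simp add: mult.assoc)
      also have "\<dots> = (\<Sum>rho\<in>?P. kostka_foulkes_at lam rho t * hl_real t rho m)"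
        by (intro sum.cong refl) (simp add: B)
      also have "\<dots> = schur lam m" using fun_cong[OF schur_hl_real[OF lam, of t], of m] by simp
      also have "\<dots> = (\<Sum>nu\<in>?P. if nu = lam then schur nu m else 0)" using lam by simp
      also have "\<dots> = (\<Sum>nu\<in>?P. (if lam = nu then 1 else 0) * schur nu m)" by (intro sum.cong refl) auto
      finally show "(\<Sum>nu\<in>?P. (\<Sum>rho\<in>?P. kostka_foulkes_at lam rho t * B rho nu) * schur nu m) =
          (\<Sum>nu\<in>?P. (if lam = nu then 1 else 0) * schur nu m)" .
    qed
    from schur.unique_coefficients[OF this nu] show ?thesis .
  qed
  have inv: "(\<Sum>rho\<in>?P. B rho nu * (\<Sum>lam\<in>?P. kostka_foulkes_at lam rho t * z lam)) = z nu" for z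
  proof -
    have "(\<Sum>rho\<in>?P. B rho nu * (\<Sum>lam\<in>?P. kostka_foulkes_at lam rho t * z lam)) =
        (\<Sum>lam\<in>?P. (\<Sum>rho\<in>?P. kostka_foulkes_at lam rho t * B rho nu) * z lam)"
      unfolding sum_distrib_left sum_distrib_right by (subst sum.swap) (simp add: mult_ac)
    also have "\<dots> = (\<Sum>lam\<in>?P. if lam = nu then z lam else 0)" by (intro sum.cong refl) (simp add: KB)
    finally show ?thesis using nu by simp
  qed
  have "(\<Sum>rho\<in>?P. B rho nu * (\<Sum>lam\<in>?P. kostka_foulkes_at lam rho t * x lam)) =
      (\<Sum>rho\<in>?P. B rho nu * (\<Sum>lam\<in>?P. kostka_foulkes_at lam rho t * y lam))"
    by (intro sum.cong refl) (simp add: eq)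
  then show ?thesis by (simp only: inv)
qed

theorem mainTheorem2:
  fixes \<alpha> \<beta> :: "nat \<Rightarrow> real" and t :: real
  assumes "(\<alpha>, \<beta>) \<in> thoma_simplex"
    and "t = 1 / real CARD('k)"
  shows "(\<forall>n\<ge>1. \<forall>u :: 'k::{field,finite} mat. \<forall>rho\<in>partitions n.
            unipotent_mat n u \<and> has_jordan_type u rho \<longrightarrow>
              GLB_char (\<alpha>, \<beta>) n u = of_real (thoma_eval (\<alpha>, \<beta>) (r_fun t rho)) \<and>
              thoma_eval (\<alpha>, \<beta>) (r_fun t rho) =
                t powi (- int (n_stat rho)) *
                (\<Sum>lam\<in>partitions n.
                   kostka_foulkes_at lam rho t * thoma_eval (\<alpha>, \<beta>) (schur lam)))
       \<and> (\<forall>\<alpha>' \<beta>'. (\<alpha>', \<beta>') \<in> thoma_simplex \<longrightarrow>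
            (\<forall>n\<ge>1. \<forall>u :: 'k mat. unipotent_mat n u \<longrightarrow>
               GLB_char (\<alpha>, \<beta>) n u = GLB_char (\<alpha>', \<beta>') n u) \<longrightarrow>
            (\<forall>n\<ge>1. \<forall>g :: 'k mat. g \<in> carrier (GL n) \<longrightarrow>
               GLB_char (\<alpha>, \<beta>) n g = GLB_char (\<alpha>', \<beta>') n g))"
proof (rule conjI)
  have q: "real CARD('k) ^ k = t powi (- int k)" for k
    by (simp add: assms(2) power_int_minus power_int_of_nat divide_inverse power_inverse)
  have t: "1 / real CARD('k) = t" using assms(2) by simp
  show "\<forall>n\<ge>1. \<forall>u :: 'k mat. \<forall>rho\<in>partitions n. unipotent_mat n u \<and> has_jordan_type u rho \<longrightarrow>
      GLB_char (\<alpha>, \<beta>) n u = of_real (thoma_eval (\<alpha>, \<beta>) (r_fun t rho)) \<and>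
      thoma_eval (\<alpha>, \<beta>) (r_fun t rho) = t powi (- int (n_stat rho)) *
        (\<Sum>lam\<in>partitions n. kostka_foulkes_at lam rho t * thoma_eval (\<alpha>, \<beta>) (schur lam))"
  proof (intro allI ballI impI)
    fix n :: nat and u :: "'k mat" and rho
    assume rho: "rho \<in> partitions n" and u: "unipotent_mat n u \<and> has_jordan_type u rho"
    have r: "thoma_eval (\<alpha>, \<beta>) (r_fun t rho) = t powi (- int (n_stat rho)) *
        (\<Sum>lam\<in>partitions n. kostka_foulkes_at lam rho t * thoma_eval (\<alpha>, \<beta>) (schur lam))"
      by (rule thoma_eval_r_fun[OF rho])
    have "u \<in> carrier (GL n)" "has_jordan_type u rho" using u by (auto simp: unipotent_mat_def)
    then have "GLB_char (\<alpha>, \<beta>) n u = of_real (real CARD('k) ^ n_stat rho *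
        (\<Sum>lam\<in>partitions n. kostka_foulkes_at lam rho (1 / real CARD('k)) * thoma_eval (\<alpha>, \<beta>) (schur lam)))"
      using rho by (intro GLB_char_unipotent)
    then show "GLB_char (\<alpha>, \<beta>) n u = of_real (thoma_eval (\<alpha>, \<beta>) (r_fun t rho)) \<and>
        thoma_eval (\<alpha>, \<beta>) (r_fun t rho) = t powi (- int (n_stat rho)) *
        (\<Sum>lam\<in>partitions n. kostka_foulkes_at lam rho t * thoma_eval (\<alpha>, \<beta>) (schur lam))"
      unfolding r q t by blast
  qed
  show "\<forall>\<alpha>' \<beta>'. (\<alpha>', \<beta>') \<in> thoma_simplex \<longrightarrow>
      (\<forall>n\<ge>1. \<forall>u :: 'k mat. unipotent_mat n u \<longrightarrow> GLB_char (\<alpha>, \<beta>) n u = GLB_char (\<alpha>', \<beta>') n u) \<longrightarrow>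
      (\<forall>n\<ge>1. \<forall>g :: 'k mat. g \<in> carrier (GL n) \<longrightarrow> GLB_char (\<alpha>, \<beta>) n g = GLB_char (\<alpha>', \<beta>') n g)"
  proof (intro allI impI)
    fix \<alpha>' \<beta>' and n :: nat and g :: "'k mat"
    assume eq: "\<forall>n\<ge>1. \<forall>u :: 'k mat. unipotent_mat n u \<longrightarrow> GLB_char (\<alpha>, \<beta>) n u = GLB_char (\<alpha>', \<beta>') n u"
      and n: "1 \<le> n"
    \<comment> \<open>Equality at one unipotent matrix of each Jordan type gives as many linear
      equations as there are Schur values in degree \<open>n\<close>. Once these values agree, so do
      the characters at every \<open>g\<close>.\<close>
    have "thoma_eval (\<alpha>, \<beta>) (schur lam) = thoma_eval (\<alpha>', \<beta>') (schur lam)" if lam: "lam \<in> partitions n" for lam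
    proof (rule kostka_foulkes_solve[OF _ lam])
      fix rho assume rho: "rho \<in> partitions n"
      obtain u :: "'k mat" where u: "unipotent_mat n u" "has_jordan_type u rho"
        using ex_unipotent_jordan_type[OF rho] by blast
      have GL: "u \<in> carrier (GL n)" using u(1) by (simp add: unipotent_mat_def)
      have "GLB_char (\<alpha>, \<beta>) n u = GLB_char (\<alpha>', \<beta>') n u" using eq n u(1) by blast
      then have "real CARD('k) ^ n_stat rho *
          (\<Sum>lam\<in>partitions n. kostka_foulkes_at lam rho (1 / real CARD('k)) * thoma_eval (\<alpha>, \<beta>) (schur lam)) =
        real CARD('k) ^ n_stat rho *
          (\<Sum>lam\<in>partitions n. kostka_foulkes_at lam rho (1 / real CARD('k)) * thoma_eval (\<alpha>', \<beta>') (schur lam))"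
        unfolding GLB_char_unipotent[OF GL rho u(2)] of_real_eq_iff .
      moreover have "real CARD('k) ^ n_stat rho \<noteq> 0" by simp
      ultimately show "(\<Sum>lam\<in>partitions n. kostka_foulkes_at lam rho (1 / real CARD('k)) * thoma_eval (\<alpha>, \<beta>) (schur lam)) =
          (\<Sum>lam\<in>partitions n. kostka_foulkes_at lam rho (1 / real CARD('k)) * thoma_eval (\<alpha>', \<beta>') (schur lam))"
        by (simp only: mult_cancel_left simp_thms)
    qed
    then show "GLB_char (\<alpha>, \<beta>) n g = GLB_char (\<alpha>', \<beta>') n g" by (simp add: GLB_char_def)
  qed
qed

end
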